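(* Let $r>0$, $0<t_*<\infty$, $u\in(0,2\pi r)$, and let $X(t)$, $t\in[0,t_* )$, be the elliptic Bessel process with parameter $D=3$ started at $u$, with expectation $\mathbb E^u$. Let $T\in[0,t_* )$. Then for any $\mathcal F_X(T)$-observable $F$, $$\mathbb E^u[F(X(\cdot))]=\mathbf E^u\left[F(Y_{-1}(\cdot))\,\frac{p_{-1}^r(t_*-T,\pi r|Y_{-1}(T))}{p_{-1}^r(t_*,\pi r|u)}\right].$$
   Context: For $v\in\mathbb C$, $\Im\tau>0$: $\vartheta_1(v;\tau)=i\sum_{n\in\mathbb Z}(-1)^n e^{\pi i\tau(n-1/2)^2}e^{(2n-1)\pi i v}$; $\tau(t)=\frac{i(t_*-t)}{2\pi r^2}$; $U_1(t,x)=-\log\vartheta_1\!\left(\frac{x}{2\pi r};\tau(t)\right)$, $x\in(0,2\pi r)$, $U_1'=\partial_xU_1$ (extended $2\pi r$-periodically). The elliptic Bessel process with $D=3$ started at $u\in(0,2\pi r)$: $\check X(t)=u+B(t)-\int_0^tU_1'(s,\check X(s))\,ds$, $t\in[0,t_* )$, with $B$ a standard Brownian motion started at $0$; $X(t)=\check X(t)\bmod2\pi r\in[0,2\pi r)$. $\mathcal F_X(t)=\sigma(X(s):s\in[0,t])$. $\mathcal F_X(T)$-observable: a function $F(X(\cdot))=\prod_{m=1}^Mg_m(X(t_m))$ with $M\in\mathbb N$, $0\le t_1<\cdots<t_M\le T$, and bounded measurable $g_m:\mathbb R\to\mathbb R$ satisfying (1) $g_m(x+2\pi rn)=g_m(x)$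 for all $n\in\mathbb Z$; (2) $g_m(-x)=g_m(x)$ and $g_m(2\pi r+x)=g_m(2\pi r-x)$ for $x\in(0,2\pi r)$. $p^{\rm BM}(t,y|x)=e^{-(y-x)^2/2t}/\sqrt{2\pi t}$ for $t>0$ and $\delta(y-x)$ for $t=0$; $p_{-1}^r(t,y|x)=\sum_{w\in\mathbb Z}(-1)^wp^{\rm BM}(t,y+2\pi rw|x)$. The signed process $Y_{-1}(t)$, $t\in[0,t_* )$, in $[0,2\pi r)$ started at $u$ is given by its (signed) finite-dimensional distributions: for $0\le t_1<\cdots<t_M<t_*$ and Borel $A_m\subset[0,2\pi r)$, $\mathbf P^u[Y_{-1}(t_m)\in A_m,1\le m\le M]=\int_{A_1}dx^{(1)}\cdots\int_{A_M}dx^{(M)}\prod_{m=1}^Mp_{-1}^r(t_m-t_{m-1},x^{(m)}|x^{(m-1)})$ with $t_0=0$, $x^{(0)}=u$. $\mathbf E^u$ is integration against these signed measures. *)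

theory Defs
  imports "HOL-Probability.Probability" "HOL-Library.Real_Mod"
begin

section \<open>The elliptic Bessel process with \<open>D = 3\<close>\<close>

definition vartheta1 :: "complex \<Rightarrow> complex \<Rightarrow> complex" where
  "vartheta1 v \<tau> =
     \<i> * (\<Sum>\<^sub>\<infinity>n::int. (-1) powi n
              * exp (of_real pi * \<i> * \<tau> * (of_int n - 1/2)^2)
              * exp ((2 * of_int n - 1) * of_real pi * \<i> * v))"

definition tau :: "real \<Rightarrow> real \<Rightarrow> real \<Rightarrow> complex" where
  "tau r tstar t = \<i> * of_real (tstar - t) / of_real (2 * pi * r^2)"

text \<open>For \<open>t < tstar\<close> and \<open>x\<close> strictly between \<open>0\<close> and \<open>2 * pi * r\<close> the value of
  \<open>vartheta1\<close> below is a positive real number, so the complex and the real logarithm agree.\<close>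

definition U1 :: "real \<Rightarrow> real \<Rightarrow> real \<Rightarrow> real \<Rightarrow> real" where
  "U1 r tstar t x = - ln (Re (vartheta1 (of_real (x / (2 * pi * r))) (tau r tstar t)))"

text \<open>The spatial derivative, extended periodically.  It is singular at the integer multiples of
  \<open>2 * pi * r\<close>; the value given to it there is irrelevant, since the process below never
  visits these points.\<close>

definition U1' :: "real \<Rightarrow> real \<Rightarrow> real \<Rightarrow> real \<Rightarrow> real" where
  "U1' r tstar t x = deriv (U1 r tstar t) (x rmod (2 * pi * r))"

text \<open>\<open>B\<close> is a standard Brownian motion, started at \<open>0\<close>, with respect to the filtration
  \<open>\<F>\<close> on the probability space \<open>M\<close>.\<close>

definition brownian_motion ::
    "'a measure \<Rightarrow> (real \<Rightarrow> 'a measure) \<Rightarrow> (real \<Rightarrow> 'a \<Rightarrow> real) \<Rightarrow> bool" where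
  "brownian_motion M \<F> B \<longleftrightarrow>
     prob_space M \<and>
     filtration (space M) \<F> \<and> (\<forall>t\<ge>0. subalgebra M (\<F> t)) \<and>
     (\<forall>t\<ge>0. B t \<in> borel_measurable (\<F> t)) \<and>
     (AE \<omega> in M. B 0 \<omega> = 0) \<and>
     (AE \<omega> in M. continuous_on {0..} (\<lambda>t. B t \<omega>)) \<and>
     (\<forall>s t. 0 \<le> s \<and> s < t \<longrightarrow>
        distributed M lborel (\<lambda>\<omega>. B t \<omega> - B s \<omega>) (normal_density 0 (sqrt (t - s))) \<and>
        prob_space.indep_set M (sets (\<F> s))
          {(\<lambda>\<omega>. B t \<omega> - B s \<omega>) -` A \<inter> space M | A. A \<in> sets borel})"

text \<open>\<open>Xc\<close> is an \<open>\<F>\<close>-adapted solution on \<open>[0, tstar)\<close>, driven by \<open>B\<close> and started at \<open>u\<close>, of the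
  stochastic integral equation.  The noise is additive, so the equation is a pathwise one.  As
  \<open>\<F>\<close> is arbitrary, both strong and weak solutions are covered.\<close>

definition elliptic_bessel3_lift ::
    "'a measure \<Rightarrow> (real \<Rightarrow> 'a measure) \<Rightarrow> (real \<Rightarrow> 'a \<Rightarrow> real)
     \<Rightarrow> real \<Rightarrow> real \<Rightarrow> real \<Rightarrow> (real \<Rightarrow> 'a \<Rightarrow> real) \<Rightarrow> bool" where
  "elliptic_bessel3_lift M \<F> B r tstar u Xc \<longleftrightarrow>
     brownian_motion M \<F> B \<and>
     (\<forall>t\<in>{0..<tstar}. Xc t \<in> borel_measurable (\<F> t)) \<and>
     (AE \<omega> in M. \<forall>t\<in>{0..<tstar}.
        set_integrable lborel {0..t} (\<lambda>s. U1' r tstar s (Xc s \<omega>)) \<and>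
        Xc t \<omega> = u + B t \<omega> - (LINT s:{0..t}|lborel. U1' r tstar s (Xc s \<omega>)))"

definition elliptic_bessel3 ::
    "'a measure \<Rightarrow> real \<Rightarrow> real \<Rightarrow> real \<Rightarrow> (real \<Rightarrow> 'a \<Rightarrow> real) \<Rightarrow> bool" where
  "elliptic_bessel3 M r tstar u X \<longleftrightarrow>
     (\<exists>\<F> B Xc. elliptic_bessel3_lift M \<F> B r tstar u Xc \<and>
        (\<forall>t\<in>{0..<tstar}. \<forall>\<omega>\<in>space M. X t \<omega> = Xc t \<omega> rmod (2 * pi * r)))"


section \<open>Observables\<close>

text \<open>An observable is the path functional \<open>observable n t g\<close>; it is an
  \<open>\<F>\<^sub>X(T)\<close>-observable if its times \<open>t 1 < \<dots> < t n\<close> and factors \<open>g 1, \<dots>, g n\<close> satisfy the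
  following conditions.\<close>

definition observable :: "nat \<Rightarrow> (nat \<Rightarrow> real) \<Rightarrow> (nat \<Rightarrow> real \<Rightarrow> real) \<Rightarrow> (real \<Rightarrow> real) \<Rightarrow> real" where
  "observable n t g x = (\<Prod>m=1..n. g m (x (t m)))"

definition is_observable ::
    "real \<Rightarrow> real \<Rightarrow> nat \<Rightarrow> (nat \<Rightarrow> real) \<Rightarrow> (nat \<Rightarrow> real \<Rightarrow> real) \<Rightarrow> bool" where
  "is_observable r T n t g \<longleftrightarrow>
     strict_mono_on {1..n} t \<and> t ` {1..n} \<subseteq> {0..T} \<and>
     (\<forall>m\<in>{1..n}.
        g m \<in> borel_measurable borel \<and> bounded (range (g m)) \<and>
        (\<forall>x. \<forall>k::int. g m (x + 2 * pi * r * of_int k) = g m x) \<and>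
        (\<forall>x\<in>{0<..<2 * pi * r}.
           g m (- x) = g m x \<and> g m (2 * pi * r + x) = g m (2 * pi * r - x)))"


section \<open>The signed process\<close>

text \<open>Transition densities, for \<open>t > 0\<close>.\<close>

definition pBM :: "real \<Rightarrow> real \<Rightarrow> real \<Rightarrow> real" where
  "pBM t y x = exp (- ((y - x)^2) / (2 * t)) / sqrt (2 * pi * t)"

definition p_minus :: "real \<Rightarrow> real \<Rightarrow> real \<Rightarrow> real \<Rightarrow> real" where
  "p_minus r t y x = (\<Sum>\<^sub>\<infinity>w::int. (-1) powi w * pBM t (y + 2 * pi * r * of_int w) x)"

text \<open>\<open>p_minus_int r t x f\<close> is the integral of \<open>f\<close> over \<open>[0, 2 * pi * r)\<close> against the signed
  transition kernel from \<open>x\<close>.  At \<open>t = 0\<close> the Gaussian densities are replaced by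
  \<open>\<delta>(y + 2 * pi * r * w - x)\<close>, that is, by unit point masses at \<open>y = x - 2 * pi * r * w\<close>.\<close>

definition p_minus_int :: "real \<Rightarrow> real \<Rightarrow> real \<Rightarrow> (real \<Rightarrow> real) \<Rightarrow> real" where
  "p_minus_int r t x f =
     (if t = 0
      then (\<Sum>\<^sub>\<infinity>w::int. (-1) powi w *
              (indicator {0..<2 * pi * r} (x - 2 * pi * r * of_int w)
                * f (x - 2 * pi * r * of_int w)))
      else (LINT y:{0..<2 * pi * r}|lborel. p_minus r t y x * f y))"

text \<open>The signed measure of the event that the process, being at \<open>x\<close> at time \<open>s\<close>, lies in
  \<open>A t\<close> at each of the later times \<open>t\<close> in the list.\<close>

primrec Y_law :: "real \<Rightarrow> real \<Rightarrow> real \<Rightarrow> real list \<Rightarrow> (real \<Rightarrow> real set) \<Rightarrow> real" where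
  "Y_law r s x [] A = 1"
| "Y_law r s x (t # ts) A =
     p_minus_int r (t - s) x (\<lambda>y. indicator (A t) y * Y_law r t y ts A)"

text \<open>Integration against these signed measures of a functional \<open>\<Phi>\<close> of the path at the listed
  times.  The argument \<open>\<xi>\<close> accumulates the positions already integrated over.\<close>

primrec Y_integral ::
    "real \<Rightarrow> real \<Rightarrow> real \<Rightarrow> real list \<Rightarrow> ((real \<Rightarrow> real) \<Rightarrow> real) \<Rightarrow> (real \<Rightarrow> real) \<Rightarrow> real" where
  "Y_integral r s x [] \<Phi> \<xi> = \<Phi> \<xi>"
| "Y_integral r s x (t # ts) \<Phi> \<xi> =
     p_minus_int r (t - s) x (\<lambda>y. Y_integral r t y ts \<Phi> (\<xi>(t := y)))"

text \<open>\<open>Y_prob r u J A\<close> is the signed finite-dimensional distribution at the finite set of times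
  \<open>J\<close> of the process started at \<open>u\<close>, and \<open>Y_expectation r u J \<Phi>\<close> is the integral of a functional
  \<open>\<Phi>\<close> which depends on the path only through its values at the times in \<open>J\<close>.\<close>

definition Y_prob :: "real \<Rightarrow> real \<Rightarrow> real set \<Rightarrow> (real \<Rightarrow> real set) \<Rightarrow> real" where
  "Y_prob r u J A = Y_law r 0 u (sorted_list_of_set J) A"

definition Y_expectation :: "real \<Rightarrow> real \<Rightarrow> real set \<Rightarrow> ((real \<Rightarrow> real) \<Rightarrow> real) \<Rightarrow> real" where
  "Y_expectation r u J \<Phi> = Y_integral r 0 u (sorted_list_of_set J) \<Phi> (\<lambda>_. 0)"

lemma p_minus_int_cmult: "p_minus_int r t x (\<lambda>y. c * f y) = c * p_minus_int r t x f"
proof (cases "t = 0")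
  case True
  have "(\<Sum>\<^sub>\<infinity>w::int. (-1) powi w * (indicator {0..<2 * pi * r} (x - 2 * pi * r * of_int w)
            * (c * f (x - 2 * pi * r * of_int w))))
      = (\<Sum>\<^sub>\<infinity>w::int. c * ((-1) powi w * (indicator {0..<2 * pi * r} (x - 2 * pi * r * of_int w)
            * f (x - 2 * pi * r * of_int w))))"
    by (simp add: mult_ac)
  then show ?thesis
    using True by (simp add: p_minus_int_def infsum_cmult_right')
next
  case False
  have "(LINT y:{0..<2 * pi * r}|lborel. p_minus r t y x * (c * f y))
      = (LINT y:{0..<2 * pi * r}|lborel. c * (p_minus r t y x * f y))"
    by (simp add: mult_ac)
  then show ?thesis
    using False by (simp add: p_minus_int_def)
qed

lemma Y_integral_rectangle:
  assumes "distinct ts" "finite S" "S \<inter> set ts = {}"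
  shows "Y_integral r s x ts (\<lambda>\<xi>. \<Prod>t\<in>S \<union> set ts. indicator (A t) (\<xi> t)) \<xi>
       = (\<Prod>t\<in>S. indicator (A t) (\<xi> t)) * Y_law r s x ts A"
  using assms
proof (induction ts arbitrary: S s x \<xi>)
  case Nil
  then show ?case by simp
next
  case (Cons t ts)
  have IH: "Y_integral r t y ts (\<lambda>\<xi>. \<Prod>t\<in>S \<union> set (t # ts). indicator (A t) (\<xi> t)) (\<xi>(t := y))
      = (\<Prod>t\<in>S. indicator (A t) (\<xi> t)) * (indicator (A t) y * Y_law r t y ts A)" for y
  proof -
    have "Y_integral r t y ts (\<lambda>\<xi>. \<Prod>t\<in>insert t S \<union> set ts. indicator (A t) (\<xi> t)) (\<xi>(t := y))
      = (\<Prod>t'\<in>insert t S. indicator (A t') ((\<xi>(t := y)) t')) * Y_law r t y ts A"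
      by (rule Cons.IH) (use Cons.prems in auto)
    also have "(\<Prod>t'\<in>insert t S. indicator (A t') ((\<xi>(t := y)) t'))
      = indicator (A t) y * (\<Prod>t'\<in>S. indicator (A t') ((\<xi>(t := y)) t') :: real)"
      using Cons.prems by (subst prod.insert) auto
    also have "(\<Prod>t'\<in>S. indicator (A t') ((\<xi>(t := y)) t') :: real)
      = (\<Prod>t'\<in>S. indicator (A t') (\<xi> t'))"
      by (rule prod.cong) (use Cons.prems in auto)
    finally show ?thesis by (simp add: mult_ac del: fun_upd_apply)
  qed
  show ?case
    by (simp only: Y_integral.simps Y_law.simps IH p_minus_int_cmult)
qed

lemma Y_expectation_rectangle:
  assumes "finite J"
  shows "Y_expectation r u J (\<lambda>\<xi>. \<Prod>t\<in>J. indicator (A t) (\<xi> t)) = Y_prob r u J A"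
  using Y_integral_rectangle[of "sorted_list_of_set J" "{}"] assms
  by (simp add: Y_expectation_def Y_prob_def)

end

theory Submission
  imports Defs
begin

text \<open>By Poisson summation \<open>p_minus r \<tau> (pi * r)\<close> is a positive multiple of \<open>\<vartheta>\<^sub>1\<close>, so the process is
  the \<open>h\<close>-transform, with this space-time harmonic function \<open>h\<close>, of a Brownian motion whose kernel is
  diagonalised on \<open>[0, 2 * pi * r]\<close> by the functions \<open>sin ((m + 1/2) * x / r)\<close>. Instead of Girsanov's
  theorem, which would require hitting times, only martingales that are bounded up to time \<open>T\<close> are used: the quotients
  \<open>exp (\<mu>\<^sub>m * t) * sin ((m + 1/2) * x / r) / h\<close> extend smoothly across the singularities of the drift (both
  numerator and denominator contain the factor \<open>sin (x / (2 * r))\<close>), and they solve the backward equation off the zeros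
  of that factor. As the set of times spent at the zeros is null, Ito's formula makes these quotients martingales along the
  process. Evaluating them at successive times gives the formula for observables whose factors are polynomials
  in \<open>cos (x / r)\<close>; even and periodic functions are functions of \<open>cos (x / r)\<close>, and bounded Borel functions of
  \<open>cos (x / r)\<close> are reached from polynomials by bounded pointwise limits, under which both sides are continuous.\<close>

section \<open>Functionals determined by moments\<close>

text \<open>The signs in the kernel are what makes it tractable: against antiperiodic functions the
  folded kernel acts like Brownian motion on the whole line. The factors of an observable are even
  and periodic and the terminal weight is odd and antiperiodic, so only functions
  \<open>sin (x / (2 * r))\<close> times an even periodic function are ever evolved. With
  polynomials in \<open>cos (x / r)\<close> for the latter, multiplication by the cosine and
  evolution stay in the span of the half-integer sines, so a multi-time integral is evaluated from
  the last time backwards, with the same polynomial on both sides.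

  Two obstacles shape the rest. The quotients need \<open>theta_k > 0\<close> also where the sine
  vanishes, and there positivity of \<open>theta_h\<close> inside the period says nothing; the sine
  series yields it for large times, the image series for small ones, and Poisson summation, deduced
  from equality of sine moments, identifies the two. And a solution of the equation is not assumed
  to avoid the singularities of its drift, so the equation itself must show that it spends no time
  there.\<close>

text \<open>A monotone class argument: polynomials reach continuous functions by Weierstrass, ramps
  reach indicators of half-lines, Dynkin's theorem reaches Borel sets, and simple functions with
  increasing limits reach bounded Borel functions. Only bounded sequential limits are taken, so
  \<open>P\<close> may be an equation between integrals.\<close>

lemma bounded_borel_closure:
  fixes P :: "('a \<Rightarrow> real) \<Rightarrow> bool" and c :: "'a \<Rightarrow> real"
  assumes c: "\<And>x. c x \<in> {-1..1}"
    and pow: "\<And>k. P (\<lambda>x. c x ^ k)"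
    and lin: "\<And>a f g. P f \<Longrightarrow> P g \<Longrightarrow> P (\<lambda>x. a * f x + g x)"
    and lim: "\<And>f F C. (\<And>n. P (f n)) \<Longrightarrow> (\<And>n x. \<bar>f n x\<bar> \<le> C) \<Longrightarrow>
                (\<And>x. (\<lambda>n. f n x) \<longlonglongrightarrow> F x) \<Longrightarrow> P F"
    and \<phi>: "\<phi> \<in> borel_measurable borel" "\<And>y. \<bar>\<phi> y\<bar> \<le> K"
  shows "P (\<lambda>x. \<phi> (c x))"
proof -
  have const: "P (\<lambda>x. a)" for a
    using lin[OF pow[of 0] pow[of 0], of "a - 1"] by (simp add: algebra_simps)
  have poly: "P (\<lambda>x. \<Sum>i\<le>n. a i * c x ^ i)" for a :: "nat \<Rightarrow> real" and n
  proof (induction n)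
    case 0
    then show ?case using const[of "a 0"] by simp
  next
    case (Suc n)
    show ?case using lin[OF pow[of "Suc n"] Suc, of "a (Suc n)"] by (simp add: add.commute)
  qed
  have cont: "P (\<lambda>x. f (c x))" if f: "continuous_on {-1..1::real} f" for f
  proof -
    have "\<exists>g. real_polynomial_function g \<and> (\<forall>x\<in>{-1..1}. \<bar>f x - g x\<bar> < inverse (real (Suc n)))" for n
      using Stone_Weierstrass_real_polynomial_function[OF compact_Icc f, of "inverse (real (Suc n))"]
      by (metis inverse_positive_iff_positive of_nat_0_less_iff zero_less_Suc)
    then obtain g where g: "\<And>n. real_polynomial_function (g n)"
        "\<And>n x. x \<in> {-1..1} \<Longrightarrow> \<bar>f x - g n x\<bar> < inverse (real (Suc n))"
      by metis
    have "bounded (f ` {-1..1})"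
      by (rule compact_imp_bounded[OF compact_continuous_image[OF f compact_Icc]])
    then obtain B where B: "\<And>x. x \<in> {-1..1} \<Longrightarrow> \<bar>f x\<bar> \<le> B"
      by (force simp: bounded_iff)
    show ?thesis
    proof (rule lim[of "\<lambda>n x. g n (c x)" "B + 1"])
      fix n
      from g(1)[of n] obtain a N where "g n = (\<lambda>x. \<Sum>i\<le>N. a i * x^i)"
        unfolding real_polynomial_function_iff_sum by blast
      then show "P (\<lambda>x. g n (c x))" using poly by simp
    next
      fix n x
      have "inverse (real (Suc n)) \<le> 1" by (simp add: field_simps)
      then show "\<bar>g n (c x)\<bar> \<le> B + 1" using g(2)[OF c[of x], of n] B[OF c[of x]] by linarith
    next
      fix x
      show "(\<lambda>n. g n (c x)) \<longlonglongrightarrow> f (c x)"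
      proof (rule Lim_transform[OF tendsto_const])
        show "(\<lambda>n. g n (c x) - f (c x)) \<longlonglongrightarrow> 0"
          by (rule Lim_null_comparison[OF _ LIMSEQ_inverse_real_of_nat])
             (use g(2)[OF c[of x]] in \<open>auto simp: abs_minus_commute less_imp_le\<close>)
      qed
    qed
  qed
  \<comment> \<open>The approximating ramps equal 1 up to and including \<open>a\<close>, which
    makes the limit the indicator of the closed half-line.\<close>
  have half: "P (\<lambda>x. indicator {..a} (c x))" for a
  proof (rule lim[of "\<lambda>n x. max 0 (1 - real n * max 0 (c x - a))" 1])
    fix n show "P (\<lambda>x. max 0 (1 - real n * max 0 (c x - a)))"
      by (rule cont) (intro continuous_intros)
  next
    fix x
    show "(\<lambda>n. max 0 (1 - real n * max 0 (c x - a))) \<longlonglongrightarrow> indicator {..a} (c x)"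
    proof (cases "c x \<le> a")
      case True
      then show ?thesis by simp
    next
      case False
      then have "\<forall>\<^sub>F n in sequentially. 1 / (c x - a) \<le> real n"
        by (intro eventually_sequentiallyI[of "nat \<lceil>1 / (c x - a)\<rceil>"]) linarith
      then have "\<forall>\<^sub>F n in sequentially. 0 = max 0 (1 - real n * max 0 (c x - a))"
        by eventually_elim (use False in \<open>auto simp: field_simps\<close>)
      then show ?thesis using False
        by (intro Lim_transform_eventually[OF tendsto_const]) (auto elim: eventually_mono)
    qed
  qed (auto simp: max_def)
  have ind: "P (\<lambda>x. indicator A (c x))" if "A \<in> sets borel" for A
  proof -
    have "Int_stable (range (atMost :: real \<Rightarrow> _))"
    proof (unfold Int_stable_def, safe)
      fix a b :: real
      show "{..a} \<inter> {..b} \<in> range atMost" by (intro range_eqI[of _ _ "min a b"]) auto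
    qed
    moreover have "range (atMost :: real \<Rightarrow> _) \<subseteq> Pow UNIV" by simp
    moreover have "A \<in> sigma_sets UNIV (range atMost)"
      using that by (simp add: borel_eq_atMost)
    ultimately show ?thesis
    proof (induct rule: sigma_sets_induct_disjoint)
      case (basic A)
      then show ?case using half by auto
    next
      case empty
      then show ?case using const[of 0] by simp
    next
      case (compl A)
      then have "P (\<lambda>x. (-1) * indicator A (c x) + 1)" by (intro lin const)
      moreover have "(\<lambda>x. (-1) * indicator A (c x) + 1) = (\<lambda>x. indicator (UNIV - A) (c x) :: real)"
        by (auto simp: indicator_def)
      ultimately show ?case by simp
    next
      case (union A)
      show ?case
      proof (rule lim[of "\<lambda>n x. \<Sum>i<n. indicator (A i) (c x)" 1])
        fix n show "P (\<lambda>x. \<Sum>i<n. indicator (A i) (c x))"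
        proof (induction n)
          case 0
          then show ?case using const[of 0] by simp
        next
          case (Suc n)
          show ?case using lin[OF union(3)[of n] Suc, of 1] by (simp add: add.commute)
        qed
      next
        fix n x
        have "(\<Sum>i<n. indicator (A i) (c x) :: real) = indicator (\<Union>i<n. A i) (c x)"
          using union(1) by (intro indicator_UN_disjoint[symmetric])
            (auto simp: disjoint_family_on_def)
        then show "\<bar>\<Sum>i<n. indicator (A i) (c x)\<bar> \<le> (1::real)" by (simp add: indicator_def)
      next
        fix x
        show "(\<lambda>n. \<Sum>i<n. indicator (A i) (c x)) \<longlonglongrightarrow> (indicator (\<Union> (range A)) (c x) :: real)"
          using indicator_sums[of A "c x"] union(1)
          by (auto simp: sums_def disjoint_family_on_def)
      qed
    qed
  qed
  \<comment> \<open>Shifting by \<open>K\<close> makes the function nonnegative, as the induction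
    over measurable functions requires.\<close>
  define u where "u y = \<phi> y + K" for y
  have u: "u \<in> borel_measurable borel" "\<And>y. 0 \<le> u y" "\<And>y. u y \<le> 2 * K"
  proof -
    show "u \<in> borel_measurable borel" using \<phi>(1) unfolding u_def by simp
    show "0 \<le> u y" "u y \<le> 2 * K" for y
      using abs_le_D1[OF \<phi>(2)[of y]] abs_le_D2[OF \<phi>(2)[of y]] by (auto simp: u_def)
  qed
  \<comment> \<open>The bound sits inside the induction formula with \<open>K\<close> arbitrary:
    scaling divides it by the factor, a summand inherits it because the other one is nonnegative,
    and the members of an increasing sequence inherit it from the limit.\<close>
  have "(\<forall>y. u y \<le> 2 * K) \<longrightarrow> P (\<lambda>x. u (c x))"
    if "u \<in> borel_measurable borel" "\<And>y. 0 \<le> u y" for u :: "real \<Rightarrow> real" and K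
    using that
  proof (induct arbitrary: K rule: borel_measurable_induct_real)
    case (set A)
    then show ?case using ind by auto
  next
    case (mult u a)
    show ?case
    proof (cases "a = 0")
      case True
      then show ?thesis using const[of 0] by simp
    next
      case False
      show ?thesis
      proof
        assume "\<forall>y. a * u y \<le> 2 * K"
        then have "\<forall>y. u y \<le> 2 * (K / a)" using False mult by (auto simp: field_simps)
        then have "P (\<lambda>x. u (c x))" using mult by blast
        from lin[OF this const[of 0], of a] show "P (\<lambda>x. a * u (c x))" by simp
      qed
    qed
  next
    case (add u v)
    show ?case
    proof
      assume *: "\<forall>y. v y + u y \<le> 2 * K"
      have "P (\<lambda>x. u (c x))" "P (\<lambda>x. v (c x))"
        using add * by (metis add_increasing add_increasing2 add_le_same_cancel1 le_add_same_cancel1 le_add_same_cancel2 order_trans)+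
      from lin[OF this, of 1] show "P (\<lambda>x. v (c x) + u (c x))" by (simp add: add.commute)
    qed
  next
    case (seq U)
    show ?case
    proof
      assume *: "\<forall>y. u y \<le> 2 * K"
      have le: "U i y \<le> u y" for i y
        using incseq_le[of "\<lambda>i. U i y" "u y" i] seq by (auto simp: incseq_def le_fun_def)
      show "P (\<lambda>x. u (c x))"
      proof (rule lim[of "\<lambda>i x. U i (c x)" "2 * K"])
        fix i show "P (\<lambda>x. U i (c x))" using seq(3)[of i K] le * order_trans by blast
        fix x show "\<bar>U i (c x)\<bar> \<le> 2 * K" using seq(2)[of i "c x"] le[of i "c x"] *[rule_format, of "c x"] by simp
      qed (use seq in auto)
    qed
  qed
  then have "P (\<lambda>x. u (c x))" using u by blast
  from lin[OF this const[of "- K"], of 1] show ?thesis by (simp add: u_def)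
qed

section \<open>Even periodic functions as functions of the cosine\<close>

definition even_periodic :: "real \<Rightarrow> (real \<Rightarrow> real) \<Rightarrow> bool" where
  "even_periodic r g \<longleftrightarrow> g \<in> borel_measurable borel \<and> bounded (range g) \<and>
     (\<forall>x. g (x + 2 * pi * r) = g x) \<and> (\<forall>x. g (- x) = g x)"

lemma even_periodic_int:
  assumes "even_periodic r g"
  shows "g (x + 2 * pi * r * of_int k) = g x"
proof -
  interpret periodic_fun_simple g "2 * pi * r"
    using assms by unfold_locales (simp add: even_periodic_def)
  show ?thesis using plus_of_int[of x k] by (simp add: mult_ac)
qed

text \<open>\<open>r * arccos (cos (x / r))\<close> is the point of \<open>[0, pi * r]\<close> that
  reflections and shifts by the period identify with \<open>x\<close>.\<close>

lemma even_periodic_cos: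
  assumes "0 < r" "even_periodic r g"
  shows "g x = g (r * arccos (cos (x / r)))"
proof -
  have "cos (arccos (cos (x / r))) = cos (x / r)" by simp
  then obtain n where n: "n \<in> \<int>" "x / r = arccos (cos (x/r)) + 2 * n * pi \<or> x / r = - arccos (cos (x/r)) + 2 * n * pi"
    unfolding cos_eq by (metis add.inverse_inverse cos_eq)
  then obtain k where k: "n = of_int k" by (auto elim: Ints_cases)
  show ?thesis
    using n(2)
  proof
    assume "x / r = arccos (cos (x/r)) + 2 * n * pi"
    then have "x = r * arccos (cos (x/r)) + 2 * pi * r * of_int k"
      using assms(1) k by (simp add: field_simps)
    then show ?thesis using even_periodic_int[OF assms(2)] by metis
  next
    assume "x / r = - arccos (cos (x/r)) + 2 * n * pi"
    then have "x = - (r * arccos (cos (x/r))) + 2 * pi * r * of_int k"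
      using assms(1) k by (simp add: field_simps)
    then show ?thesis using even_periodic_int[OF assms(2)] assms(2)
      unfolding even_periodic_def by metis
  qed
qed

text \<open>The outer function of the cosine is \<open>g\<close> composed with
  \<open>r * arccos\<close>; the argument is clamped to \<open>[-1, 1]\<close> so that this function
  is Borel on the whole line.\<close>

lemma even_periodic_closure:
  fixes P :: "(real \<Rightarrow> real) \<Rightarrow> bool"
  assumes r: "0 < r" and g: "even_periodic r g"
    and pow: "\<And>k. P (\<lambda>x. cos (x / r) ^ k)"
    and lin: "\<And>a f g. P f \<Longrightarrow> P g \<Longrightarrow> P (\<lambda>x. a * f x + g x)"
    and lim: "\<And>f F C. (\<And>n. P (f n)) \<Longrightarrow> (\<And>n x. \<bar>f n x\<bar> \<le> C) \<Longrightarrow>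
                (\<And>x. (\<lambda>n. f n x) \<longlonglongrightarrow> F x) \<Longrightarrow> P F"
  shows "P g"
proof -
  define \<phi> where "\<phi> c = g (r * arccos (max (-1) (min 1 c)))" for c
  have "continuous_on UNIV (\<lambda>c::real. arccos (max (-1) (min 1 c)))"
    by (rule continuous_on_arccos) (auto intro!: continuous_intros)
  then have [measurable]: "(\<lambda>c::real. arccos (max (-1) (min 1 c))) \<in> borel_measurable borel"
    by (rule borel_measurable_continuous_onI)
  have [measurable]: "g \<in> borel_measurable borel" using g by (simp add: even_periodic_def)
  obtain K where K: "\<And>x. \<bar>g x\<bar> \<le> K" using g by (auto simp: even_periodic_def bounded_iff)
  have "P (\<lambda>x. \<phi> (cos (x / r)))"
  proof (rule bounded_borel_closure[where K = K and P = P and c = "\<lambda>x. cos (x / r)"])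
    show "\<phi> \<in> borel_measurable borel" unfolding \<phi>_def by measurable
  qed (use K in \<open>auto simp: \<phi>_def intro: pow lin\<close>, rule lim)
  moreover have "\<phi> (cos (x / r)) = g x" for x
    using even_periodic_cos[OF r g, of x] by (simp add: \<phi>_def)
  ultimately show ?thesis by simp
qed

section \<open>The signed transition kernel\<close>

text \<open>The involution \<open>w\<close> to \<open>1 - w\<close> pairs the indices
  \<open>- j\<close> and \<open>j + 1\<close>. The members of a pair carry opposite signs
  \<open>(-1)^w\<close> and, in the theta series, the same square \<open>(w - 1/2)^2\<close>, so a
  pair collapses to a difference of two images or to one sine.\<close>

lemma infsum_int_pairs:
  fixes f :: "int \<Rightarrow> 'a::banach"
  assumes "summable (\<lambda>j. norm (f (int j + 1)))" "summable (\<lambda>j. norm (f (- int j)))"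
  shows "infsum f UNIV = (\<Sum>j. f (- int j) + f (int j + 1))"
proof -
  have a: "((\<lambda>j. f (int j + 1)) has_sum (\<Sum>j. f (int j + 1))) UNIV"
    by (rule norm_summable_imp_has_sum[OF assms(1) summable_sums[OF summable_norm_cancel[OF assms(1)]]])
  have b: "((\<lambda>j. f (- int j)) has_sum (\<Sum>j. f (- int j))) UNIV"
    by (rule norm_summable_imp_has_sum[OF assms(2) summable_sums[OF summable_norm_cancel[OF assms(2)]]])
  have "(f has_sum (\<Sum>j. f (int j + 1))) (range (\<lambda>j. int j + 1))"
    by (subst has_sum_reindex) (use a in \<open>auto simp: o_def inj_def\<close>)
  moreover have "(f has_sum (\<Sum>j. f (- int j))) (range (\<lambda>j. - int j))"
    by (subst has_sum_reindex) (use b in \<open>auto simp: o_def inj_def\<close>)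
  moreover have "range (\<lambda>j. int j + 1) \<inter> range (\<lambda>j. - int j) = {}" by auto
  ultimately have "(f has_sum ((\<Sum>j. f (int j + 1)) + (\<Sum>j. f (- int j))))
      (range (\<lambda>j. int j + 1) \<union> range (\<lambda>j. - int j))"
    by (rule has_sum_Un_disjoint)
  moreover have "range (\<lambda>j. int j + 1) \<union> range (\<lambda>j. - int j) = UNIV"
  proof (intro equalityI subsetI UNIV_I)
    fix w :: int
    show "w \<in> range (\<lambda>j. int j + 1) \<union> range (\<lambda>j. - int j)"
    proof (cases "w \<ge> 1")
      case True
      then have "w = int (nat (w - 1)) + 1" by simp
      then show ?thesis by blast
    next
      case False
      then have "w = - int (nat (- w))" by simp
      then show ?thesis by blast
    qed
  qed
  ultimately show ?thesis
    using suminf_add[OF summable_norm_cancel[OF assms(1)] summable_norm_cancel[OF assms(2)]]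
    by (auto intro!: infsumI simp: add.commute)
qed

section \<open>Convergence of the image series\<close>

lemma pBM_normal: "0 < t \<Longrightarrow> pBM t y x = normal_density x (sqrt t) y"
  by (simp add: pBM_def normal_density_def)

lemma pBM_nonneg [simp]: "0 < t \<Longrightarrow> 0 \<le> pBM t y x"
  by (simp add: pBM_def)

text \<open>With \<open>a = y - x\<close> and \<open>b = L * w\<close>, the inequality
  \<open>(b + 2 * a)^2 >= 0\<close> gives \<open>(a + b)^2 >= b^2 / 2 - a^2\<close>. Since
  \<open>w^2 >= |w|\<close>, the image series is dominated by a geometric one, uniformly for
  \<open>x\<close> within distance \<open>d\<close> of \<open>y\<close>.\<close>

lemma pBM_bound:
  assumes "0 < t" "\<bar>y - x\<bar> \<le> d"
  shows "pBM t (y + L * of_int w) x \<le> exp (d\<^sup>2 / (2*t)) / sqrt (2*pi*t) * exp (- (L\<^sup>2 / (4*t))) ^ nat \<bar>w\<bar>"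
proof -
  have w: "real (nat \<bar>w\<bar>) \<le> (real_of_int w)\<^sup>2"
  proof -
    have "\<bar>w\<bar> \<le> w\<^sup>2" by (metis abs_ge_zero abs_le_square_iff abs_power2 linorder_le_cases power2_abs power2_eq_square self_le_power zero_less_numeral int_one_le_iff_zero_less mult_eq_0_iff order_le_less zero_le_power2)
    then have "real_of_int \<bar>w\<bar> \<le> real_of_int (w\<^sup>2)" by (simp only: of_int_le_iff)
    then show ?thesis by simp
  qed
  have d: "(y - x)\<^sup>2 \<le> d\<^sup>2" using assms(2) by (metis abs_ge_zero order_trans power2_abs power_mono)
  have "0 \<le> (L * w + 2 * (y - x))\<^sup>2" by simp
  also have "\<dots> = 2 * (y + L * w - x)\<^sup>2 - L\<^sup>2 * (real_of_int w)\<^sup>2 + 2 * (y-x)\<^sup>2"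
    by (simp add: power2_eq_square algebra_simps)
  finally have "L\<^sup>2 * (real_of_int w)\<^sup>2 / 2 - d\<^sup>2 \<le> (y + L * w - x)\<^sup>2" using d by simp
  moreover have "L\<^sup>2 * real (nat \<bar>w\<bar>) \<le> L\<^sup>2 * (real_of_int w)\<^sup>2" using w by (intro mult_left_mono) auto
  ultimately have "L\<^sup>2 * real (nat \<bar>w\<bar>) / 2 - d\<^sup>2 \<le> (y + L * w - x)\<^sup>2" by linarith
  then have "(L\<^sup>2 * real (nat \<bar>w\<bar>) / 2 - d\<^sup>2) / (2 * t) \<le> (y + L * w - x)\<^sup>2 / (2 * t)"
    using assms by (intro divide_right_mono) auto
  also have "(L\<^sup>2 * real (nat \<bar>w\<bar>) / 2 - d\<^sup>2) / (2 * t) = real (nat \<bar>w\<bar>) * (L\<^sup>2 / (4*t)) - d\<^sup>2 / (2*t)"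
    using assms by (simp add: field_simps)
  finally have "- (y + L * w - x)\<^sup>2 / (2*t) \<le> d\<^sup>2 / (2*t) + real (nat \<bar>w\<bar>) * (- (L\<^sup>2 / (4*t)))" by simp
  then have "exp (- (y + L * w - x)\<^sup>2 / (2*t)) \<le> exp (d\<^sup>2 / (2*t)) * exp (- (L\<^sup>2 / (4*t))) ^ nat \<bar>w\<bar>"
    unfolding exp_of_nat_mult[symmetric] exp_add[symmetric] by simp
  then show ?thesis
    unfolding pBM_def using assms by (simp add: divide_right_mono)
qed

lemma summable_pBM:
  assumes "0 < r" "0 < t"
  shows "summable (\<lambda>j. pBM t (y - 2*pi*r * real j) x)"
    and "summable (\<lambda>j. pBM t (y + 2*pi*r * (real j + 1)) x)"
proof -
  define \<rho> where "\<rho> = exp (- ((2*pi*r)\<^sup>2 / (4*t)))"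
  define C where "C = exp (\<bar>y - x\<bar>\<^sup>2 / (2*t)) / sqrt (2*pi*t)"
  have \<rho>: "0 < \<rho>" "\<rho> < 1" "0 \<le> C" using assms by (auto simp: \<rho>_def C_def)
  have s: "summable (\<lambda>j. C * \<rho> ^ j)"
    using \<rho> by (intro summable_mult summable_geometric) auto
  show "summable (\<lambda>j. pBM t (y - 2*pi*r * real j) x)"
  proof (rule summable_comparison_test'[OF s])
    fix j show "norm (pBM t (y - 2*pi*r * real j) x) \<le> C * \<rho> ^ j"
      using assms pBM_bound[OF assms(2), of y x "\<bar>y - x\<bar>" "2*pi*r" "- int j"] by (simp add: C_def \<rho>_def)
  qed
  show "summable (\<lambda>j. pBM t (y + 2*pi*r * (real j + 1)) x)"
  proof (rule summable_comparison_test'[OF s])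
    fix j
    have "pBM t (y + 2*pi*r * (real j + 1)) x \<le> C * \<rho> ^ Suc j"
      using pBM_bound[OF assms(2), of y x "\<bar>y - x\<bar>" "2*pi*r" "int j + 1"]
      by (simp add: C_def \<rho>_def nat_add_distrib del: power_Suc)
    also have "\<dots> \<le> C * \<rho> ^ j" using \<rho> by (intro mult_left_mono power_decreasing) auto
    finally show "norm (pBM t (y + 2*pi*r * (real j + 1)) x) \<le> C * \<rho> ^ j" using assms by simp
  qed
qed

text \<open>An ordinary series of paired images, to which the lemmas on measurability and on
  exchanging sum and integral apply.\<close>

lemma p_minus_suminf:
  assumes "0 < r" "0 < t"
  shows "p_minus r t y x =
    (\<Sum>j. (-1)^j * (pBM t (y - 2*pi*r * real j) x - pBM t (y + 2*pi*r * (real j + 1)) x))"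
proof -
  have "p_minus r t y x = (\<Sum>j. (-1) powi (- int j) * pBM t (y + 2*pi*r * of_int (- int j)) x
      + (-1) powi (int j + 1) * pBM t (y + 2*pi*r * of_int (int j + 1)) x)"
    unfolding p_minus_def
  proof (rule infsum_int_pairs)
    show "summable (\<lambda>j. norm ((-1) powi (int j + 1) * pBM t (y + 2*pi*r * of_int (int j + 1)) x))"
      using summable_pBM(2)[OF assms] assms by (simp add: abs_mult power_int_abs)
    show "summable (\<lambda>j. norm ((-1) powi (- int j) * pBM t (y + 2*pi*r * of_int (- int j)) x))"
      using summable_pBM(1)[OF assms] assms by (simp add: abs_mult power_int_abs)
  qed
  also have "\<dots> = (\<Sum>j. (-1)^j * (pBM t (y - 2*pi*r * real j) x - pBM t (y + 2*pi*r * (real j + 1)) x))"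
    by (intro suminf_cong)
       (simp add: power_int_minus power_int_add algebra_simps flip: power_inverse)
  finally show ?thesis .
qed

lemma pBM_measurable [measurable (raw)]:
  assumes "f \<in> borel_measurable M" "g \<in> borel_measurable M"
  shows "(\<lambda>w. pBM t (f w) (g w)) \<in> borel_measurable M"
  unfolding pBM_def using assms by measurable

lemma p_minus_measurable [measurable (raw)]:
  assumes "0 < r" "0 < t" "f \<in> borel_measurable M" "g \<in> borel_measurable M"
  shows "(\<lambda>w. p_minus r t (f w) (g w)) \<in> borel_measurable M"
  unfolding p_minus_suminf[OF assms(1,2)] using assms(3,4) by measurable

lemma pBM_integral: "0 < t \<Longrightarrow> integrable lborel (\<lambda>y. pBM t y x)" "0 < t \<Longrightarrow> (LINT y|lborel. pBM t y x) = 1"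
  by (simp_all add: pBM_normal)

text \<open>The pair with index \<open>j\<close> contributes the cell \<open>j\<close> periods to
  the left of \<open>[0, L)\<close> and the cell \<open>j + 1\<close> periods to its right, so
  \<open>n\<close> pairs tile an interval symmetric about \<open>L\<close>.\<close>

lemma sum_shifted_integrals:
  fixes F :: "real \<Rightarrow> real"
  assumes F: "integrable lborel F" and L: "0 < L"
  shows "(\<Sum>j<n. LINT y:{0..<L}|lborel. F (y - L * real j) + F (y + L * (real j + 1)))
       = (LINT y:{L - L * real n..<L + L * real n}|lborel. F y)"
proof (induction n)
  case 0
  then show ?case by (simp add: set_lebesgue_integral_def)
next
  case (Suc n)
  have int: "set_integrable lborel A F" if "A \<in> sets borel" for A
    using integrable_mult_indicator[of A lborel F] F that by (simp add: set_integrable_def)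
  have shift: "(LINT y:{0..<L}|lborel. F (y + c)) = (LINT y:{c..<c + L}|lborel. F y)" for c
    unfolding set_lebesgue_integral_def
    by (subst lborel_integral_real_affine[of 1 _ c]) (auto simp: indicator_def add.commute intro!: Bochner_Integration.integral_cong)
  have si: "set_integrable lborel {0..<L} (\<lambda>y. F (y + c))" for c
    using integrable_mult_indicator[of "{0..<L}" lborel, OF _ lborel_integrable_real_affine[OF F, of 1 c]]
    by (simp add: set_integrable_def add.commute)
  have "(LINT y:{0..<L}|lborel. F (y - L * real n) + F (y + L * (real n + 1)))
      = (LINT y:{- (L * real n)..<L - L * real n}|lborel. F y) + (LINT y:{L + L * real n..<L + L * real (Suc n)}|lborel. F y)"
    using shift[of "- (L * real n)"] shift[of "L * (real n + 1)"] si[of "- (L * real n)"] si[of "L * (real n + 1)"]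
    by (simp add: set_integral_add algebra_simps)
  moreover have "(LINT y:{L - L * real (Suc n)..<L + L * real (Suc n)}|lborel. F y)
     = (LINT y:{- (L * real n)..<L - L * real n}|lborel. F y) +
       ((LINT y:{L - L * real n..<L + L * real n}|lborel. F y) + (LINT y:{L + L * real n..<L + L * real (Suc n)}|lborel. F y))"
  proof -
    have A: "{L - L * real n..<L + L * real (Suc n)} = {L - L * real n..<L + L * real n} \<union> {L + L * real n..<L + L * real (Suc n)}"
      using L by (auto simp: algebra_simps) (smt (verit) mult_nonneg_nonneg of_nat_0_le_iff)
    have B: "{L - L * real (Suc n)..<L + L * real (Suc n)} = {- (L * real n)..<L - L * real n} \<union> {L - L * real n..<L + L * real (Suc n)}"
      using L by (auto simp: algebra_simps) (smt (verit) mult_nonneg_nonneg of_nat_0_le_iff)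
    show ?thesis
      unfolding B by (subst set_integral_Un[OF _ int int], force, simp, simp, subst A, subst set_integral_Un[OF _ int int]) auto
  qed
  ultimately show ?case using Suc by simp
qed

lemma shifted_integrals_tendsto:
  fixes F :: "real \<Rightarrow> real"
  assumes F: "integrable lborel F" and L: "0 < L"
  shows "(\<lambda>j. LINT y:{0..<L}|lborel. F (y - L * real j) + F (y + L * (real j + 1))) sums (LINT y|lborel. F y)"
  unfolding sums_def sum_shifted_integrals[OF F L]
  unfolding set_lebesgue_integral_def
proof (rule integral_dominated_convergence[where w = "\<lambda>y. \<bar>F y\<bar>"])
  show "integrable lborel (\<lambda>y. \<bar>F y\<bar>)" using F by simp
  show "AE y in lborel. (\<lambda>n. indicator {L - L * real n..<L + L * real n} y *\<^sub>R F y) \<longlonglongrightarrow> F y"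
  proof (rule AE_I2)
    fix y
    have "\<forall>\<^sub>F n in sequentially. 1 + \<bar>y\<bar> / L < real n"
      using filterlim_real_sequentially by (auto simp: filterlim_at_top_dense)
    then have "\<forall>\<^sub>F n in sequentially. F y = indicator {L - L * real n..<L + L * real n} y *\<^sub>R F y"
    proof eventually_elim
      case (elim n)
      then have "L + \<bar>y\<bar> < L * real n" using L by (simp add: field_simps)
      then show ?case using L by (auto simp: indicator_def)
    qed
    then show "(\<lambda>n. indicator {L - L * real n..<L + L * real n} y *\<^sub>R F y) \<longlonglongrightarrow> F y"
      by (rule Lim_transform_eventually[OF tendsto_const])
  qed
qed (use F in \<open>auto simp: indicator_def\<close>)

text \<open>Without their signs the images tile the line, so the integrals of the majorants
  \<open>G j\<close> over one period sum to the Gaussian mass 1. This justifies integration term by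
  term and makes the signed kernel a contraction for the supremum norm.\<close>

lemma p_minus_dominated:
  fixes f :: "real \<Rightarrow> real"
  assumes r: "0 < r" and t: "0 < t" and f: "f \<in> borel_measurable borel" "\<And>y. \<bar>f y\<bar> \<le> C"
  shows "set_integrable lborel {0..<2*pi*r} (\<lambda>y. p_minus r t y x * f y)"
    and "p_minus_int r t x f = (\<Sum>j. LINT y:{0..<2*pi*r}|lborel.
           (-1)^j * (pBM t (y - 2*pi*r * real j) x - pBM t (y + 2*pi*r * (real j + 1)) x) * f y)"
    and "\<bar>p_minus_int r t x f\<bar> \<le> C"
proof -
  define L where "L = 2*pi*r"
  have L: "0 < L" using r by (simp add: L_def)
  define g where "g j y = (-1)^j * (pBM t (y - L * real j) x - pBM t (y + L * (real j + 1)) x)" for j y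
  define G where "G j y = pBM t (y - L * real j) x + pBM t (y + L * (real j + 1)) x" for j y
  have [measurable]: "g j \<in> borel_measurable borel" "G j \<in> borel_measurable borel" for j
    unfolding g_def G_def by measurable
  have gG: "\<bar>g j y\<bar> \<le> G j y" for j y
    using pBM_nonneg[OF t, of "y - L * real j" x] pBM_nonneg[OF t, of "y + L * (real j + 1)" x]
    by (simp add: g_def G_def abs_mult)
  have G0: "0 \<le> G j y" for j y using gG[of j y] by simp
  have C: "0 \<le> C" using f(2)[of 0] by simp
  have Gi: "set_integrable lborel {0..<L} (G j)" for j
  proof -
    have "integrable lborel (\<lambda>y. pBM t (y + c) x)" for c
      using lborel_integrable_real_affine[OF pBM_integral(1)[OF t, of x], of 1 c] by (simp add: add.commute)
    from Bochner_Integration.integrable_add[OF this[of "- L * real j"] this[of "L * (real j + 1)"]]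
    have "integrable lborel (G j)" by (simp add: G_def[abs_def])
    from integrable_mult_indicator[OF _ this, of "{0..<L}"]
    show ?thesis by (simp add: set_integrable_def)
  qed
  have Gsum: "(\<lambda>j. LINT y:{0..<L}|lborel. G j y) sums 1"
    using shifted_integrals_tendsto[OF pBM_integral(1)[OF t, of x] L] pBM_integral(2)[OF t, of x]
    by (simp add: G_def)
  define F where "F j y = indicator {0..<L} y * (g j y * f y)" for j y
  have FG: "\<bar>F j y\<bar> \<le> C * (indicator {0..<L} y * G j y)" for j y
    using mult_mono[OF gG[of j y] f(2)[of y]] C G0[of j y] by (auto simp: F_def abs_mult indicator_def mult_ac)
  have Fi: "integrable lborel (F j)" for j
    by (rule Bochner_Integration.integrable_bound[OF integrable_mult_right[of C, OF Gi[of j, unfolded set_integrable_def]]])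
       (use FG C G0 f(1) in \<open>auto simp: F_def[abs_def]\<close>)
  have absF: "(LINT y|lborel. \<bar>F j y\<bar>) \<le> C * (LINT y:{0..<L}|lborel. G j y)" for j
  proof -
    have "(LINT y|lborel. \<bar>F j y\<bar>) \<le> (LINT y|lborel. C * (indicator {0..<L} y * G j y))"
      by (rule integral_mono) (use Fi Gi FG in \<open>auto simp: set_integrable_def\<close>)
    then show ?thesis by (simp add: set_lebesgue_integral_def)
  qed
  have sF: "summable (\<lambda>j. LINT y|lborel. norm (F j y))"
    by (rule summable_comparison_test'[OF summable_mult[OF sums_summable[OF Gsum], of C]])
       (use absF in auto)
  have sG: "summable (\<lambda>j. G j y)" for y
    using summable_add[OF summable_pBM[OF r t, of y x]] by (simp add: G_def L_def)
  have sn: "AE y in lborel. summable (\<lambda>j. norm (F j y))"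
  proof (rule AE_I2)
    fix y show "summable (\<lambda>j. norm (F j y))"
    proof (rule summable_comparison_test'[OF summable_mult[OF sG[of y], of C]])
      fix j
      have "C * (indicator {0..<L} y * G j y) \<le> C * G j y"
        using C G0[of j y] by (intro mult_left_mono) (auto simp: indicator_def)
      then show "norm (norm (F j y)) \<le> C * G j y" using FG[of j y] by simp
    qed
  qed
  have Fs: "(\<Sum>j. F j y) = indicator {0..<L} y * (p_minus r t y x * f y)" for y
  proof -
    have "summable (\<lambda>j. g j y)" by (rule summable_comparison_test'[OF sG[of y]]) (use gG in auto)
    then have "(\<Sum>j. g j y * (f y * indicator {0..<L} y)) = (\<Sum>j. g j y) * (f y * indicator {0..<L} y)"
      by (rule suminf_mult2[symmetric])
    then show ?thesis unfolding p_minus_suminf[OF r t] by (simp add: F_def g_def L_def mult_ac)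
  qed
  have "integrable lborel (\<lambda>y. \<Sum>j. F j y)" by (rule integrable_suminf[OF Fi sn sF])
  then show "set_integrable lborel {0..<2*pi*r} (\<lambda>y. p_minus r t y x * f y)"
    by (simp add: set_integrable_def Fs L_def)
  have "p_minus_int r t x f = (LINT y|lborel. (\<Sum>j. F j y))"
    using t by (simp add: p_minus_int_def set_lebesgue_integral_def Fs L_def)
  also have "\<dots> = (\<Sum>j. LINT y|lborel. F j y)"
    by (rule integral_suminf[OF Fi sn sF])
  finally have eq: "p_minus_int r t x f = (\<Sum>j. LINT y|lborel. F j y)" .
  then show "p_minus_int r t x f = (\<Sum>j. LINT y:{0..<2*pi*r}|lborel.
           (-1)^j * (pBM t (y - 2*pi*r * real j) x - pBM t (y + 2*pi*r * (real j + 1)) x) * f y)"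
    by (simp add: set_lebesgue_integral_def F_def g_def L_def mult_ac)
  have le: "\<bar>LINT y|lborel. F j y\<bar> \<le> C * (LINT y:{0..<L}|lborel. G j y)" for j
    using absF[of j] integral_abs_bound[of lborel "F j"] by linarith
  have sa: "summable (\<lambda>j. \<bar>LINT y|lborel. F j y\<bar>)"
    by (rule summable_comparison_test'[OF summable_mult[OF sums_summable[OF Gsum], of C]])
       (use le in auto)
  have "\<bar>p_minus_int r t x f\<bar> \<le> (\<Sum>j. \<bar>LINT y|lborel. F j y\<bar>)"
    unfolding eq by (rule summable_rabs[OF sa])
  also have "\<dots> \<le> (\<Sum>j. C * (LINT y:{0..<L}|lborel. G j y))"
    by (rule suminf_le[OF le sa summable_mult[OF sums_summable[OF Gsum]]])
  also have "\<dots> = C" using Gsum by (simp add: suminf_mult sums_iff)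
  finally show "\<bar>p_minus_int r t x f\<bar> \<le> C" .
qed

section \<open>Action of the kernel on antiperiodic functions\<close>

text \<open>Antiperiodicity turns each sign \<open>(-1)^w\<close> into a shift of the argument of
  \<open>f\<close>, so every signed image is a translate of the one function
  \<open>pBM t y x * f y\<close>; unfolding the cells leaves an integral over the line without
  signs.\<close>

lemma p_minus_int_antiperiodic:
  fixes f :: "real \<Rightarrow> real"
  assumes r: "0 < r" and t: "0 < t" and f: "f \<in> borel_measurable borel" "\<And>y. \<bar>f y\<bar> \<le> C"
    and anti: "\<And>y. f (y + 2*pi*r) = - f y"
  shows "p_minus_int r t x f = (LINT y|lborel. pBM t y x * f y)"
proof -
  define L where "L = 2*pi*r"
  have L: "0 < L" using r by (simp add: L_def)
  have anti1: "f (y + L * real j) = (-1)^j * f y" for y j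
  proof (induction j)
    case (Suc j)
    have "f (y + L * real (Suc j)) = f ((y + L * real j) + 2*pi*r)" by (simp add: L_def algebra_simps)
    then show ?case using anti Suc by simp
  qed simp
  have anti2: "f (y - L * real j) = (-1)^j * f y" for y j
    using anti1[of "y - L * real j" j] by (simp add: power_mult_distrib[symmetric] flip: mult.assoc)
  have anti3: "f (y + L * (real j + 1)) = - ((-1)^j * f y)" for y j
    using anti1[of y "Suc j"] by (simp add: add.commute)
  define F where "F y = pBM t y x * f y" for y
  have F: "integrable lborel F"
  proof (rule Bochner_Integration.integrable_bound)
    show "integrable lborel (\<lambda>y. pBM t y x * C)" using pBM_integral(1)[OF t] by simp
    show "F \<in> borel_measurable lborel" using f(1) unfolding F_def by measurable
    show "AE y in lborel. norm (F y) \<le> norm (pBM t y x * C)"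
      using t order_trans[OF f(2) abs_ge_self] by (auto simp: F_def abs_mult intro!: mult_left_mono AE_I2)
  qed
  have "(-1)^j * (pBM t (y - L * real j) x - pBM t (y + L * (real j + 1)) x) * f y
      = F (y - L * real j) + F (y + L * (real j + 1))" for j y
    unfolding F_def anti2 anti3 by (simp add: algebra_simps)
  with p_minus_dominated(2)[OF r t f] shifted_integrals_tendsto[OF F L]
  show ?thesis by (simp add: L_def F_def sums_iff)
qed

text \<open>Real and imaginary part of the characteristic function of the standard normal
  law.\<close>

lemma std_normal_cos_sin:
  "(LINT z|lborel. std_normal_density z * cos (a * z)) = exp (- a\<^sup>2 / 2)"
  "(LINT z|lborel. std_normal_density z * sin (a * z)) = 0"
proof -
  have i: "integrable std_normal_distribution (\<lambda>z. iexp (a * z))"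
    by (rule finite_measure.integrable_const_bound[where B = 1])
       (auto simp: prob_space_normal_density prob_space.finite_measure)
  have c: "complex_of_real (exp (- a\<^sup>2 / 2)) = (CLINT z|std_normal_distribution. iexp (a * z))"
    using char_std_normal_distribution by (simp add: char_def fun_eq_iff)
  have "exp (- a\<^sup>2 / 2) = (LINT z|std_normal_distribution. cos (a * z))"
    using arg_cong[OF c, of Re] integral_Re[OF i] by (simp add: Re_exp)
  then show "(LINT z|lborel. std_normal_density z * cos (a * z)) = exp (- a\<^sup>2 / 2)"
    by (simp add: integral_density)
  have "0 = (LINT z|std_normal_distribution. sin (a * z))"
    using arg_cong[OF c, of Im] integral_Im[OF i] by (simp add: Im_exp)
  then show "(LINT z|lborel. std_normal_density z * sin (a * z)) = 0"
    by (simp add: integral_density)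
qed

lemma pBM_integral_shift:
  assumes "0 < t"
  shows "(LINT y|lborel. pBM t y x * f y) = (LINT z|lborel. std_normal_density z * f (x + sqrt t * z))"
proof -
  have "(LINT y|lborel. pBM t y x * f y)
      = sqrt t * (LINT z|lborel. pBM t (x + sqrt t * z) x * f (x + sqrt t * z))"
    using assms by (subst lborel_integral_real_affine[of "sqrt t" _ x]) auto
  also have "\<dots> = (LINT z|lborel. std_normal_density z * f (x + sqrt t * z))"
    using assms by (subst Bochner_Integration.integral_mult_right_zero[symmetric])
      (auto intro!: Bochner_Integration.integral_cong
        simp: pBM_def std_normal_density_def real_sqrt_mult power_mult_distrib)
  finally show ?thesis .
qed

text \<open>The eigenvalue of minus one half of the second derivative for
  \<open>sin ((m + 1/2) * x / r)\<close>. Among the sines vanishing at both ends of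
  \<open>[0, 2 * pi * r]\<close> these are the antiperiodic ones.\<close>

definition dirichlet_rate :: "real \<Rightarrow> nat \<Rightarrow> real" where
  "dirichlet_rate r m = (real m + 1/2)\<^sup>2 / (2 * r\<^sup>2)"

text \<open>The sine is antiperiodic, so the kernel acts as a Gaussian convolution. This multiplies
  by the characteristic function at \<open>a * sqrt t\<close>, and the term with
  \<open>cos (a * x)\<close> integrates to zero.\<close>

lemma p_minus_int_sin:
  assumes r: "0 < r" and t: "0 < t"
  shows "p_minus_int r t x (\<lambda>y. sin ((real m + 1/2) * y / r))
       = exp (- dirichlet_rate r m * t) * sin ((real m + 1/2) * x / r)"
proof -
  define a where "a = (real m + 1/2) / r"
  have "p_minus_int r t x (\<lambda>y. sin (a * y)) = (LINT y|lborel. pBM t y x * sin (a * y))"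
  proof (rule p_minus_int_antiperiodic[OF r t, where C = 1])
    fix y
    have "a * (y + 2*pi*r) = a * y + pi + 2 * pi * real m" using r by (simp add: a_def field_simps)
    then show "sin (a * (y + 2*pi*r)) = - sin (a * y)"
      using sin_cos_eq_iff sin.plus_of_nat[of "a * y + pi" m] by (simp add: mult_ac)
  qed auto
  also have "\<dots> = (LINT z|lborel. sin (a * x) * (std_normal_density z * cos ((a * sqrt t) * z))
                     + cos (a * x) * (std_normal_density z * sin ((a * sqrt t) * z)))"
    unfolding pBM_integral_shift[OF t]
    by (intro Bochner_Integration.integral_cong) (auto simp: algebra_simps sin_add)
  also have "\<dots> = sin (a * x) * exp (- (a * sqrt t)\<^sup>2 / 2)"
  proof (subst Bochner_Integration.integral_add)
    have "integrable lborel (\<lambda>z. std_normal_density z * cos (b * z))" for b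
      by (rule Bochner_Integration.integrable_bound[OF integrable_normal_density[where \<mu> = 0 and \<sigma> = 1]])
         (auto simp: abs_mult mult_left_le)
    moreover have "integrable lborel (\<lambda>z. std_normal_density z * sin (b * z))" for b
      by (rule Bochner_Integration.integrable_bound[OF integrable_normal_density[where \<mu> = 0 and \<sigma> = 1]])
         (auto simp: abs_mult mult_left_le)
    ultimately show "integrable lborel (\<lambda>z. sin (a * x) * (std_normal_density z * cos ((a * sqrt t) * z)))"
       "integrable lborel (\<lambda>z. cos (a * x) * (std_normal_density z * sin ((a * sqrt t) * z)))"
      by (auto intro!: integrable_mult_right)
  qed (simp add: std_normal_cos_sin)
  also have "- (a * sqrt t)\<^sup>2 / 2 = - dirichlet_rate r m * t"
    using t by (simp add: a_def dirichlet_rate_def power_mult_distrib power_divide)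
  finally show ?thesis by (simp add: a_def mult_ac)
qed

lemma p_minus_int_0:
  assumes "x \<in> {0..<2*pi*r}"
  shows "p_minus_int r 0 x f = f x"
proof -
  have "(\<Sum>\<^sub>\<infinity>w::int. (-1) powi w * (indicator {0..<2 * pi * r} (x - 2 * pi * r * of_int w)
                * f (x - 2 * pi * r * of_int w))) =
        (\<Sum>\<^sub>\<infinity>w\<in>{0::int}. (-1) powi w * (indicator {0..<2 * pi * r} (x - 2 * pi * r * of_int w)
                * f (x - 2 * pi * r * of_int w)))"
  proof (rule infsum_cong_neutral)
    fix w :: int assume "w \<in> UNIV - {0}"
    then consider "w \<ge> 1" | "w \<le> -1" by force
    then have "x - 2 * pi * r * of_int w \<notin> {0..<2 * pi * r}"
    proof cases
      case 1
      then have "2*pi*r * 1 \<le> 2*pi*r * of_int w" using assms by (intro mult_left_mono) (auto intro: less_imp_le order_le_less_trans)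
      then have "2*pi*r \<le> 2*pi*r * of_int w" by (simp only: mult_1_right)
      then show ?thesis using assms by (simp only: atLeastLessThan_iff) linarith
    next
      case 2
      then have "2*pi*r * of_int w \<le> 2*pi*r * (-1)" using assms by (intro mult_left_mono) (auto intro: less_imp_le order_le_less_trans)
      then have "2*pi*r * of_int w \<le> - (2*pi*r)" by (simp only: mult_minus_right mult_1_right)
      then show ?thesis using assms by (simp only: atLeastLessThan_iff) linarith
    qed
    then show "(-1) powi w * (indicator {0..<2 * pi * r} (x - 2 * pi * r * of_int w)
                * f (x - 2 * pi * r * of_int w)) = 0" by simp
  qed auto
  then show ?thesis using assms by (simp add: p_minus_int_def)
qed

text \<open>The disjunction on \<open>t\<close> and \<open>x\<close> recurs below: at time zero the
  kernel is a signed sum of point masses, which for a start in \<open>[0, 2 * pi * r)\<close>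
  reduces to the unit mass at \<open>x\<close>, while from elsewhere it lands on a translate,
  possibly with a minus sign.\<close>

lemma p_minus_int_add:
  assumes r: "0 < r" and t: "0 < t \<or> t = 0 \<and> x \<in> {0..<2*pi*r}"
    and f: "f \<in> borel_measurable borel" "\<And>y. \<bar>f y\<bar> \<le> C"
    and g: "g \<in> borel_measurable borel" "\<And>y. \<bar>g y\<bar> \<le> D"
  shows "p_minus_int r t x (\<lambda>y. f y + g y) = p_minus_int r t x f + p_minus_int r t x g"
  using t
proof
  assume t: "0 < t"
  show ?thesis
    using t set_integral_add(2)[OF p_minus_dominated(1)[OF r t f] p_minus_dominated(1)[OF r t g]]
    by (simp add: p_minus_int_def distrib_left)
qed (simp add: p_minus_int_0)

lemma p_minus_int_tendsto:
  assumes r: "0 < r" and t: "0 < t \<or> t = 0 \<and> x \<in> {0..<2*pi*r}"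
    and f: "\<And>n. f n \<in> borel_measurable borel" "\<And>n y. \<bar>f n y\<bar> \<le> C"
    and lim: "\<And>y. (\<lambda>n. f n y) \<longlonglongrightarrow> F y"
  shows "(\<lambda>n. p_minus_int r t x (f n)) \<longlonglongrightarrow> p_minus_int r t x F"
  using t
proof
  assume t: "0 < t"
  have [measurable]: "F \<in> borel_measurable borel"
    by (rule borel_measurable_LIMSEQ_real[OF lim f(1)])
  have [measurable]: "f n \<in> borel_measurable borel" for n by (rule f)
  have [measurable]: "(\<lambda>y. p_minus r t y x) \<in> borel_measurable borel"
    by (rule p_minus_measurable[OF r t]) auto
  have C: "0 \<le> C" using f(2)[of 0 0] by simp
  have "(\<lambda>n. LINT y|lborel. indicator {0..<2*pi*r} y *\<^sub>R (p_minus r t y x * f n y))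
      \<longlonglongrightarrow> (LINT y|lborel. indicator {0..<2*pi*r} y *\<^sub>R (p_minus r t y x * F y))"
  proof (rule integral_dominated_convergence[where w = "\<lambda>y. norm (indicator {0..<2*pi*r} y *\<^sub>R (p_minus r t y x * C))"])
    have "set_integrable lborel {0..<2*pi*r} (\<lambda>y. p_minus r t y x * C)"
      by (rule p_minus_dominated(1)[OF r t, of _ C]) (use C in auto)
    then show "integrable lborel (\<lambda>y. norm (indicator {0..<2*pi*r} y *\<^sub>R (p_minus r t y x * C)))"
      unfolding set_integrable_def by (rule integrable_norm)
    show "AE y in lborel. (\<lambda>n. indicator {0..<2*pi*r} y *\<^sub>R (p_minus r t y x * f n y))
        \<longlonglongrightarrow> indicator {0..<2*pi*r} y *\<^sub>R (p_minus r t y x * F y)"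
      by (intro AE_I2 tendsto_intros lim)
    fix n show "AE y in lborel. norm (indicator {0..<2*pi*r} y *\<^sub>R (p_minus r t y x * f n y))
        \<le> norm (indicator {0..<2*pi*r} y *\<^sub>R (p_minus r t y x * C))"
      using f(2)[of n] C by (intro AE_I2) (auto simp: abs_mult indicator_def intro!: mult_left_mono)
  qed measurable
  then show ?thesis using t by (simp add: p_minus_int_def set_lebesgue_integral_def)
qed (use lim in \<open>simp add: p_minus_int_0\<close>)

lemma p_minus_int_bound:
  assumes r: "0 < r" and t: "0 < t \<or> t = 0 \<and> x \<in> {0..<2*pi*r}"
    and f: "f \<in> borel_measurable borel" "\<And>y. \<bar>f y\<bar> \<le> C"
  shows "\<bar>p_minus_int r t x f\<bar> \<le> C"
  using t p_minus_dominated(3)[OF r _ f] f(2) by (auto simp: p_minus_int_0)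

lemma p_minus_int_measurable:
  assumes r: "0 < r" and t: "0 < t" and f[measurable]: "f \<in> borel_measurable borel"
  shows "(\<lambda>x. p_minus_int r t x f) \<in> borel_measurable borel"
proof -
  have [measurable]: "(\<lambda>z. p_minus r t (snd z) (fst z)) \<in> borel_measurable (borel \<Otimes>\<^sub>M lborel)"
    by (rule p_minus_measurable[OF r t]) auto
  have "(\<lambda>x. LINT y|lborel. indicator {0..<2*pi*r} y *\<^sub>R (p_minus r t y x * f y)) \<in> borel_measurable borel"
    by (rule lborel.borel_measurable_lebesgue_integral) (auto simp: case_prod_beta')
  then show ?thesis using t by (simp add: p_minus_int_def set_lebesgue_integral_def)
qed

section \<open>Theta series\<close>

text \<open>The quotient \<open>sin ((n + 1/2) * y) / sin (y / 2)\<close>, written as a cosine sum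
  so that it is smooth at the zeros of the denominator.\<close>

definition dirichlet_kernel :: "nat \<Rightarrow> real \<Rightarrow> real" where
  "dirichlet_kernel n y = 1 + 2 * (\<Sum>j=1..n. cos (real j * y))"

definition dirichlet_kernel' :: "nat \<Rightarrow> real \<Rightarrow> real" where
  "dirichlet_kernel' n y = - 2 * (\<Sum>j=1..n. real j * sin (real j * y))"

definition dirichlet_kernel'' :: "nat \<Rightarrow> real \<Rightarrow> real" where
  "dirichlet_kernel'' n y = - 2 * (\<Sum>j=1..n. (real j)\<^sup>2 * cos (real j * y))"

lemma dirichlet_kernel_deriv:
  "(dirichlet_kernel n has_real_derivative dirichlet_kernel' n y) (at y)"
  "(dirichlet_kernel' n has_real_derivative dirichlet_kernel'' n y) (at y)"
proof -
  have "((\<lambda>y. \<Sum>j=1..n. cos (real j * y)) has_real_derivative (\<Sum>j=1..n. - (real j * sin (real j * y)))) (at y)"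
    by (rule DERIV_sum) (auto intro!: derivative_eq_intros)
  from DERIV_add[OF DERIV_const[of 1] DERIV_cmult[OF this, of 2]]
  show "(dirichlet_kernel n has_real_derivative dirichlet_kernel' n y) (at y)"
    by (simp add: dirichlet_kernel_def[abs_def] dirichlet_kernel'_def sum_negf)
  have "((\<lambda>y. \<Sum>j=1..n. real j * sin (real j * y)) has_real_derivative (\<Sum>j=1..n. (real j)\<^sup>2 * cos (real j * y))) (at y)"
    by (rule DERIV_sum) (auto intro!: derivative_eq_intros simp: power2_eq_square)
  from DERIV_cmult[OF this, of "-2"]
  show "(dirichlet_kernel' n has_real_derivative dirichlet_kernel'' n y) (at y)"
    by (simp add: dirichlet_kernel'_def[abs_def] dirichlet_kernel''_def)
qed

lemma sin_dirichlet_kernel: "sin (y / 2) * dirichlet_kernel n y = sin ((real n + 1/2) * y)"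
proof (induction n)
  case 0
  then show ?case by (simp add: dirichlet_kernel_def)
next
  case (Suc n)
  have "2 * sin (y/2) * cos ((real n + 1) * y) = sin ((real n + 1) * y + y/2) - sin ((real n + 1) * y - y/2)"
    by (simp add: sin_add sin_diff)
  moreover have "(real n + 1) * y + y/2 = (real (Suc n) + 1/2) * y" "(real n + 1) * y - y/2 = (real n + 1/2) * y"
    by (simp_all add: field_simps)
  ultimately have "2 * sin (y/2) * cos ((real n + 1) * y) = sin ((real (Suc n) + 1/2) * y) - sin ((real n + 1/2) * y)"
    by simp
  then show ?case using Suc by (simp add: dirichlet_kernel_def algebra_simps)
qed

text \<open>The crude cubic bound is the same for both derivatives, so that one majorant can serve
  all the theta series.\<close>

lemma dirichlet_kernel_bounds:
  "\<bar>dirichlet_kernel n y\<bar> \<le> 2 * real n + 1"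
  "\<bar>dirichlet_kernel' n y\<bar> \<le> (2 * real n + 1) ^ 3"
  "\<bar>dirichlet_kernel'' n y\<bar> \<le> (2 * real n + 1) ^ 3"
proof -
  have "\<bar>\<Sum>j=1..n. cos (real j * y)\<bar> \<le> (\<Sum>j=1..n. 1)"
    by (rule order_trans[OF sum_abs sum_mono]) simp
  then show "\<bar>dirichlet_kernel n y\<bar> \<le> 2 * real n + 1" by (simp add: dirichlet_kernel_def)
  have le: "2 * (real n * (real n)\<^sup>2) \<le> (2 * real n + 1) ^ 3"
    by (simp add: power3_eq_cube power2_eq_square algebra_simps)
  have j: "real j \<le> (real n)\<^sup>2" "(real j)\<^sup>2 \<le> (real n)\<^sup>2" if "j \<in> {1..n}" for j
  proof -
    show "(real j)\<^sup>2 \<le> (real n)\<^sup>2" using that by (simp add: power_mono)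
    moreover have "real j \<le> (real j)\<^sup>2" using that by (simp add: power2_eq_square)
    ultimately show "real j \<le> (real n)\<^sup>2" by linarith
  qed
  have "\<bar>\<Sum>j=1..n. real j * sin (real j * y)\<bar> \<le> (\<Sum>j=1..n. (real n)\<^sup>2)"
  proof (rule order_trans[OF sum_abs sum_mono])
    fix j assume "j \<in> {1..n}"
    then show "\<bar>real j * sin (real j * y)\<bar> \<le> (real n)\<^sup>2"
      using mult_mono[OF j(1)[of j] abs_sin_le_one[of "real j * y"]] by (simp add: abs_mult)
  qed
  then show "\<bar>dirichlet_kernel' n y\<bar> \<le> (2 * real n + 1) ^ 3"
    using le by (simp add: dirichlet_kernel'_def abs_mult)
  have "\<bar>\<Sum>j=1..n. (real j)\<^sup>2 * cos (real j * y)\<bar> \<le> (\<Sum>j=1..n. (real n)\<^sup>2)"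
  proof (rule order_trans[OF sum_abs sum_mono])
    fix j assume "j \<in> {1..n}"
    then show "\<bar>(real j)\<^sup>2 * cos (real j * y)\<bar> \<le> (real n)\<^sup>2"
      using mult_mono[OF j(2)[of j] abs_cos_le_one[of "real j * y"]] by (simp add: abs_mult)
  qed
  then show "\<bar>dirichlet_kernel'' n y\<bar> \<le> (2 * real n + 1) ^ 3"
    using le by (simp add: dirichlet_kernel''_def abs_mult)
qed

lemma dirichlet_kernel_symmetry:
  "dirichlet_kernel n (y + 2 * pi) = dirichlet_kernel n y"
  "dirichlet_kernel n (- y) = dirichlet_kernel n y"
proof -
  have "cos (real j * (y + 2 * pi)) = cos (real j * y)" for j
    using cos.plus_of_nat[of "real j * y" j] by (simp add: algebra_simps)
  then show "dirichlet_kernel n (y + 2 * pi) = dirichlet_kernel n y" by (simp add: dirichlet_kernel_def)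
qed (simp add: dirichlet_kernel_def)

text \<open>The Dirichlet kernels are the Chebyshev polynomials of the fourth kind in
  \<open>cos y\<close>, and this is their three-term recurrence. It starts at index 1; at index 0
  the identity \<open>2 * cos y = dirichlet_kernel 1 y - dirichlet_kernel 0 y\<close> takes its
  place.\<close>

lemma cos_dirichlet_kernel:
  "cos y * dirichlet_kernel (Suc m) y = (dirichlet_kernel (Suc (Suc m)) y + dirichlet_kernel m y) / 2"
proof (induction m)
  case 0
  have "cos (2 * y) = 2 * cos y * cos y - 1" by (simp add: cos_double_cos power2_eq_square)
  then show ?case by (simp add: dirichlet_kernel_def algebra_simps numeral_2_eq_2)
next
  case (Suc m)
  define z where "z = (real m + 2) * y"
  have D: "dirichlet_kernel (Suc k) y = dirichlet_kernel k y + 2 * cos ((real k + 1) * y)" for k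
    by (simp add: dirichlet_kernel_def algebra_simps)
  have "2 * (cos y * cos z) = cos (z + y) + cos (z - y)" by (simp add: cos_add cos_diff)
  moreover have "z + y = (real m + 3) * y" "z - y = (real m + 1) * y" by (simp_all add: z_def algebra_simps)
  ultimately have "2 * (cos y * cos ((real m + 2) * y)) = cos ((real m + 3) * y) + cos ((real m + 1) * y)"
    by (simp add: z_def)
  then show ?case using Suc D[of m] D[of "Suc m"] D[of "Suc (Suc m)"] by (simp add: algebra_simps)
qed

text \<open>These are the polynomials in \<open>cos (x / r)\<close>, generated from the Dirichlet
  kernels rather than from powers: multiplied by \<open>sin (x / (2 * r))\<close> the generators
  become eigenfunctions, so the evolution can be computed by induction, and the powers of the cosine
  come from the recurrence.\<close>

inductive trig_poly :: "real \<Rightarrow> (real \<Rightarrow> real) \<Rightarrow> bool" for r where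
  base: "trig_poly r (\<lambda>x. dirichlet_kernel m (x / r))"
| lin: "trig_poly r f \<Longrightarrow> trig_poly r g \<Longrightarrow> trig_poly r (\<lambda>x. a * f x + g x)"

lemma trig_poly_cos_mult: "trig_poly r f \<Longrightarrow> trig_poly r (\<lambda>x. cos (x / r) * f x)"
proof (induction rule: trig_poly.induct)
  case (base m)
  have z: "trig_poly r (\<lambda>x. 0)"
    using trig_poly.lin[OF trig_poly.base[of r 0] trig_poly.base[of r 0], of "-1"] by simp
  have *: "trig_poly r (\<lambda>x. (1/2) * dirichlet_kernel i (x / r) + ((c/2) * dirichlet_kernel j (x / r) + 0))" for i j c
    by (intro trig_poly.intros z)
  show ?case
  proof (cases m)
    case 0
    show ?thesis using *[of 1 "-1" 0] by (simp add: 0 dirichlet_kernel_def add_divide_distrib)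
  next
    case (Suc k)
    then show ?thesis using *[of "Suc m" 1 k] by (simp add: cos_dirichlet_kernel add_divide_distrib)
  qed
next
  case (lin f g a)
  from trig_poly.lin[OF lin.IH, of a] show ?case by (simp add: algebra_simps)
qed

lemma trig_poly_cos_power_mult: "trig_poly r f \<Longrightarrow> trig_poly r (\<lambda>x. cos (x / r) ^ k * f x)"
proof (induction k)
  case (Suc k)
  from trig_poly_cos_mult[OF Suc.IH[OF Suc.prems]] show ?case by (simp add: mult_ac)
qed simp

lemma trig_poly_cos_power: "trig_poly r (\<lambda>x. cos (x / r) ^ k)"
  using trig_poly_cos_power_mult[OF trig_poly.base[of r 0]] by (simp add: dirichlet_kernel_def)

section \<open>Theta series: convergence, continuity and derivatives\<close>

text \<open>Differentiation in \<open>x\<close> or in \<tau> changes only the coefficient functions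
  \<open>G\<close>, so regularity is proved once for this shape.\<close>

definition theta_series :: "real \<Rightarrow> (nat \<Rightarrow> real \<Rightarrow> real) \<Rightarrow> real \<Rightarrow> real \<Rightarrow> real" where
  "theta_series r G \<tau> x = (\<Sum>n. exp (- dirichlet_rate r n * \<tau>) * G n x)"

text \<open>With \<open>N = 2 * n + 1\<close> and \<open>s = \<tau>0 / (24 * r^2)\<close> the
  exponent at \<open>\<tau>0\<close> is \<open>3 * s * N^2\<close>. The factor 3 is there so that
  \<open>exp z >= z\<close> can be cubed: \<open>exp (- 3 * z) <= 1 / z^3\<close> at
  \<open>z = s * N^2\<close> absorbs the growth \<open>N^3\<close> and leaves
  \<open>1 / N^3\<close>.\<close>

lemma theta_series_majorant:
  assumes "0 < r" "0 < \<tau>0"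
  obtains c where "0 \<le> c" "\<And>n \<tau>. \<tau>0 \<le> \<tau> \<Longrightarrow> exp (- dirichlet_rate r n * \<tau>) * (2 * real n + 1) ^ 3 \<le> c * inverse (real (Suc n)) ^ 2"
proof
  define s where "s = \<tau>0 / (24 * r\<^sup>2)"
  have s: "0 < s" using assms by (simp add: s_def)
  show "0 \<le> inverse (s ^ 3)" using s by simp
  fix n \<tau> assume \<tau>: "\<tau>0 \<le> \<tau>"
  define N where "N = 2 * real n + 1"
  have N: "1 \<le> N" "real (Suc n) \<le> N" by (simp_all add: N_def)
  have "dirichlet_rate r n * \<tau>0 = 3 * (s * N\<^sup>2)"
    using assms by (simp add: dirichlet_rate_def s_def N_def field_simps power2_eq_square)
  moreover have "dirichlet_rate r n * \<tau>0 \<le> dirichlet_rate r n * \<tau>"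
    using \<tau> by (intro mult_left_mono) (simp_all add: dirichlet_rate_def)
  ultimately have "exp (- dirichlet_rate r n * \<tau>) \<le> exp (- (3 * (s * N\<^sup>2)))" by simp
  also have "\<dots> = inverse (exp (s * N\<^sup>2) ^ 3)" by (simp add: exp_minus exp_of_nat_mult[symmetric])
  also have "\<dots> \<le> inverse ((s * N\<^sup>2) ^ 3)"
  proof -
    have "0 < s * N\<^sup>2" using s N by simp
    moreover have "s * N\<^sup>2 \<le> exp (s * N\<^sup>2)" using exp_ge_add_one_self[of "s * N\<^sup>2"] by linarith
    ultimately show ?thesis by (intro le_imp_inverse_le power_mono) auto
  qed
  finally have "exp (- dirichlet_rate r n * \<tau>) * N ^ 3 \<le> inverse ((s * N\<^sup>2) ^ 3) * N ^ 3"
    using N by (intro mult_right_mono) auto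
  also have "\<dots> = inverse (s ^ 3) * inverse N ^ 3"
    using s N by (simp add: field_simps power_mult_distrib flip: power_mult power_add)
  also have "\<dots> \<le> inverse (s ^ 3) * inverse (real (Suc n)) ^ 2"
  proof (intro mult_left_mono)
    have "inverse N ^ 3 \<le> inverse N ^ 2" using N by (intro power_decreasing) (auto simp: inverse_le_1_iff)
    also have "\<dots> \<le> inverse (real (Suc n)) ^ 2" using N by (intro power_mono le_imp_inverse_le) auto
    finally show "inverse N ^ 3 \<le> inverse (real (Suc n)) ^ 2" .
  qed (use s in simp)
  finally show "exp (- dirichlet_rate r n * \<tau>) * (2 * real n + 1) ^ 3 \<le> inverse (s ^ 3) * inverse (real (Suc n)) ^ 2"
    by (simp add: N_def)
qed

lemma theta_series_uniform:
  assumes r: "0 < r" and \<tau>0: "0 < \<tau>0" and G: "\<And>n x. \<bar>G n x\<bar> \<le> K * (2 * real n + 1) ^ 3"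
  shows "\<exists>m. summable m \<and> (\<forall>n \<tau> x. \<tau>0 \<le> \<tau> \<longrightarrow> \<bar>exp (- dirichlet_rate r n * \<tau>) * G n x\<bar> \<le> m n)"
proof -
  obtain c where c: "0 \<le> c" "\<And>n \<tau>. \<tau>0 \<le> \<tau> \<Longrightarrow> exp (- dirichlet_rate r n * \<tau>) * (2 * real n + 1) ^ 3 \<le> c * inverse (real (Suc n)) ^ 2"
    using theta_series_majorant[OF r \<tau>0] by blast
  show ?thesis
  proof (intro exI conjI allI impI)
    have "summable (\<lambda>n. inverse (real (Suc n)) ^ 2)"
      using inverse_power_summable[of 2, where 'a = real] summable_Suc_iff[of "\<lambda>n. inverse (real n ^ 2)"]
      by (simp add: power_inverse)
    then show "summable (\<lambda>n. \<bar>K\<bar> * (c * inverse (real (Suc n)) ^ 2))" by (intro summable_mult)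
    fix n \<tau> x assume "\<tau>0 \<le> \<tau>"
    have "\<bar>exp (- dirichlet_rate r n * \<tau>) * G n x\<bar> = exp (- dirichlet_rate r n * \<tau>) * \<bar>G n x\<bar>" by (simp add: abs_mult)
    also have "\<dots> \<le> exp (- dirichlet_rate r n * \<tau>) * (\<bar>K\<bar> * (2 * real n + 1) ^ 3)"
    proof (intro mult_left_mono)
      have "K * (2 * real n + 1) ^ 3 \<le> \<bar>K\<bar> * (2 * real n + 1) ^ 3" by (intro mult_right_mono) auto
      then show "\<bar>G n x\<bar> \<le> \<bar>K\<bar> * (2 * real n + 1) ^ 3" using G[of n x] by linarith
    qed simp
    also have "\<dots> = \<bar>K\<bar> * (exp (- dirichlet_rate r n * \<tau>) * (2 * real n + 1) ^ 3)" by (simp add: mult_ac)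
    also have "\<dots> \<le> \<bar>K\<bar> * (c * inverse (real (Suc n)) ^ 2)"
      by (intro mult_left_mono c(2) \<open>\<tau>0 \<le> \<tau>\<close>) simp
    finally show "\<bar>exp (- dirichlet_rate r n * \<tau>) * G n x\<bar> \<le> \<bar>K\<bar> * (c * inverse (real (Suc n)) ^ 2)" .
  qed
qed

lemma theta_series_summable:
  assumes "0 < r" "0 < \<tau>" "\<And>n x. \<bar>G n x\<bar> \<le> K * (2 * real n + 1) ^ 3"
  shows "summable (\<lambda>n. \<bar>exp (- dirichlet_rate r n * \<tau>) * G n x\<bar>)"
    and "summable (\<lambda>n. exp (- dirichlet_rate r n * \<tau>) * G n x)"
proof -
  obtain m where m: "summable m" "\<And>n \<tau>' x. \<tau> \<le> \<tau>' \<Longrightarrow> \<bar>exp (- dirichlet_rate r n * \<tau>') * G n x\<bar> \<le> m n"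
    using theta_series_uniform[where G = G, OF assms] by blast
  show "summable (\<lambda>n. \<bar>exp (- dirichlet_rate r n * \<tau>) * G n x\<bar>)"
    by (rule summable_comparison_test'[OF m(1)]) (use m(2) in auto)
  then show "summable (\<lambda>n. exp (- dirichlet_rate r n * \<tau>) * G n x)" by (rule summable_rabs_cancel)
qed

text \<open>The M-test gives uniform convergence only away from \<tau> = 0, so continuity is proved
  above each positive level and transferred to a point with the level
  \<open>\<tau> / 2\<close>.\<close>

lemma theta_series_continuous:
  assumes r: "0 < r" and G: "\<And>n x. \<bar>G n x\<bar> \<le> K * (2 * real n + 1) ^ 3"
    and c: "\<And>n. continuous_on UNIV (G n)"
  shows "continuous_on ({0<..} \<times> UNIV) (\<lambda>(\<tau>, x). theta_series r G \<tau> x)"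
proof -
  have *: "continuous_on ({\<tau>0<..} \<times> UNIV) (\<lambda>(\<tau>, x). theta_series r G \<tau> x)" if \<tau>0: "0 < \<tau>0" for \<tau>0
  proof -
    obtain m where m: "summable m" "\<And>n \<tau> x. \<tau>0 \<le> \<tau> \<Longrightarrow> \<bar>exp (- dirichlet_rate r n * \<tau>) * G n x\<bar> \<le> m n"
      using theta_series_uniform[where G = G, OF r \<tau>0 G] by blast
    have u: "uniform_limit ({\<tau>0<..} \<times> UNIV) (\<lambda>n z. \<Sum>i<n. exp (- dirichlet_rate r i * fst z) * G i (snd z))
        (\<lambda>z. \<Sum>i. exp (- dirichlet_rate r i * fst z) * G i (snd z)) sequentially"
      by (rule Weierstrass_m_test[OF _ m(1)]) (use m(2) in auto)
    have "continuous_on ({\<tau>0<..} \<times> UNIV) (\<lambda>z. \<Sum>i. exp (- dirichlet_rate r i * fst z) * G i (snd z))"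
      by (rule uniform_limit_theorem[OF _ u])
         (auto intro!: always_eventually continuous_intros continuous_on_compose2[OF c])
    then show ?thesis by (simp add: theta_series_def case_prod_beta')
  qed
  show ?thesis
  proof (rule continuous_at_imp_continuous_on, safe)
    fix \<tau> x :: real assume "0 < \<tau>"
    then have "continuous_on ({\<tau>/2<..} \<times> UNIV) (\<lambda>(\<tau>, x). theta_series r G \<tau> x)" by (intro *) simp
    then show "isCont (\<lambda>(\<tau>, x). theta_series r G \<tau> x) (\<tau>, x)"
      by (rule continuous_on_interior) (use \<open>0 < \<tau>\<close> in \<open>simp add: interior_open open_Times\<close>)
  qed
qed

lemma theta_series_deriv_x:
  assumes r: "0 < r" and \<tau>: "0 < \<tau>"
    and G: "\<And>n x. \<bar>G n x\<bar> \<le> K * (2 * real n + 1) ^ 3" "\<And>n x. \<bar>G' n x\<bar> \<le> K' * (2 * real n + 1) ^ 3"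
    and d: "\<And>n x. (G n has_real_derivative G' n x) (at x)"
  shows "(theta_series r G \<tau> has_real_derivative theta_series r G' \<tau> x) (at x)"
proof -
  obtain m where m: "summable m" "\<And>n \<tau>' x. \<tau> \<le> \<tau>' \<Longrightarrow> \<bar>exp (- dirichlet_rate r n * \<tau>') * G' n x\<bar> \<le> m n"
    using theta_series_uniform[where G = G', OF r \<tau> G(2)] by blast
  have u: "uniformly_convergent_on UNIV (\<lambda>n x. \<Sum>i<n. exp (- dirichlet_rate r i * \<tau>) * G' i x)"
    by (rule Weierstrass_m_test'[OF _ m(1)]) (use m(2) in auto)
  have "((\<lambda>x. \<Sum>n. exp (- dirichlet_rate r n * \<tau>) * G n x) has_real_derivative
        (\<Sum>n. exp (- dirichlet_rate r n * \<tau>) * G' n x)) (at x)"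
  proof (rule has_field_derivative_series'(2)[where S = UNIV and ?x0.0 = x
        and f = "\<lambda>n x. exp (- dirichlet_rate r n * \<tau>) * G n x"
        and f' = "\<lambda>n x. exp (- dirichlet_rate r n * \<tau>) * G' n x"])
    show "summable (\<lambda>n. exp (- dirichlet_rate r n * \<tau>) * G n x)"
      by (rule theta_series_summable(2)[where G = G, OF r \<tau> G(1)])
  qed (use u in \<open>auto intro!: DERIV_cmult d\<close>)
  then show ?thesis by (simp add: theta_series_def[abs_def])
qed

text \<open>A time derivative costs a factor of order \<open>n^2\<close>; the bound on
  \<open>G\<close> is therefore linear, to end within the cubic bounds used so far. These bounds are
  exported for the coefficients of \<open>theta_k\<close>.\<close>

lemma theta_series_deriv_time:
  assumes r: "0 < r" and \<tau>: "0 < \<tau>"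
    and G: "\<And>n x. \<bar>G n x\<bar> \<le> K * (2 * real n + 1)"
  shows "((\<lambda>\<tau>. theta_series r G \<tau> x) has_real_derivative theta_series r (\<lambda>n x. - dirichlet_rate r n * G n x) \<tau> x) (at \<tau>)"
    and "\<bar>- dirichlet_rate r n * G n y\<bar> \<le> K / (8 * r\<^sup>2) * (2 * real n + 1) ^ 3"
    and "\<bar>G n y\<bar> \<le> K * (2 * real n + 1) ^ 3"
proof -
  have K: "0 \<le> K" using G[of 0 0] by simp
  show b: "\<bar>- dirichlet_rate r n * G n y\<bar> \<le> K / (8 * r\<^sup>2) * (2 * real n + 1) ^ 3" for n y
  proof -
    have d: "dirichlet_rate r n = (2 * real n + 1)\<^sup>2 / (8 * r\<^sup>2)"
      by (simp add: dirichlet_rate_def power2_eq_square field_simps)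
    have "\<bar>- dirichlet_rate r n * G n y\<bar> = dirichlet_rate r n * \<bar>G n y\<bar>" by (simp add: abs_mult dirichlet_rate_def)
    also have "\<dots> \<le> dirichlet_rate r n * (K * (2 * real n + 1))"
      by (intro mult_left_mono G) (simp add: dirichlet_rate_def)
    also have "\<dots> = K / (8 * r\<^sup>2) * (2 * real n + 1) ^ 3"
      by (simp add: d power2_eq_square power3_eq_cube)
    finally show ?thesis .
  qed
  show b2: "\<bar>G n y\<bar> \<le> K * (2 * real n + 1) ^ 3" for n y
  proof -
    have "(2 * real n + 1) ^ 1 \<le> (2 * real n + 1) ^ 3" by (intro power_increasing) auto
    then have "K * (2 * real n + 1) \<le> K * (2 * real n + 1) ^ 3" using K by (intro mult_left_mono) auto
    then show ?thesis using G[of n y] by linarith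
  qed
  have \<tau>2: "0 < \<tau>/2" using \<tau> by simp
  obtain m where m: "summable m" "\<And>n \<tau>' x. \<tau>/2 \<le> \<tau>' \<Longrightarrow> \<bar>exp (- dirichlet_rate r n * \<tau>') * (- dirichlet_rate r n * G n x)\<bar> \<le> m n"
    using theta_series_uniform[where G = "\<lambda>n x. - dirichlet_rate r n * G n x", OF r \<tau>2 b] by blast
  have u: "uniformly_convergent_on {\<tau>/2..} (\<lambda>n \<tau>. \<Sum>i<n. exp (- dirichlet_rate r i * \<tau>) * (- dirichlet_rate r i * G i x))"
    by (rule Weierstrass_m_test'[OF _ m(1)]) (use m(2) in auto)
  have "((\<lambda>\<tau>. \<Sum>n. exp (- dirichlet_rate r n * \<tau>) * G n x) has_real_derivative
        (\<Sum>n. exp (- dirichlet_rate r n * \<tau>) * (- dirichlet_rate r n * G n x))) (at \<tau>)"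
  proof (rule has_field_derivative_series'(2)[where S = "{\<tau>/2..}" and ?x0.0 = \<tau>
        and f = "\<lambda>n \<tau>. exp (- dirichlet_rate r n * \<tau>) * G n x"
        and f' = "\<lambda>n \<tau>. exp (- dirichlet_rate r n * \<tau>) * (- dirichlet_rate r n * G n x)"])
    show "summable (\<lambda>n. exp (- dirichlet_rate r n * \<tau>) * G n x)"
      by (rule theta_series_summable(2)[where G = G, OF r \<tau> b2])
  qed (use u \<tau> in \<open>auto intro!: derivative_eq_intros\<close>)
  then show "((\<lambda>\<tau>. theta_series r G \<tau> x) has_real_derivative theta_series r (\<lambda>n x. - dirichlet_rate r n * G n x) \<tau> x) (at \<tau>)"
    by (simp add: theta_series_def[abs_def])
qed

text \<open>\<open>theta_h\<close> is, up to a positive factor depending on time only, the denominator \<open>\<vartheta>\<^sub>1\<close> of the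
  \<open>h\<close>-transform. \<open>theta_k\<close> is the quotient of \<open>theta_h\<close> by \<open>sin (x / (2 * r))\<close>: it has no zeros, so
  that functions divided by it stay smooth at the points where the drift is singular.\<close>

definition theta_k :: "real \<Rightarrow> real \<Rightarrow> real \<Rightarrow> real" where
  "theta_k r = theta_series r (\<lambda>n x. 2 * (-1)^n * dirichlet_kernel n (x / r))"

definition theta_k_x :: "real \<Rightarrow> real \<Rightarrow> real \<Rightarrow> real" where
  "theta_k_x r = theta_series r (\<lambda>n x. 2 * (-1)^n * dirichlet_kernel' n (x / r) / r)"

definition theta_k_xx :: "real \<Rightarrow> real \<Rightarrow> real \<Rightarrow> real" where
  "theta_k_xx r = theta_series r (\<lambda>n x. 2 * (-1)^n * dirichlet_kernel'' n (x / r) / r\<^sup>2)"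

definition theta_k_t :: "real \<Rightarrow> real \<Rightarrow> real \<Rightarrow> real" where
  "theta_k_t r = theta_series r (\<lambda>n x. - dirichlet_rate r n * (2 * (-1)^n * dirichlet_kernel n (x / r)))"

definition theta_h :: "real \<Rightarrow> real \<Rightarrow> real \<Rightarrow> real" where
  "theta_h r \<tau> x = sin (x / (2 * r)) * theta_k r \<tau> x"

lemma theta_coeff_bounds:
  assumes "0 < r"
  shows "\<bar>2 * (-1)^n * dirichlet_kernel n (x / r)\<bar> \<le> 2 * (2 * real n + 1)"
    "\<bar>2 * (-1)^n * dirichlet_kernel n (x / r)\<bar> \<le> 2 * (2 * real n + 1) ^ 3"
    "\<bar>2 * (-1)^n * dirichlet_kernel' n (x / r) / r\<bar> \<le> 2 / r * (2 * real n + 1) ^ 3"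
    "\<bar>2 * (-1)^n * dirichlet_kernel'' n (x / r) / r\<^sup>2\<bar> \<le> 2 / r\<^sup>2 * (2 * real n + 1) ^ 3"
    "\<bar>- dirichlet_rate r n * (2 * (-1)^n * dirichlet_kernel n (x / r))\<bar> \<le> 2 / (8 * r\<^sup>2) * (2 * real n + 1) ^ 3"
proof -
  show 1: "\<bar>2 * (-1)^n * dirichlet_kernel n (x / r)\<bar> \<le> 2 * (2 * real n + 1)" for n x
    using dirichlet_kernel_bounds(1)[of n "x / r"] by (simp add: abs_mult)
  show "\<bar>2 * (-1)^n * dirichlet_kernel n (x / r)\<bar> \<le> 2 * (2 * real n + 1) ^ 3"
    by (rule theta_series_deriv_time(3)[OF assms zero_less_one 1])
  show "\<bar>2 * (-1)^n * dirichlet_kernel' n (x / r) / r\<bar> \<le> 2 / r * (2 * real n + 1) ^ 3"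
    using dirichlet_kernel_bounds(2)[of n "x / r"] assms by (simp add: abs_mult field_simps)
  show "\<bar>2 * (-1)^n * dirichlet_kernel'' n (x / r) / r\<^sup>2\<bar> \<le> 2 / r\<^sup>2 * (2 * real n + 1) ^ 3"
    using dirichlet_kernel_bounds(3)[of n "x / r"] assms by (simp add: abs_mult divide_right_mono)
  show "\<bar>- dirichlet_rate r n * (2 * (-1)^n * dirichlet_kernel n (x / r))\<bar> \<le> 2 / (8 * r\<^sup>2) * (2 * real n + 1) ^ 3"
    by (rule theta_series_deriv_time(2)[OF assms zero_less_one 1])
qed

lemma dirichlet_kernel_continuous:
  assumes "0 < r"
  shows "continuous_on UNIV (\<lambda>x. dirichlet_kernel n (x / r))"
    "continuous_on UNIV (\<lambda>x. dirichlet_kernel' n (x / r))"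
    "continuous_on UNIV (\<lambda>x. dirichlet_kernel'' n (x / r))"
  unfolding dirichlet_kernel_def dirichlet_kernel'_def dirichlet_kernel''_def
  using assms by (auto intro!: continuous_intros)

lemma theta_k_continuous:
  assumes "0 < r"
  shows "continuous_on ({0<..} \<times> UNIV) (\<lambda>(\<tau>, x). theta_k r \<tau> x)"
    "continuous_on ({0<..} \<times> UNIV) (\<lambda>(\<tau>, x). theta_k_x r \<tau> x)"
    "continuous_on ({0<..} \<times> UNIV) (\<lambda>(\<tau>, x). theta_k_xx r \<tau> x)"
    "continuous_on ({0<..} \<times> UNIV) (\<lambda>(\<tau>, x). theta_k_t r \<tau> x)"
proof -
  note c = dirichlet_kernel_continuous[OF assms]
  show "continuous_on ({0<..} \<times> UNIV) (\<lambda>(\<tau>, x). theta_k r \<tau> x)"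
    unfolding theta_k_def
    by (rule theta_series_continuous[OF assms theta_coeff_bounds(2)[OF assms]]) (intro continuous_intros c)
  show "continuous_on ({0<..} \<times> UNIV) (\<lambda>(\<tau>, x). theta_k_x r \<tau> x)"
    unfolding theta_k_x_def
    by (rule theta_series_continuous[OF assms theta_coeff_bounds(3)[OF assms]]) (use assms in \<open>intro continuous_intros c; simp\<close>)
  show "continuous_on ({0<..} \<times> UNIV) (\<lambda>(\<tau>, x). theta_k_xx r \<tau> x)"
    unfolding theta_k_xx_def
    by (rule theta_series_continuous[OF assms theta_coeff_bounds(4)[OF assms]]) (use assms in \<open>intro continuous_intros c; simp\<close>)
  show "continuous_on ({0<..} \<times> UNIV) (\<lambda>(\<tau>, x). theta_k_t r \<tau> x)"
    unfolding theta_k_t_def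
    by (rule theta_series_continuous[OF assms theta_coeff_bounds(5)[OF assms]]) (intro continuous_intros c)
qed

lemma theta_k_deriv:
  assumes r: "0 < r" and \<tau>: "0 < \<tau>"
  shows "(theta_k r \<tau> has_real_derivative theta_k_x r \<tau> x) (at x)"
    "(theta_k_x r \<tau> has_real_derivative theta_k_xx r \<tau> x) (at x)"
    "((\<lambda>\<tau>. theta_k r \<tau> x) has_real_derivative theta_k_t r \<tau> x) (at \<tau>)"
proof -
  have d: "((\<lambda>x. c * f n (x / r)) has_real_derivative c * f' n (x / r) / r) (at x)"
    if "\<And>y. (f n has_real_derivative f' n y) (at y)" for c f f' and n :: nat and x
  proof -
    have "((\<lambda>x. x / r) has_real_derivative 1 / r) (at x)" using r by (auto intro!: derivative_eq_intros)
    from DERIV_cmult[OF DERIV_chain2[OF that this], of c] show ?thesis by simp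
  qed
  show "(theta_k r \<tau> has_real_derivative theta_k_x r \<tau> x) (at x)"
    unfolding theta_k_def theta_k_x_def
    by (intro theta_series_deriv_x[where G = "\<lambda>n x. 2 * (-1)^n * dirichlet_kernel n (x / r)" and K = 2 and K' = "2 / r", OF r \<tau>]
        theta_coeff_bounds(2,3)[OF r] d dirichlet_kernel_deriv)
  have "((\<lambda>x. 2 * (-1)^n * dirichlet_kernel' n (x / r) / r) has_real_derivative 2 * (-1)^n * dirichlet_kernel'' n (x / r) / r\<^sup>2) (at x)"
    for n x
    using d[where f = dirichlet_kernel' and f' = dirichlet_kernel'' and n = n and c = "2 * (-1)^n / r" and x = x,
        OF dirichlet_kernel_deriv(2)]
    by (simp add: power2_eq_square)
  then show "(theta_k_x r \<tau> has_real_derivative theta_k_xx r \<tau> x) (at x)"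
    unfolding theta_k_x_def theta_k_xx_def
    by (intro theta_series_deriv_x[where G = "\<lambda>n x. 2 * (-1)^n * dirichlet_kernel' n (x / r) / r" and K = "2 / r" and K' = "2 / r\<^sup>2", OF r \<tau>]
        theta_coeff_bounds(3,4)[OF r])
  show "((\<lambda>\<tau>. theta_k r \<tau> x) has_real_derivative theta_k_t r \<tau> x) (at \<tau>)"
    unfolding theta_k_def theta_k_t_def
    by (rule theta_series_deriv_time(1)[OF r \<tau> theta_coeff_bounds(1)[OF r]])
qed

lemma theta_k_symmetry:
  assumes "0 < r"
  shows "theta_k r \<tau> (x + 2 * pi * r) = theta_k r \<tau> x" "theta_k r \<tau> (- x) = theta_k r \<tau> x"
proof -
  have "(x + 2 * pi * r) / r = x / r + 2 * pi" using assms by (simp add: field_simps)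
  then show "theta_k r \<tau> (x + 2 * pi * r) = theta_k r \<tau> x"
    by (simp add: theta_k_def theta_series_def dirichlet_kernel_symmetry)
  show "theta_k r \<tau> (- x) = theta_k r \<tau> x"
    by (simp add: theta_k_def theta_series_def dirichlet_kernel_symmetry)
qed

text \<open>The identity \<open>sin (y / 2) * dirichlet_kernel n y = sin ((n + 1/2) * y)\<close>
  differentiated twice, which avoids any division by the sine.\<close>

lemma dirichlet_kernel_ode:
  "sin (y/2) * dirichlet_kernel'' n y + cos (y/2) * dirichlet_kernel' n y - sin (y/2) * dirichlet_kernel n y / 4
   = - (real n + 1/2)\<^sup>2 * (sin (y/2) * dirichlet_kernel n y)"
proof -
  define a where "a = real n + 1/2"
  have e1: "(\<lambda>y. sin (y/2) * dirichlet_kernel n y) = (\<lambda>y. sin (a * y))"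
    by (simp add: sin_dirichlet_kernel a_def)
  have "((\<lambda>y. sin (y/2) * dirichlet_kernel n y) has_real_derivative
        cos (y/2) / 2 * dirichlet_kernel n y + sin (y/2) * dirichlet_kernel' n y) (at y)" for y
    by (auto intro!: derivative_eq_intros dirichlet_kernel_deriv)
  moreover have "((\<lambda>y. sin (a * y)) has_real_derivative a * cos (a * y)) (at y)" for y
    by (auto intro!: derivative_eq_intros)
  ultimately have "cos (y/2) / 2 * dirichlet_kernel n y + sin (y/2) * dirichlet_kernel' n y = a * cos (a * y)" for y
    using e1 DERIV_unique by metis
  then have e2: "(\<lambda>y. cos (y/2) / 2 * dirichlet_kernel n y + sin (y/2) * dirichlet_kernel' n y) = (\<lambda>y. a * cos (a * y))" by auto
  have "((\<lambda>y. cos (y/2) / 2 * dirichlet_kernel n y + sin (y/2) * dirichlet_kernel' n y) has_real_derivative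
       (sin (y/2) * dirichlet_kernel'' n y + cos (y/2) * dirichlet_kernel' n y - sin (y/2) * dirichlet_kernel n y / 4)) (at y)"
    by (auto intro!: derivative_eq_intros dirichlet_kernel_deriv simp: field_simps)
  moreover have "((\<lambda>y. a * cos (a * y)) has_real_derivative - a\<^sup>2 * sin (a * y)) (at y)"
    by (auto intro!: derivative_eq_intros simp: power2_eq_square)
  ultimately show ?thesis
    using e2 DERIV_unique fun_cong[OF e1, of y] a_def by metis
qed

lemma dirichlet_kernel_heat:
  assumes "0 < r"
  shows "sin (x/(2*r)) * (dirichlet_kernel'' n (x/r) / r\<^sup>2) + cos (x/(2*r)) / r * (dirichlet_kernel' n (x/r) / r)
     - sin (x/(2*r)) * dirichlet_kernel n (x/r) / (4 * r\<^sup>2) = - 2 * dirichlet_rate r n * (sin (x/(2*r)) * dirichlet_kernel n (x/r))"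
proof -
  have "x / r / 2 = x / (2 * r)" by simp
  with dirichlet_kernel_ode[of "x/r" n]
  have "(sin (x/(2*r)) * dirichlet_kernel'' n (x/r) + cos (x/(2*r)) * dirichlet_kernel' n (x/r) - sin (x/(2*r)) * dirichlet_kernel n (x/r) / 4) / r\<^sup>2
   = - (real n + 1/2)\<^sup>2 * (sin (x/(2*r)) * dirichlet_kernel n (x/r)) / r\<^sup>2" by (simp add: mult.commute)
  then show ?thesis using assms
    by (simp add: dirichlet_rate_def diff_divide_distrib add_divide_distrib power2_eq_square)
qed

text \<open>The heat equation for \<open>theta_h\<close>, whose second space derivative is twice its
  \<tau>-derivative, with the product \<open>sin (x / (2 * r)) * theta_k\<close> differentiated
  out.\<close>

lemma theta_k_heat:
  assumes r: "0 < r" and \<tau>: "0 < \<tau>"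
  shows "sin (x/(2*r)) * theta_k_xx r \<tau> x + cos (x/(2*r)) / r * theta_k_x r \<tau> x
     - sin (x/(2*r)) * theta_k r \<tau> x / (4 * r\<^sup>2) = 2 * sin (x/(2*r)) * theta_k_t r \<tau> x"
proof -
  define s c where "s = sin (x/(2*r))" and "c = cos (x/(2*r))"
  let ?e = "\<lambda>n. exp (- dirichlet_rate r n * \<tau>)"
  note S = theta_series_summable(2)[where G = "\<lambda>n x. 2 * (-1)^n * dirichlet_kernel n (x / r)" and x = x,
      OF r \<tau> theta_coeff_bounds(2)[OF r]]
 theta_series_summable(2)[where G = "\<lambda>n x. 2 * (-1)^n * dirichlet_kernel' n (x / r) / r" and x = x,
      OF r \<tau> theta_coeff_bounds(3)[OF r]]
 theta_series_summable(2)[where G = "\<lambda>n x. 2 * (-1)^n * dirichlet_kernel'' n (x / r) / r\<^sup>2" and x = x,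
      OF r \<tau> theta_coeff_bounds(4)[OF r]]
 theta_series_summable(2)[where G = "\<lambda>n x. - dirichlet_rate r n * (2 * (-1)^n * dirichlet_kernel n (x / r))" and x = x,
      OF r \<tau> theta_coeff_bounds(5)[OF r]]
  have "s * theta_k_xx r \<tau> x + c / r * theta_k_x r \<tau> x - s / (4 * r\<^sup>2) * theta_k r \<tau> x
     = (\<Sum>n. s * (?e n * (2 * (-1)^n * dirichlet_kernel'' n (x / r) / r\<^sup>2)) + c / r * (?e n * (2 * (-1)^n * dirichlet_kernel' n (x / r) / r))
         - s / (4 * r\<^sup>2) * (?e n * (2 * (-1)^n * dirichlet_kernel n (x / r))))"
    unfolding theta_k_def theta_k_x_def theta_k_xx_def theta_series_def
    using S by (simp only: suminf_mult[symmetric] suminf_add suminf_diff summable_mult summable_add)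
  also have "\<dots> = (\<Sum>n. 2 * s * (?e n * (- dirichlet_rate r n * (2 * (-1)^n * dirichlet_kernel n (x / r)))))"
  proof (rule suminf_cong)
    fix n
    let ?A = "s * (dirichlet_kernel'' n (x/r) / r\<^sup>2) + c / r * (dirichlet_kernel' n (x/r) / r) - s * dirichlet_kernel n (x/r) / (4 * r\<^sup>2)"
    have "s * (?e n * (2 * (-1)^n * dirichlet_kernel'' n (x / r) / r\<^sup>2)) + c / r * (?e n * (2 * (-1)^n * dirichlet_kernel' n (x / r) / r))
         - s / (4 * r\<^sup>2) * (?e n * (2 * (-1)^n * dirichlet_kernel n (x / r))) = ?e n * (2 * (-1)^n) * ?A"
      by (simp add: algebra_simps)
    also have "?A = - 2 * dirichlet_rate r n * (s * dirichlet_kernel n (x/r))"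
      using dirichlet_kernel_heat[OF r] unfolding s_def c_def .
    finally show "s * (?e n * (2 * (-1)^n * dirichlet_kernel'' n (x / r) / r\<^sup>2)) + c / r * (?e n * (2 * (-1)^n * dirichlet_kernel' n (x / r) / r))
         - s / (4 * r\<^sup>2) * (?e n * (2 * (-1)^n * dirichlet_kernel n (x / r))) = 2 * s * (?e n * (- dirichlet_rate r n * (2 * (-1)^n * dirichlet_kernel n (x / r))))"
      by (simp add: algebra_simps)
  qed
  also have "\<dots> = 2 * s * theta_k_t r \<tau> x"
    unfolding theta_k_t_def theta_series_def using S(4) by (rule suminf_mult)
  finally show ?thesis by (simp add: s_def c_def)
qed

lemma theta_h_series:
  assumes r: "0 < r" and \<tau>: "0 < \<tau>"
  shows "(\<lambda>n. exp (- dirichlet_rate r n * \<tau>) * (2 * (-1)^n * sin ((real n + 1/2) * x / r))) sums theta_h r \<tau> x"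
proof -
  have "sin (x / (2*r)) * dirichlet_kernel n (x / r) = sin ((real n + 1/2) * x / r)" for n
    using sin_dirichlet_kernel[of "x / r" n] by (simp add: mult.commute)
  then have *: "sin (x / (2*r)) * (exp (- dirichlet_rate r n * \<tau>) * (2 * (-1)^n * dirichlet_kernel n (x / r)))
     = exp (- dirichlet_rate r n * \<tau>) * (2 * (-1)^n * sin ((real n + 1/2) * x / r))" for n
    by (simp add: algebra_simps)
  show ?thesis
    using sums_mult[OF summable_sums[OF theta_series_summable(2)[where G = "\<lambda>n x. 2 * (-1)^n * dirichlet_kernel n (x / r)"
      and x = x, OF r \<tau> theta_coeff_bounds(2)[OF r]]], of "sin (x / (2*r))"]
    unfolding * by (simp add: theta_h_def theta_k_def theta_series_def)
qed

text \<open>The indices \<open>- j\<close> and \<open>j + 1\<close> have the same Gaussian weight,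
  with exponent \<open>- dirichlet_rate r j\<close> times the remaining time. Their oscillating
  factors combine to \<open>- 2 * \<i>\<close> times a sine, and the prefactor \<open>\<i>\<close>
  of \<open>vartheta1\<close> makes the value real.\<close>

lemma vartheta1_theta_h:
  assumes r: "0 < r" and t: "t < tstar"
  shows "vartheta1 (of_real (x / (2 * pi * r))) (tau r tstar t) = of_real (theta_h r (tstar - t) x)"
proof -
  define \<tau> where "\<tau> = tstar - t"
  have \<tau>: "0 < \<tau>" using t by (simp add: \<tau>_def)
  define f where "f w = (-1) powi w * exp (of_real pi * \<i> * tau r tstar t * (of_int w - 1/2)^2)
              * exp ((2 * of_int w - 1) * of_real pi * \<i> * of_real (x / (2 * pi * r)))" for w :: int
  have f: "f w = of_real ((-1) powi w * exp (- \<tau> * (of_int w - 1/2)\<^sup>2 / (2 * r\<^sup>2))) * exp (\<i> * of_real ((of_int w - 1/2) * x / r))" for w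
  proof -
    have "of_real pi * \<i> * tau r tstar t * (of_int w - 1/2)^2 = of_real (- \<tau> * (of_int w - 1/2)\<^sup>2 / (2 * r\<^sup>2))"
      using r by (simp add: tau_def \<tau>_def field_simps)
    moreover have "(2 * of_int w - 1) * of_real pi * \<i> * of_real (x / (2 * pi * r)) = \<i> * of_real ((of_int w - 1/2) * x / r)"
      using r by (simp add: field_simps)
    ultimately show ?thesis
      by (simp only: f_def exp_of_real of_real_mult of_real_power_int of_real_minus of_real_1)
  qed
  have f1: "f (- int j) = of_real (exp (- dirichlet_rate r j * \<tau>) * (-1)^j) * exp (- (\<i> * of_real ((real j + 1/2) * x / r)))" for j
  proof -
    have "(of_int (- int j) - 1/2 :: real)\<^sup>2 = (real j + 1/2)\<^sup>2" by (simp add: power2_eq_square algebra_simps)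
    then have "- \<tau> * (of_int (- int j) - 1/2)\<^sup>2 / (2 * r\<^sup>2) = - dirichlet_rate r j * \<tau>"
      by (simp add: dirichlet_rate_def)
    moreover have "(of_int (- int j) - 1/2) * x / r = - ((real j + 1/2) * x / r)"
    proof -
      have "(of_int (- int j) - 1/2) = - (real j + 1/2)" by simp
      then show ?thesis by (simp only: mult_minus_left minus_divide_left)
    qed
    ultimately show ?thesis unfolding f by (simp add: power_int_minus flip: power_inverse)
  qed
  have f2: "f (int j + 1) = - of_real (exp (- dirichlet_rate r j * \<tau>) * (-1)^j) * exp (\<i> * of_real ((real j + 1/2) * x / r))" for j
  proof -
    have "(of_int (int j + 1) - 1/2 :: real)\<^sup>2 = (real j + 1/2)\<^sup>2" by (simp add: power2_eq_square algebra_simps)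
    then have "- \<tau> * (of_int (int j + 1) - 1/2)\<^sup>2 / (2 * r\<^sup>2) = - dirichlet_rate r j * \<tau>"
      by (simp add: dirichlet_rate_def)
    moreover have "(of_int (int j + 1) - 1/2) * x / r = (real j + 1/2) * x / r" by (simp add: field_simps)
    ultimately show ?thesis unfolding f by (simp add: power_int_add add.commute)
  qed
  have s: "summable (\<lambda>j. exp (- dirichlet_rate r j * \<tau>))"
  proof (rule summable_comparison_test')
    show "summable (\<lambda>j. \<bar>exp (- dirichlet_rate r j * \<tau>) * (2 * real j + 1)\<bar>)"
      by (rule theta_series_summable(1)[OF r \<tau>, of "\<lambda>j x. 2 * real j + 1" 1])
         (use power_increasing[of 1 3 "2 * real _ + 1"] in auto)
  qed auto
  have "infsum f UNIV = (\<Sum>j. f (- int j) + f (int j + 1))"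
  proof (rule infsum_int_pairs)
    have "norm (exp (\<i> * of_real y)) = 1" "norm (exp (- (\<i> * of_real y))) = 1" for y
      using norm_exp_i_times[of y] norm_exp_i_times[of "- y"] by simp_all
    then show "summable (\<lambda>j. norm (f (int j + 1)))" "summable (\<lambda>j. norm (f (- int j)))"
      using s by (simp_all add: f1 f2 norm_mult norm_power)
  qed
  also have "(\<lambda>j. f (- int j) + f (int j + 1))
     = (\<lambda>j. (- \<i>) * of_real (exp (- dirichlet_rate r j * \<tau>) * (2 * (-1)^j * sin ((real j + 1/2) * x / r))))"
  proof
    fix j
    let ?z = "(real j + 1/2) * x / r"
    have "exp (- (\<i> * of_real ?z)) - exp (\<i> * of_real ?z) = - 2 * \<i> * of_real (sin ?z)"
      by (simp add: sin_exp_eq flip: sin_of_real)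
    moreover have "f (- int j) + f (int j + 1) = of_real (exp (- dirichlet_rate r j * \<tau>) * (-1)^j) * (exp (- (\<i> * of_real ?z)) - exp (\<i> * of_real ?z))"
      unfolding f1 f2 by (simp add: algebra_simps)
    ultimately show "f (- int j) + f (int j + 1) = (- \<i>) * of_real (exp (- dirichlet_rate r j * \<tau>) * (2 * (-1)^j * sin ?z))"
      by simp
  qed
  also have "(\<Sum>j. (- \<i>) * of_real (exp (- dirichlet_rate r j * \<tau>) * (2 * (-1)^j * sin ((real j + 1/2) * x / r))))
     = (- \<i>) * of_real (theta_h r \<tau> x)"
    using sums_mult[OF sums_of_real[OF theta_h_series[OF r \<tau>, of x]], of "- \<i>"] by (rule sums_unique[symmetric])
  finally have "infsum f UNIV = - \<i> * of_real (theta_h r \<tau> x)" .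
  moreover have "vartheta1 (of_real (x / (2 * pi * r))) (tau r tstar t) = \<i> * infsum f UNIV"
    unfolding vartheta1_def f_def[abs_def] ..
  ultimately show ?thesis by (simp add: \<tau>_def)
qed

section \<open>Positivity at large times\<close>

text \<open>The constant is what the tail leaves of the head: \<open>(2 * n + 1) / 5^n\<close>
  summed over \<open>n >= 1\<close> is \<open>7/8\<close>. Both regimes of \<tau> lead to this same
  majorant, with \<open>2 * n + 1\<close> from the size of a term and \<open>1 / 5^n\<close> from
  the Gaussian decay.\<close>

lemma suminf_ge_eighth_head:
  fixes f :: "nat \<Rightarrow> real"
  assumes "summable f" and f: "\<And>n. 1 \<le> n \<Longrightarrow> \<bar>f n\<bar> \<le> f 0 * ((2 * real n + 1) / 5 ^ n)"
  shows "f 0 / 8 \<le> suminf f"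
proof -
  have g: "(\<lambda>n. (1/5::real) ^ n) sums (5/4)" using geometric_sums[of "1/5::real"] by simp
  have "(\<lambda>n. real (Suc n) * (1/5) ^ n) sums (1 / (1 - 1/5)\<^sup>2)"
    using geometric_deriv_sums[of "1/5::real"] by simp
  then have "(\<lambda>n. 2 * (real (Suc n) * (1/5) ^ n) - (1/5) ^ n) sums (2 * (1 / (1 - 1/5)\<^sup>2) - 5/4 :: real)"
    by (intro sums_diff sums_mult g)
  moreover have "2 * (real (Suc n) * (1/5) ^ n) - (1/5) ^ n = (2 * real n + 1) / 5 ^ n" for n
    by (simp add: field_simps)
  moreover have "2 * (1 / (1 - 1/5)\<^sup>2) - 5/4 = (15/8 :: real)" by (simp add: power2_eq_square)
  ultimately have "(\<lambda>n. (2 * real n + 1) / 5 ^ n) sums (15/8)" by (simp only:)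
  then have "(\<lambda>n. (2 * real (Suc n) + 1) / 5 ^ Suc n) sums (7/8)"
    by (subst sums_Suc_iff) simp
  from sums_mult[OF this, of "f 0"]
  have m: "(\<lambda>n. f 0 * ((2 * real (Suc n) + 1) / 5 ^ Suc n)) sums (7/8 * f 0)" by (simp add: mult.commute)
  have s: "summable (\<lambda>n. f (Suc n))" using assms(1) by (subst summable_Suc_iff)
  have "- (7/8 * f 0) \<le> (\<Sum>n. f (Suc n))"
  proof (rule sums_le[OF _ sums_minus[OF m] summable_sums[OF s]])
    fix n show "- (f 0 * ((2 * real (Suc n) + 1) / 5 ^ Suc n)) \<le> f (Suc n)"
      using f[of "Suc n"] by (simp only: abs_le_iff) linarith
  qed
  then show ?thesis using suminf_split_head[OF assms(1)] by simp
qed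

text \<open>The base comes from \<open>exp 2 >= 1 + 2 + 2^2 / 2 = 5\<close>.\<close>

lemma exp_minus_two_power: "exp (- 2 * real n) \<le> 1 / 5 ^ n"
proof -
  have "(5::real) \<le> exp 2" using exp_lower_Taylor_quadratic[of 2] by simp
  then have "5 ^ n \<le> exp (2::real) ^ n" by (intro power_mono) auto
  also have "exp (2::real) ^ n = exp (2 * real n)" by (simp add: exp_of_nat_mult[symmetric] mult.commute)
  finally have "1 / exp (2 * real n) \<le> 1 / 5 ^ n" by (intro divide_left_mono) auto
  then show ?thesis by (simp add: exp_minus field_simps)
qed

text \<open>Relative to the head the exponential of term \<open>n\<close> is
  \<open>exp (- (n^2 + n) * \<tau> / (2 * r^2))\<close>. From the threshold
  \<open>\<tau> = 2 * r^2\<close> on this is at most \<open>exp (- 2 * n)\<close> for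
  \<open>n >= 1\<close>, while the Dirichlet kernel is at most \<open>2 * n + 1\<close>.\<close>

lemma theta_k_pos_large:
  assumes r: "0 < r" and \<tau>: "2 * r\<^sup>2 \<le> \<tau>"
  shows "0 < theta_k r \<tau> x"
proof -
  define f where "f n = exp (- dirichlet_rate r n * \<tau>) * (2 * (-1)^n * dirichlet_kernel n (x / r))" for n
  have \<tau>0: "0 < \<tau>" using r \<tau> by (smt (verit) zero_less_power)
  have s: "summable f" unfolding f_def
    by (rule theta_series_summable(2)[where G = "\<lambda>n x. 2 * (-1)^n * dirichlet_kernel n (x / r)", OF r \<tau>0 theta_coeff_bounds(2)[OF r]])
  have f0: "f 0 = 2 * exp (- dirichlet_rate r 0 * \<tau>)" by (simp add: f_def dirichlet_kernel_def)
  have "f 0 / 8 \<le> suminf f"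
  proof (rule suminf_ge_eighth_head[OF s])
    fix n :: nat assume n: "1 \<le> n"
    have "dirichlet_rate r n = dirichlet_rate r 0 + (real n * real n + real n) / (2 * r\<^sup>2)"
      using r by (simp add: dirichlet_rate_def power2_eq_square field_simps)
    then have e: "exp (- dirichlet_rate r n * \<tau>) = exp (- dirichlet_rate r 0 * \<tau>) * exp (- ((real n * real n + real n) * (\<tau> / (2 * r\<^sup>2))))"
      by (simp add: exp_add[symmetric] algebra_simps)
    have "1 \<le> \<tau> / (2 * r\<^sup>2)" using \<tau> r by (simp add: field_simps)
    moreover have "2 * real n \<le> real n * real n + real n" using n by simp
    ultimately have "2 * real n * 1 \<le> (real n * real n + real n) * (\<tau> / (2 * r\<^sup>2))"
      by (intro mult_mono) auto
    then have "exp (- ((real n * real n + real n) * (\<tau> / (2 * r\<^sup>2)))) \<le> exp (- 2 * real n)" by simp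
    also note exp_minus_two_power[of n]
    finally have "exp (- dirichlet_rate r n * \<tau>) \<le> exp (- dirichlet_rate r 0 * \<tau>) * (1 / 5 ^ n)"
      unfolding e by (intro mult_left_mono) auto
    then have "exp (- dirichlet_rate r n * \<tau>) * (2 * \<bar>dirichlet_kernel n (x / r)\<bar>)
        \<le> (exp (- dirichlet_rate r 0 * \<tau>) * (1 / 5 ^ n)) * (2 * (2 * real n + 1))"
      using dirichlet_kernel_bounds(1)[of n "x / r"] by (intro mult_mono) auto
    then show "\<bar>f n\<bar> \<le> f 0 * ((2 * real n + 1) / 5 ^ n)" unfolding f0 by (simp add: f_def abs_mult field_simps)
  qed
  moreover have "0 < f 0" by (simp add: f0)
  moreover have "theta_k r \<tau> x = suminf f" by (simp add: f_def[abs_def] theta_k_def theta_series_def)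
  ultimately show ?thesis by linarith
qed

section \<open>Poisson summation\<close>

text \<open>Replacing \<open>w\<close> by \<open>- w\<close> transposes the kernel; at
  \<open>y = pi * r\<close> the map \<open>w\<close> to \<open>- 1 - w\<close> reflects the images
  about 0 and changes the sign.\<close>

lemma p_minus_reindex:
  shows "p_minus r t y x = p_minus r t x y" and "p_minus r t (pi * r) (- x) = - p_minus r t (pi * r) x"
proof -
  have "p_minus r t y x = (\<Sum>\<^sub>\<infinity>w::int. (-1) powi (- w) * pBM t (y + 2 * pi * r * of_int (- w)) x)"
    unfolding p_minus_def
    by (rule infsum_reindex_bij_betw[symmetric, of uminus UNIV UNIV "\<lambda>w. (-1) powi w * pBM t (y + 2 * pi * r * of_int w) x"])
       (simp add: bij_uminus)
  also have "\<dots> = p_minus r t x y"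
    unfolding p_minus_def
  proof (rule infsum_cong)
    fix w :: int
    have "(y + 2 * pi * r * of_int (- w) - x)\<^sup>2 = (x + 2 * pi * r * of_int w - y)\<^sup>2" by (simp add: power2_eq_square algebra_simps)
    then show "(-1) powi (- w) * pBM t (y + 2 * pi * r * of_int (- w)) x = (-1) powi w * pBM t (x + 2 * pi * r * of_int w) y"
      by (simp add: pBM_def power_int_minus flip: power_int_inverse)
  qed
  finally show "p_minus r t y x = p_minus r t x y" .
  have "bij_betw (\<lambda>w::int. - 1 - w) UNIV UNIV" by (rule bij_betwI[of _ _ _ "\<lambda>w. - 1 - w"]) auto
  then have "p_minus r t (pi * r) (- x) = (\<Sum>\<^sub>\<infinity>w::int. (-1) powi (- 1 - w) * pBM t (pi * r + 2 * pi * r * of_int (- 1 - w)) (- x))"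
    unfolding p_minus_def
    by (rule infsum_reindex_bij_betw[symmetric, of "\<lambda>w. - 1 - w" UNIV UNIV "\<lambda>w. (-1) powi w * pBM t (pi * r + 2 * pi * r * of_int w) (- x)"])
  also have "\<dots> = (\<Sum>\<^sub>\<infinity>w::int. - ((-1) powi w * pBM t (pi * r + 2 * pi * r * of_int w) x))"
  proof (rule infsum_cong)
    fix w :: int
    have "(pi * r + 2 * pi * r * of_int (- 1 - w) - - x)\<^sup>2 = (pi * r + 2 * pi * r * of_int w - x)\<^sup>2"
      by (simp add: power2_eq_square algebra_simps)
    moreover have "(-1 :: real) powi (- 1 - w) = - ((-1) powi w)"
      by (simp add: power_int_diff power_int_minus divide_inverse flip: power_int_inverse)
    ultimately show "(-1) powi (- 1 - w) * pBM t (pi * r + 2 * pi * r * of_int (- 1 - w)) (- x) = - ((-1) powi w * pBM t (pi * r + 2 * pi * r * of_int w) x)"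
      by (simp add: pBM_def)
  qed
  also have "\<dots> = - p_minus r t (pi * r) x" by (simp add: p_minus_def infsum_uminus)
  finally show "p_minus r t (pi * r) (- x) = - p_minus r t (pi * r) x" .
qed

lemma p_minus_shift: "p_minus r t y (x + 2 * pi * r) = - p_minus r t y x"
proof -
  have "bij_betw (\<lambda>w::int. w + 1) UNIV UNIV" by (rule bij_betwI[of _ _ _ "\<lambda>w. w - 1"]) auto
  then have "p_minus r t y (x + 2 * pi * r) = (\<Sum>\<^sub>\<infinity>w::int. (-1) powi (w + 1) * pBM t (y + 2 * pi * r * of_int (w + 1)) (x + 2 * pi * r))"
    unfolding p_minus_def
    by (rule infsum_reindex_bij_betw[symmetric, of "\<lambda>w. w + 1" UNIV UNIV "\<lambda>w. (-1) powi w * pBM t (y + 2 * pi * r * of_int w) (x + 2 * pi * r)"])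
  also have "\<dots> = (\<Sum>\<^sub>\<infinity>w::int. - ((-1) powi w * pBM t (y + 2 * pi * r * of_int w) x))"
  proof (rule infsum_cong)
    fix w :: int
    have e: "y + 2 * pi * r * of_int (w + 1) - (x + 2 * pi * r) = y + 2 * pi * r * of_int w - x" by (simp add: algebra_simps)
    show "(-1) powi (w + 1) * pBM t (y + 2 * pi * r * of_int (w + 1)) (x + 2 * pi * r) = - ((-1) powi w * pBM t (y + 2 * pi * r * of_int w) x)"
      unfolding pBM_def e by (simp add: power_int_add)
  qed
  also have "\<dots> = - p_minus r t y x" by (simp add: p_minus_def infsum_uminus)
  finally show ?thesis .
qed

lemma p_minus_continuous:
  assumes r: "0 < r" and t: "0 < t"
  shows "continuous_on UNIV (\<lambda>x. p_minus r t y x)"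
proof -
  have *: "continuous_on (ball y d) (\<lambda>x. p_minus r t y x)" for d
  proof -
    define \<rho> where "\<rho> = exp (- ((2*pi*r)\<^sup>2 / (4*t)))"
    define C where "C = exp (d\<^sup>2 / (2*t)) / sqrt (2*pi*t)"
    have \<rho>: "0 < \<rho>" "\<rho> < 1" "0 \<le> C" using assms by (auto simp: \<rho>_def C_def)
    have s: "summable (\<lambda>j. 2 * C * \<rho> ^ j)"
      using \<rho> by (intro summable_mult summable_geometric) auto
    have "uniform_limit (ball y d) (\<lambda>n x. \<Sum>j<n. (-1)^j * (pBM t (y - 2*pi*r * real j) x - pBM t (y + 2*pi*r * (real j + 1)) x))
        (\<lambda>x. \<Sum>j. (-1)^j * (pBM t (y - 2*pi*r * real j) x - pBM t (y + 2*pi*r * (real j + 1)) x)) sequentially"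
    proof (rule Weierstrass_m_test[OF _ s])
      fix j x assume "x \<in> ball y d"
      then have yx: "\<bar>y - x\<bar> \<le> d" by (simp add: dist_real_def)
      have a: "pBM t (y - 2*pi*r * real j) x \<le> C * \<rho> ^ j"
        using pBM_bound[OF t yx, of "2*pi*r" "- int j"] by (simp add: C_def \<rho>_def)
      have "pBM t (y + 2*pi*r * (real j + 1)) x \<le> C * \<rho> ^ Suc j"
        using pBM_bound[OF t yx, of "2*pi*r" "int j + 1"] by (simp add: C_def \<rho>_def nat_add_distrib del: power_Suc)
      also have "\<dots> \<le> C * \<rho> ^ j" using \<rho> by (intro mult_left_mono power_decreasing) auto
      finally have b: "pBM t (y + 2*pi*r * (real j + 1)) x \<le> C * \<rho> ^ j" .
      show "norm ((-1)^j * (pBM t (y - 2*pi*r * real j) x - pBM t (y + 2*pi*r * (real j + 1)) x)) \<le> 2 * C * \<rho> ^ j"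
        using a b pBM_nonneg[OF t, of "y - 2*pi*r * real j" x] pBM_nonneg[OF t, of "y + 2*pi*r * (real j + 1)" x]
        by (simp add: abs_mult)
    qed
    then have "continuous_on (ball y d) (\<lambda>x. \<Sum>j. (-1)^j * (pBM t (y - 2*pi*r * real j) x - pBM t (y + 2*pi*r * (real j + 1)) x))"
      by (rule uniform_limit_theorem[rotated]) (use t in \<open>auto simp: pBM_def intro!: always_eventually continuous_intros\<close>)
    then show ?thesis by (simp add: p_minus_suminf[OF r t])
  qed
  show ?thesis
  proof (rule continuous_at_imp_continuous_on, rule ballI)
    fix x show "isCont (\<lambda>x. p_minus r t y x) x"
      using *[of "dist y x + 1"] by (rule continuous_on_interior) (simp add: interior_open)
  qed
qed

text \<open>Orthogonality of the half-integer sines over one period, applied term by term; the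
  coefficient 2 of the series meets the squared norm \<open>pi * r\<close>.\<close>

lemma theta_h_integral_sin:
  assumes r: "0 < r" and \<tau>: "0 < \<tau>"
  shows "(LINT x:{0..<2*pi*r}|lborel. theta_h r \<tau> x * sin ((real m + 1/2) * x / r))
       = 2 * pi * r * ((-1)^m * exp (- dirichlet_rate r m * \<tau>))"
proof -
  define L where "L = 2*pi*r"
  have L: "0 < L" using r by (simp add: L_def)
  have orth: "(LINT x:{0..<L}|lborel. sin ((real n + 1/2) * x / r) * sin ((real m + 1/2) * x / r)) = (if n = m then L / 2 else 0)" for n
  proof -
    have cosint: "(LINT x:{0..<L}|lborel. cos (real_of_int p * x / r)) = (if p = 0 then L else 0)" for p :: int
    proof -
      have "(LINT x:{0..<L}|lborel. cos (real_of_int p * x / r)) = (LINT x:{0..L}|lborel. cos (real_of_int p * x / r))"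
        by (rule set_integral_cong_set) (auto intro!: AE_I[where N = "{L}"] simp: set_borel_measurable_def)
      also have "\<dots> = (if p = 0 then L else 0)"
      proof (cases "p = 0")
        case True
        then show ?thesis using L by (simp add: set_lebesgue_integral_def)
      next
        case False
        define F where "F x = sin (real_of_int p * x / r) * r / real_of_int p" for x
        have "(\<integral>x. indicator {0..L} x *\<^sub>R cos (real_of_int p * x / r) \<partial>lborel) = F L - F 0"
        proof (rule integral_FTC_Icc)
          show "(F has_vector_derivative cos (real_of_int p * x / r)) (at x within {0..L})" for x
            unfolding has_real_derivative_iff_has_vector_derivative[symmetric] F_def
            using False r by (auto intro!: derivative_eq_intros)
        qed (use L r in \<open>auto intro!: continuous_intros\<close>)
        moreover have "real_of_int p * L / r = 2 * pi * of_int p" using r by (simp add: L_def field_simps)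
        ultimately show ?thesis using False by (simp add: F_def set_lebesgue_integral_def)
      qed
      finally show ?thesis .
    qed
    have ci: "set_integrable lborel {0..<L} (\<lambda>x. cos (real_of_int p * x / r) / 2)" for p
    proof -
      have "set_integrable lborel {0..L} (\<lambda>x. cos (real_of_int p * x / r) / 2)"
        by (rule borel_integrable_atLeastAtMost') (use r in \<open>auto intro!: continuous_intros\<close>)
      then show ?thesis by (rule set_integrable_subset) auto
    qed
    \<comment> \<open>Sum and difference of two half-integer frequencies are integers, and the sum
      \<open>n + m + 1\<close> is never zero, so only \<open>n = m\<close> survives.\<close>
    have "sin ((real n + 1/2) * x / r) * sin ((real m + 1/2) * x / r)
      = cos (real_of_int (int n - int m) * x / r) / 2 - cos (real_of_int (int n + int m + 1) * x / r) / 2" for x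
    proof -
      have "(real n + 1/2) * x / r - (real m + 1/2) * x / r = real_of_int (int n - int m) * x / r"
        "(real n + 1/2) * x / r + (real m + 1/2) * x / r = real_of_int (int n + int m + 1) * x / r"
        using r by (simp_all add: field_simps)
      then show ?thesis by (simp add: sin_times_sin diff_divide_distrib)
    qed
    then have "(LINT x:{0..<L}|lborel. sin ((real n + 1/2) * x / r) * sin ((real m + 1/2) * x / r))
      = (LINT x:{0..<L}|lborel. cos (real_of_int (int n - int m) * x / r) / 2 - cos (real_of_int (int n + int m + 1) * x / r) / 2)"
      by simp
    also have "\<dots> = (LINT x:{0..<L}|lborel. cos (real_of_int (int n - int m) * x / r) / 2) - (LINT x:{0..<L}|lborel. cos (real_of_int (int n + int m + 1) * x / r) / 2)"
      by (rule set_integral_diff(2)[OF ci ci])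
    also have "\<dots> = (if n = m then L / 2 else 0)"
      unfolding set_integral_divide_zero cosint by auto
    finally show ?thesis .
  qed
  define F where "F n x = indicator {0..<L} x * (exp (- dirichlet_rate r n * \<tau>) * (2 * (-1)^n * sin ((real n + 1/2) * x / r)) * sin ((real m + 1/2) * x / r))" for n x
  have s: "summable (\<lambda>n. exp (- dirichlet_rate r n * \<tau>))"
  proof (rule summable_comparison_test')
    show "summable (\<lambda>j. \<bar>exp (- dirichlet_rate r j * \<tau>) * (2 * real j + 1)\<bar>)"
      by (rule theta_series_summable(1)[OF r \<tau>, of "\<lambda>j x. 2 * real j + 1" 1])
         (use power_increasing[of 1 3 "2 * real _ + 1"] in auto)
  qed auto
  have Fb: "\<bar>F n x\<bar> \<le> 2 * exp (- dirichlet_rate r n * \<tau>) * indicator {0..<L} x" for n x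
    using mult_mono[OF abs_sin_le_one[of "(real n + 1/2) * x / r"] abs_sin_le_one[of "(real m + 1/2) * x / r"]]
    by (auto simp: F_def abs_mult indicator_def mult_left_le mult_ac)
  have indi: "integrable lborel (\<lambda>x. c * indicator {0..<L} x :: real)" for c
    using L by (intro integrable_mult_right integrable_real_indicator) auto
  have Fi: "integrable lborel (F n)" for n
  proof (rule Bochner_Integration.integrable_bound[OF indi[of "2 * exp (- dirichlet_rate r n * \<tau>)"]])
    show "F n \<in> borel_measurable lborel" unfolding F_def by measurable
    show "AE x in lborel. norm (F n x) \<le> norm (2 * exp (- dirichlet_rate r n * \<tau>) * indicator {0..<L} x)"
      by (intro AE_I2) (metis Fb abs_ge_self order_trans real_norm_def)
  qed
  have "(\<lambda>n. LINT x|lborel. F n x) sums (LINT x|lborel. (\<Sum>n. F n x))"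
  proof (rule sums_integral[OF Fi])
    show "AE x in lborel. summable (\<lambda>n. norm (F n x))"
    proof (rule AE_I2)
      fix x
      have "summable (\<lambda>n. 2 * exp (- dirichlet_rate r n * \<tau>) * indicator {0..<L} x)"
        by (intro summable_mult2 summable_mult s)
      then show "summable (\<lambda>n. norm (F n x))"
        by (rule summable_comparison_test') (use Fb in simp)
    qed
    have le: "(LINT x|lborel. norm (F n x)) \<le> 2 * exp (- dirichlet_rate r n * \<tau>) * L" for n
    proof -
      have "(LINT x|lborel. norm (F n x)) \<le> (LINT x|lborel. 2 * exp (- dirichlet_rate r n * \<tau>) * indicator {0..<L} x)"
        using Fi indi Fb by (intro integral_mono) auto
      then show ?thesis using L by simp
    qed
    have "summable (\<lambda>n. 2 * exp (- dirichlet_rate r n * \<tau>) * L)"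
      by (intro summable_mult2 summable_mult s)
    then show "summable (\<lambda>n. LINT x|lborel. norm (F n x))"
      by (rule summable_comparison_test') (use le in simp)
  qed
  moreover have "(LINT x|lborel. F n x) = (if n = m then (-1)^m * exp (- dirichlet_rate r m * \<tau>) * L else 0)" for n
  proof -
    have "(LINT x|lborel. F n x) = exp (- dirichlet_rate r n * \<tau>) * (2 * (-1)^n) * (LINT x:{0..<L}|lborel. sin ((real n + 1/2) * x / r) * sin ((real m + 1/2) * x / r))"
      unfolding set_lebesgue_integral_def F_def
      by (subst Bochner_Integration.integral_mult_right_zero[symmetric]) (auto intro!: Bochner_Integration.integral_cong simp: mult_ac)
    then show ?thesis unfolding orth by simp
  qed
  ultimately have "(\<lambda>n. if n = m then (-1)^m * exp (- dirichlet_rate r m * \<tau>) * L else 0) sums (LINT x|lborel. (\<Sum>n. F n x))"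
    by (simp only:)
  from sums_unique2[OF this sums_single[of m "\<lambda>_. (-1)^m * exp (- dirichlet_rate r m * \<tau>) * L"]]
  have "(LINT x|lborel. (\<Sum>n. F n x)) = (-1)^m * exp (- dirichlet_rate r m * \<tau>) * L" .
  moreover have "(\<Sum>n. F n x) = indicator {0..<L} x * (theta_h r \<tau> x * sin ((real m + 1/2) * x / r))" for x
  proof -
    from sums_mult[OF sums_mult2[OF theta_h_series[OF r \<tau>, of x], of "sin ((real m + 1/2) * x / r)"], of "indicator {0..<L} x"]
    show ?thesis unfolding F_def by (rule sums_unique[symmetric])
  qed
  ultimately show ?thesis by (simp add: set_lebesgue_integral_def L_def mult_ac)
qed

lemma half_angle_sin_pos:
  assumes "0 < r" "x \<in> {0<..<2*pi*r}"
  shows "0 < sin (x / (2 * r))"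
  using assms by (intro sin_gt_zero) (auto simp: field_simps)

lemma theta_h_symmetry:
  assumes r: "0 < r"
  shows "theta_h r \<tau> (x + 2 * pi * r) = - theta_h r \<tau> x" "theta_h r \<tau> (- x) = - theta_h r \<tau> x"
proof -
  have "(x + 2 * pi * r) / (2 * r) = x / (2 * r) + pi" using r by (simp add: field_simps)
  then show "theta_h r \<tau> (x + 2 * pi * r) = - theta_h r \<tau> x"
    using theta_k_symmetry(1)[OF r, of \<tau> x] by (simp add: theta_h_def)
qed (simp add: theta_h_def theta_k_symmetry(2)[OF r])

lemma theta_k_continuous_x:
  assumes "0 < r" "0 < \<tau>"
  shows "continuous_on A (theta_k r \<tau>)" "continuous_on A (theta_h r \<tau>)"
proof -
  have "continuous_on UNIV ((\<lambda>(\<tau>, x). theta_k r \<tau> x) \<circ> (\<lambda>x. (\<tau>, x)))"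
    by (rule continuous_on_compose) (use assms in \<open>auto intro!: continuous_intros continuous_on_subset[OF theta_k_continuous(1)]\<close>)
  then have c: "continuous_on UNIV (theta_k r \<tau>)" by (simp add: o_def)
  then show "continuous_on A (theta_k r \<tau>)" by (rule continuous_on_subset) simp
  show "continuous_on A (theta_h r \<tau>)" unfolding theta_h_def
    using assms by (intro continuous_intros continuous_on_subset[OF c]) auto
qed

lemma even_periodicI_continuous:
  assumes r: "0 < r" and c: "continuous_on UNIV g"
    and "\<And>x. g (x + 2 * pi * r) = g x" "\<And>x. g (- x) = g x"
  shows "even_periodic r g"
proof -
  have "bounded (g ` {0..2*pi*r})"
    by (intro compact_imp_bounded compact_continuous_image continuous_on_subset[OF c]) auto
  moreover have "range g \<subseteq> g ` {0..2*pi*r}"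
  proof safe
    fix x
    interpret periodic_fun_simple g "2 * pi * r" by unfold_locales (rule assms)
    have "g x = g (x rmod (2*pi*r))"
      using minus_of_int[of x "\<lfloor>x / (2*pi*r)\<rfloor>"] r by (simp add: rmod_def mult_ac)
    moreover have "x rmod (2*pi*r) \<in> {0..2*pi*r}"
      using r rmod_nonneg[of "2*pi*r" x] rmod_le[of "2*pi*r" x] by auto
    ultimately show "g x \<in> g ` {0..2*pi*r}" by blast
  qed
  ultimately show ?thesis
    using assms borel_measurable_continuous_onI[OF c] by (auto simp: even_periodic_def intro: bounded_subset)
qed

lemma trig_poly_sin_induct:
  assumes r: "0 < r" and f: "trig_poly r f"
    and sin: "\<And>m. P (\<lambda>x. sin ((real m + 1/2) * x / r))"
    and lin: "\<And>a f g. P f \<Longrightarrow> P g \<Longrightarrow> P (\<lambda>x. a * f x + g x)"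
  shows "P (\<lambda>x. sin (x / (2*r)) * f x)"
  using f
proof (induction rule: trig_poly.induct)
  case (base m)
  have "sin (x / (2*r)) * dirichlet_kernel m (x / r) = sin ((real m + 1/2) * x / r)" for x
    using sin_dirichlet_kernel[of "x / r" m] by (simp add: mult.commute)
  then show ?case using sin[of m] by simp
next
  case (lin f g a)
  from assms(4)[OF lin.IH, of a] show ?case by (simp add: algebra_simps)
qed

text \<open>Vanishing sine moments extend, by the closure principle, to all functions
  \<open>sin (x / (2 * r)) * \<phi> x\<close> with \<phi> even and periodic. As \<open>d\<close> is
  odd and antiperiodic, \<open>d x * sin (x / (2 * r))\<close> is an admissible \<phi>, and the
  moment becomes the integral of its square.\<close>

lemma zero_of_sin_moments:
  assumes r: "0 < r" and c: "continuous_on UNIV d"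
    and shift: "\<And>x. d (x + 2 * pi * r) = - d x" and odd: "\<And>x. d (- x) = - d x"
    and mom: "\<And>m. (LINT x:{0..<2*pi*r}|lborel. d x * sin ((real m + 1/2) * x / r)) = 0"
  shows "d x = 0"
proof -
  define L where "L = 2*pi*r"
  have L: "0 < L" using r by (simp add: L_def)
  define g where "g x = d x * sin (x / (2*r))" for x
  have sshift: "sin ((x + 2 * pi * r) / (2 * r)) = - sin (x / (2*r))" for x
  proof -
    have "(x + 2 * pi * r) / (2 * r) = x / (2 * r) + pi" using r by (simp add: field_simps)
    then show ?thesis by simp
  qed
  have gc: "continuous_on UNIV g" unfolding g_def using r by (intro continuous_intros c) auto
  have ge: "even_periodic r g"
    by (rule even_periodicI_continuous[OF r gc]) (simp_all add: g_def shift odd sshift)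
  define P where "P \<phi> \<longleftrightarrow> \<phi> \<in> borel_measurable borel \<and> bounded (range \<phi>) \<and> (LINT x:{0..<L}|lborel. d x * \<phi> x) = 0" for \<phi> :: "real \<Rightarrow> real"
  have [measurable]: "d \<in> borel_measurable borel" by (rule borel_measurable_continuous_onI[OF c])
  have "bounded (d ` {0..L})"
    by (intro compact_imp_bounded compact_continuous_image continuous_on_subset[OF c]) auto
  then obtain B where "\<forall>y\<in>d ` {0..L}. norm y \<le> B" unfolding bounded_iff by blast
  then have B: "\<bar>d x\<bar> \<le> B" if "x \<in> {0..L}" for x using that by auto
  have indi: "integrable lborel (\<lambda>x. c * indicator {0..<L} x :: real)" for c
    using L by (intro integrable_mult_right integrable_real_indicator) auto
  have bnd: "norm (indicator {0..<L} x *\<^sub>R (d x * \<phi> x)) \<le> B * C * indicator {0..<L} x" if "\<And>x. \<bar>\<phi> x\<bar> \<le> C" for x C and \<phi> :: "real \<Rightarrow> real"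
    using mult_mono[OF B[of x] that[of x]] B[of 0] L by (auto simp: indicator_def abs_mult)
  have int: "set_integrable lborel {0..<L} (\<lambda>x. d x * \<phi> x)"
    if \<phi>: "\<phi> \<in> borel_measurable borel" "bounded (range \<phi>)" for \<phi>
  proof -
    obtain C where C: "\<And>x. \<bar>\<phi> x\<bar> \<le> C" using \<phi>(2) by (auto simp: bounded_iff)
    have "AE x in lborel. norm (indicator {0..<L} x *\<^sub>R (d x * \<phi> x)) \<le> norm (B * C * indicator {0..<L} x)"
      by (intro AE_I2 order_trans[OF bnd[OF C]]) (simp only: real_norm_def abs_ge_self)
    then show ?thesis unfolding set_integrable_def
      using \<phi>(1) by (intro Bochner_Integration.integrable_bound[OF indi[of "B * C"]]) auto
  qed
  have Plin: "P (\<lambda>x. a * f x + h x)" if "P f" "P h" for a f h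
  proof -
    have b: "bounded (range (\<lambda>x. a * f x + h x))"
      using that bounded_scaleR_comp[of f UNIV a] by (intro bounded_plus_comp) (auto simp: P_def)
    have "(LINT x:{0..<L}|lborel. d x * (a * f x + h x)) = (LINT x:{0..<L}|lborel. a * (d x * f x) + d x * h x)"
      by (simp add: algebra_simps)
    also have "\<dots> = 0"
      using that int[of f] int[of h] by (subst set_integral_add(2)) (auto simp: P_def)
    finally show ?thesis using that b by (auto simp: P_def)
  qed
  \<comment> \<open>The closure principle runs over the cofactor of the half-angle sine, since this
    is the even periodic part.\<close>
  have Pg: "P (\<lambda>x. sin (x / (2*r)) * g x)"
  proof (rule even_periodic_closure[OF r ge, where P = "\<lambda>\<phi>. P (\<lambda>x. sin (x / (2*r)) * \<phi> x)"])
    show "P (\<lambda>x. sin (x / (2*r)) * cos (x / r) ^ k)" for k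
    proof (rule trig_poly_sin_induct[OF r trig_poly_cos_power])
      show "P (\<lambda>x. sin ((real m + 1/2) * x / r))" for m
        using mom[of m] by (auto simp: P_def L_def bounded_iff intro!: exI[of _ 1])
    qed (rule Plin)
  next
    fix a :: real and f h
    assume "P (\<lambda>x. sin (x / (2*r)) * f x)" "P (\<lambda>x. sin (x / (2*r)) * h x)"
    from Plin[OF this, of a] show "P (\<lambda>x. sin (x / (2*r)) * (a * f x + h x))" by (simp add: algebra_simps)
  next
    fix f F C assume f: "\<And>n. P (\<lambda>x. sin (x / (2*r)) * f n x)" and C: "\<And>n x. \<bar>f n x\<bar> \<le> C"
      and lim: "\<And>x. (\<lambda>n. f n x) \<longlonglongrightarrow> F x"
    let ?f = "\<lambda>n x. sin (x / (2*r)) * f n x" and ?F = "\<lambda>x. sin (x / (2*r)) * F x"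
    have lim': "(\<lambda>n. ?f n x) \<longlonglongrightarrow> ?F x" for x by (intro tendsto_intros lim)
    have fm: "?f n \<in> borel_measurable borel" for n using f by (simp add: P_def)
    have Fm: "?F \<in> borel_measurable borel" by (rule borel_measurable_LIMSEQ_real[OF lim' fm])
    have C0: "0 \<le> C" using C[of 0 0] by simp
    have fC: "\<bar>?f n x\<bar> \<le> C" for n x
      using mult_mono[OF abs_sin_le_one[of "x / (2*r)"] C[of n x]] C0 by (simp add: abs_mult)
    have FC: "\<bar>?F x\<bar> \<le> C" for x
      by (rule LIMSEQ_le_const2[OF tendsto_rabs[OF lim'[of x]]]) (use fC in auto)
    have "(\<lambda>n. LINT x|lborel. indicator {0..<L} x *\<^sub>R (d x * ?f n x)) \<longlonglongrightarrow> (LINT x|lborel. indicator {0..<L} x *\<^sub>R (d x * ?F x))"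
    proof (rule integral_dominated_convergence[OF _ _ indi[of "B * C"]])
      show "AE x in lborel. (\<lambda>n. indicator {0..<L} x *\<^sub>R (d x * ?f n x)) \<longlonglongrightarrow> indicator {0..<L} x *\<^sub>R (d x * ?F x)"
        by (intro AE_I2 tendsto_intros lim)
      show "AE x in lborel. norm (indicator {0..<L} x *\<^sub>R (d x * ?f n x)) \<le> B * C * indicator {0..<L} x" for n
        by (intro AE_I2 bnd fC)
    qed (use fm Fm in measurable)
    then have "(LINT x:{0..<L}|lborel. d x * ?F x) = 0"
      using f by (simp add: set_lebesgue_integral_def P_def LIMSEQ_const_iff)
    then show "P ?F" using Fm FC by (auto simp: P_def bounded_iff)
  qed
  have gg: "(\<lambda>x. d x * (sin (x / (2*r)) * g x)) = (\<lambda>x. g x * g x)"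
    by (rule ext) (simp only: g_def mult_ac)
  have "(LINT x:{0..<L}|lborel. d x * (sin (x / (2*r)) * g x)) = 0"
    using Pg unfolding P_def by blast
  moreover have "set_integrable lborel {0..<L} (\<lambda>x. d x * (sin (x / (2*r)) * g x))"
    using Pg unfolding P_def by (intro int) blast+
  ultimately have "AE x in lborel. indicator {0..<L} x *\<^sub>R (g x * g x) = 0"
    unfolding gg set_integrable_def set_lebesgue_integral_def
    by (subst (asm) integral_nonneg_eq_0_iff_AE) auto
  then have AE: "AE x in lborel. x \<notin> {x \<in> {0<..<L}. g x \<noteq> 0}"
    by eventually_elim (auto simp: indicator_def split: if_splits)
  have op: "open {x \<in> {0<..<L}. g x \<noteq> 0}"
  proof -
    have "open (g -` (- {0}) \<inter> {0<..<L})"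
      by (intro open_Int continuous_on_open_vimage[THEN iffD1, rule_format, OF open_UNIV gc, simplified]) auto
    moreover have "g -` (- {0}) \<inter> {0<..<L} = {x \<in> {0<..<L}. g x \<noteq> 0}" by auto
    ultimately show ?thesis by simp
  qed
  have "{x \<in> {0<..<L}. g x \<noteq> 0} = {}"
  proof (rule ccontr)
    assume ne: "{x \<in> {0<..<L}. g x \<noteq> 0} \<noteq> {}"
    have "{x \<in> {0<..<L}. g x \<noteq> 0} \<in> null_sets lborel"
      using AE op by (subst (asm) AE_iff_null_sets[symmetric]) auto
    then have "negligible {x \<in> {0<..<L}. g x \<noteq> 0}"
      by (simp add: negligible_iff_null_sets null_sets_completionI)
    then show False using open_not_negligible[OF op ne] by simp
  qed
  then have d0: "d x = 0" if "x \<in> {0<..<L}" for x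
    using that half_angle_sin_pos[OF r, of x] by (force simp: g_def L_def)
  have d1: "d x = 0" if "x \<in> {0..L}" for x
  proof -
    have "closed (d -` {0})" using continuous_closed_vimage[of "{0}" d] c by (simp add: continuous_on_eq_continuous_at)
    moreover have "{0<..<L} \<subseteq> d -` {0}" using d0 by auto
    ultimately have "closure {0<..<L} \<subseteq> d -` {0}" by (simp add: closure_minimal)
    then show ?thesis using that L by auto
  qed
  \<comment> \<open>Under a shift by the period \<open>d\<close> itself changes sign; its square is
    periodic.\<close>
  have "d x * d x = d (x rmod L) * d (x rmod L)"
  proof -
    interpret periodic_fun_simple "\<lambda>x. d x * d x" L by unfold_locales (simp add: shift L_def)
    show ?thesis using minus_of_int[of x "\<lfloor>x / L\<rfloor>"] L by (simp add: rmod_def mult_ac)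
  qed
  also have "d (x rmod L) = 0"
    using L rmod_nonneg[of L x] rmod_le[of L x] by (intro d1) auto
  finally show ?thesis by simp
qed

text \<open>Both sides are continuous, odd and antiperiodic, so comparing sine moments suffices. For
  the image sum, symmetry of the kernel turns the moment into the evolution of an eigenfunction
  started at \<open>pi * r\<close>, where its value is \<open>(-1)^m\<close>; for the sine series it
  is given by the coefficient.\<close>

lemma poisson_theta_h:
  assumes r: "0 < r" and \<tau>: "0 < \<tau>"
  shows "p_minus r \<tau> (pi * r) x = theta_h r \<tau> x / (2 * pi * r)"
proof -
  define d where "d x = p_minus r \<tau> (pi * r) x - theta_h r \<tau> x / (2 * pi * r)" for x
  have "d x = 0"
  proof (rule zero_of_sin_moments[where d = d, OF r])
    show "continuous_on UNIV d"
      unfolding d_def using r by (intro continuous_intros p_minus_continuous[OF r \<tau>] theta_k_continuous_x(2)[OF r \<tau>]) auto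
    show "d (x + 2 * pi * r) = - d x" "d (- x) = - d x" for x
      using p_minus_shift[of r \<tau> "pi * r" x] p_minus_reindex(2)[of r \<tau> x] theta_h_symmetry[OF r, of \<tau> x]
      by (simp_all add: d_def)
    fix m
    let ?s = "\<lambda>x. sin ((real m + 1/2) * x / r)"
    have [measurable]: "theta_h r \<tau> \<in> borel_measurable borel"
      by (rule borel_measurable_continuous_onI[OF theta_k_continuous_x(2)[OF r \<tau>]])
    have i1: "set_integrable lborel {0..<2*pi*r} (\<lambda>x. p_minus r \<tau> (pi * r) x * ?s x)"
      using p_minus_dominated(1)[OF r \<tau>, of ?s 1 "pi * r"] by (simp add: p_minus_reindex(1)[of r \<tau> "pi * r"])
    have "set_integrable lborel {0..2*pi*r} (\<lambda>x. theta_h r \<tau> x * ?s x / (2 * pi * r))"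
      using r by (intro borel_integrable_atLeastAtMost' continuous_intros theta_k_continuous_x(2)[OF r \<tau>]) auto
    then have i2: "set_integrable lborel {0..<2*pi*r} (\<lambda>x. theta_h r \<tau> x * ?s x / (2 * pi * r))"
      by (rule set_integrable_subset) auto
    have "(LINT x:{0..<2*pi*r}|lborel. d x * ?s x)
       = (LINT x:{0..<2*pi*r}|lborel. p_minus r \<tau> (pi * r) x * ?s x) - (LINT x:{0..<2*pi*r}|lborel. theta_h r \<tau> x * ?s x / (2 * pi * r))"
      unfolding set_integral_diff(2)[OF i1 i2, symmetric] by (simp add: d_def algebra_simps)
    also have "(LINT x:{0..<2*pi*r}|lborel. p_minus r \<tau> (pi * r) x * ?s x) = p_minus_int r \<tau> (pi * r) ?s"
      using \<tau> by (simp add: p_minus_int_def p_minus_reindex(1)[of r \<tau> "pi * r"])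
    also have "\<dots> = exp (- dirichlet_rate r m * \<tau>) * (-1)^m"
    proof -
      have "(real m + 1/2) * (pi * r) / r = pi / 2 + pi * real m" using r by (simp add: field_simps)
      then show ?thesis unfolding p_minus_int_sin[OF r \<tau>] by (simp add: sin_add cos_npi2 del: sin_cos_eq)
    qed
    also have "(LINT x:{0..<2*pi*r}|lborel. theta_h r \<tau> x * ?s x / (2 * pi * r)) = (-1)^m * exp (- dirichlet_rate r m * \<tau>)"
      unfolding set_integral_divide_zero theta_h_integral_sin[OF r \<tau>] using r by simp
    finally show "(LINT x:{0..<2*pi*r}|lborel. d x * ?s x) = 0" by simp
  qed
  then show ?thesis by (simp add: d_def)
qed

section \<open>Positivity at small times\<close>

text \<open>The paired image series is controlled by its head, but the head vanishes at the right
  end of the period. It does so linearly, as \<open>sin (x / (2 * r))\<close> does, and this factor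
  is kept explicit so that the bound for \<open>theta_k\<close> is uniform up to that end. On the
  right half period \<open>z = x - pi * r\<close> is nonnegative, so that
  \<open>(z + L * j)^2 >= z^2 + (L * j)^2\<close>.\<close>

lemma theta_k_lower_small:
  assumes r: "0 < r" and \<tau>: "0 < \<tau>" "\<tau> \<le> 2 * r\<^sup>2"
  shows "\<exists>c>0. \<forall>x\<in>{pi*r..<2*pi*r}. c \<le> theta_k r \<tau> x"
proof -
  define L where "L = 2*pi*r"
  define K where "K = 1 / sqrt (2 * pi * \<tau>)"
  have L: "0 < L" using r by (simp add: L_def)
  have K: "0 < K" using \<tau> by (simp add: K_def)
  \<comment> \<open>The factors are worst cases over the half period: \<open>L\<close> from Poisson
    summation, the Gaussian head at \<open>z = L / 2\<close>, the slope in \<open>L - x\<close> of a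
    lower bound for \<open>1 - exp (- \<delta>)\<close>, \<open>1/8\<close> from the tail estimate,
    and \<open>2 * r\<close> from \<open>2 * r * sin (x / (2 * r)) <= L - x\<close>.\<close>
  define c where "c = L * (K * exp (- (L\<^sup>2 / (8 * \<tau>))) * (L / \<tau> / (1 + L\<^sup>2 / (2 * \<tau>)))) / 8 * (2 * r)"
  have "0 < 1 + L\<^sup>2 / (2 * \<tau>)" using \<tau> by (simp add: add_pos_nonneg)
  then have c: "0 < c" unfolding c_def using L K r \<tau> by (intro mult_pos_pos divide_pos_pos) auto
  have "c \<le> theta_k r \<tau> x" if x: "x \<in> {pi*r..<2*pi*r}" for x
  proof -
  define z where "z = x - pi * r"
  \<comment> \<open>In pair \<open>j\<close> the farther image is smaller by the factor
    \<open>exp (- \<delta>) ^ (2 * j + 1)\<close>, and \<delta> tends to zero as \<open>x\<close>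
    approaches \<open>L\<close>.\<close>
  define \<delta> where "\<delta> = (L - x) * L / \<tau>"
  define f where "f j = (-1)^j * (pBM \<tau> (pi * r - 2*pi*r * real j) x - pBM \<tau> (pi * r + 2*pi*r * (real j + 1)) x)" for j
  have z: "0 \<le> z" "z < L / 2" using x by (auto simp: z_def L_def)
  have \<delta>: "0 < \<delta>" "\<delta> \<le> L\<^sup>2 / (2 * \<tau>)"
  proof -
    show "0 < \<delta>" using x L \<tau> by (auto simp: \<delta>_def L_def intro!: divide_pos_pos mult_pos_pos)
    have "(L - x) * L \<le> (L / 2) * L" using x L by (intro mult_right_mono) (auto simp: L_def)
    then have "\<delta> \<le> (L / 2) * L / \<tau>" unfolding \<delta>_def using \<tau> by (intro divide_right_mono) auto
    then show "\<delta> \<le> L\<^sup>2 / (2 * \<tau>)" by (simp add: power2_eq_square)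
  qed
  have sf: "summable f"
  proof (rule summable_comparison_test')
    show "summable (\<lambda>j. pBM \<tau> (pi * r - 2*pi*r * real j) x + pBM \<tau> (pi * r + 2*pi*r * (real j + 1)) x)"
      by (intro summable_add summable_pBM r \<tau>)
    fix j show "norm (f j) \<le> pBM \<tau> (pi * r - 2*pi*r * real j) x + pBM \<tau> (pi * r + 2*pi*r * (real j + 1)) x"
      using pBM_nonneg[OF \<tau>(1), of "pi * r - 2*pi*r * real j" x] pBM_nonneg[OF \<tau>(1), of "pi * r + 2*pi*r * (real j + 1)" x]
      by (simp add: f_def abs_mult)
  qed
  have fe: "f j = (-1)^j * (K * exp (- (z + L * j)\<^sup>2 / (2 * \<tau>)) * (1 - exp (- \<delta>) ^ (2 * j + 1)))" for j
  proof -
    have a: "pBM \<tau> (pi * r - 2*pi*r * real j) x = K * exp (- (z + L * j)\<^sup>2 / (2 * \<tau>))"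
    proof -
      have "(pi * r - 2*pi*r * real j - x)\<^sup>2 = (z + L * j)\<^sup>2" by (simp add: z_def L_def power2_eq_square algebra_simps)
      then show ?thesis by (simp add: pBM_def K_def)
    qed
    have b: "pBM \<tau> (pi * r + 2*pi*r * (real j + 1)) x = K * (exp (- (z + L * j)\<^sup>2 / (2 * \<tau>)) * exp (- \<delta>) ^ (2 * j + 1))"
    proof -
      have "(pi * r + 2*pi*r * (real j + 1) - x)\<^sup>2 = (z + L * j)\<^sup>2 + 2 * (2 * j + 1) * ((L - x) * L)"
        by (simp add: z_def L_def power2_eq_square algebra_simps)
      then have "- (pi * r + 2*pi*r * (real j + 1) - x)\<^sup>2 / (2 * \<tau>) = - (z + L * j)\<^sup>2 / (2 * \<tau>) + real (2 * j + 1) * (- \<delta>)"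
        using \<tau> by (simp add: \<delta>_def field_simps)
      then show ?thesis unfolding exp_of_nat_mult[symmetric] exp_add[symmetric] by (simp add: pBM_def K_def)
    qed
    show ?thesis unfolding f_def a b by (simp add: algebra_simps)
  qed
  have q: "0 < exp (- \<delta>)" "exp (- \<delta>) < 1" using \<delta> by auto
  have f0: "f 0 = K * exp (- z\<^sup>2 / (2 * \<tau>)) * (1 - exp (- \<delta>))" by (simp add: fe)
  have "f 0 / 8 \<le> suminf f"
  proof (rule suminf_ge_eighth_head[OF sf])
    fix j :: nat assume "1 \<le> j"
    \<comment> \<open>Bernoulli's inequality in the form \<open>1 - q^k <= k * (1 - q)\<close>
      extracts from every term the factor by which the head vanishes.\<close>
    have "1 + real (2 * j + 1) * (exp (- \<delta>) - 1) \<le> (1 + (exp (- \<delta>) - 1)) ^ (2 * j + 1)"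
      by (rule Bernoulli_inequality) (use q in simp)
    then have B: "1 - exp (- \<delta>) ^ (2 * j + 1) \<le> (2 * real j + 1) * (1 - exp (- \<delta>))"
      by (simp add: algebra_simps)
    have qp: "0 \<le> 1 - exp (- \<delta>) ^ (2 * j + 1)" using q by (simp add: power_le_one del: power_Suc)
    \<comment> \<open>Here the upper bound on \<tau> enters: it makes the Gaussian decay at least
      \<open>exp (- 2)\<close> per index.\<close>
    have "L\<^sup>2 \<ge> 4 * \<tau>"
    proof -
      have "4 * \<tau> \<le> 2 * 2 * 2 * r\<^sup>2" using \<tau> by simp
      also have "\<dots> \<le> pi * pi * 2 * 2 * r\<^sup>2" using pi_ge_two mult_mono[OF pi_ge_two pi_ge_two] by (intro mult_right_mono) auto
      also have "\<dots> = L\<^sup>2" by (simp add: L_def power2_eq_square)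
      finally show ?thesis .
    qed
    then have "4 * \<tau> * real j \<le> L\<^sup>2 * (real j)\<^sup>2" using \<open>1 \<le> j\<close>
      by (intro mult_mono) (auto simp: power2_eq_square)
    moreover have "z\<^sup>2 + L\<^sup>2 * (real j)\<^sup>2 \<le> (z + L * j)\<^sup>2" using z L by (simp add: power2_eq_square algebra_simps)
    ultimately have "z\<^sup>2 + 4 * \<tau> * real j \<le> (z + L * j)\<^sup>2" by linarith
    then have "(z\<^sup>2 + 4 * \<tau> * real j) / (2 * \<tau>) \<le> (z + L * j)\<^sup>2 / (2 * \<tau>)" using \<tau> by (intro divide_right_mono) auto
    moreover have "(z\<^sup>2 + 4 * \<tau> * real j) / (2 * \<tau>) = z\<^sup>2 / (2 * \<tau>) + 2 * real j"
      using \<tau> by (simp add: add_divide_distrib)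
    ultimately have "- (z + L * j)\<^sup>2 / (2 * \<tau>) \<le> - z\<^sup>2 / (2 * \<tau>) + - 2 * real j" by simp
    then have "exp (- (z + L * j)\<^sup>2 / (2 * \<tau>)) \<le> exp (- z\<^sup>2 / (2 * \<tau>)) * exp (- 2 * real j)"
      unfolding exp_add[symmetric] by simp
    also have "\<dots> \<le> exp (- z\<^sup>2 / (2 * \<tau>)) * (1 / 5 ^ j)"
      by (intro mult_left_mono exp_minus_two_power) simp
    finally have "exp (- (z + L * j)\<^sup>2 / (2 * \<tau>)) * (1 - exp (- \<delta>) ^ (2 * j + 1))
        \<le> (exp (- z\<^sup>2 / (2 * \<tau>)) * (1 / 5 ^ j)) * ((2 * real j + 1) * (1 - exp (- \<delta>)))"
      using B qp by (intro mult_mono) auto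
    then have "K * (exp (- (z + L * j)\<^sup>2 / (2 * \<tau>)) * (1 - exp (- \<delta>) ^ (2 * j + 1)))
        \<le> K * ((exp (- z\<^sup>2 / (2 * \<tau>)) * (1 / 5 ^ j)) * ((2 * real j + 1) * (1 - exp (- \<delta>))))"
      using K by (intro mult_left_mono) auto
    moreover have "\<bar>f j\<bar> = K * (exp (- (z + L * j)\<^sup>2 / (2 * \<tau>)) * (1 - exp (- \<delta>) ^ (2 * j + 1)))"
      using K qp by (simp add: fe abs_mult del: power_Suc)
    ultimately show "\<bar>f j\<bar> \<le> f 0 * ((2 * real j + 1) / 5 ^ j)" unfolding f0 by (simp add: mult_ac)
  qed
  moreover have "suminf f = theta_h r \<tau> x / L"
    using poisson_theta_h[OF r \<tau>(1), of x] p_minus_suminf[OF r \<tau>(1), of "pi * r" x] by (simp add: f_def[abs_def] L_def)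
  ultimately have h: "L * (f 0 / 8) \<le> theta_h r \<tau> x" using L by (simp add: field_simps)
  have s: "0 < sin (x / (2*r))" using x r by (intro half_angle_sin_pos) (auto simp: less_le_trans[of 0 "pi*r"])
  have "sin (x / (2*r)) = sin ((L - x) / (2*r))"
  proof -
    have "(L - x) / (2*r) = pi - x / (2*r)" using r by (simp add: L_def field_simps)
    then show ?thesis by simp
  qed
  also have "\<dots> \<le> (L - x) / (2*r)" using x r by (intro sin_x_le_x) (auto simp: L_def)
  finally have sle: "sin (x / (2*r)) * (2 * r) \<le> L - x" using r by (simp add: field_simps)
  have "exp (- \<delta>) \<le> 1 / (1 + \<delta>)"
    using exp_ge_add_one_self[of \<delta>] \<delta> by (simp add: exp_minus field_simps)
  then have "1 - 1 / (1 + \<delta>) \<le> 1 - exp (- \<delta>)" by simp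
  moreover have "\<delta> / (1 + L\<^sup>2 / (2 * \<tau>)) \<le> \<delta> / (1 + \<delta>)" using \<delta> by (intro divide_left_mono) auto
  moreover have "1 - 1 / (1 + \<delta>) = \<delta> / (1 + \<delta>)" using \<delta> by (simp add: field_simps)
  ultimately have e1: "\<delta> / (1 + L\<^sup>2 / (2 * \<tau>)) \<le> 1 - exp (- \<delta>)" by linarith
  have "z\<^sup>2 \<le> (L/2)\<^sup>2" using z by (intro power_mono) auto
  then have "z\<^sup>2 / (2 * \<tau>) \<le> (L/2)\<^sup>2 / (2 * \<tau>)" using \<tau> by (intro divide_right_mono) auto
  then have e2: "exp (- (L\<^sup>2 / (8 * \<tau>))) \<le> exp (- z\<^sup>2 / (2 * \<tau>))" by (simp add: power_divide)
  have f0le: "K * exp (- (L\<^sup>2 / (8 * \<tau>))) * (\<delta> / (1 + L\<^sup>2 / (2 * \<tau>))) \<le> f 0"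
    unfolding f0 using K e1 e2 \<delta> by (intro mult_mono) auto
  have "c * sin (x / (2*r)) = L * (K * exp (- (L\<^sup>2 / (8 * \<tau>))) * (L / \<tau> / (1 + L\<^sup>2 / (2 * \<tau>)))) / 8 * (sin (x / (2*r)) * (2 * r))"
    by (simp add: c_def)
  also have "\<dots> \<le> L * (K * exp (- (L\<^sup>2 / (8 * \<tau>))) * (L / \<tau> / (1 + L\<^sup>2 / (2 * \<tau>)))) / 8 * (L - x)"
    using L K \<tau> by (intro mult_left_mono[OF sle]) auto
  also have "\<dots> = L * (K * exp (- (L\<^sup>2 / (8 * \<tau>))) * (\<delta> / (1 + L\<^sup>2 / (2 * \<tau>)))) / 8"
    by (simp add: \<delta>_def mult_ac)
  also have "\<dots> \<le> L * f 0 / 8" using f0le L by (intro divide_right_mono mult_left_mono) auto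
  also have "\<dots> \<le> theta_h r \<tau> x" using h by simp
  finally have "c * sin (x / (2*r)) \<le> theta_k r \<tau> x * sin (x / (2*r))" by (simp add: theta_h_def mult.commute)
  then show "c \<le> theta_k r \<tau> x" using s by simp
  qed
  with c show ?thesis by blast
qed

text \<open>Evenness and periodicity move \<open>x\<close> to the closed right half period. Its end
  \<open>2 * pi * r\<close>, where \<open>theta_h\<close> vanishes, is reached only through the
  closure, which is why the small-time bound is uniform and not merely pointwise.\<close>

lemma theta_k_pos:
  assumes r: "0 < r" and \<tau>: "0 < \<tau>"
  shows "0 < theta_k r \<tau> x"
proof (cases "2 * r\<^sup>2 \<le> \<tau>")
  case True
  then show ?thesis by (rule theta_k_pos_large[OF r])
next
  case False
  then have \<tau>2: "\<tau> \<le> 2 * r\<^sup>2" by simp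
  obtain c where c: "0 < c" "\<And>x. x \<in> {pi*r..<2*pi*r} \<Longrightarrow> c \<le> theta_k r \<tau> x"
    using theta_k_lower_small[OF r \<tau> \<tau>2] by blast
  have ge: "c \<le> theta_k r \<tau> x" if "x \<in> closure {pi*r..<2*pi*r}" for x
    using theta_k_continuous_x(1)[OF r \<tau>] that c(2) by (rule continuous_ge_on_closure)
  define y where "y = r * arccos (cos (x / r))"
  have y: "0 \<le> y" "y \<le> pi * r" using r arccos_bounded[of "cos (x / r)"] by (auto simp: y_def mult.commute)
  have "theta_k r \<tau> x = theta_k r \<tau> y"
    unfolding y_def
    by (rule even_periodic_cos[OF r]) (intro even_periodicI_continuous r theta_k_continuous_x \<tau> theta_k_symmetry)
  also have "\<dots> = theta_k r \<tau> (2 * pi * r - y)"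
    using theta_k_symmetry[OF r, of \<tau> "- y"] theta_k_symmetry[OF r, of \<tau> y] by simp
  finally have "theta_k r \<tau> x = theta_k r \<tau> (2 * pi * r - y)" .
  moreover have "2 * pi * r - y \<in> closure {pi*r..<2*pi*r}"
    using y r by simp
  ultimately show ?thesis using ge c(1) by fastforce
qed

section \<open>The drift and the functions that turn into martingales\<close>

text \<open>The logarithmic derivative of \<open>theta_h\<close> in \<open>x\<close>, with its
  cotangent singularity separated from a smooth quotient.\<close>

definition theta_drift :: "real \<Rightarrow> real \<Rightarrow> real \<Rightarrow> real" where
  "theta_drift r \<tau> x = cos (x / (2*r)) / sin (x / (2*r)) / (2*r) + theta_k_x r \<tau> x / theta_k r \<tau> x"

lemma deriv_shift_periodic:
  fixes f :: "real \<Rightarrow> real"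
  assumes "\<And>x. f (x + L) = f x" "\<And>x. (f has_real_derivative f' x) (at x)"
  shows "f' (x + L) = f' x"
proof -
  have "((\<lambda>x. f (x + L)) has_real_derivative f' (x + L)) (at x)"
    using assms(2)[of "x + L"] by (simp add: DERIV_shift)
  then show ?thesis using assms by (auto intro: DERIV_unique)
qed

text \<open>Reduction modulo the period may flip the sign of \<open>sin (x / (2 * r))\<close>, but
  its square and \<open>theta_drift\<close> are periodic. On the open period \<open>theta_h\<close>
  is positive and the logarithm can be differentiated.\<close>

lemma U1'_theta_drift:
  assumes r: "0 < r" and t: "t < tstar" and x: "sin (x / (2*r)) \<noteq> 0"
  shows "U1' r tstar t x = - theta_drift r (tstar - t) x"
proof -
  define \<tau> where "\<tau> = tstar - t"
  have \<tau>: "0 < \<tau>" using t by (simp add: \<tau>_def)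
  define L where "L = 2*pi*r"
  have L: "0 < L" using r by (simp add: L_def)
  have ang: "(x + L) / (2 * r) = x / (2 * r) + pi" for x using r by (simp add: field_simps L_def)
  define y where "y = x rmod L"
  have y: "y = x - of_int \<lfloor>x / L\<rfloor> * L" using L by (simp add: y_def rmod_def)
  have sin: "(sin (y / (2*r)))\<^sup>2 = (sin (x / (2*r)))\<^sup>2"
  proof -
    interpret periodic_fun_simple "\<lambda>x. (sin (x / (2*r)))\<^sup>2" L by unfold_locales (simp add: ang)
    show ?thesis unfolding y by (rule minus_of_int)
  qed
  have drift: "theta_drift r \<tau> y = theta_drift r \<tau> x"
  proof -
    have "theta_k_x r \<tau> (x + L) = theta_k_x r \<tau> x" for x
      by (rule deriv_shift_periodic[OF _ theta_k_deriv(1)[OF r \<tau>]]) (simp add: L_def theta_k_symmetry[OF r])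
    then interpret periodic_fun_simple "theta_drift r \<tau>" L
      using theta_k_symmetry(1)[OF r, folded L_def] by unfold_locales (simp add: theta_drift_def ang flip: L_def)
    show ?thesis unfolding y by (rule minus_of_int)
  qed
  have "y \<noteq> 0" using sin x by auto
  moreover have "0 \<le> y" "y < L" using L rmod_nonneg[of L x] rmod_less[of L x] by (auto simp: y_def)
  ultimately have sy: "0 < sin (y / (2*r))" by (intro half_angle_sin_pos r) (auto simp: L_def)
  have hy: "0 < theta_h r \<tau> y" using sy theta_k_pos[OF r \<tau>] by (simp add: theta_h_def)
  have "(theta_h r \<tau> has_real_derivative cos (y / (2*r)) / (2*r) * theta_k r \<tau> y + sin (y / (2*r)) * theta_k_x r \<tau> y) (at y)"
    unfolding theta_h_def using r by (auto intro!: derivative_eq_intros theta_k_deriv[OF r \<tau>])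
  from DERIV_minus[OF DERIV_chain2[OF DERIV_ln_divide[OF hy] this]]
  have "((\<lambda>x. - ln (theta_h r \<tau> x)) has_real_derivative
     - (1 / theta_h r \<tau> y * (cos (y / (2*r)) / (2*r) * theta_k r \<tau> y + sin (y / (2*r)) * theta_k_x r \<tau> y))) (at y)" .
  moreover have "1 / theta_h r \<tau> y * (cos (y / (2*r)) / (2*r) * theta_k r \<tau> y + sin (y / (2*r)) * theta_k_x r \<tau> y) = theta_drift r \<tau> y"
    using sy theta_k_pos[OF r \<tau>, of y] r by (simp add: theta_h_def theta_drift_def field_simps)
  moreover have "U1 r tstar t = (\<lambda>x. - ln (theta_h r \<tau> x))"
    by (rule ext) (simp only: U1_def vartheta1_theta_h[OF r t] Re_complex_of_real \<tau>_def)
  ultimately have "deriv (U1 r tstar t) y = - theta_drift r \<tau> y"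
    by (simp add: DERIV_imp_deriv)
  then show ?thesis by (simp add: U1'_def drift flip: L_def y_def \<tau>_def)
qed

lemma bounded_periodic_strip:
  fixes f :: "real \<Rightarrow> real \<Rightarrow> real"
  assumes L: "0 < L" and c: "continuous_on ({a..b} \<times> UNIV) (\<lambda>(s, x). f s x)"
    and per: "\<And>s x. s \<in> {a..b} \<Longrightarrow> f s (x + L) = f s x"
  shows "\<exists>K. \<forall>s\<in>{a..b}. \<forall>x. \<bar>f s x\<bar> \<le> K"
proof -
  have "bounded ((\<lambda>(s, x). f s x) ` ({a..b} \<times> {0..L}))"
    by (intro compact_imp_bounded compact_continuous_image continuous_on_subset[OF c] compact_Times) auto
  then obtain K where "\<forall>y\<in>(\<lambda>(s, x). f s x) ` ({a..b} \<times> {0..L}). norm y \<le> K" unfolding bounded_iff by blast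
  then have K: "\<bar>f s x\<bar> \<le> K" if "s \<in> {a..b}" "x \<in> {0..L}" for s x using that by force
  have "\<bar>f s x\<bar> \<le> K" if s: "s \<in> {a..b}" for s x
  proof -
    interpret periodic_fun_simple "f s" L by unfold_locales (rule per[OF s])
    have "f s x = f s (x rmod L)" using minus_of_int[of x "\<lfloor>x / L\<rfloor>"] L by (simp add: rmod_def mult_ac)
    moreover have "x rmod L \<in> {0..L}" using L rmod_nonneg[of L x] rmod_le[of L x] by auto
    ultimately show ?thesis using K[OF s] by simp
  qed
  then show ?thesis by blast
qed

text \<open>Global bounds by one constant \<open>K\<close> take the place of localisation: every
  expectation below is finite without stopping times. The time derivative is taken within the
  interval, hence one-sided at its ends.\<close>

definition ito_function ::
  "real \<Rightarrow> real \<Rightarrow> (real \<Rightarrow> real \<Rightarrow> real) \<Rightarrow> (real \<Rightarrow> real \<Rightarrow> real) \<Rightarrow> (real \<Rightarrow> real \<Rightarrow> real) \<Rightarrow> (real \<Rightarrow> real \<Rightarrow> real) \<Rightarrow> real \<Rightarrow> bool" where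
  "ito_function a b f ft fx fxx K \<longleftrightarrow>
     (\<forall>s\<in>{a..b}. \<forall>x. ((\<lambda>s. f s x) has_real_derivative ft s x) (at s within {a..b}) \<and>
        (f s has_real_derivative fx s x) (at x) \<and> (fx s has_real_derivative fxx s x) (at x) \<and>
        \<bar>f s x\<bar> \<le> K \<and> \<bar>ft s x\<bar> \<le> K \<and> \<bar>fx s x\<bar> \<le> K \<and> \<bar>fxx s x\<bar> \<le> K) \<and>
     continuous_on ({a..b} \<times> UNIV) (\<lambda>(s, x). ft s x) \<and>
     continuous_on ({a..b} \<times> UNIV) (\<lambda>(s, x). fx s x) \<and>
     continuous_on ({a..b} \<times> UNIV) (\<lambda>(s, x). fxx s x)"

text \<open>\<open>f\<close> is \<open>exp (dirichlet_rate r m * s)\<close> times an eigenfunction,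
  divided by \<open>theta_h\<close>, with the common factor \<open>sin (x / (2 * r))\<close>
  cancelled. A ratio of two solutions of the backward heat equation solves the equation with the
  logarithmic derivative of the denominator as drift. The bounds come from periodicity and
  compactness.\<close>

lemma theta_ito_function:
  fixes r a b tstar :: real and m :: nat
  assumes r: "0 < r" and ab: "a \<le> b" "b < tstar"
  defines "f \<equiv> \<lambda>s x. exp (dirichlet_rate r m * s) * (dirichlet_kernel m (x / r) / theta_k r (tstar - s) x)"
  obtains ft fx fxx K where "ito_function a b f ft fx fxx K"
    and "\<And>s x. s \<in> {a..b} \<Longrightarrow> sin (x / (2*r)) \<noteq> 0 \<Longrightarrow> ft s x + fxx s x / 2 + theta_drift r (tstar - s) x * fx s x = 0"
proof -
  define L where "L = 2*pi*r"
  have L: "0 < L" using r by (simp add: L_def)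
  define \<mu> where "\<mu> = dirichlet_rate r m"
  define k k1 k2 kt where "k s = theta_k r (tstar - s)" and "k1 s = theta_k_x r (tstar - s)"
    and "k2 s = theta_k_xx r (tstar - s)" and "kt s = theta_k_t r (tstar - s)" for s
  define d0 d1 d2 where "d0 x = dirichlet_kernel m (x / r)" and "d1 x = dirichlet_kernel' m (x / r) / r"
    and "d2 x = dirichlet_kernel'' m (x / r) / r\<^sup>2" for x
  define E where "E s = exp (\<mu> * s)" for s
  define fx where "fx s x = E s * ((d1 x * k s x - d0 x * k1 s x) / (k s x * k s x))" for s x
  define fxx where "fxx s x = E s * (((d2 x * k s x - d0 x * k2 s x) * (k s x * k s x) - (d1 x * k s x - d0 x * k1 s x) * (2 * k s x * k1 s x))
     / ((k s x * k s x) * (k s x * k s x)))" for s x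
  define ft where "ft s x = \<mu> * E s * (d0 x / k s x) + E s * (d0 x * kt s x / (k s x * k s x))" for s x
  have f: "f s x = E s * (d0 x / k s x)" for s x by (simp add: f_def E_def d0_def k_def \<mu>_def)
  have \<tau>: "0 < tstar - s" if "s \<in> {a..b}" for s using that ab by simp
  have k0: "k s x \<noteq> 0" if "s \<in> {a..b}" for s x using theta_k_pos[OF r \<tau>[OF that]] by (simp add: k_def less_imp_neq[THEN not_sym])
  have dk: "(k s has_real_derivative k1 s x) (at x)" "(k1 s has_real_derivative k2 s x) (at x)"
    "((\<lambda>s. k s x) has_real_derivative - kt s x) (at s)" if "s \<in> {a..b}" for s x
  proof -
    show "(k s has_real_derivative k1 s x) (at x)" "(k1 s has_real_derivative k2 s x) (at x)"
      unfolding k_def k1_def k2_def by (rule theta_k_deriv[OF r \<tau>[OF that]])+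
    have "((\<lambda>s. tstar - s) has_real_derivative -1) (at s)" by (auto intro!: derivative_eq_intros)
    from DERIV_chain2[OF theta_k_deriv(3)[OF r \<tau>[OF that], of x] this]
    show "((\<lambda>s. k s x) has_real_derivative - kt s x) (at s)" by (simp add: k_def kt_def)
  qed
  have dd: "(d0 has_real_derivative d1 x) (at x)" "(d1 has_real_derivative d2 x) (at x)" for x
  proof -
    have q: "((\<lambda>x. x / r) has_real_derivative 1 / r) (at x)" using r by (auto intro!: derivative_eq_intros)
    show "(d0 has_real_derivative d1 x) (at x)"
      using DERIV_chain2[OF dirichlet_kernel_deriv(1) q] by (simp add: d0_def[abs_def] d1_def)
    show "(d1 has_real_derivative d2 x) (at x)"
      using DERIV_cdivide[where c = r, OF DERIV_chain2[OF dirichlet_kernel_deriv(2) q]]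
      by (simp add: d1_def[abs_def] d2_def power2_eq_square)
  qed
  have D1: "(f s has_real_derivative fx s x) (at x)" if "s \<in> {a..b}" for s x
    unfolding f fx_def by (intro DERIV_cmult DERIV_divide dd dk that k0)
  have D2: "(fx s has_real_derivative fxx s x) (at x)" if s: "s \<in> {a..b}" for s x
  proof -
    have n: "((\<lambda>x. d1 x * k s x - d0 x * k1 s x) has_real_derivative d2 x * k s x - d0 x * k2 s x) (at x)"
      by (auto intro!: derivative_eq_intros dd dk[OF s])
    have "((\<lambda>x. k s x * k s x) has_real_derivative 2 * k s x * k1 s x) (at x)"
      by (auto intro!: derivative_eq_intros dk[OF s])
    from DERIV_cmult[OF DERIV_divide[OF n this], of "E s"] show ?thesis
      unfolding fx_def fxx_def using k0[OF s] by simp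
  qed
  have Dt: "((\<lambda>s. f s x) has_real_derivative ft s x) (at s)" if s: "s \<in> {a..b}" for s x
    unfolding f ft_def E_def using k0[OF s, of x]
    by (auto intro!: derivative_eq_intros dk[OF s] simp: field_simps)
  have ck: "continuous_on ({a..b} \<times> UNIV) (\<lambda>(s, x). g (tstar - s) x)"
    if "continuous_on ({0<..} \<times> UNIV) (\<lambda>(\<tau>, x). g \<tau> x)" for g :: "real \<Rightarrow> real \<Rightarrow> real"
  proof -
    have "continuous_on ({a..b} \<times> UNIV) (\<lambda>z. (\<lambda>(\<tau>, x). g \<tau> x) (tstar - fst z, snd z))"
      by (rule continuous_on_compose2[OF that]) (use ab in \<open>auto intro!: continuous_intros\<close>)
    then show ?thesis by (simp add: case_prod_beta')
  qed
  have cd: "continuous_on A (\<lambda>z. g (snd z))" if "continuous_on UNIV g" for g :: "real \<Rightarrow> real" and A :: "(real \<times> real) set"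
    by (rule continuous_on_compose2[OF that]) (auto intro!: continuous_intros)
  note ckk = ck[OF theta_k_continuous(1)[OF r], folded k_def] ck[OF theta_k_continuous(2)[OF r], folded k1_def]
    ck[OF theta_k_continuous(3)[OF r], folded k2_def] ck[OF theta_k_continuous(4)[OF r], folded kt_def]
  have d012: "continuous_on UNIV d0" "continuous_on UNIV d1" "continuous_on UNIV d2"
    using dirichlet_kernel_continuous[OF r, of m] r unfolding d0_def d1_def d2_def by (auto intro!: continuous_intros)
  have C: "continuous_on ({a..b} \<times> UNIV) (\<lambda>(s, x). f s x)" "continuous_on ({a..b} \<times> UNIV) (\<lambda>(s, x). ft s x)"
    "continuous_on ({a..b} \<times> UNIV) (\<lambda>(s, x). fx s x)" "continuous_on ({a..b} \<times> UNIV) (\<lambda>(s, x). fxx s x)"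
    unfolding f fx_def ft_def fxx_def E_def case_prod_beta'
    by (intro continuous_intros ckk[unfolded case_prod_beta'] cd d012; use k0 in auto)+
  have pf: "f s (x + L) = f s x" for s x
  proof -
    have "(x + L) / r = x / r + 2 * pi" using r by (simp add: L_def field_simps)
    then show ?thesis using theta_k_symmetry(1)[OF r] by (simp add: f_def dirichlet_kernel_symmetry L_def)
  qed
  have px: "fx s (x + L) = fx s x" if "s \<in> {a..b}" for s x
    by (rule deriv_shift_periodic[of "f s"]) (use pf D1 that in auto)
  have pxx: "fxx s (x + L) = fxx s x" if "s \<in> {a..b}" for s x
    by (rule deriv_shift_periodic[of "fx s"]) (use px D2 that in auto)
  have pt: "ft s (x + L) = ft s x" if "s \<in> {a..b}" for s x
    using Dt[OF that, of "x + L"] Dt[OF that, of x] unfolding pf by (rule DERIV_unique)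
  obtain K0 K1 K2 K3 where K: "\<forall>s\<in>{a..b}. \<forall>x. \<bar>f s x\<bar> \<le> K0" "\<forall>s\<in>{a..b}. \<forall>x. \<bar>ft s x\<bar> \<le> K1"
    "\<forall>s\<in>{a..b}. \<forall>x. \<bar>fx s x\<bar> \<le> K2" "\<forall>s\<in>{a..b}. \<forall>x. \<bar>fxx s x\<bar> \<le> K3"
    using bounded_periodic_strip[OF L C(1) pf] bounded_periodic_strip[OF L C(2) pt]
      bounded_periodic_strip[OF L C(3) px] bounded_periodic_strip[OF L C(4) pxx] by metis
  have "ito_function a b f ft fx fxx (max (max K0 K1) (max K2 K3))"
    unfolding ito_function_def using C(2-4) D1 D2 Dt[THEN has_field_derivative_at_within] K by (auto simp: le_max_iff_disj)
  moreover have "ft s x + fxx s x / 2 + theta_drift r (tstar - s) x * fx s x = 0"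
    if s: "s \<in> {a..b}" and sx: "sin (x / (2*r)) \<noteq> 0" for s x
  proof -
    \<comment> \<open>Dividing both heat identities by the sine leaves \<open>w\<close> as the
      coefficient of the first derivatives; the zero-order term with \<open>e\<close> cancels in the
      quotient.\<close>
    define w where "w = cos (x / (2*r)) / sin (x / (2*r)) / r"
    define e where "e = 1 / (4 * r\<^sup>2)"
    define K K1 KT where "K = k s x" and "K1 = k1 s x" and "KT = kt s x"
    have wc: "cos (x / (2*r)) / r = sin (x / (2*r)) * w" using sx by (simp add: w_def)
    have "sin (x / (2*r)) * d2 x + sin (x / (2*r)) * w * d1 x - sin (x / (2*r)) * d0 x * e = - 2 * \<mu> * (sin (x / (2*r)) * d0 x)"
      using dirichlet_kernel_heat[OF r, of x m] unfolding wc by (simp add: d0_def d1_def d2_def \<mu>_def e_def)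
    then have "sin (x / (2*r)) * (d2 x + w * d1 x - d0 x * e + 2 * \<mu> * d0 x) = 0" by (simp add: algebra_simps)
    then have "d2 x + w * d1 x - d0 x * e + 2 * \<mu> * d0 x = 0" using sx by (simp only: mult_eq_0_iff) simp
    then have d2: "d2 x = d0 x * e - 2 * \<mu> * d0 x - w * d1 x" by (simp add: algebra_simps)
    have "sin (x / (2*r)) * k2 s x + sin (x / (2*r)) * w * k1 s x - sin (x / (2*r)) * k s x * e = 2 * sin (x / (2*r)) * kt s x"
      using theta_k_heat[OF r \<tau>[OF s], of x] unfolding wc by (simp add: k_def k1_def k2_def kt_def e_def)
    then have "sin (x / (2*r)) * (k2 s x + w * k1 s x - k s x * e - 2 * kt s x) = 0" by (simp add: algebra_simps)
    then have "k2 s x + w * k1 s x - k s x * e - 2 * kt s x = 0" using sx by (simp only: mult_eq_0_iff) simp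
    then have k2: "k2 s x = K * e + 2 * KT - w * K1" by (simp add: algebra_simps K_def K1_def KT_def)
    have dr: "theta_drift r (tstar - s) x = w / 2 + K1 / K" by (simp add: theta_drift_def w_def K_def K1_def k_def k1_def)
    have K0: "K \<noteq> 0" using k0[OF s] by (simp add: K_def)
    define q0 q1 q2 q3 q4 where "q0 = d0 x / K" and "q1 = (d1 x * K - d0 x * K1) / (K * K)"
      and "q2 = ((d2 x * K - d0 x * k2 s x) * (K * K) - (d1 x * K - d0 x * K1) * (2 * K * K1)) / ((K * K) * (K * K))"
      and "q3 = d0 x * KT / (K * K)" and "q4 = K1 / K"
    have "\<mu> * q0 + q3 + q2 / 2 + (w / 2 + q4) * q1 = 0"
      unfolding q0_def q1_def q2_def q3_def q4_def d2 k2 using K0 by (simp add: field_simps)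
    then have "E s * (\<mu> * q0 + q3 + q2 / 2 + (w / 2 + q4) * q1) = 0" by simp
    moreover have "ft s x = \<mu> * E s * q0 + E s * q3" "fx s x = E s * q1" "fxx s x = E s * q2"
      by (simp_all add: ft_def fx_def fxx_def q0_def q1_def q2_def q3_def K_def K1_def KT_def)
    ultimately show ?thesis unfolding dr q4_def[symmetric] by (simp add: algebra_simps)
  qed
  ultimately show ?thesis using that by blast
qed

section \<open>Brownian increments\<close>

text \<open>Boundedness in L2 implies uniform integrability: Fatou carries the bound to the limit,
  and almost sure convergence improves to convergence in L1, hence of moments against bounded
  \<open>Z\<close>.\<close>

lemma (in prob_space) L2_bounded_limit:
  fixes f :: "nat \<Rightarrow> 'a \<Rightarrow> real"
  assumes f[measurable]: "\<And>n. f n \<in> borel_measurable M" and g[measurable]: "g \<in> borel_measurable M"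
    and sq: "\<And>n. integrable M (\<lambda>\<omega>. (f n \<omega>)\<^sup>2)" and C: "\<And>n. expectation (\<lambda>\<omega>. (f n \<omega>)\<^sup>2) \<le> C"
    and lim: "AE \<omega> in M. (\<lambda>n. f n \<omega>) \<longlonglongrightarrow> g \<omega>"
  shows "integrable M (\<lambda>\<omega>. (g \<omega>)\<^sup>2)" and "expectation (\<lambda>\<omega>. (g \<omega>)\<^sup>2) \<le> C"
    and "Z \<in> borel_measurable M \<Longrightarrow> (\<And>\<omega>. \<bar>Z \<omega>\<bar> \<le> c) \<Longrightarrow>
      (\<lambda>n. expectation (\<lambda>\<omega>. Z \<omega> * f n \<omega>)) \<longlonglongrightarrow> expectation (\<lambda>\<omega>. Z \<omega> * g \<omega>)"
proof -
  have "0 \<le> expectation (\<lambda>\<omega>. (f 0 \<omega>)\<^sup>2)" by (rule integral_nonneg_AE) simp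
  then have C0: "0 \<le> C" using C[of 0] by linarith
  have "(\<integral>\<^sup>+\<omega>. ennreal ((g \<omega>)\<^sup>2) \<partial>M) = (\<integral>\<^sup>+\<omega>. liminf (\<lambda>n. ennreal ((f n \<omega>)\<^sup>2)) \<partial>M)"
  proof (rule nn_integral_cong_AE)
    show "AE \<omega> in M. ennreal ((g \<omega>)\<^sup>2) = liminf (\<lambda>n. ennreal ((f n \<omega>)\<^sup>2))"
      using lim
    proof eventually_elim
      case (elim \<omega>)
      then have "(\<lambda>n. ennreal ((f n \<omega>)\<^sup>2)) \<longlonglongrightarrow> ennreal ((g \<omega>)\<^sup>2)"
        by (intro tendsto_ennrealI tendsto_power)
      then show ?case by (metis lim_imp_Liminf trivial_limit_sequentially)
    qed
  qed
  also have "\<dots> \<le> liminf (\<lambda>n. \<integral>\<^sup>+\<omega>. ennreal ((f n \<omega>)\<^sup>2) \<partial>M)" by (rule nn_integral_liminf) measurable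
  also have "\<dots> \<le> ennreal C"
  proof (rule Liminf_le)
    show "\<forall>\<^sub>F n in sequentially. (\<integral>\<^sup>+\<omega>. ennreal ((f n \<omega>)\<^sup>2) \<partial>M) \<le> ennreal C"
      using C by (intro always_eventually allI) (simp add: nn_integral_eq_integral[OF sq] ennreal_leI)
  qed simp
  finally have nn: "(\<integral>\<^sup>+\<omega>. ennreal ((g \<omega>)\<^sup>2) \<partial>M) \<le> ennreal C" .
  then have "(\<integral>\<^sup>+\<omega>. ennreal ((g \<omega>)\<^sup>2) \<partial>M) < \<infinity>" by (simp add: order_le_less_trans[OF _ ennreal_less_top])
  then show gi: "integrable M (\<lambda>\<omega>. (g \<omega>)\<^sup>2)" by (intro integrableI_nonneg) auto
  show gC: "expectation (\<lambda>\<omega>. (g \<omega>)\<^sup>2) \<le> C"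
    using nn C0 by (simp add: nn_integral_eq_integral[OF gi])
  have fi: "integrable M (f n)" for n by (rule square_integrable_imp_integrable[OF f sq])
  have gi1: "integrable M g" by (rule square_integrable_imp_integrable[OF g gi])
  define d where "d n \<omega> = \<bar>f n \<omega> - g \<omega>\<bar>" for n \<omega>
  have [measurable]: "d n \<in> borel_measurable M" for n unfolding d_def by measurable
  have di: "integrable M (d n)" for n unfolding d_def using fi gi1 by auto
  have dsq: "(d n \<omega>)\<^sup>2 \<le> 2 * (f n \<omega>)\<^sup>2 + 2 * (g \<omega>)\<^sup>2" for n \<omega>
    using sum_squares_ge_zero[of "f n \<omega> + g \<omega>" 0] by (simp add: d_def power2_eq_square algebra_simps)
  have dsi: "integrable M (\<lambda>\<omega>. (d n \<omega>)\<^sup>2)" for n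
    by (rule Bochner_Integration.integrable_bound[of _ "\<lambda>\<omega>. 2 * (f n \<omega>)\<^sup>2 + 2 * (g \<omega>)\<^sup>2"])
       (use sq gi dsq in auto)
  have dsC: "expectation (\<lambda>\<omega>. (d n \<omega>)\<^sup>2) \<le> 4 * C" for n
  proof -
    have "expectation (\<lambda>\<omega>. (d n \<omega>)\<^sup>2) \<le> expectation (\<lambda>\<omega>. 2 * (f n \<omega>)\<^sup>2 + 2 * (g \<omega>)\<^sup>2)"
      using dsi sq gi dsq by (intro integral_mono) auto
    also have "\<dots> \<le> 4 * C" using sq gi C[of n] gC by simp
    finally show ?thesis .
  qed
  have dlim: "(\<lambda>n. expectation (d n)) \<longlonglongrightarrow> 0"
  proof (rule LIMSEQ_I)
    fix e :: real assume e: "0 < e"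
    \<comment> \<open>The level for the truncation \<open>d <= min d N + d^2 / N\<close>: the first
      part tends to zero by dominated convergence, and with this \<open>N\<close> the second has
      mean at most \<open>e / 2\<close>.\<close>
    define N where "N = 8 * (C + 1) / e"
    have N: "0 < N" using e C0 by (simp add: N_def)
    have "(\<lambda>n. expectation (\<lambda>\<omega>. min (d n \<omega>) N)) \<longlonglongrightarrow> expectation (\<lambda>\<omega>. 0)"
    proof (rule integral_dominated_convergence[where w = "\<lambda>_. N"])
      show "AE \<omega> in M. (\<lambda>n. min (d n \<omega>) N) \<longlonglongrightarrow> 0"
        using lim
      proof eventually_elim
        case (elim \<omega>)
        then have "(\<lambda>n. min (d n \<omega>) N) \<longlonglongrightarrow> min \<bar>g \<omega> - g \<omega>\<bar> N" unfolding d_def by (intro tendsto_intros)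
        then show ?case using N by simp
      qed
      show "AE \<omega> in M. norm (min (d n \<omega>) N) \<le> N" for n using N by (auto simp: d_def)
    qed auto
    then have "\<forall>\<^sub>F n in sequentially. expectation (\<lambda>\<omega>. min (d n \<omega>) N) < e / 2"
      using e by (intro order_tendstoD) auto
    then obtain n0 where n0: "\<And>n. n \<ge> n0 \<Longrightarrow> expectation (\<lambda>\<omega>. min (d n \<omega>) N) < e / 2"
      by (auto simp: eventually_sequentially)
    have "norm (expectation (d n) - 0) < e" if "n \<ge> n0" for n
    proof -
      have mi: "integrable M (\<lambda>\<omega>. min (d n \<omega>) N)" by (rule integrable_const_bound[of _ N]) (use N in \<open>auto simp: d_def\<close>)
      have "d n \<omega> \<le> min (d n \<omega>) N + (d n \<omega>)\<^sup>2 / N" for \<omega>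
      proof (cases "d n \<omega> \<le> N")
        case False
        then have "d n \<omega> * N \<le> (d n \<omega>)\<^sup>2" using N by (simp add: power2_eq_square)
        then have "d n \<omega> \<le> (d n \<omega>)\<^sup>2 / N" using N by (simp add: pos_le_divide_eq)
        then show ?thesis using False N by simp
      qed (use N in simp)
      then have "expectation (d n) \<le> expectation (\<lambda>\<omega>. min (d n \<omega>) N + (d n \<omega>)\<^sup>2 / N)"
        using di dsi mi by (intro integral_mono) auto
      also have "\<dots> = expectation (\<lambda>\<omega>. min (d n \<omega>) N) + expectation (\<lambda>\<omega>. (d n \<omega>)\<^sup>2) / N"
        using dsi mi by simp
      also have "\<dots> < e / 2 + 4 * C / N" using n0[OF that] dsC[of n] N by (intro add_less_le_mono divide_right_mono) auto
      also have "\<dots> \<le> e" using e C0 by (simp add: N_def field_simps)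
      finally have "expectation (d n) < e" .
      moreover have "0 \<le> expectation (d n)" by (rule integral_nonneg_AE) (simp add: d_def)
      ultimately show ?thesis by simp
    qed
    then show "\<exists>n0. \<forall>n\<ge>n0. norm (expectation (d n) - 0) < e" by blast
  qed
  assume Z[measurable]: "Z \<in> borel_measurable M" and Zc: "\<And>\<omega>. \<bar>Z \<omega>\<bar> \<le> c"
  have Zi: "integrable M (\<lambda>\<omega>. Z \<omega> * h \<omega>)" if h: "integrable M h" for h :: "'a \<Rightarrow> real"
  proof (rule Bochner_Integration.integrable_bound[of _ "\<lambda>\<omega>. c * \<bar>h \<omega>\<bar>"])
    show "AE \<omega> in M. norm (Z \<omega> * h \<omega>) \<le> norm (c * \<bar>h \<omega>\<bar>)"
      using mult_right_mono[OF order_trans[OF Zc abs_ge_self] abs_ge_zero] by (intro AE_I2) (simp add: abs_mult)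
  qed (use h in auto)
  show "(\<lambda>n. expectation (\<lambda>\<omega>. Z \<omega> * f n \<omega>)) \<longlonglongrightarrow> expectation (\<lambda>\<omega>. Z \<omega> * g \<omega>)"
  proof (rule Lim_transform[OF tendsto_const], rule Lim_null_comparison)
    show "(\<lambda>n. c * expectation (d n)) \<longlonglongrightarrow> 0" using tendsto_mult_left[OF dlim, of c] by simp
    have "\<bar>expectation (\<lambda>\<omega>. Z \<omega> * f n \<omega>) - expectation (\<lambda>\<omega>. Z \<omega> * g \<omega>)\<bar> \<le> c * expectation (d n)" for n
    proof -
      have "expectation (\<lambda>\<omega>. Z \<omega> * f n \<omega>) - expectation (\<lambda>\<omega>. Z \<omega> * g \<omega>) = expectation (\<lambda>\<omega>. Z \<omega> * (f n \<omega> - g \<omega>))"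
        using Zi[OF fi] Zi[OF gi1] by (simp add: right_diff_distrib)
      also have "\<bar>\<dots>\<bar> \<le> expectation (\<lambda>\<omega>. \<bar>Z \<omega> * (f n \<omega> - g \<omega>)\<bar>)" by (rule integral_abs_bound)
      also have "\<dots> \<le> expectation (\<lambda>\<omega>. c * d n \<omega>)"
      proof (rule integral_mono)
        show "integrable M (\<lambda>\<omega>. \<bar>Z \<omega> * (f n \<omega> - g \<omega>)\<bar>)" by (intro integrable_abs Zi Bochner_Integration.integrable_diff fi gi1)
      qed (use di mult_right_mono[OF Zc abs_ge_zero] in \<open>auto simp: abs_mult d_def[abs_def]\<close>)
      finally show ?thesis by simp
    qed
    then show "\<forall>\<^sub>F n in sequentially. norm (expectation (\<lambda>\<omega>. Z \<omega> * f n \<omega>) - expectation (\<lambda>\<omega>. Z \<omega> * g \<omega>)) \<le> c * expectation (d n)"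
      by simp
  qed
qed

section \<open>Gaussian averages and their generator\<close>

text \<open>The heat semigroup at time \<open>h\<close>: the mean of \<open>f\<close> at the end of
  a Brownian increment of length \<open>h\<close> started at \<open>x\<close>.\<close>

definition heat_op :: "real \<Rightarrow> (real \<Rightarrow> real) \<Rightarrow> real \<Rightarrow> real" where
  "heat_op h f x = (LINT z|lborel. normal_density 0 (sqrt h) z * f (x + z))"

lemma heat_op_std:
  assumes "0 < h"
  shows "heat_op h f x = (LINT z|lborel. std_normal_density z * f (x + sqrt h * z))"
  using pBM_integral_shift[OF assms, of 0 "\<lambda>y. f (x + y)"] assms by (simp add: heat_op_def pBM_normal)

lemma heat_op_bounds:
  assumes f[measurable]: "f \<in> borel_measurable borel" and K: "\<And>x. \<bar>f x\<bar> \<le> K" and h: "0 < h"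
  shows "\<bar>heat_op h f x\<bar> \<le> K" and "heat_op h f \<in> borel_measurable borel"
proof -
  have "\<bar>heat_op h f x\<bar> \<le> (LINT z|lborel. \<bar>normal_density 0 (sqrt h) z * f (x + z)\<bar>)"
    unfolding heat_op_def by (rule integral_abs_bound)
  also have "\<dots> \<le> (LINT z|lborel. normal_density 0 (sqrt h) z * K)"
  proof (rule integral_mono_AE')
    show "integrable lborel (\<lambda>z. normal_density 0 (sqrt h) z * K)" using h by simp
    show "AE z in lborel. \<bar>normal_density 0 (sqrt h) z * f (x + z)\<bar> \<le> normal_density 0 (sqrt h) z * K"
      using K by (auto simp: abs_mult intro!: mult_left_mono)
  qed (use order_trans[OF abs_ge_zero K] in auto)
  also have "\<dots> = K" using h by simp
  finally show "\<bar>heat_op h f x\<bar> \<le> K" .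
  show "heat_op h f \<in> borel_measurable borel"
    unfolding heat_op_def[abs_def] by (rule lborel.borel_measurable_lebesgue_integral) measurable
qed

lemma taylor_second_order:
  fixes f :: "real \<Rightarrow> real"
  assumes "\<And>x. (f has_real_derivative f' x) (at x)" "\<And>x. (f' has_real_derivative f'' x) (at x)"
  shows "\<exists>\<eta>. \<bar>\<eta> - x\<bar> \<le> \<bar>y\<bar> \<and> f (x + y) = f x + y * f' x + y\<^sup>2 / 2 * f'' \<eta>"
proof (cases "y = 0")
  case False
  define diff where "diff m = (if m = 0 then f else if m = 1 then f' else f'')" for m :: nat
  have "\<exists>t. (if x + y < x then x + y < t \<and> t < x else x < t \<and> t < x + y) \<and>
      f (x + y) = (\<Sum>m<2. (diff m x / fact m) * (x + y - x)^m) + (diff 2 t / fact 2) * (x + y - x)^2"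
    by (rule Taylor[where a = "x - \<bar>y\<bar>" and b = "x + \<bar>y\<bar>"])
       (use assms False in \<open>auto simp: diff_def less_2_cases_iff\<close>)
  then show ?thesis by (auto simp: diff_def numeral_2_eq_2 split: if_splits intro!: exI[of _ "_::real"])
qed (auto intro: exI[of _ x])

text \<open>The first-order term has Gaussian mean zero and may be subtracted under the integral;
  what remains is quadratic in the increment, hence of order \<open>h\<close>.\<close>

lemma heat_op_minus:
  assumes f: "\<And>x. (f has_real_derivative f' x) (at x)" "\<And>x. (f' has_real_derivative f'' x) (at x)"
    and K: "\<And>x. \<bar>f x\<bar> \<le> K" "\<And>x. \<bar>f'' x\<bar> \<le> K" and h: "0 < h"
  shows "heat_op h f x - f x = (LINT z|lborel. std_normal_density z * (f (x + sqrt h * z) - f x - sqrt h * z * f' x))"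
    and "\<bar>f (x + sqrt h * z) - f x - sqrt h * z * f' x\<bar> \<le> h * K * (z\<^sup>2 / 2)"
    and "\<bar>heat_op h f x - f x\<bar> \<le> h * K / 2"
proof -
  have fc: "continuous_on UNIV f" using f(1) by (intro DERIV_continuous_on) auto
  have [measurable]: "f \<in> borel_measurable borel" by (rule borel_measurable_continuous_onI[OF fc])
  have i1: "integrable lborel (\<lambda>z. std_normal_density z * f (x + sqrt h * z))"
  proof (rule Bochner_Integration.integrable_bound[of _ "\<lambda>z. std_normal_density z * K"])
    show "AE z in lborel. norm (std_normal_density z * f (x + sqrt h * z)) \<le> norm (std_normal_density z * K)"
      using K(1) order_trans[OF K(1) abs_ge_self] by (auto simp: abs_mult intro!: mult_left_mono)
  qed auto
  have i2: "integrable lborel (\<lambda>z. std_normal_density z * f x)" by simp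
  have i3: "integrable lborel (\<lambda>z. sqrt h * f' x * (std_normal_density z * z))"
    using integrable_std_normal_moment[of 1] by (intro integrable_mult_right) simp
  have z3: "(LINT z|lborel. sqrt h * f' x * (std_normal_density z * z)) = 0"
    using integral_std_normal_moment_odd[of 0] by simp
  have "(LINT z|lborel. std_normal_density z * (f (x + sqrt h * z) - f x - sqrt h * z * f' x))
     = (LINT z|lborel. std_normal_density z * f (x + sqrt h * z) - std_normal_density z * f x - sqrt h * f' x * (std_normal_density z * z))"
    by (simp add: algebra_simps)
  also have "\<dots> = heat_op h f x - f x"
    using i1 i2 i3 z3 by (simp add: heat_op_std[OF h])
  finally show eq: "heat_op h f x - f x = (LINT z|lborel. std_normal_density z * (f (x + sqrt h * z) - f x - sqrt h * z * f' x))" ..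
  show b: "\<bar>f (x + sqrt h * z) - f x - sqrt h * z * f' x\<bar> \<le> h * K * (z\<^sup>2 / 2)" for z
  proof -
    obtain \<eta> where "f (x + sqrt h * z) = f x + sqrt h * z * f' x + (sqrt h * z)\<^sup>2 / 2 * f'' \<eta>"
      using taylor_second_order[OF f, of x "sqrt h * z"] by auto
    then have "\<bar>f (x + sqrt h * z) - f x - sqrt h * z * f' x\<bar> = h * z\<^sup>2 / 2 * \<bar>f'' \<eta>\<bar>"
      using h by (simp add: abs_mult power_mult_distrib)
    also have "\<dots> \<le> h * z\<^sup>2 / 2 * K" using h by (intro mult_left_mono K) auto
    finally show ?thesis by (simp add: mult_ac)
  qed
  have i4: "integrable lborel (\<lambda>z. h * K / 2 * (std_normal_density z * z\<^sup>2))"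
    using integrable_std_normal_moment[of 2] by (intro integrable_mult_right) simp
  have "\<bar>heat_op h f x - f x\<bar> \<le> (LINT z|lborel. \<bar>std_normal_density z * (f (x + sqrt h * z) - f x - sqrt h * z * f' x)\<bar>)"
    unfolding eq by (rule integral_abs_bound)
  also have "\<dots> \<le> (LINT z|lborel. h * K / 2 * (std_normal_density z * z\<^sup>2))"
  proof (rule integral_mono_AE'[OF i4])
    show "AE z in lborel. \<bar>std_normal_density z * (f (x + sqrt h * z) - f x - sqrt h * z * f' x)\<bar> \<le> h * K / 2 * (std_normal_density z * z\<^sup>2)"
      using mult_left_mono[OF b normal_density_nonneg] by (intro AE_I2) (simp add: abs_mult mult_ac)
  qed (use h order_trans[OF abs_ge_zero K(1)] in auto)
  also have "\<dots> = h * K / 2" using integral_std_normal_moment_even[of 1] by simp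
  finally show "\<bar>heat_op h f x - f x\<bar> \<le> h * K / 2" .
qed

context
  fixes a b f ft fx fxx K
  assumes ito: "ito_function a b f ft fx fxx K"
begin

lemma ito_function_props:
  assumes "s \<in> {a..b}"
  shows "((\<lambda>s. f s x) has_real_derivative ft s x) (at s within {a..b})"
    "(f s has_real_derivative fx s x) (at x)" "(fx s has_real_derivative fxx s x) (at x)"
    "\<bar>f s x\<bar> \<le> K" "\<bar>ft s x\<bar> \<le> K" "\<bar>fx s x\<bar> \<le> K" "\<bar>fxx s x\<bar> \<le> K"
    "f s \<in> borel_measurable borel"
proof -
  show D: "((\<lambda>s. f s x) has_real_derivative ft s x) (at s within {a..b})"
    "(f s has_real_derivative fx s x) (at x)" "(fx s has_real_derivative fxx s x) (at x)"
    "\<bar>f s x\<bar> \<le> K" "\<bar>ft s x\<bar> \<le> K" "\<bar>fx s x\<bar> \<le> K" "\<bar>fxx s x\<bar> \<le> K" for x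
    using ito assms unfolding ito_function_def by blast+
  show "f s \<in> borel_measurable borel"
    by (intro borel_measurable_continuous_onI DERIV_continuous_on[of UNIV _ "fx s"]) (use D in auto)
qed

lemma ito_function_tendsto:
  assumes "\<And>n. \<sigma> n \<in> {a..b}" "r \<in> {a..b}" "\<sigma> \<longlonglongrightarrow> r" "y \<longlonglongrightarrow> x"
  shows "(\<lambda>n. ft (\<sigma> n) (y n)) \<longlonglongrightarrow> ft r x" "(\<lambda>n. fx (\<sigma> n) (y n)) \<longlonglongrightarrow> fx r x"
    "(\<lambda>n. fxx (\<sigma> n) (y n)) \<longlonglongrightarrow> fxx r x"
proof -
  have *: "(\<lambda>n. g (\<sigma> n) (y n)) \<longlonglongrightarrow> g r x" if "continuous_on ({a..b} \<times> UNIV) (\<lambda>(s, x). g s x)" for g :: "real \<Rightarrow> real \<Rightarrow> real"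
    using continuous_on_tendsto_compose[OF that tendsto_Pair[OF assms(3,4)]] assms(1,2) by auto
  show "(\<lambda>n. ft (\<sigma> n) (y n)) \<longlonglongrightarrow> ft r x" "(\<lambda>n. fx (\<sigma> n) (y n)) \<longlonglongrightarrow> fx r x"
    "(\<lambda>n. fxx (\<sigma> n) (y n)) \<longlonglongrightarrow> fxx r x"
    using ito unfolding ito_function_def by (auto intro: *)
qed

lemma ito_time_mvt:
  assumes "\<sigma> \<in> {a..b}" "0 < h" "\<sigma> + h \<in> {a..b}"
  shows "\<exists>\<sigma>'\<in>{\<sigma>..\<sigma> + h}. f (\<sigma> + h) x - f \<sigma> x = h * ft \<sigma>' x"
proof -
  have "\<exists>s\<in>{\<sigma><..<\<sigma> + h}. f (\<sigma> + h) x - f \<sigma> x = (\<lambda>d. ft s x * d) (\<sigma> + h - \<sigma>)"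
  proof (rule mvt_simple)
    fix s assume "\<sigma> \<le> s" "s \<le> \<sigma> + h"
    then show "((\<lambda>s. f s x) has_derivative (\<lambda>d. ft s x * d)) (at s within {\<sigma>..\<sigma> + h})"
      using assms DERIV_subset[OF ito_function_props(1)[of s x], of "{\<sigma>..\<sigma> + h}"] by (auto simp: has_field_derivative_def)
  qed (use assms in auto)
  then show ?thesis by (auto simp: mult.commute intro!: bexI less_imp_le)
qed

lemma generator_bound:
  assumes "\<sigma> \<in> {a..b}" "0 < h" "\<sigma> + h \<in> {a..b}"
  shows "\<bar>heat_op h (f (\<sigma> + h)) x - f \<sigma> x\<bar> \<le> 2 * K * h"
proof -
  obtain \<sigma>' where "\<sigma>' \<in> {\<sigma>..\<sigma> + h}" "f (\<sigma> + h) x - f \<sigma> x = h * ft \<sigma>' x"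
    using ito_time_mvt[OF assms] by blast
  then have "\<bar>f (\<sigma> + h) x - f \<sigma> x\<bar> \<le> h * K"
    using ito_function_props(5)[of \<sigma>' x] assms by (auto simp: abs_mult)
  moreover have "\<bar>heat_op h (f (\<sigma> + h)) x - f (\<sigma> + h) x\<bar> \<le> h * K / 2"
    by (rule heat_op_minus(3)[OF ito_function_props(2,3,4,7)[OF assms(3)] assms(2)])
  moreover have "0 \<le> h * K" using assms ito_function_props(4)[OF assms(1), of x] by simp
  ultimately have "\<bar>heat_op h (f (\<sigma> + h)) x - f \<sigma> x\<bar> \<le> 2 * (h * K)" by linarith
  then show ?thesis by (simp add: mult_ac)
qed

text \<open>Time and space move separately: the mean value theorem handles the time step at a fixed
  point, Taylor's formula the Gaussian average at the later time, with a multiple of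
  \<open>z^2\<close> as integrable majorant. Times and base points vary with \<open>n\<close>,
  because the statement is applied along mesh points closing in on a given time.\<close>

lemma generator_tendsto:
  assumes \<sigma>: "\<And>n. \<sigma> n \<in> {a..b}" "\<And>n. 0 < h n" "\<And>n. \<sigma> n + h n \<in> {a..b}"
    and r: "r \<in> {a..b}" and lim: "\<sigma> \<longlonglongrightarrow> r" "h \<longlonglongrightarrow> 0" "y \<longlonglongrightarrow> x"
  shows "(\<lambda>n. (heat_op (h n) (f (\<sigma> n + h n)) (y n) - f (\<sigma> n) (y n)) / h n) \<longlonglongrightarrow> ft r x + fxx r x / 2"
proof -
  have sh: "(\<lambda>n. \<sigma> n + h n) \<longlonglongrightarrow> r" using tendsto_add[OF lim(1,2)] by simp
  have "\<forall>n. \<exists>s\<in>{\<sigma> n..\<sigma> n + h n}. f (\<sigma> n + h n) (y n) - f (\<sigma> n) (y n) = h n * ft s (y n)"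
    by (intro allI ito_time_mvt \<sigma>)
  then obtain s where s: "\<And>n. s n \<in> {\<sigma> n..\<sigma> n + h n}" "\<And>n. f (\<sigma> n + h n) (y n) - f (\<sigma> n) (y n) = h n * ft (s n) (y n)"
    by metis
  have "s \<longlonglongrightarrow> r" by (rule tendsto_sandwich[OF _ _ lim(1) sh]) (use s(1) in auto)
  moreover have "s n \<in> {a..b}" for n using s(1)[of n] \<sigma>(1,3)[of n] by auto
  ultimately have t: "(\<lambda>n. ft (s n) (y n)) \<longlonglongrightarrow> ft r x" using ito_function_tendsto(1)[OF _ r _ lim(3)] by blast
  define q where "q n z = (f (\<sigma> n + h n) (y n + sqrt (h n) * z) - f (\<sigma> n + h n) (y n) - sqrt (h n) * z * fx (\<sigma> n + h n) (y n)) / h n" for n z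
  have [measurable]: "f (\<sigma> n + h n) \<in> borel_measurable borel" for n by (rule ito_function_props(8)[OF \<sigma>(3)])
  have "(\<lambda>n. LINT z|lborel. std_normal_density z * q n z) \<longlonglongrightarrow> (LINT z|lborel. std_normal_density z * (z\<^sup>2 / 2 * fxx r x))"
  proof (rule integral_dominated_convergence[where w = "\<lambda>z. K / 2 * (std_normal_density z * z\<^sup>2)"])
    show "integrable lborel (\<lambda>z. K / 2 * (std_normal_density z * z\<^sup>2))"
      using integrable_std_normal_moment[of 2] by (intro integrable_mult_right) simp
    show "AE z in lborel. (\<lambda>n. std_normal_density z * q n z) \<longlonglongrightarrow> std_normal_density z * (z\<^sup>2 / 2 * fxx r x)"
    proof (intro AE_I2 tendsto_mult tendsto_const)
      fix z
      have "\<forall>n. \<exists>\<eta>. \<bar>\<eta> - y n\<bar> \<le> \<bar>sqrt (h n) * z\<bar> \<and> f (\<sigma> n + h n) (y n + sqrt (h n) * z)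
          = f (\<sigma> n + h n) (y n) + sqrt (h n) * z * fx (\<sigma> n + h n) (y n) + (sqrt (h n) * z)\<^sup>2 / 2 * fxx (\<sigma> n + h n) \<eta>"
        using taylor_second_order[OF ito_function_props(2,3)[OF \<sigma>(3)]] by blast
      from choice[OF this] obtain \<eta> where \<eta>: "\<And>n. \<bar>\<eta> n - y n\<bar> \<le> \<bar>sqrt (h n) * z\<bar>" "\<And>n. f (\<sigma> n + h n) (y n + sqrt (h n) * z)
          = f (\<sigma> n + h n) (y n) + sqrt (h n) * z * fx (\<sigma> n + h n) (y n) + (sqrt (h n) * z)\<^sup>2 / 2 * fxx (\<sigma> n + h n) (\<eta> n)"
        by blast
      have "(\<lambda>n. \<bar>sqrt (h n) * z\<bar>) \<longlonglongrightarrow> \<bar>sqrt 0 * z\<bar>" by (intro tendsto_intros lim)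
      then have "(\<lambda>n. \<bar>sqrt (h n) * z\<bar>) \<longlonglongrightarrow> 0" by simp
      then have "(\<lambda>n. \<eta> n - y n) \<longlonglongrightarrow> 0" by (rule Lim_null_comparison[rotated]) (use \<eta>(1) in simp)
      from tendsto_add[OF this lim(3)] have "\<eta> \<longlonglongrightarrow> x" by simp
      then have "(\<lambda>n. z\<^sup>2 / 2 * fxx (\<sigma> n + h n) (\<eta> n)) \<longlonglongrightarrow> z\<^sup>2 / 2 * fxx r x"
        by (intro tendsto_mult tendsto_const ito_function_tendsto(3) \<sigma>(3) r sh)
      moreover have "q n z = z\<^sup>2 / 2 * fxx (\<sigma> n + h n) (\<eta> n)" for n
        using \<sigma>(2)[of n] by (simp add: q_def \<eta>(2) power_mult_distrib)
      ultimately show "(\<lambda>n. q n z) \<longlonglongrightarrow> z\<^sup>2 / 2 * fxx r x" by (simp only:)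
    qed
    show "AE z in lborel. norm (std_normal_density z * q n z) \<le> K / 2 * (std_normal_density z * z\<^sup>2)" for n
    proof (rule AE_I2)
      fix z
      have "\<bar>f (\<sigma> n + h n) (y n + sqrt (h n) * z) - f (\<sigma> n + h n) (y n) - sqrt (h n) * z * fx (\<sigma> n + h n) (y n)\<bar> \<le> h n * K * (z\<^sup>2 / 2)"
        by (rule heat_op_minus(2)[OF ito_function_props(2,3,4,7)[OF \<sigma>(3)] \<sigma>(2)])
      then have "\<bar>q n z\<bar> \<le> K * (z\<^sup>2 / 2)" using \<sigma>(2)[of n] by (simp add: q_def abs_divide pos_divide_le_eq mult_ac)
      from mult_left_mono[OF this normal_density_nonneg[of 0 1 z]]
      show "norm (std_normal_density z * q n z) \<le> K / 2 * (std_normal_density z * z\<^sup>2)" by (simp add: abs_mult mult_ac)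
    qed
  qed (unfold q_def, measurable)
  also have "(LINT z|lborel. std_normal_density z * (z\<^sup>2 / 2 * fxx r x)) = fxx r x / 2"
    using integral_std_normal_moment_even[of 1] integral_mult_right_zero[of lborel "fxx r x / 2" "\<lambda>z. std_normal_density z * z\<^sup>2"]
    by (simp add: mult_ac)
  finally have i: "(\<lambda>n. LINT z|lborel. std_normal_density z * q n z) \<longlonglongrightarrow> fxx r x / 2" .
  have "(heat_op (h n) (f (\<sigma> n + h n)) (y n) - f (\<sigma> n) (y n)) / h n = ft (s n) (y n) + (LINT z|lborel. std_normal_density z * q n z)" for n
  proof -
    have "heat_op (h n) (f (\<sigma> n + h n)) (y n) - f (\<sigma> n + h n) (y n)
       = (LINT z|lborel. std_normal_density z * (f (\<sigma> n + h n) (y n + sqrt (h n) * z) - f (\<sigma> n + h n) (y n) - sqrt (h n) * z * fx (\<sigma> n + h n) (y n)))"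
      by (rule heat_op_minus(1)[OF ito_function_props(2,3,4,7)[OF \<sigma>(3)] \<sigma>(2)])
    also have "\<dots> = h n * (LINT z|lborel. std_normal_density z * q n z)"
      unfolding q_def using \<sigma>(2)[of n] by (subst integral_mult_right_zero[symmetric]) simp
    finally have "heat_op (h n) (f (\<sigma> n + h n)) (y n) - f (\<sigma> n + h n) (y n) = h n * (LINT z|lborel. std_normal_density z * q n z)" .
    then have "heat_op (h n) (f (\<sigma> n + h n)) (y n) - f (\<sigma> n) (y n) = h n * (ft (s n) (y n) + (LINT z|lborel. std_normal_density z * q n z))"
      using s(2)[of n] by (simp add: distrib_left)
    then show ?thesis using \<sigma>(2)[of n] by simp
  qed
  then show ?thesis using tendsto_add[OF t i] by simp
qed

end

section \<open>Brownian motion relative to a filtration\<close>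

locale bm_filtration =
  fixes M :: "'a measure" and F :: "real \<Rightarrow> 'a measure" and B :: "real \<Rightarrow> 'a \<Rightarrow> real"
  assumes bm: "brownian_motion M F B"

sublocale bm_filtration \<subseteq> prob_space M
  using bm unfolding brownian_motion_def by (elim conjE)

context bm_filtration
begin

lemma F_measurable_M: "0 \<le> s \<Longrightarrow> f \<in> measurable (F s) N \<Longrightarrow> f \<in> measurable M N"
  using bm measurable_from_subalg[of M "F s"] unfolding brownian_motion_def by blast

lemma F_measurable_mono:
  assumes "s \<le> t" "f \<in> measurable (F s) N"
  shows "f \<in> measurable (F t) N"
proof -
  have "filtration (space M) F" using bm unfolding brownian_motion_def by blast
  then interpret filtration "space M" F .
  show ?thesis using measurable_mono[OF order_refl refl sets_F_mono[OF assms(1)], of N] assms(2) by (auto simp: space_F)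
qed

lemma B_measurable: "0 \<le> t \<Longrightarrow> B t \<in> borel_measurable (F t)"
  using bm unfolding brownian_motion_def by blast

text \<open>This stands in for conditioning on \<open>F s\<close>: the bounded variable
  \<open>W\<close> tests against the past, and independence with Fubini allows the past value
  \<open>Y\<close> to be frozen while the increment is integrated out.\<close>

lemma increment_freeze:
  fixes W Y :: "'a \<Rightarrow> real"
  assumes st: "0 \<le> s" "s < t"
    and W: "W \<in> borel_measurable (F s)" "\<And>\<omega>. \<bar>W \<omega>\<bar> \<le> c" and Y: "Y \<in> borel_measurable (F s)"
    and \<phi>[measurable]: "(\<lambda>(y, z). \<phi> y z) \<in> borel_measurable (borel \<Otimes>\<^sub>M borel)" and d: "\<And>y z. \<bar>\<phi> y z :: real\<bar> \<le> d"
  shows "expectation (\<lambda>\<omega>. W \<omega> * \<phi> (Y \<omega>) (B t \<omega> - B s \<omega>))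
       = expectation (\<lambda>\<omega>. W \<omega> * (LINT z|lborel. normal_density 0 (sqrt (t - s)) z * \<phi> (Y \<omega>) z))"
proof -
  define P where "P \<omega> = (W \<omega>, Y \<omega>)" for \<omega>
  define \<Delta> where "\<Delta> \<omega> = B t \<omega> - B s \<omega>" for \<omega>
  \<comment> \<open>\<open>indep_var\<close> relates two variables of the same type, hence the dummy second component.\<close>
  define \<Delta>2 where "\<Delta>2 \<omega> = (\<Delta> \<omega>, 0 :: real)" for \<omega>
  have PF: "P \<in> measurable (F s) (borel \<Otimes>\<^sub>M borel)" unfolding P_def using W(1) Y by measurable
  have P[measurable]: "P \<in> measurable M (borel \<Otimes>\<^sub>M borel)" by (rule F_measurable_M[OF st(1) PF])
  have "B t \<in> borel_measurable M" "B s \<in> borel_measurable M"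
    using st F_measurable_M[OF _ B_measurable] by auto
  then have \<Delta>[measurable]: "\<Delta> \<in> borel_measurable M" unfolding \<Delta>_def by measurable
  have \<Delta>2[measurable]: "\<Delta>2 \<in> measurable M (borel \<Otimes>\<^sub>M borel)" unfolding \<Delta>2_def by measurable
  have dist: "distributed M lborel \<Delta> (normal_density 0 (sqrt (t - s)))"
    and ind: "indep_set (sets (F s)) {\<Delta> -` A \<inter> space M | A. A \<in> sets borel}"
    using bm st unfolding brownian_motion_def \<Delta>_def by blast+
  have sp: "space (F s) = space M" using bm st unfolding brownian_motion_def subalgebra_def by blast
  let ?D = "{\<Delta> -` A \<inter> space M | A. A \<in> sets borel}"
  have "indep_var (borel \<Otimes>\<^sub>M borel) P (borel \<Otimes>\<^sub>M borel) \<Delta>2"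
    unfolding indep_var_eq
  proof (intro conjI P \<Delta>2)
    have "indep_set (sigma_sets (space M) (sets (F s))) (sigma_sets (space M) ?D)"
    proof (rule indep_set_sigma_sets[OF ind])
      show "Int_stable (sets (F s))" by (auto simp: Int_stable_def)
      show "Int_stable ?D"
      proof (unfold Int_stable_def, safe)
        fix A A' :: "real set" assume "A \<in> sets borel" "A' \<in> sets borel"
        then show "\<exists>C. \<Delta> -` A \<inter> space M \<inter> (\<Delta> -` A' \<inter> space M) = \<Delta> -` C \<inter> space M \<and> C \<in> sets borel"
          by (intro exI[of _ "A \<inter> A'"]) auto
      qed
    qed
    moreover have "sigma_sets (space M) {P -` A \<inter> space M | A. A \<in> sets (borel \<Otimes>\<^sub>M borel)} \<subseteq> sigma_sets (space M) (sets (F s))"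
      by (rule sigma_sets_mono') (use measurable_sets[OF PF] sp in auto)
    moreover have "sigma_sets (space M) {\<Delta>2 -` A \<inter> space M | A. A \<in> sets (borel \<Otimes>\<^sub>M borel)} \<subseteq> sigma_sets (space M) ?D"
    proof (rule sigma_sets_mono', safe)
      fix A :: "(real \<times> real) set" assume A: "A \<in> sets (borel \<Otimes>\<^sub>M borel)"
      have "(\<lambda>z. (z, 0 :: real)) -` A \<inter> space borel \<in> sets borel"
        by (rule measurable_sets[OF _ A]) simp
      then show "\<exists>C. \<Delta>2 -` A \<inter> space M = \<Delta> -` C \<inter> space M \<and> C \<in> sets borel"
        by (intro exI[of _ "(\<lambda>z. (z, 0 :: real)) -` A"]) (auto simp: \<Delta>2_def)
    qed
    ultimately show "indep_set (sigma_sets (space M) {P -` A \<inter> space M | A. A \<in> sets (borel \<Otimes>\<^sub>M borel)})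
        (sigma_sets (space M) {\<Delta>2 -` A \<inter> space M | A. A \<in> sets (borel \<Otimes>\<^sub>M borel)})"
      unfolding indep_set_def by (elim indep_sets_mono_sets) (auto split: bool.split)
  qed
  then have joint: "distr M (borel \<Otimes>\<^sub>M borel) P \<Otimes>\<^sub>M distr M (borel \<Otimes>\<^sub>M borel) \<Delta>2
      = distr M ((borel \<Otimes>\<^sub>M borel) \<Otimes>\<^sub>M (borel \<Otimes>\<^sub>M borel)) (\<lambda>\<omega>. (P \<omega>, \<Delta>2 \<omega>))"
    by (simp add: indep_var_distribution_eq)
  interpret P1: prob_space "distr M (borel \<Otimes>\<^sub>M borel) P" by (rule prob_space_distr[OF P])
  interpret P2: prob_space "distr M (borel \<Otimes>\<^sub>M borel) \<Delta>2" by (rule prob_space_distr[OF \<Delta>2])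
  interpret PP: pair_prob_space "distr M (borel \<Otimes>\<^sub>M borel) P" "distr M (borel \<Otimes>\<^sub>M borel) \<Delta>2" ..
  define \<Psi> where "\<Psi> p z = fst p * \<phi> (snd p) (fst z)" for p :: "real \<times> real" and z :: "real \<times> real"
  have \<Psi>[measurable]: "(\<lambda>(p, z). \<Psi> p z) \<in> borel_measurable ((borel \<Otimes>\<^sub>M borel) \<Otimes>\<^sub>M (borel \<Otimes>\<^sub>M borel))"
  proof -
    have "(\<lambda>q. (snd (fst q), fst (snd q))) \<in> measurable ((borel \<Otimes>\<^sub>M borel) \<Otimes>\<^sub>M (borel \<Otimes>\<^sub>M borel)) (borel \<Otimes>\<^sub>M (borel :: real measure))"
      by measurable
    from measurable_compose[OF this \<phi>] show ?thesis unfolding \<Psi>_def case_prod_beta' by simp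
  qed
  have i0: "integrable M (\<lambda>\<omega>. \<Psi> (P \<omega>) (\<Delta>2 \<omega>))"
  proof (rule integrable_const_bound[where B = "c * d"])
    show "AE \<omega> in M. norm (\<Psi> (P \<omega>) (\<Delta>2 \<omega>)) \<le> c * d"
      using mult_mono[OF W(2) d] order_trans[OF abs_ge_zero W(2)] by (auto simp: \<Psi>_def P_def abs_mult)
    show "(\<lambda>\<omega>. \<Psi> (P \<omega>) (\<Delta>2 \<omega>)) \<in> borel_measurable M"
      using measurable_compose[OF _ \<Psi>, of "\<lambda>\<omega>. (P \<omega>, \<Delta>2 \<omega>)"] by simp
  qed
  have i1: "integrable (distr M (borel \<Otimes>\<^sub>M borel) P \<Otimes>\<^sub>M distr M (borel \<Otimes>\<^sub>M borel) \<Delta>2) (\<lambda>(p, z). \<Psi> p z)"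
    unfolding joint using i0 by (subst integrable_distr_eq) auto
  have "expectation (\<lambda>\<omega>. \<Psi> (P \<omega>) (\<Delta>2 \<omega>))
      = integral\<^sup>L (distr M (borel \<Otimes>\<^sub>M borel) P \<Otimes>\<^sub>M distr M (borel \<Otimes>\<^sub>M borel) \<Delta>2) (\<lambda>(p, z). \<Psi> p z)"
    unfolding joint by (subst integral_distr) auto
  also have "\<dots> = (LINT p|distr M (borel \<Otimes>\<^sub>M borel) P. LINT z|distr M (borel \<Otimes>\<^sub>M borel) \<Delta>2. \<Psi> p z)"
    using PP.integral_fst'[OF i1] by simp
  also have "\<dots> = expectation (\<lambda>\<omega>. LINT z|distr M (borel \<Otimes>\<^sub>M borel) \<Delta>2. \<Psi> (P \<omega>) z)"
  proof (rule integral_distr[OF P])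
    show "(\<lambda>p. LINT z|distr M (borel \<Otimes>\<^sub>M borel) \<Delta>2. \<Psi> p z) \<in> borel_measurable (borel \<Otimes>\<^sub>M borel)"
      by (rule P2.borel_measurable_lebesgue_integral) (use \<Psi> in simp)
  qed
  also have "\<dots> = expectation (\<lambda>\<omega>. W \<omega> * (LINT z|lborel. normal_density 0 (sqrt (t - s)) z * \<phi> (Y \<omega>) z))"
  proof (rule Bochner_Integration.integral_cong[OF refl])
    fix \<omega>
    have "(\<lambda>z. (Y \<omega>, z)) \<in> measurable borel (borel \<Otimes>\<^sub>M (borel :: real measure))" by measurable
    from measurable_compose[OF this \<phi>] have \<phi>Y: "(\<lambda>z. \<phi> (Y \<omega>) z) \<in> borel_measurable borel" by simp
    have "(LINT z|distr M (borel \<Otimes>\<^sub>M borel) \<Delta>2. \<Psi> (P \<omega>) z) = expectation (\<lambda>\<omega>'. W \<omega> * \<phi> (Y \<omega>) (\<Delta> \<omega>'))"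
    proof (subst integral_distr[OF \<Delta>2])
      show "\<Psi> (P \<omega>) \<in> borel_measurable (borel \<Otimes>\<^sub>M borel)"
        unfolding \<Psi>_def[abs_def] using measurable_compose[OF measurable_fst \<phi>Y] by simp
    qed (simp add: \<Psi>_def P_def \<Delta>2_def)
    also have "\<dots> = W \<omega> * (LINT z|lborel. normal_density 0 (sqrt (t - s)) z * \<phi> (Y \<omega>) z)"
    proof -
      have "(LINT z|lborel. normal_density 0 (sqrt (t - s)) z * \<phi> (Y \<omega>) z) = expectation (\<lambda>\<omega>'. \<phi> (Y \<omega>) (\<Delta> \<omega>'))"
        by (rule distributed_integral[OF dist]) (use \<phi>Y in auto)
      then show ?thesis by (simp only: Bochner_Integration.integral_mult_right_zero)
    qed
    finally show "(LINT z|distr M (borel \<Otimes>\<^sub>M borel) \<Delta>2. \<Psi> (P \<omega>) z)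
        = W \<omega> * (LINT z|lborel. normal_density 0 (sqrt (t - s)) z * \<phi> (Y \<omega>) z)" .
  qed
  finally show ?thesis unfolding \<Psi>_def P_def \<Delta>_def \<Delta>2_def fst_conv snd_conv .
qed

lemma increment_second_moment:
  assumes "0 \<le> s" "s < t"
  shows "integrable M (\<lambda>\<omega>. (B t \<omega> - B s \<omega>)\<^sup>2)" "expectation (\<lambda>\<omega>. (B t \<omega> - B s \<omega>)\<^sup>2) = t - s"
proof -
  have dist: "distributed M lborel (\<lambda>\<omega>. B t \<omega> - B s \<omega>) (normal_density 0 (sqrt (t - s)))"
    using bm assms unfolding brownian_motion_def by auto
  have "integrable lborel (\<lambda>z. normal_density 0 (sqrt (t - s)) z * z\<^sup>2)"
    using integrable_normal_moment[of "sqrt (t - s)" 0 2] assms by simp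
  then show "integrable M (\<lambda>\<omega>. (B t \<omega> - B s \<omega>)\<^sup>2)"
    using distributed_integrable[OF dist, of "\<lambda>z. z\<^sup>2"] by simp
  have "(LINT z|lborel. normal_density 0 (sqrt (t - s)) z * z\<^sup>2) = t - s"
    using integral_normal_moment_even[of "sqrt (t - s)" 0 1] assms by simp
  then show "expectation (\<lambda>\<omega>. (B t \<omega> - B s \<omega>)\<^sup>2) = t - s"
    using distributed_integral[OF dist, of "\<lambda>z. z\<^sup>2"] by simp
qed

end

section \<open>Ito's formula in expectation\<close>

lemma mvt_between:
  fixes g :: "real \<Rightarrow> real"
  assumes "\<And>x. (g has_real_derivative g' x) (at x)"
  shows "\<exists>\<xi>. \<bar>\<xi> - p\<bar> \<le> \<bar>p - q\<bar> \<and> g p - g q = g' \<xi> * (p - q)"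
proof (cases p q rule: linorder_cases)
  case less
  then obtain z where "p < z" "z < q" "g q - g p = (q - p) * g' z" using MVT2[of p q g g'] assms by blast
  then show ?thesis using less by (intro exI[of _ z]) (auto simp: algebra_simps)
next
  case greater
  then obtain z where "q < z" "z < p" "g p - g q = (p - q) * g' z" using MVT2[of q p g g'] assms by blast
  then show ?thesis using greater by (intro exI[of _ z]) (auto simp: algebra_simps)
qed auto

lemma sum_indicator_partition:
  fixes a h :: real
  assumes "0 \<le> h"
  shows "(\<Sum>i<j. indicator {a + real i * h<..a + real (Suc i) * h} r) = (indicator {a<..a + real j * h} r :: real)"
proof (induction j)
  case (Suc j)
  define H where "H = real j * h"
  have "0 \<le> H" using assms by (simp add: H_def)
  moreover have "real (Suc j) * h = H + h" by (simp add: H_def algebra_simps)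
  ultimately have "indicator {a<..a + real (Suc j) * h} r = indicator {a<..a + real j * h} r + (indicator {a + real j * h<..a + real (Suc j) * h} r :: real)"
    using assms unfolding H_def[symmetric] by (auto simp: indicator_def)
  then show ?case using Suc by simp
qed simp

text \<open>On each mesh interval the noise increment acts before the drift. The noise part is
  compensated by its Gaussian average \<open>heat_op\<close>, so the telescoping sum leaves a
  generator quotient and a drift term. The second-order term comes from this average and not from
  squared increments of the path, which is why a single deterministic path can be treated.\<close>

lemma ito_pathwise:
  fixes x \<beta> bb :: "real \<Rightarrow> real"
  assumes ito: "ito_function a b f ft fx fxx K" and ab: "a < b"
    and x: "continuous_on {a..b} x" and \<beta>: "continuous_on {a..b} \<beta>" and bb: "set_integrable lborel {a<..b} bb"
    and incr: "\<And>p q. a \<le> p \<Longrightarrow> p \<le> q \<Longrightarrow> q \<le> b \<Longrightarrow> x q - x p = \<beta> q - \<beta> p - (LINT r:{p<..q}|lborel. bb r)"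
  defines "h n \<equiv> (b - a) / real (Suc n)" and "\<tau> n i \<equiv> a + real i * ((b - a) / real (Suc n))"
  shows "(\<lambda>n. f b (x b) - f a (x a) - (\<Sum>i<Suc n. f (\<tau> n (Suc i)) (x (\<tau> n i) + (\<beta> (\<tau> n (Suc i)) - \<beta> (\<tau> n i)))
              - heat_op (h n) (f (\<tau> n (Suc i))) (x (\<tau> n i))))
     \<longlonglongrightarrow> (LINT r:{a<..b}|lborel. ft r (x r) + fxx r (x r) / 2 - fx r (x r) * bb r)"
proof -
  have h: "0 < h n" for n using ab by (simp add: h_def)
  have \<tau>: "\<tau> n i = a + real i * h n" for n i by (simp add: \<tau>_def h_def)
  have \<tau>0: "\<tau> n 0 = a" for n by (simp add: \<tau>)
  have \<tau>N: "\<tau> n (Suc n) = b" for n by (simp add: \<tau> h_def del: of_nat_Suc)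
  have \<tau>S: "\<tau> n (Suc i) = \<tau> n i + h n" for n i by (simp add: \<tau> algebra_simps)
  have \<tau>mono: "\<tau> n i \<le> \<tau> n j" if "i \<le> j" for n i j using that h[of n] by (simp add: \<tau>)
  have \<tau>in: "\<tau> n i \<in> {a..b}" if "i \<le> Suc n" for n i
    using \<tau>mono[of 0 i n] \<tau>mono[OF that, of n] by (simp add: \<tau>0 \<tau>N)
  have h0: "h \<longlonglongrightarrow> 0"
    using tendsto_mult_left[OF LIMSEQ_inverse_real_of_nat, of "b - a"] by (simp add: h_def[abs_def] divide_inverse)
  note props = ito_function_props[OF ito]
  have K: "0 \<le> K" using props(4)[of a 0] ab by (auto intro: order_trans[OF abs_ge_zero])
  \<comment> \<open>The intermediate position, after the noise of the interval and before its
    drift.\<close>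
  define y where "y n i = x (\<tau> n i) + (\<beta> (\<tau> n (Suc i)) - \<beta> (\<tau> n i))" for n i
  have xy: "x (\<tau> n (Suc i)) - y n i = - (LINT r:{\<tau> n i<..\<tau> n (Suc i)}|lborel. bb r)" if "i < Suc n" for n i
    using incr[of "\<tau> n i" "\<tau> n (Suc i)"] \<tau>in[of i n] \<tau>in[of "Suc i" n] \<tau>mono[of i "Suc i" n] that by (simp add: y_def)
  have "\<forall>n i. \<exists>\<xi>. i < Suc n \<longrightarrow> \<bar>\<xi> - x (\<tau> n (Suc i))\<bar> \<le> \<bar>x (\<tau> n (Suc i)) - y n i\<bar> \<and>
      f (\<tau> n (Suc i)) (x (\<tau> n (Suc i))) - f (\<tau> n (Suc i)) (y n i) = fx (\<tau> n (Suc i)) \<xi> * (x (\<tau> n (Suc i)) - y n i)"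
  proof (intro allI)
    fix n i
    show "\<exists>\<xi>. i < Suc n \<longrightarrow> \<bar>\<xi> - x (\<tau> n (Suc i))\<bar> \<le> \<bar>x (\<tau> n (Suc i)) - y n i\<bar> \<and>
      f (\<tau> n (Suc i)) (x (\<tau> n (Suc i))) - f (\<tau> n (Suc i)) (y n i) = fx (\<tau> n (Suc i)) \<xi> * (x (\<tau> n (Suc i)) - y n i)"
    proof (cases "i < Suc n")
      case True
      then have "\<tau> n (Suc i) \<in> {a..b}" by (intro \<tau>in) simp
      from mvt_between[OF props(2)[OF this]] show ?thesis by blast
    qed simp
  qed
  then obtain \<xi> where \<xi>: "\<And>n i. i < Suc n \<Longrightarrow> \<bar>\<xi> n i - x (\<tau> n (Suc i))\<bar> \<le> \<bar>x (\<tau> n (Suc i)) - y n i\<bar>"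
    "\<And>n i. i < Suc n \<Longrightarrow> f (\<tau> n (Suc i)) (x (\<tau> n (Suc i))) - f (\<tau> n (Suc i)) (y n i) = fx (\<tau> n (Suc i)) (\<xi> n i) * (x (\<tau> n (Suc i)) - y n i)"
    unfolding choice_iff by blast
  define c where "c n i = (heat_op (h n) (f (\<tau> n (Suc i))) (x (\<tau> n i)) - f (\<tau> n i) (x (\<tau> n i))) / h n" for n i
  define G where "G n i r = c n i - fx (\<tau> n (Suc i)) (\<xi> n i) * bb r" for n i r
  define I where "I n i = {\<tau> n i<..\<tau> n (Suc i)}" for n i
  \<comment> \<open>The sum as the integral of a function of time, ready for dominated convergence.
    As \<open>bb\<close> is merely integrable, it stays under the integral sign, while the other
    factors are frozen on each interval.\<close>
  define \<Phi> where "\<Phi> n r = (\<Sum>i<Suc n. indicator (I n i) r * G n i r)" for n r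
  have Isub: "I n i \<subseteq> {a<..b}" if "i < Suc n" for n i
    using \<tau>in[of i n] \<tau>in[of "Suc i" n] that by (auto simp: I_def)
  have bbI: "set_integrable lborel (I n i) bb" if "i < Suc n" for n i
    by (rule set_integrable_subset[OF bb _ Isub[OF that]]) (simp add: I_def)
  have cI: "set_integrable lborel (I n i) (\<lambda>_. c n i)" for n i
    using h[of n] by (simp add: I_def set_integrable_def \<tau>S)
  have GI: "set_integrable lborel (I n i) (G n i)" if "i < Suc n" for n i
    unfolding G_def using bbI[OF that] cI by (intro set_integral_diff set_integrable_mult_right) auto
  have GL: "(LINT r:I n i|lborel. G n i r) = heat_op (h n) (f (\<tau> n (Suc i))) (x (\<tau> n i)) - f (\<tau> n i) (x (\<tau> n i))
       + (f (\<tau> n (Suc i)) (x (\<tau> n (Suc i))) - f (\<tau> n (Suc i)) (y n i))" if "i < Suc n" for n i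
  proof -
    have "(LINT r:I n i|lborel. G n i r) = (LINT r:I n i|lborel. c n i) - (LINT r:I n i|lborel. fx (\<tau> n (Suc i)) (\<xi> n i) * bb r)"
      unfolding G_def by (rule set_integral_diff(2)) (use bbI[OF that] cI in auto)
    also have "(LINT r:I n i|lborel. c n i) = c n i * h n"
      using h[of n] by (simp add: I_def set_lebesgue_integral_def \<tau>S)
    also have "(LINT r:I n i|lborel. fx (\<tau> n (Suc i)) (\<xi> n i) * bb r) = - (f (\<tau> n (Suc i)) (x (\<tau> n (Suc i))) - f (\<tau> n (Suc i)) (y n i))"
      unfolding \<xi>(2)[OF that] xy[OF that] by (simp add: I_def)
    finally show ?thesis using h[of n] by (simp add: c_def)
  qed
  have \<Phi>L: "(LINT r|lborel. \<Phi> n r) = f b (x b) - f a (x a) - (\<Sum>i<Suc n. f (\<tau> n (Suc i)) (y n i) - heat_op (h n) (f (\<tau> n (Suc i))) (x (\<tau> n i)))" for n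
  proof -
    have "(LINT r|lborel. \<Phi> n r) = (\<Sum>i<Suc n. LINT r:I n i|lborel. G n i r)"
      unfolding \<Phi>_def set_lebesgue_integral_def real_scaleR_def
      by (rule Bochner_Integration.integral_sum) (use GI in \<open>simp add: set_integrable_def\<close>)
    also have "\<dots> = (\<Sum>i<Suc n. (f (\<tau> n (Suc i)) (x (\<tau> n (Suc i))) - f (\<tau> n i) (x (\<tau> n i)))
          - (f (\<tau> n (Suc i)) (y n i) - heat_op (h n) (f (\<tau> n (Suc i))) (x (\<tau> n i))))"
      by (rule sum.cong) (auto simp: GL)
    also have "\<dots> = (\<Sum>i<Suc n. f (\<tau> n (Suc i)) (x (\<tau> n (Suc i))) - f (\<tau> n i) (x (\<tau> n i)))
          - (\<Sum>i<Suc n. f (\<tau> n (Suc i)) (y n i) - heat_op (h n) (f (\<tau> n (Suc i))) (x (\<tau> n i)))"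
      by (rule sum_subtractf)
    also have "(\<Sum>i<Suc n. f (\<tau> n (Suc i)) (x (\<tau> n (Suc i))) - f (\<tau> n i) (x (\<tau> n i))) = f b (x b) - f a (x a)"
      using sum_lessThan_telescope[of "\<lambda>i. f (\<tau> n i) (x (\<tau> n i))" "Suc n"] by (simp only: \<tau>0 \<tau>N)
    finally show ?thesis .
  qed
  have Isum: "(\<Sum>i<Suc n. indicator (I n i) r) = (indicator {a<..b} r :: real)" for n r
    using sum_indicator_partition[of "h n" a r "Suc n"] h[of n] \<tau>N[of n]
    unfolding I_def \<tau> by (simp only: less_imp_le)
  have cb: "\<bar>c n i\<bar> \<le> 2 * K" if "i < Suc n" for n i
  proof -
    have "\<bar>heat_op (h n) (f (\<tau> n i + h n)) (x (\<tau> n i)) - f (\<tau> n i) (x (\<tau> n i))\<bar> \<le> 2 * K * h n"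
      by (rule generator_bound[OF ito _ h]) (use \<tau>in[of i n] \<tau>in[of "Suc i" n] that in \<open>auto simp: \<tau>S\<close>)
    then show ?thesis using h[of n] by (simp add: c_def \<tau>S abs_divide pos_divide_le_eq)
  qed
  have Gb: "\<bar>G n i r\<bar> \<le> 2 * K + K * \<bar>bb r\<bar>" if "i < Suc n" for n i r
  proof -
    have "\<bar>fx (\<tau> n (Suc i)) (\<xi> n i) * bb r\<bar> \<le> K * \<bar>bb r\<bar>"
      using props(6)[OF \<tau>in[of "Suc i" n]] that by (simp add: abs_mult mult_right_mono)
    then show ?thesis using cb[OF that] unfolding G_def by linarith
  qed
  have \<Phi>b: "\<bar>\<Phi> n r\<bar> \<le> indicator {a<..b} r * (2 * K + K * \<bar>bb r\<bar>)" for n r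
  proof -
    have "\<bar>\<Phi> n r\<bar> \<le> (\<Sum>i<Suc n. \<bar>indicator (I n i) r * G n i r\<bar>)" unfolding \<Phi>_def by (rule sum_abs)
    also have "\<dots> \<le> (\<Sum>i<Suc n. indicator (I n i) r * (2 * K + K * \<bar>bb r\<bar>))"
      by (rule sum_mono) (use Gb in \<open>auto simp: abs_mult intro!: mult_left_mono\<close>)
    also have "\<dots> = indicator {a<..b} r * (2 * K + K * \<bar>bb r\<bar>)" by (simp only: sum_distrib_right[symmetric] Isum)
    finally show ?thesis .
  qed
  have lim: "(\<lambda>n. \<Phi> n r) \<longlonglongrightarrow> indicator {a<..b} r * (ft r (x r) + fxx r (x r) / 2 - fx r (x r) * bb r)" for r
  proof (cases "r \<in> {a<..b}")
    case False
    then have "\<Phi> n r = 0" for n using \<Phi>b[of n r] by simp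
    then show ?thesis using False by simp
  next
    case r: True
    have "\<exists>i<Suc n. r \<in> I n i" for n
    proof (rule ccontr)
      assume "\<not> (\<exists>i<Suc n. r \<in> I n i)"
      then have "(\<Sum>i<Suc n. indicator (I n i) r) = (0::real)" by (intro sum.neutral) auto
      then show False using Isum[of n r] r by simp
    qed
    \<comment> \<open>\<open>i n\<close> is the cell of the mesh \<open>n\<close> that contains
      \<open>r\<close>; both of its ends converge to \<open>r\<close>.\<close>
    then obtain i where i: "\<And>n. i n < Suc n" "\<And>n. r \<in> I n (i n)" by metis
    have \<Phi>r: "\<Phi> n r = G n (i n) r" for n
    proof -
      have "indicator (I n j) r * G n j r = 0" if "j \<noteq> i n" for j
      proof -
        have "r \<notin> I n j"
          using that \<tau>mono[of "Suc j" "i n" n] \<tau>mono[of "Suc (i n)" j n] i(2)[of n] by (cases "j < i n") (auto simp: I_def)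
        then show ?thesis by simp
      qed
      then have "\<Phi> n r = (\<Sum>j\<in>{i n}. indicator (I n j) r * G n j r)"
        unfolding \<Phi>_def using i(1)[of n] by (intro sum.mono_neutral_right) auto
      then show ?thesis using i(2)[of n] by simp
    qed
    define \<sigma> where "\<sigma> n = \<tau> n (i n)" for n
    have \<sigma>S: "\<tau> n (Suc (i n)) = \<sigma> n + h n" for n by (simp add: \<sigma>_def \<tau>S)
    have \<sigma>in: "\<sigma> n \<in> {a..b}" "\<sigma> n + h n \<in> {a..b}" for n
      using \<tau>in[of "i n" n] \<tau>in[of "Suc (i n)" n] i(1)[of n] by (auto simp: \<sigma>_def \<tau>S)
    have \<sigma>r: "\<sigma> n < r" "r \<le> \<sigma> n + h n" for n using i(2)[of n] by (auto simp: I_def \<sigma>_def \<tau>S)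
    have s1: "\<sigma> \<longlonglongrightarrow> r"
    proof (rule tendsto_sandwich)
      show "(\<lambda>n. r - h n) \<longlonglongrightarrow> r" using tendsto_diff[OF tendsto_const h0, of r] by simp
      show "(\<lambda>n. r) \<longlonglongrightarrow> r" by simp
    qed (use \<sigma>r in \<open>auto intro!: always_eventually simp: less_imp_le algebra_simps\<close>)
    have s2: "(\<lambda>n. \<sigma> n + h n) \<longlonglongrightarrow> r" using tendsto_add[OF s1 h0] by simp
    have rin: "r \<in> {a..b}" using r by auto
    have x1: "(\<lambda>n. x (\<sigma> n)) \<longlonglongrightarrow> x r" "(\<lambda>n. x (\<sigma> n + h n)) \<longlonglongrightarrow> x r"
      "(\<lambda>n. \<beta> (\<sigma> n)) \<longlonglongrightarrow> \<beta> r" "(\<lambda>n. \<beta> (\<sigma> n + h n)) \<longlonglongrightarrow> \<beta> r"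
      using continuous_on_tendsto_compose[OF x s1 rin] continuous_on_tendsto_compose[OF x s2 rin]
        continuous_on_tendsto_compose[OF \<beta> s1 rin] continuous_on_tendsto_compose[OF \<beta> s2 rin] \<sigma>in by auto
    have "(\<lambda>n. \<bar>x (\<sigma> n + h n) - (x (\<sigma> n) + (\<beta> (\<sigma> n + h n) - \<beta> (\<sigma> n)))\<bar>) \<longlonglongrightarrow> \<bar>x r - (x r + (\<beta> r - \<beta> r))\<bar>"
      by (intro tendsto_intros x1)
    then have "(\<lambda>n. \<bar>x (\<sigma> n + h n) - y n (i n)\<bar>) \<longlonglongrightarrow> 0" by (simp add: y_def \<sigma>S flip: \<sigma>_def)
    then have "(\<lambda>n. \<xi> n (i n) - x (\<sigma> n + h n)) \<longlonglongrightarrow> 0"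
      by (rule Lim_null_comparison[rotated]) (use \<xi>(1)[OF i(1)] in \<open>simp add: \<sigma>S\<close>)
    from tendsto_add[OF this x1(2)] have \<xi>l: "(\<lambda>n. \<xi> n (i n)) \<longlonglongrightarrow> x r" by simp
    have "(\<lambda>n. fx (\<sigma> n + h n) (\<xi> n (i n))) \<longlonglongrightarrow> fx r (x r)"
      by (rule ito_function_tendsto(2)[OF ito \<sigma>in(2) rin s2 \<xi>l])
    moreover have "(\<lambda>n. c n (i n)) \<longlonglongrightarrow> ft r (x r) + fxx r (x r) / 2"
      using generator_tendsto[OF ito \<sigma>in(1) h \<sigma>in(2) rin s1 h0 x1(1)] by (simp add: c_def \<sigma>S flip: \<sigma>_def)
    ultimately have "(\<lambda>n. c n (i n) - fx (\<sigma> n + h n) (\<xi> n (i n)) * bb r) \<longlonglongrightarrow> ft r (x r) + fxx r (x r) / 2 - fx r (x r) * bb r"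
      by (intro tendsto_intros)
    then show ?thesis using r by (simp add: \<Phi>r G_def \<sigma>S)
  qed
  have \<Phi>i: "integrable lborel (\<Phi> n)" for n
    unfolding \<Phi>_def[abs_def] by (intro Bochner_Integration.integrable_sum) (use GI in \<open>simp add: set_integrable_def\<close>)
  have "(\<lambda>n. LINT r|lborel. \<Phi> n r) \<longlonglongrightarrow> (LINT r|lborel. indicator {a<..b} r * (ft r (x r) + fxx r (x r) / 2 - fx r (x r) * bb r))"
  proof (rule integral_dominated_convergence[where w = "\<lambda>r. indicator {a<..b} r * (2 * K + K * \<bar>bb r\<bar>)"])
    have "set_integrable lborel {a<..b} (\<lambda>r. 2 * K + K * \<bar>bb r\<bar>)"
    proof (rule set_integral_add(1))
      show "set_integrable lborel {a<..b} (\<lambda>r. 2 * K)" using ab by (simp add: set_integrable_def)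
      show "set_integrable lborel {a<..b} (\<lambda>r. K * \<bar>bb r\<bar>)" by (intro set_integrable_mult_right set_integrable_abs bb)
    qed
    then show "integrable lborel (\<lambda>r. indicator {a<..b} r * (2 * K + K * \<bar>bb r\<bar>))" by (simp add: set_integrable_def)
    show "(\<lambda>r. indicator {a<..b} r * (ft r (x r) + fxx r (x r) / 2 - fx r (x r) * bb r)) \<in> borel_measurable lborel"
      by (rule borel_measurable_LIMSEQ_real[OF lim borel_measurable_integrable[OF \<Phi>i]])
    show "\<Phi> n \<in> borel_measurable lborel" for n by (rule borel_measurable_integrable[OF \<Phi>i])
  qed (use lim \<Phi>b in auto)
  then show ?thesis unfolding \<Phi>L y_def by (simp add: set_lebesgue_integral_def)
qed

lemma set_integral_split:
  fixes f :: "real \<Rightarrow> real"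
  assumes "a \<le> p" "p \<le> q" and f: "set_integrable lborel {a..q} f"
  shows "(LINT r:{a..q}|lborel. f r) = (LINT r:{a..p}|lborel. f r) + (LINT r:{p<..q}|lborel. f r)"
proof -
  have "{a..q} = {a..p} \<union> {p<..q}" using assms by auto
  moreover have "(LINT r:{a..p} \<union> {p<..q}|lborel. f r) = (LINT r:{a..p}|lborel. f r) + (LINT r:{p<..q}|lborel. f r)"
    by (rule set_integral_Un) (use assms in \<open>auto intro: set_integrable_subset[OF f]\<close>)
  ultimately show ?thesis by simp
qed

lemma (in prob_space) integrable_mult_bounded:
  fixes Y Z :: "'a \<Rightarrow> real"
  assumes "Y \<in> borel_measurable M" "Z \<in> borel_measurable M" "\<And>\<omega>. \<bar>Y \<omega>\<bar> \<le> c" "\<And>\<omega>. \<bar>Z \<omega>\<bar> \<le> d"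
  shows "integrable M (\<lambda>\<omega>. Y \<omega> * Z \<omega>)"
proof (rule integrable_const_bound[of _ "c * d"])
  have "\<bar>Y \<omega>\<bar> * \<bar>Z \<omega>\<bar> \<le> c * d" for \<omega>
    using assms(3,4)[of \<omega>] order_trans[OF abs_ge_zero assms(3)] by (intro mult_mono) auto
  then show "AE \<omega> in M. norm (Y \<omega> * Z \<omega>) \<le> c * d" by (simp add: abs_mult)
qed (use assms(1,2) in measurable)

text \<open>Of the drift only integrability in time along almost every path is known; measurability
  in the sample point has to come from the adapted processes \<open>X\<close> and
  \<open>B\<close>.\<close>

locale drifted_bm = bm_filtration M F B
  for M :: "'a measure" and F :: "real \<Rightarrow> 'a measure" and B :: "real \<Rightarrow> 'a \<Rightarrow> real" +
  fixes X :: "real \<Rightarrow> 'a \<Rightarrow> real" and b :: "'a \<Rightarrow> real \<Rightarrow> real" and u T :: real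
  assumes X_measurable: "\<And>t. t \<in> {0..<T} \<Longrightarrow> X t \<in> borel_measurable (F t)"
    and X_eq: "AE \<omega> in M. \<forall>t\<in>{0..<T}. set_integrable lborel {0..t} (b \<omega>) \<and>
        X t \<omega> = u + B t \<omega> - (LINT s:{0..t}|lborel. b \<omega> s)"
begin

definition good_path :: "'a \<Rightarrow> bool" where
  "good_path \<omega> \<longleftrightarrow> B 0 \<omega> = 0 \<and> continuous_on {0..} (\<lambda>t. B t \<omega>) \<and>
     (\<forall>t\<in>{0..<T}. set_integrable lborel {0..t} (b \<omega>) \<and> X t \<omega> = u + B t \<omega> - (LINT s:{0..t}|lborel. b \<omega> s))"

lemma AE_good_path: "AE \<omega> in M. good_path \<omega>"
proof -
  have "AE \<omega> in M. continuous_on {0..} (\<lambda>t. B t \<omega>)" "AE \<omega> in M. B 0 \<omega> = 0"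
    using bm unfolding brownian_motion_def by blast+
  then show ?thesis using X_eq by eventually_elim (simp add: good_path_def)
qed

lemma good_path_continuous:
  assumes "good_path \<omega>" "0 \<le> t" "t < T"
  shows "continuous_on {0..t} (\<lambda>s. X s \<omega>)"
proof -
  have bi: "set_integrable lborel {0..s} (b \<omega>)" "X s \<omega> = u + B s \<omega> - (LINT s:{0..s}|lborel. b \<omega> s)" if "s \<in> {0..t}" for s
    using assms that by (auto simp: good_path_def)
  have "continuous_on {0..t} (\<lambda>s. integral {0..s} (b \<omega>))"
    by (rule indefinite_integral_continuous_1) (use set_borel_integral_eq_integral(1)[OF bi(1)] assms in auto)
  moreover have "(LINT r:{0..s}|lborel. b \<omega> r) = integral {0..s} (b \<omega>)" if "s \<in> {0..t}" for s
    by (rule set_borel_integral_eq_integral(2)[OF bi(1)[OF that]])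
  ultimately have "continuous_on {0..t} (\<lambda>s. LINT r:{0..s}|lborel. b \<omega> r)" by (rule continuous_on_eq[OF _ sym])
  moreover have "continuous_on {0..t} (\<lambda>s. B s \<omega>)"
    using assms unfolding good_path_def by (auto intro: continuous_on_subset)
  ultimately have "continuous_on {0..t} (\<lambda>s. u + B s \<omega> - (LINT r:{0..s}|lborel. b \<omega> r))" by (intro continuous_intros)
  then show ?thesis by (rule continuous_on_eq) (use bi(2) in simp)
qed

lemma X_M_measurable: "0 \<le> t \<Longrightarrow> t < T \<Longrightarrow> X t \<in> borel_measurable M"
  using F_measurable_M X_measurable by auto

text \<open>\<open>D\<close> is a martingale difference: freezing the past gives mean zero against
  variables of \<open>F p\<close>. Its second moment is linear in \<open>q - p\<close>: the noise
  moves \<open>g\<close> by at most \<open>K * |B q - B p|\<close>, the average by at most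
  \<open>(q - p) * K / 2\<close>, and \<open>(q - p)^2 <= T * (q - p)\<close>.\<close>

lemma increment_term:
  fixes g g' g'' :: "real \<Rightarrow> real"
  assumes pq: "0 \<le> p" "p < q" "q < T"
    and g: "\<And>x. (g has_real_derivative g' x) (at x)" "\<And>x. (g' has_real_derivative g'' x) (at x)"
    and K: "\<And>x. \<bar>g x\<bar> \<le> K" "\<And>x. \<bar>g' x\<bar> \<le> K" "\<And>x. \<bar>g'' x\<bar> \<le> K"
  defines "D \<equiv> \<lambda>\<omega>. g (X p \<omega> + (B q \<omega> - B p \<omega>)) - heat_op (q - p) g (X p \<omega>)"
  shows "D \<in> borel_measurable (F q)" "\<bar>D \<omega>\<bar> \<le> 2 * K"
    "W \<in> borel_measurable (F p) \<Longrightarrow> (\<And>\<omega>. \<bar>W \<omega>\<bar> \<le> c) \<Longrightarrow> expectation (\<lambda>\<omega>. W \<omega> * D \<omega>) = 0"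
    "expectation (\<lambda>\<omega>. (D \<omega>)\<^sup>2) \<le> (2 * K\<^sup>2 + K\<^sup>2 * T) * (q - p)"
proof -
  have h: "0 < q - p" using pq by simp
  have gm[measurable]: "g \<in> borel_measurable borel"
    by (intro borel_measurable_continuous_onI DERIV_continuous_on[of UNIV _ g']) (use g in auto)
  note [measurable] = heat_op_bounds(2)[OF gm K(1) h]
  have [measurable]: "X p \<in> borel_measurable (F q)" "B p \<in> borel_measurable (F q)" "B q \<in> borel_measurable (F q)"
    using pq F_measurable_mono[OF less_imp_le[OF pq(2)] X_measurable[of p]] F_measurable_mono[OF less_imp_le[OF pq(2)] B_measurable[of p]] B_measurable[of q]
    by auto
  show DF: "D \<in> borel_measurable (F q)" unfolding D_def by measurable
  have [measurable]: "D \<in> borel_measurable M" by (rule F_measurable_M[OF _ DF]) (use pq in simp)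
  have [measurable]: "X p \<in> borel_measurable M" using X_M_measurable pq by simp
  have [measurable]: "B p \<in> borel_measurable M" "B q \<in> borel_measurable M"
    using pq F_measurable_M[OF _ B_measurable] by auto
  show Db: "\<bar>D \<omega>\<bar> \<le> 2 * K" for \<omega>
    using K(1)[of "X p \<omega> + (B q \<omega> - B p \<omega>)"] heat_op_bounds(1)[OF gm K(1) h, of "X p \<omega>"] unfolding D_def by linarith
  show "expectation (\<lambda>\<omega>. W \<omega> * D \<omega>) = 0" if W: "W \<in> borel_measurable (F p)" and c: "\<And>\<omega>. \<bar>W \<omega>\<bar> \<le> c" for W c
  proof -
    have [measurable]: "W \<in> borel_measurable M" by (rule F_measurable_M[OF pq(1) W])
    have "expectation (\<lambda>\<omega>. W \<omega> * g (X p \<omega> + (B q \<omega> - B p \<omega>))) = expectation (\<lambda>\<omega>. W \<omega> * (LINT z|lborel. normal_density 0 (sqrt (q - p)) z * g (X p \<omega> + z)))"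
      using increment_freeze[OF pq(1,2) W c X_measurable[of p], of "\<lambda>y z. g (y + z)" K] K(1) pq by simp
    moreover have "integrable M (\<lambda>\<omega>. W \<omega> * g (X p \<omega> + (B q \<omega> - B p \<omega>)))"
      by (rule integrable_mult_bounded[OF _ _ c K(1)]) measurable
    moreover have "integrable M (\<lambda>\<omega>. W \<omega> * heat_op (q - p) g (X p \<omega>))"
      by (rule integrable_mult_bounded[OF _ _ c heat_op_bounds(1)[OF gm K(1) h]]) measurable
    ultimately show ?thesis by (simp add: D_def right_diff_distrib heat_op_def)
  qed
  have K0: "0 \<le> K" using K(1)[of 0] by simp
  have Dsq: "(D \<omega>)\<^sup>2 \<le> 2 * K\<^sup>2 * (B q \<omega> - B p \<omega>)\<^sup>2 + K\<^sup>2 * T * (q - p)" for \<omega>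
  proof -
    define \<alpha> where "\<alpha> = g (X p \<omega> + (B q \<omega> - B p \<omega>)) - g (X p \<omega>)"
    define \<gamma> where "\<gamma> = heat_op (q - p) g (X p \<omega>) - g (X p \<omega>)"
    obtain \<xi> where "\<alpha> = g' \<xi> * (B q \<omega> - B p \<omega>)"
      using mvt_between[of g g', OF g(1), of "X p \<omega> + (B q \<omega> - B p \<omega>)" "X p \<omega>"] by (auto simp: \<alpha>_def)
    then have "\<bar>\<alpha>\<bar> \<le> K * \<bar>B q \<omega> - B p \<omega>\<bar>" using K(2)[of \<xi>] by (simp add: abs_mult mult_right_mono)
    then have "\<bar>\<alpha>\<bar>\<^sup>2 \<le> (K * \<bar>B q \<omega> - B p \<omega>\<bar>)\<^sup>2" by (intro power_mono) auto
    then have \<alpha>2: "\<alpha>\<^sup>2 \<le> K\<^sup>2 * (B q \<omega> - B p \<omega>)\<^sup>2" by (simp add: power_mult_distrib)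
    have "\<bar>\<gamma>\<bar> \<le> (q - p) * K / 2" unfolding \<gamma>_def by (rule heat_op_minus(3)[OF g K(1,3) h])
    then have "\<bar>\<gamma>\<bar>\<^sup>2 \<le> ((q - p) * K / 2)\<^sup>2" by (intro power_mono) auto
    also have "\<dots> = K\<^sup>2 * (q - p) * (q - p) / 4" by (simp add: power2_eq_square)
    also have "\<dots> \<le> K\<^sup>2 * (q - p) * T / 4" using pq K0 by (intro divide_right_mono mult_left_mono) auto
    finally have \<gamma>2: "\<gamma>\<^sup>2 \<le> K\<^sup>2 * T * (q - p) / 4" by (simp add: mult_ac)
    have "0 \<le> K\<^sup>2 * T * (q - p)" using pq by simp
    moreover have "0 \<le> (\<alpha> + \<gamma>)\<^sup>2" by simp
    then have "(D \<omega>)\<^sup>2 \<le> 2 * \<alpha>\<^sup>2 + 2 * \<gamma>\<^sup>2" by (simp add: D_def \<alpha>_def \<gamma>_def power2_eq_square algebra_simps)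
    ultimately show ?thesis using \<alpha>2 \<gamma>2 by linarith
  qed
  have i: "integrable M (\<lambda>\<omega>. 2 * K\<^sup>2 * (B q \<omega> - B p \<omega>)\<^sup>2 + K\<^sup>2 * T * (q - p))"
    using increment_second_moment(1)[OF pq(1,2)] by simp
  have "integrable M (\<lambda>\<omega>. (D \<omega>)\<^sup>2)"
    by (rule Bochner_Integration.integrable_bound[OF i]) (use Dsq in \<open>auto intro: order_trans[OF _ abs_ge_self]\<close>)
  then have "expectation (\<lambda>\<omega>. (D \<omega>)\<^sup>2) \<le> expectation (\<lambda>\<omega>. 2 * K\<^sup>2 * (B q \<omega> - B p \<omega>)\<^sup>2 + K\<^sup>2 * T * (q - p))"
    by (intro integral_mono i Dsq)
  also have "\<dots> = 2 * K\<^sup>2 * expectation (\<lambda>\<omega>. (B q \<omega> - B p \<omega>)\<^sup>2) + K\<^sup>2 * T * (q - p)"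
    using increment_second_moment(1)[OF pq(1,2)] by (simp add: prob_space)
  also have "\<dots> = (2 * K\<^sup>2 + K\<^sup>2 * T) * (q - p)"
    unfolding increment_second_moment(2)[OF pq(1,2)] by (simp add: algebra_simps)
  finally show "expectation (\<lambda>\<omega>. (D \<omega>)\<^sup>2) \<le> (2 * K\<^sup>2 + K\<^sup>2 * T) * (q - p)" .
qed

text \<open>\<open>V\<close> is the limit of the increment of \<open>f\<close> minus sums of
  martingale differences. By orthogonality these sums are bounded in L2 by a multiple of the total
  length \<open>t - s\<close>, for every mesh, and the L2 bound lets their vanishing mean against
  \<open>Z\<close> survive the limit. The constant \<open>8 * K^2\<close> is twice the square of the
  bound \<open>2 * K\<close> for the increment.\<close>

lemma ito_expectation:
  assumes st: "0 \<le> s" "s < t" "t < T" and ito: "ito_function s t f ft fx fxx K"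
  shows "\<exists>V. V \<in> borel_measurable M \<and> integrable M (\<lambda>\<omega>. (V \<omega>)\<^sup>2) \<and>
     expectation (\<lambda>\<omega>. (V \<omega>)\<^sup>2) \<le> 8 * K\<^sup>2 + 2 * (2 * K\<^sup>2 + K\<^sup>2 * T) * (t - s) \<and>
     (\<forall>\<omega>. good_path \<omega> \<longrightarrow> V \<omega> = (LINT r:{s<..t}|lborel. ft r (X r \<omega>) + fxx r (X r \<omega>) / 2 - fx r (X r \<omega>) * b \<omega> r)) \<and>
     (\<forall>Z c. Z \<in> borel_measurable (F s) \<longrightarrow> (\<forall>\<omega>. \<bar>Z \<omega>\<bar> \<le> c) \<longrightarrow>
        expectation (\<lambda>\<omega>. Z \<omega> * (f t (X t \<omega>) - f s (X s \<omega>))) = expectation (\<lambda>\<omega>. Z \<omega> * V \<omega>))"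
proof -
  define h where "h n = (t - s) / real (Suc n)" for n
  define \<tau> where "\<tau> n i = s + real i * ((t - s) / real (Suc n))" for n i
  have h: "0 < h n" for n using st by (simp add: h_def)
  have \<tau>: "\<tau> n i = s + real i * h n" for n i by (simp add: \<tau>_def h_def)
  have \<tau>0: "\<tau> n 0 = s" for n by (simp add: \<tau>)
  have \<tau>N: "\<tau> n (Suc n) = t" for n by (simp add: \<tau> h_def del: of_nat_Suc)
  have \<tau>S: "\<tau> n (Suc i) - \<tau> n i = h n" for n i by (simp add: \<tau> algebra_simps)
  have \<tau>mono: "\<tau> n i \<le> \<tau> n j" if "i \<le> j" for n i j using that h[of n] by (simp add: \<tau>)
  have \<tau>in: "\<tau> n i \<in> {s..t}" if "i \<le> Suc n" for n i
    using \<tau>mono[of 0 i n] \<tau>mono[OF that, of n] by (simp add: \<tau>0 \<tau>N)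
  note props = ito_function_props[OF ito]
  define D where "D n i \<omega> = f (\<tau> n (Suc i)) (X (\<tau> n i) \<omega> + (B (\<tau> n (Suc i)) \<omega> - B (\<tau> n i) \<omega>)) - heat_op (h n) (f (\<tau> n (Suc i))) (X (\<tau> n i) \<omega>)" for n i \<omega>
  define C where "C = 2 * K\<^sup>2 + K\<^sup>2 * T"
  have D: "D n i \<in> borel_measurable (F (\<tau> n (Suc i)))" "\<bar>D n i \<omega>\<bar> \<le> 2 * K"
    "W \<in> borel_measurable (F (\<tau> n i)) \<Longrightarrow> (\<And>\<omega>. \<bar>W \<omega>\<bar> \<le> c) \<Longrightarrow> expectation (\<lambda>\<omega>. W \<omega> * D n i \<omega>) = 0"
    "expectation (\<lambda>\<omega>. (D n i \<omega>)\<^sup>2) \<le> C * h n" if i: "i < Suc n" for n i \<omega> W c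
  proof -
    have 1: "0 \<le> \<tau> n i" "\<tau> n i < \<tau> n (Suc i)" "\<tau> n (Suc i) < T"
      using \<tau>in[of i n] \<tau>in[of "Suc i" n] \<tau>S[of n i] h[of n] i st by auto
    have 2: "\<tau> n (Suc i) \<in> {s..t}" using i by (intro \<tau>in) simp
    note I = increment_term[OF 1 props(2,3,4,6,7)[OF 2], unfolded \<tau>S, folded D_def]
    show "D n i \<in> borel_measurable (F (\<tau> n (Suc i)))" using I(1) by (simp add: D_def[abs_def])
    show "\<bar>D n i \<omega>\<bar> \<le> 2 * K" by (rule I(2))
    show "W \<in> borel_measurable (F (\<tau> n i)) \<Longrightarrow> (\<And>\<omega>. \<bar>W \<omega>\<bar> \<le> c) \<Longrightarrow> expectation (\<lambda>\<omega>. W \<omega> * D n i \<omega>) = 0" by (rule I(3))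
    show "expectation (\<lambda>\<omega>. (D n i \<omega>)\<^sup>2) \<le> C * h n" unfolding C_def by (rule I(4))
  qed
  have FM: "g \<in> borel_measurable (F (\<tau> n i)) \<Longrightarrow> g \<in> borel_measurable M" if "i \<le> Suc n" for g :: "'a \<Rightarrow> real" and n i
    by (rule F_measurable_M) (use \<tau>in[OF that] st in auto)
  have S: "(\<lambda>\<omega>. \<Sum>i<j. D n i \<omega>) \<in> borel_measurable (F (\<tau> n j)) \<and> (\<forall>\<omega>. \<bar>\<Sum>i<j. D n i \<omega>\<bar> \<le> 2 * K * real j) \<and>
      expectation (\<lambda>\<omega>. (\<Sum>i<j. D n i \<omega>)\<^sup>2) \<le> C * h n * real j" if "j \<le> Suc n" for n j
    using that
  proof (induction j)
    case (Suc j)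
    then have j: "j < Suc n" by simp
    note IH = Suc.IH[OF less_imp_le[OF j]]
    let ?S = "\<lambda>\<omega>. \<Sum>i<j. D n i \<omega>"
    have Sm: "?S \<in> borel_measurable (F (\<tau> n j))" and Sb: "\<And>\<omega>. \<bar>?S \<omega>\<bar> \<le> 2 * K * real j"
      and Se: "expectation (\<lambda>\<omega>. (?S \<omega>)\<^sup>2) \<le> C * h n * real j" using IH by auto
    have "?S \<in> borel_measurable (F (\<tau> n (Suc j)))" by (rule F_measurable_mono[OF \<tau>mono Sm]) simp
    then have 1: "(\<lambda>\<omega>. \<Sum>i<Suc j. D n i \<omega>) \<in> borel_measurable (F (\<tau> n (Suc j)))" using D(1)[OF j] by simp
    have 2: "\<bar>\<Sum>i<Suc j. D n i \<omega>\<bar> \<le> 2 * K * real (Suc j)" for \<omega>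
      using D(2)[OF j, of \<omega>] Sb[of \<omega>] by (simp add: algebra_simps)
    have [measurable]: "?S \<in> borel_measurable M" "D n j \<in> borel_measurable M"
      using FM[OF less_imp_le[OF j] Sm] FM[OF _ D(1)[OF j]] j by auto
    have sq: "norm (x\<^sup>2) \<le> c\<^sup>2" if "\<bar>x\<bar> \<le> c" for x c :: real
      using power_mono[OF that abs_ge_zero, of 2] by simp
    have i1: "integrable M (\<lambda>\<omega>. (?S \<omega>)\<^sup>2)"
      by (rule integrable_const_bound[of _ "(2 * K * real j)\<^sup>2"]) (intro AE_I2 sq Sb, measurable)
    have i2: "integrable M (\<lambda>\<omega>. (D n j \<omega>)\<^sup>2)"
      by (rule integrable_const_bound[of _ "(2 * K)\<^sup>2"]) (intro AE_I2 sq D(2)[OF j], measurable)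
    have i3: "integrable M (\<lambda>\<omega>. 2 * (?S \<omega> * D n j \<omega>))"
      by (intro integrable_mult_right integrable_mult_bounded[OF _ _ Sb D(2)[OF j]]) measurable
    have "expectation (\<lambda>\<omega>. (\<Sum>i<Suc j. D n i \<omega>)\<^sup>2) = expectation (\<lambda>\<omega>. (?S \<omega>)\<^sup>2 + 2 * (?S \<omega> * D n j \<omega>) + (D n j \<omega>)\<^sup>2)"
      by (simp add: power2_sum algebra_simps)
    also have "\<dots> = expectation (\<lambda>\<omega>. (?S \<omega>)\<^sup>2) + 2 * expectation (\<lambda>\<omega>. ?S \<omega> * D n j \<omega>) + expectation (\<lambda>\<omega>. (D n j \<omega>)\<^sup>2)"
      using i1 i2 i3 by simp
    \<comment> \<open>Orthogonality: the earlier sum is measurable at the left end of the interval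
      and can serve as test variable.\<close>
    also have "expectation (\<lambda>\<omega>. ?S \<omega> * D n j \<omega>) = 0" by (rule D(3)[OF j Sm Sb])
    finally have "expectation (\<lambda>\<omega>. (\<Sum>i<Suc j. D n i \<omega>)\<^sup>2) \<le> C * h n * real (Suc j)"
      using Se D(4)[OF j] by (simp add: algebra_simps)
    with 1 2 show ?case by blast
  qed (auto simp: prob_space)
  define R where "R n \<omega> = f t (X t \<omega>) - f s (X s \<omega>) - (\<Sum>i<Suc n. D n i \<omega>)" for n \<omega>
  have [measurable]: "(\<lambda>\<omega>. \<Sum>i<Suc n. D n i \<omega>) \<in> borel_measurable M" for n
    using FM[OF _ conjunct1[OF S[of "Suc n" n]]] by simp
  have [measurable]: "X s \<in> borel_measurable M" "X t \<in> borel_measurable M" using X_M_measurable st by auto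
  have [measurable]: "f s \<in> borel_measurable borel" "f t \<in> borel_measurable borel" using props(8) st by auto
  have Rm[measurable]: "R n \<in> borel_measurable M" for n unfolding R_def by measurable
  have fb: "\<bar>f t (X t \<omega>) - f s (X s \<omega>)\<bar> \<le> 2 * K" for \<omega>
    using props(4)[of t "X t \<omega>"] props(4)[of s "X s \<omega>"] st by auto
  have Ssq: "integrable M (\<lambda>\<omega>. (\<Sum>i<Suc n. D n i \<omega>)\<^sup>2)" for n
  proof (rule integrable_const_bound[of _ "(2 * K * real (Suc n))\<^sup>2"])
    have "\<bar>\<Sum>i<Suc n. D n i \<omega>\<bar> \<le> 2 * K * real (Suc n)" for \<omega> using S[of "Suc n" n] by blast
    then have "(\<Sum>i<Suc n. D n i \<omega>)\<^sup>2 \<le> (2 * K * real (Suc n))\<^sup>2" for \<omega> by (metis abs_ge_zero power2_abs power_mono)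
    then show "AE \<omega> in M. norm ((\<Sum>i<Suc n. D n i \<omega>)\<^sup>2) \<le> (2 * K * real (Suc n))\<^sup>2" by simp
  qed measurable
  have Rle: "(R n \<omega>)\<^sup>2 \<le> 8 * K\<^sup>2 + 2 * (\<Sum>i<Suc n. D n i \<omega>)\<^sup>2" for n \<omega>
  proof -
    define d where "d = f t (X t \<omega>) - f s (X s \<omega>)"
    define S' where "S' = (\<Sum>i<Suc n. D n i \<omega>)"
    have "d\<^sup>2 \<le> (2 * K)\<^sup>2" using fb[of \<omega>] unfolding d_def[symmetric] by (metis abs_ge_zero power2_abs power_mono)
    moreover have "0 \<le> (d + S')\<^sup>2" by simp
    then have "(d - S')\<^sup>2 \<le> 2 * d\<^sup>2 + 2 * S'\<^sup>2" by (simp add: power2_eq_square algebra_simps)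
    ultimately show ?thesis unfolding R_def d_def[symmetric] S'_def[symmetric] by (simp add: power_mult_distrib)
  qed
  have Rsq: "integrable M (\<lambda>\<omega>. (R n \<omega>)\<^sup>2)" for n
    by (rule Bochner_Integration.integrable_bound[of _ "\<lambda>\<omega>. 8 * K\<^sup>2 + 2 * (\<Sum>i<Suc n. D n i \<omega>)\<^sup>2"])
       (use Ssq Rle in \<open>auto intro: order_trans[OF _ abs_ge_self] simp del: sum.lessThan_Suc\<close>)
  have RE: "expectation (\<lambda>\<omega>. (R n \<omega>)\<^sup>2) \<le> 8 * K\<^sup>2 + 2 * C * (t - s)" for n
  proof -
    have "expectation (\<lambda>\<omega>. (R n \<omega>)\<^sup>2) \<le> expectation (\<lambda>\<omega>. 8 * K\<^sup>2 + 2 * (\<Sum>i<Suc n. D n i \<omega>)\<^sup>2)"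
      by (intro integral_mono Rsq Rle Bochner_Integration.integrable_add integrable_mult_right Ssq) simp
    also have "\<dots> = 8 * K\<^sup>2 + 2 * expectation (\<lambda>\<omega>. (\<Sum>i<Suc n. D n i \<omega>)\<^sup>2)"
      using Ssq[of n] by (simp add: prob_space del: sum.lessThan_Suc)
    also have "expectation (\<lambda>\<omega>. (\<Sum>i<Suc n. D n i \<omega>)\<^sup>2) \<le> C * h n * real (Suc n)" using S[of "Suc n" n] by blast
    also have "C * h n * real (Suc n) = C * (t - s)" by (simp add: h_def del: of_nat_Suc)
    finally show ?thesis by simp
  qed
  have lim: "(\<lambda>n. R n \<omega>) \<longlonglongrightarrow> (LINT r:{s<..t}|lborel. ft r (X r \<omega>) + fxx r (X r \<omega>) / 2 - fx r (X r \<omega>) * b \<omega> r)"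
    if good: "good_path \<omega>" for \<omega>
    unfolding R_def D_def \<tau>_def h_def
  proof (rule ito_pathwise[OF ito st(2)])
    have Xc: "continuous_on {0..t} (\<lambda>r. X r \<omega>)" by (rule good_path_continuous[OF good]) (use st in auto)
    show "continuous_on {s..t} (\<lambda>r. X r \<omega>)" by (rule continuous_on_subset[OF Xc]) (use st in auto)
    show "continuous_on {s..t} (\<lambda>r. B r \<omega>)" using good st unfolding good_path_def by (auto intro: continuous_on_subset)
    have bi: "set_integrable lborel {0..q} (b \<omega>)" "X q \<omega> = u + B q \<omega> - (LINT s:{0..q}|lborel. b \<omega> s)" if "0 \<le> q" "q \<le> t" for q
      using good that st unfolding good_path_def by auto
    show "set_integrable lborel {s<..t} (b \<omega>)" by (rule set_integrable_subset[OF bi(1)[of t]]) (use st in auto)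
    show "X q \<omega> - X p \<omega> = B q \<omega> - B p \<omega> - (LINT r:{p<..q}|lborel. b \<omega> r)" if "s \<le> p" "p \<le> q" "q \<le> t" for p q
      using bi(2)[of p] bi[of q] set_integral_split[of 0 p q "b \<omega>"] that st by simp
  qed
  \<comment> \<open>Defined as a limit of measurable functions at every sample point; the integral
    with which it agrees on good paths is not known to be measurable.\<close>
  define V where "V \<omega> = lim (\<lambda>n. R n \<omega>)" for \<omega>
  have Vm[measurable]: "V \<in> borel_measurable M" unfolding V_def by measurable
  have Veq: "V \<omega> = (LINT r:{s<..t}|lborel. ft r (X r \<omega>) + fxx r (X r \<omega>) / 2 - fx r (X r \<omega>) * b \<omega> r)" if "good_path \<omega>" for \<omega>
    unfolding V_def by (rule limI[OF lim[OF that]])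
  have Vlim: "AE \<omega> in M. (\<lambda>n. R n \<omega>) \<longlonglongrightarrow> V \<omega>"
    using AE_good_path by eventually_elim (simp add: Veq lim)
  note L2 = L2_bounded_limit[OF Rm Vm Rsq RE Vlim]
  have "expectation (\<lambda>\<omega>. Z \<omega> * (f t (X t \<omega>) - f s (X s \<omega>))) = expectation (\<lambda>\<omega>. Z \<omega> * V \<omega>)"
    if Z: "Z \<in> borel_measurable (F s)" and c: "\<And>\<omega>. \<bar>Z \<omega>\<bar> \<le> c" for Z c
  proof -
    have [measurable]: "Z \<in> borel_measurable M" by (rule F_measurable_M[OF st(1) Z])
    have "expectation (\<lambda>\<omega>. Z \<omega> * R n \<omega>) = expectation (\<lambda>\<omega>. Z \<omega> * (f t (X t \<omega>) - f s (X s \<omega>)))" for n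
    proof -
      have ZD: "integrable M (\<lambda>\<omega>. Z \<omega> * D n i \<omega>)" "expectation (\<lambda>\<omega>. Z \<omega> * D n i \<omega>) = 0" if i: "i < Suc n" for i
      proof -
        have [measurable]: "D n i \<in> borel_measurable M" using FM[OF _ D(1)[OF i]] i by simp
        show "integrable M (\<lambda>\<omega>. Z \<omega> * D n i \<omega>)"
          by (rule integrable_mult_bounded[OF _ _ c D(2)[OF i]]) measurable
        have "Z \<in> borel_measurable (F (\<tau> n i))" by (rule F_measurable_mono[OF _ Z]) (use \<tau>mono[of 0 i n] in \<open>simp add: \<tau>0\<close>)
        then show "expectation (\<lambda>\<omega>. Z \<omega> * D n i \<omega>) = 0" by (rule D(3)[OF i _ c])
      qed
      have "integrable M (\<lambda>\<omega>. Z \<omega> * (f t (X t \<omega>) - f s (X s \<omega>)))"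
        by (rule integrable_mult_bounded[OF _ _ c fb]) measurable
      moreover have "integrable M (\<lambda>\<omega>. \<Sum>i<Suc n. Z \<omega> * D n i \<omega>)" using ZD(1) by (intro Bochner_Integration.integrable_sum) auto
      moreover have "expectation (\<lambda>\<omega>. \<Sum>i<Suc n. Z \<omega> * D n i \<omega>) = 0"
        using ZD by (subst Bochner_Integration.integral_sum) auto
      ultimately show ?thesis
        by (simp add: R_def right_diff_distrib sum_distrib_left del: sum.lessThan_Suc)
    qed
    then have "(\<lambda>n. expectation (\<lambda>\<omega>. Z \<omega> * R n \<omega>)) \<longlonglongrightarrow> expectation (\<lambda>\<omega>. Z \<omega> * (f t (X t \<omega>) - f s (X s \<omega>)))" by simp
    moreover have "(\<lambda>n. expectation (\<lambda>\<omega>. Z \<omega> * R n \<omega>)) \<longlonglongrightarrow> expectation (\<lambda>\<omega>. Z \<omega> * V \<omega>)"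
      by (rule L2(3)[OF _ c]) measurable
    ultimately show ?thesis by (rule LIMSEQ_unique)
  qed
  then show ?thesis using L2(1,2) Veq Vm unfolding C_def by blast
qed

end

section \<open>Iterated signed kernels\<close>

text \<open>The signed integral of a product with one factor per time. Factors are indexed by the
  time itself, so that a single one can be exchanged by a function update.\<close>

primrec chain :: "real \<Rightarrow> real \<Rightarrow> real \<Rightarrow> real list \<Rightarrow> (real \<Rightarrow> real \<Rightarrow> real) \<Rightarrow> real" where
  "chain r s x [] G = 1"
| "chain r s x (t # ts) G = p_minus_int r (t - s) x (\<lambda>y. G t y * chain r t y ts G)"

text \<open>\<open>S\<close> collects the times already integrated over; for the remaining kernels
  their factors are constants and move out.\<close>

lemma Y_integral_product:
  assumes "distinct ts" "finite S" "S \<inter> set ts = {}"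
  shows "Y_integral r s x ts (\<lambda>\<xi>. \<Prod>t\<in>S \<union> set ts. G t (\<xi> t)) \<xi> = (\<Prod>t\<in>S. G t (\<xi> t)) * chain r s x ts G"
  using assms
proof (induction ts arbitrary: S s x \<xi>)
  case (Cons t ts)
  have "Y_integral r t y ts (\<lambda>\<xi>. \<Prod>t\<in>S \<union> set (t # ts). G t (\<xi> t)) (\<xi>(t := y))
      = (\<Prod>t\<in>S. G t (\<xi> t)) * (G t y * chain r t y ts G)" for y
  proof -
    have "Y_integral r t y ts (\<lambda>\<xi>. \<Prod>t\<in>insert t S \<union> set ts. G t (\<xi> t)) (\<xi>(t := y))
      = (\<Prod>t'\<in>insert t S. G t' ((\<xi>(t := y)) t')) * chain r t y ts G"
      by (rule Cons.IH) (use Cons.prems in auto)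
    also have "(\<Prod>t'\<in>insert t S. G t' ((\<xi>(t := y)) t')) = G t y * (\<Prod>t'\<in>S. G t' ((\<xi>(t := y)) t'))"
      using Cons.prems by (subst prod.insert) auto
    also have "(\<Prod>t'\<in>S. G t' ((\<xi>(t := y)) t')) = (\<Prod>t'\<in>S. G t' (\<xi> t'))"
      by (rule prod.cong) (use Cons.prems in auto)
    finally show ?thesis by (simp add: mult_ac del: fun_upd_apply)
  qed
  then show ?case by (simp only: Y_integral.simps chain.simps p_minus_int_cmult)
qed simp

lemma p_minus_int_cong:
  assumes "\<And>y. y \<in> {0..<2*pi*r} \<Longrightarrow> f y = g y"
  shows "p_minus_int r t x f = p_minus_int r t x g"
proof -
  have "(\<lambda>w::int. (-1) powi w * (indicator {0..<2 * pi * r} (x - 2 * pi * r * of_int w) * f (x - 2 * pi * r * of_int w)))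
     = (\<lambda>w. (-1) powi w * (indicator {0..<2 * pi * r} (x - 2 * pi * r * of_int w) * g (x - 2 * pi * r * of_int w)))"
    using assms by (auto simp: indicator_def)
  moreover have "(LINT y:{0..<2 * pi * r}|lborel. p_minus r t y x * f y) = (LINT y:{0..<2 * pi * r}|lborel. p_minus r t y x * g y)"
    by (rule set_lebesgue_integral_cong) (use assms in auto)
  ultimately show ?thesis by (simp add: p_minus_int_def)
qed

lemma chain_cong: "(\<And>t. t \<in> set ts \<Longrightarrow> G t = G' t) \<Longrightarrow> chain r s x ts G = chain r s x ts G'"
  by (induction ts arbitrary: s x) simp_all

text \<open>Only the first step can have length zero, and it must then start inside the period,
  where the kernel at time zero is the identity; strict sorting makes all later steps
  positive.\<close>

definition chain_start :: "real \<Rightarrow> real \<Rightarrow> real \<Rightarrow> real list \<Rightarrow> bool" where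
  "chain_start r s x ts \<longleftrightarrow> sorted_wrt (<) ts \<and>
     ((\<forall>t\<in>set ts. s < t) \<or> (x \<in> {0..<2*pi*r} \<and> (\<forall>t\<in>set ts. s \<le> t)))"

lemma chain_start_Cons:
  assumes "chain_start r s x (t # ts)"
  shows "0 < t - s \<or> t - s = 0 \<and> x \<in> {0..<2*pi*r}" "chain_start r t y ts"
    "sorted_wrt (<) ts" "\<forall>t'\<in>set ts. t < t'" "t \<notin> set ts"
  using assms by (auto simp: chain_start_def)

lemma chain_bounded:
  assumes r: "0 < r" and "sorted_wrt (<) ts" "\<forall>t\<in>set ts. s < t"
    and "\<And>t. t \<in> set ts \<Longrightarrow> G t \<in> borel_measurable borel" "\<And>t y. t \<in> set ts \<Longrightarrow> \<bar>G t y\<bar> \<le> C t"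
  shows "(\<lambda>x. chain r s x ts G) \<in> borel_measurable borel \<and> (\<forall>x. \<bar>chain r s x ts G\<bar> \<le> prod_list (map C ts))"
  using assms(2-)
proof (induction ts arbitrary: s)
  case (Cons t ts)
  have IH: "(\<lambda>x. chain r t x ts G) \<in> borel_measurable borel" "\<bar>chain r t x ts G\<bar> \<le> prod_list (map C ts)" for x
    using Cons.IH[of t] Cons.prems by auto
  have m: "(\<lambda>y. G t y * chain r t y ts G) \<in> borel_measurable borel" using IH Cons.prems(3)[of t] by simp
  have b: "\<bar>G t y * chain r t y ts G\<bar> \<le> prod_list (map C (t # ts))" for y
    using mult_mono[OF Cons.prems(4)[of t y] IH(2)[of y]] order_trans[OF abs_ge_zero Cons.prems(4)[of t y]] by (simp add: abs_mult)
  have st: "0 < t - s" using Cons.prems(2) by simp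
  show ?case
    using p_minus_int_measurable[OF r st m] p_minus_int_bound[OF r disjI1[OF st] m b] by simp
qed simp

text \<open>Linearity in one factor and, in the next lemma, continuity under bounded pointwise
  limits are what the closure principle asks of the kernel side.\<close>

lemma chain_linear:
  assumes r: "0 < r" and st: "chain_start r s x ts" and t0: "t0 \<in> set ts"
    and G: "\<And>t. t \<in> set ts \<Longrightarrow> G t \<in> borel_measurable borel" "\<And>t y. t \<in> set ts \<Longrightarrow> \<bar>G t y\<bar> \<le> C t"
    and f: "f \<in> borel_measurable borel" "\<And>y. \<bar>f y\<bar> \<le> D" and g: "g \<in> borel_measurable borel" "\<And>y. \<bar>g y\<bar> \<le> E"
  shows "chain r s x ts (G(t0 := \<lambda>y. a * f y + g y)) = a * chain r s x ts (G(t0 := f)) + chain r s x ts (G(t0 := g))"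
  using st t0 G
proof (induction ts arbitrary: s x)
  case (Cons t ts)
  note c = chain_start_Cons[OF Cons.prems(1)]
  have bd: "(\<lambda>y. chain r t y ts (G(t0 := h))) \<in> borel_measurable borel \<and> (\<forall>y. \<bar>chain r t y ts (G(t0 := h))\<bar> \<le> prod_list (map (C(t0 := H)) ts))"
    if "h \<in> borel_measurable borel" "\<And>y. \<bar>h y\<bar> \<le> H" for h H
    by (rule chain_bounded[OF r c(3,4)]) (use Cons.prems(3,4) that in auto)
  note bf = bd[OF f] and bg = bd[OF g]
  show ?case
  proof (cases "t = t0")
    case True
    have eq: "chain r t y ts (G(t0 := h)) = chain r t y ts G" for y h by (rule chain_cong) (use c(5) True in auto)
    define ch where "ch y = chain r t y ts G" for y
    define P where "P = prod_list (map (C(t0 := D)) ts)"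
    have ch: "ch \<in> borel_measurable borel" "\<And>y. \<bar>ch y\<bar> \<le> P" using bf unfolding eq ch_def P_def by auto
    have "p_minus_int r (t - s) x (\<lambda>y. a * (f y * ch y) + g y * ch y)
       = p_minus_int r (t - s) x (\<lambda>y. a * (f y * ch y)) + p_minus_int r (t - s) x (\<lambda>y. g y * ch y)"
    proof (rule p_minus_int_add[OF r c(1)])
      show "\<bar>a * (f y * ch y)\<bar> \<le> \<bar>a\<bar> * (D * P)" for y
        using mult_mono[OF f(2)[of y] ch(2)[of y]] order_trans[OF abs_ge_zero f(2)] by (auto simp: abs_mult intro!: mult_left_mono)
      show "\<bar>g y * ch y\<bar> \<le> E * P" for y
        using mult_mono[OF g(2)[of y] ch(2)[of y]] order_trans[OF abs_ge_zero g(2)] by (auto simp: abs_mult)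
    qed (use f g ch in auto)
    moreover have "(G(t0 := h)) t = h" for h using True by simp
    ultimately show ?thesis
      by (simp only: chain.simps eq distrib_right mult.assoc p_minus_int_cmult flip: ch_def)
  next
    case False
    have t0: "t0 \<in> set ts" using Cons.prems(2) False by auto
    define cf cg where "cf y = chain r t y ts (G(t0 := f))" and "cg y = chain r t y ts (G(t0 := g))" for y
    have IH: "chain r t y ts (G(t0 := \<lambda>y. a * f y + g y)) = a * cf y + cg y" for y
      unfolding cf_def cg_def by (rule Cons.IH[OF c(2) t0]) (use Cons.prems(3,4) in auto)
    have Gt: "G t \<in> borel_measurable borel" "\<And>y. \<bar>G t y\<bar> \<le> C t" using Cons.prems(3,4) by auto
    obtain Pf Pg where cf: "cf \<in> borel_measurable borel" "\<And>y. \<bar>cf y\<bar> \<le> Pf" and cg: "cg \<in> borel_measurable borel" "\<And>y. \<bar>cg y\<bar> \<le> Pg"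
      using bf bg unfolding cf_def[abs_def] cg_def[abs_def] by blast
    have "p_minus_int r (t - s) x (\<lambda>y. a * (G t y * cf y) + G t y * cg y)
       = p_minus_int r (t - s) x (\<lambda>y. a * (G t y * cf y)) + p_minus_int r (t - s) x (\<lambda>y. G t y * cg y)"
    proof (rule p_minus_int_add[OF r c(1)])
      show "\<bar>a * (G t y * cf y)\<bar> \<le> \<bar>a\<bar> * (C t * Pf)" for y
        using mult_mono[OF Gt(2)[of y] cf(2)[of y]] order_trans[OF abs_ge_zero Gt(2)] by (auto simp: abs_mult intro!: mult_left_mono)
      show "\<bar>G t y * cg y\<bar> \<le> C t * Pg" for y
        using mult_mono[OF Gt(2)[of y] cg(2)[of y]] order_trans[OF abs_ge_zero Gt(2)] by (auto simp: abs_mult)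
    qed (use Gt cf cg in auto)
    moreover have "(G(t0 := h)) t = G t" for h using False by simp
    ultimately show ?thesis
      by (simp only: chain.simps IH distrib_left mult.left_commute[of _ a] p_minus_int_cmult flip: cf_def cg_def)
  qed
qed simp

lemma chain_tendsto:
  assumes r: "0 < r" and st: "chain_start r s x ts" and t0: "t0 \<in> set ts"
    and G: "\<And>t. t \<in> set ts \<Longrightarrow> G t \<in> borel_measurable borel" "\<And>t y. t \<in> set ts \<Longrightarrow> \<bar>G t y\<bar> \<le> C t"
    and f: "\<And>n. f n \<in> borel_measurable borel" "\<And>n y. \<bar>f n y\<bar> \<le> D" and lim: "\<And>y. (\<lambda>n. f n y) \<longlonglongrightarrow> F y"
  shows "(\<lambda>n. chain r s x ts (G(t0 := f n))) \<longlonglongrightarrow> chain r s x ts (G(t0 := F))"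
  using st t0 G
proof (induction ts arbitrary: s x)
  case (Cons t ts)
  note c = chain_start_Cons[OF Cons.prems(1)]
  have bd: "(\<lambda>y. chain r t y ts (G(t0 := f n))) \<in> borel_measurable borel \<and> (\<forall>y. \<bar>chain r t y ts (G(t0 := f n))\<bar> \<le> prod_list (map (C(t0 := D)) ts))" for n
    by (rule chain_bounded[OF r c(3,4)]) (use Cons.prems(3,4) f in auto)
  define H where "H n = (G(t0 := f n)) t" for n
  have H: "H n \<in> borel_measurable borel" "\<bar>H n y\<bar> \<le> (C(t0 := D)) t" for n y
    using Cons.prems(3,4) f by (auto simp: H_def)
  have Hl: "(\<lambda>n. H n y) \<longlonglongrightarrow> (G(t0 := F)) t y" for y using lim by (simp add: H_def)
  have cl: "(\<lambda>n. chain r t y ts (G(t0 := f n))) \<longlonglongrightarrow> chain r t y ts (G(t0 := F))" for y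
  proof (cases "t0 \<in> set ts")
    case True
    then show ?thesis by (intro Cons.IH c(2)) (use Cons.prems(3,4) in auto)
  next
    case False
    then have "chain r t y ts (G(t0 := h)) = chain r t y ts G" for h by (intro chain_cong) auto
    then show ?thesis by simp
  qed
  have "(\<lambda>n. p_minus_int r (t - s) x (\<lambda>y. H n y * chain r t y ts (G(t0 := f n))))
     \<longlonglongrightarrow> p_minus_int r (t - s) x (\<lambda>y. (G(t0 := F)) t y * chain r t y ts (G(t0 := F)))"
  proof (rule p_minus_int_tendsto[OF r c(1)])
    show "\<bar>H n y * chain r t y ts (G(t0 := f n))\<bar> \<le> (C(t0 := D)) t * prod_list (map (C(t0 := D)) ts)" for n y
      unfolding abs_mult by (rule mult_mono) (use H(2)[of n y] order_trans[OF abs_ge_zero H(2)[of n y]] bd[of n] in auto)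
    show "(\<lambda>y. H n y * chain r t y ts (G(t0 := f n))) \<in> borel_measurable borel" for n
      by (intro borel_measurable_times H(1)) (use bd in blast)
    show "(\<lambda>n. H n y * chain r t y ts (G(t0 := f n))) \<longlonglongrightarrow> (G(t0 := F)) t y * chain r t y ts (G(t0 := F))" for y
      by (intro tendsto_mult Hl cl)
  qed
  then show ?case unfolding H_def chain.simps .
qed simp

lemma abs_mult_le: "\<bar>a * b\<bar> \<le> A * B" if "\<bar>a\<bar> \<le> A" "\<bar>b\<bar> \<le> B" for a b A B :: real
  unfolding abs_mult by (intro mult_mono that order_trans[OF abs_ge_zero that(1)]) simp

lemma trig_poly_scale: "trig_poly r f \<Longrightarrow> trig_poly r (\<lambda>x. a * f x)"
  using trig_poly.lin[of r f f "a - 1"] by (simp add: algebra_simps)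

lemma trig_poly_even_periodic:
  assumes r: "0 < r" and "trig_poly r f"
  shows "even_periodic r f" "continuous_on UNIV f"
proof -
  have "continuous_on UNIV f \<and> (\<forall>x. f (x + 2 * pi * r) = f x) \<and> (\<forall>x. f (- x) = f x)"
    using assms(2)
  proof (induction rule: trig_poly.induct)
    case (base m)
    have "(x + 2 * pi * r) / r = x / r + 2 * pi" for x using r by (simp add: field_simps)
    then show ?case using dirichlet_kernel_continuous(1)[OF r] by (simp add: dirichlet_kernel_symmetry)
  qed (auto intro!: continuous_intros)
  then show "even_periodic r f" "continuous_on UNIV f" by (auto intro: even_periodicI_continuous[OF r])
qed

lemma even_periodic_bounded:
  assumes "even_periodic r f"
  obtains C where "\<And>x. \<bar>f x\<bar> \<le> C"
  using assms unfolding even_periodic_def bounded_iff by (metis UNIV_I image_eqI real_norm_def)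

lemma even_periodic_mult_theta:
  assumes r: "0 < r" and \<tau>: "0 < \<tau>" and f: "even_periodic r f"
  shows "even_periodic r (\<lambda>x. f x / theta_k r \<tau> x)" "even_periodic r (\<lambda>x. f x * theta_k r \<tau> x)"
proof -
  note k = theta_k_continuous_x(1)[OF r \<tau>] theta_k_symmetry[OF r] theta_k_pos[OF r \<tau>]
  have k1: "even_periodic r (theta_k r \<tau>)" by (rule even_periodicI_continuous[OF r]) (use k in auto)
  have k2: "even_periodic r (\<lambda>x. inverse (theta_k r \<tau> x))"
    by (rule even_periodicI_continuous[OF r]) (use k in \<open>auto intro!: continuous_intros simp: less_imp_neq[THEN not_sym]\<close>)
  have m: "even_periodic r (\<lambda>x. f x * g x)" if g: "even_periodic r g" for g
  proof -
    obtain C D where C: "\<And>x. \<bar>f x\<bar> \<le> C" and D: "\<And>x. \<bar>g x\<bar> \<le> D"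
      using even_periodic_bounded[OF f] even_periodic_bounded[OF g] by metis
    have "\<bar>f x * g x\<bar> \<le> C * D" for x
      using mult_mono[OF C[of x] D[of x]] order_trans[OF abs_ge_zero C] by (simp add: abs_mult)
    then have "bounded (range (\<lambda>x. f x * g x))" by (auto simp: bounded_iff)
    then show ?thesis using f g by (auto simp: even_periodic_def)
  qed
  show "even_periodic r (\<lambda>x. f x / theta_k r \<tau> x)" using m[OF k2] by (simp add: divide_inverse)
  show "even_periodic r (\<lambda>x. f x * theta_k r \<tau> x)" by (rule m[OF k1])
qed

section \<open>The elliptic Bessel process\<close>

locale elliptic_lift =
  fixes M :: "'a measure" and F :: "real \<Rightarrow> 'a measure" and B X :: "real \<Rightarrow> 'a \<Rightarrow> real" and r tstar u :: real
  assumes r: "0 < r" and u: "u \<in> {0<..<2 * pi * r}" and tstar: "0 < tstar"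
    and lift: "elliptic_bessel3_lift M F B r tstar u X"

sublocale elliptic_lift \<subseteq> drifted_bm M F B X "\<lambda>\<omega> s. U1' r tstar s (X s \<omega>)" u tstar
proof -
  note L = lift[unfolded elliptic_bessel3_lift_def]
  show "drifted_bm M F B X (\<lambda>\<omega> s. U1' r tstar s (X s \<omega>)) u tstar"
    by (intro drifted_bm.intro bm_filtration.intro drifted_bm_axioms.intro conjunct1[OF L]
        bspec[OF conjunct1[OF conjunct2[OF L]]] conjunct2[OF conjunct2[OF L]])
qed

context elliptic_lift
begin

text \<open>The equation gives the drift no meaningful value at its singularities, so the backward
  equation is available only off them. Integrability of the drift along the path, which is part of
  the equation, dominates the first-order term of Ito's formula. A null set of times suffices later,
  since the drift enters only through time integrals.\<close>

lemma occupation: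
  assumes t: "0 < t" "t < tstar"
  shows "AE \<omega> in M. AE s in lborel. s \<in> {0<..t} \<longrightarrow> sin (X s \<omega> / (2 * r)) \<noteq> 0"
proof -
  define c where "c x = 1 - cos (x / r)" for x
  define \<epsilon> where "\<epsilon> n = inverse (real (Suc n))" for n
  \<comment> \<open>As \<open>n \<rightarrow> \<infinity>\<close>, \<open>f n\<close> and \<open>fx n\<close> vanish, while \<open>fxx n\<close> tends to \<open>1 / r\<^sup>2\<close> times the indicator of the
    zero set of \<open>sin (x / (2 * r))\<close>; Ito's formula then forces the occupation time of that set to be zero.\<close>
  define f where "f n s x = \<epsilon> n * ln (1 + c x / \<epsilon> n)" for n and s x :: real
  define fx where "fx n s x = sin (x / r) / r * (\<epsilon> n / (\<epsilon> n + c x))" for n and s x :: real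
  define fxx where "fxx n s x = cos (x / r) / r\<^sup>2 * (\<epsilon> n / (\<epsilon> n + c x)) - (sin (x / r) / r)\<^sup>2 * (\<epsilon> n / (\<epsilon> n + c x)\<^sup>2)" for n and s x :: real
  define K where "K = 2 + 1 / r + 2 / r\<^sup>2"
  have \<epsilon>: "0 < \<epsilon> n" for n by (simp add: \<epsilon>_def)
  have \<epsilon>0: "\<epsilon> \<longlonglongrightarrow> 0" unfolding \<epsilon>_def[abs_def] by (rule LIMSEQ_inverse_real_of_nat)
  have c: "0 \<le> c x" "c x \<le> 2" for x using cos_le_one[of "x / r"] cos_ge_minus_one[of "x / r"] unfolding c_def by linarith+
  have \<epsilon>c: "0 < \<epsilon> n + c x" for n x using \<epsilon>[of n] c(1)[of x] by linarith
  have cc: "continuous_on UNIV c" unfolding c_def using r by (intro continuous_intros) auto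
  have dc: "(c has_real_derivative sin (x / r) / r) (at x)" for x
    unfolding c_def using r by (auto intro!: derivative_eq_intros)
  have D1: "(f n s has_real_derivative fx n s x) (at x)" for n s x
  proof -
    have p: "0 < 1 + c x / \<epsilon> n" using \<epsilon>[of n] c(1)[of x] by (simp add: add_pos_nonneg)
    have "((\<lambda>x. 1 + c x / \<epsilon> n) has_real_derivative sin (x / r) / r / \<epsilon> n) (at x)"
      using \<epsilon>[of n] by (auto intro!: derivative_eq_intros dc)
    from DERIV_cmult[OF DERIV_chain2[OF DERIV_ln_divide[OF p] this], of "\<epsilon> n"]
    have "(f n s has_real_derivative \<epsilon> n * (1 / (1 + c x / \<epsilon> n) * (sin (x / r) / r / \<epsilon> n))) (at x)" unfolding f_def .
    moreover have "\<epsilon> n * (1 / (1 + c x / \<epsilon> n) * (sin (x / r) / r / \<epsilon> n)) = fx n s x"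
    proof -
      have e: "1 + c x / \<epsilon> n = (\<epsilon> n + c x) / \<epsilon> n" using \<epsilon>[of n] by (simp add: field_simps)
      show ?thesis unfolding e using \<epsilon>[of n] by (simp add: fx_def mult_ac)
    qed
    ultimately show ?thesis by simp
  qed
  have D2: "(fx n s has_real_derivative fxx n s x) (at x)" for n s x
  proof -
    have "((\<lambda>x. sin (x / r) / r) has_real_derivative cos (x / r) / r\<^sup>2) (at x)"
      using r by (auto intro!: derivative_eq_intros simp: power2_eq_square)
    moreover have "((\<lambda>x. \<epsilon> n / (\<epsilon> n + c x)) has_real_derivative - (\<epsilon> n * (sin (x / r) / r)) / (\<epsilon> n + c x)\<^sup>2) (at x)"
      using \<epsilon>c[of n x] by (auto intro!: derivative_eq_intros dc simp: power2_eq_square)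
    ultimately have "(fx n s has_real_derivative cos (x / r) / r\<^sup>2 * (\<epsilon> n / (\<epsilon> n + c x)) + - (\<epsilon> n * (sin (x / r) / r)) / (\<epsilon> n + c x)\<^sup>2 * (sin (x / r) / r)) (at x)"
      unfolding fx_def by (rule DERIV_mult)
    then show ?thesis by (simp add: fxx_def power2_eq_square mult_ac)
  qed
  have q: "0 \<le> \<epsilon> n / (\<epsilon> n + c x)" "\<epsilon> n / (\<epsilon> n + c x) \<le> 1" for n x
    using \<epsilon>[of n] c(1)[of x] by (auto simp: field_simps add_pos_nonneg)
  have fb: "0 \<le> f n s x" "f n s x \<le> 2" "f n s x \<le> 2 * sqrt (\<epsilon> n * c x)" for n s x
  proof -
    have z: "0 \<le> c x / \<epsilon> n" using \<epsilon>[of n] c(1)[of x] by simp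
    then show "0 \<le> f n s x" using \<epsilon>[of n] by (simp add: f_def)
    have "f n s x \<le> \<epsilon> n * (c x / \<epsilon> n)" unfolding f_def
      using \<epsilon>[of n] ln_add_one_self_le_self[OF z] by (intro mult_left_mono) auto
    then show "f n s x \<le> 2" using \<epsilon>[of n] c(2)[of x] by simp
    \<comment> \<open>Taking the square root inside gives a bound of order
      \<open>sqrt (\<epsilon> n)\<close>, hence convergence to zero, where
      \<open>ln (1 + z) <= z\<close> by itself gives only boundedness.\<close>
    have "ln (1 + c x / \<epsilon> n) \<le> 2 * ln (1 + sqrt (c x / \<epsilon> n))"
    proof -
      have "1 + c x / \<epsilon> n \<le> (1 + sqrt (c x / \<epsilon> n))\<^sup>2" using z by (simp add: power2_sum)
      then have "ln (1 + c x / \<epsilon> n) \<le> ln ((1 + sqrt (c x / \<epsilon> n))\<^sup>2)" using z by (intro ln_mono) auto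
      also have "\<dots> = 2 * ln (1 + sqrt (c x / \<epsilon> n))" using z by (subst ln_realpow) (auto simp: add_pos_nonneg)
      finally show ?thesis .
    qed
    also have "\<dots> \<le> 2 * sqrt (c x / \<epsilon> n)" using z by (intro mult_left_mono ln_add_one_self_le_self) auto
    finally have "f n s x \<le> \<epsilon> n * (2 * sqrt (c x / \<epsilon> n))" unfolding f_def using \<epsilon>[of n] by (intro mult_left_mono) auto
    also have "\<dots> = 2 * sqrt (\<epsilon> n * c x)"
    proof -
      have "\<epsilon> n * c x = (\<epsilon> n)\<^sup>2 * (c x / \<epsilon> n)" using \<epsilon>[of n] by (simp add: power2_eq_square)
      then show ?thesis using \<epsilon>[of n] by (simp only: real_sqrt_mult real_sqrt_abs)
    qed
    finally show "f n s x \<le> 2 * sqrt (\<epsilon> n * c x)" .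
  qed
  have fxb: "\<bar>fx n s x\<bar> \<le> 1 / r" for n s x
  proof -
    have "\<bar>fx n s x\<bar> = \<bar>sin (x / r)\<bar> / r * (\<epsilon> n / (\<epsilon> n + c x))" using \<epsilon>[of n] \<epsilon>c[of n x] r by (simp add: fx_def abs_mult)
    also have "\<dots> \<le> 1 / r * 1" using q[of n x] r by (intro mult_mono divide_right_mono) auto
    finally show ?thesis by simp
  qed
  have fxxb: "\<bar>fxx n s x\<bar> \<le> 2 / r\<^sup>2" for n s x
  proof -
    have "\<bar>cos (x / r) / r\<^sup>2 * (\<epsilon> n / (\<epsilon> n + c x))\<bar> = \<bar>cos (x / r)\<bar> / r\<^sup>2 * (\<epsilon> n / (\<epsilon> n + c x))" using \<epsilon>[of n] \<epsilon>c[of n x] by (simp add: abs_mult)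
    also have "\<dots> \<le> 1 / r\<^sup>2 * 1" using q[of n x] by (intro mult_mono divide_right_mono) auto
    finally have 1: "\<bar>cos (x / r) / r\<^sup>2 * (\<epsilon> n / (\<epsilon> n + c x))\<bar> \<le> 1 / r\<^sup>2" by simp
    \<comment> \<open>The squared sine is at most \<open>2 * c x\<close>; this balances the square
      in the denominator and bounds \<open>fxx n\<close> uniformly in \<open>n\<close>.\<close>
    have "(sin (x / r))\<^sup>2 = c x * (2 - c x)" using sin_cos_squared_add[of "x / r"] by (simp add: c_def power2_eq_square algebra_simps)
    also have "\<dots> \<le> c x * 2" using c[of x] by (intro mult_left_mono) auto
    finally have "(sin (x / r))\<^sup>2 * \<epsilon> n \<le> c x * 2 * \<epsilon> n" using \<epsilon>[of n] by (intro mult_right_mono) auto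
    also have "\<dots> \<le> (\<epsilon> n + c x)\<^sup>2" using c(1)[of x] \<epsilon>[of n] by (simp add: power2_sum)
    finally have "(sin (x / r))\<^sup>2 * \<epsilon> n / (\<epsilon> n + c x)\<^sup>2 \<le> 1" using \<epsilon>c[of n x] by simp
    then have "(sin (x / r))\<^sup>2 * \<epsilon> n / (\<epsilon> n + c x)\<^sup>2 / r\<^sup>2 \<le> 1 / r\<^sup>2" by (intro divide_right_mono) auto
    then have 2: "\<bar>(sin (x / r) / r)\<^sup>2 * (\<epsilon> n / (\<epsilon> n + c x)\<^sup>2)\<bar> \<le> 1 / r\<^sup>2"
      using \<epsilon>[of n] by (simp add: power_divide mult_ac)
    have "\<bar>fxx n s x\<bar> \<le> \<bar>cos (x / r) / r\<^sup>2 * (\<epsilon> n / (\<epsilon> n + c x))\<bar> + \<bar>(sin (x / r) / r)\<^sup>2 * (\<epsilon> n / (\<epsilon> n + c x)\<^sup>2)\<bar>"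
      unfolding fxx_def by (rule abs_triangle_ineq4)
    also note add_mono[OF 1 2]
    finally show ?thesis by simp
  qed
  have K: "2 \<le> K" "1 / r \<le> K" "2 / r\<^sup>2 \<le> K" "0 \<le> K" using r by (auto simp: K_def)
  have C: "continuous_on UNIV (fx n s)" "continuous_on UNIV (fxx n s)" for n s
    unfolding fx_def fxx_def using r \<epsilon>c[of n] by (intro continuous_intros cc; simp add: less_imp_neq[THEN not_sym])+
  have ito: "ito_function 0 t (f n) (\<lambda>_ _. 0) (fx n) (fxx n) K" for n
    unfolding ito_function_def
  proof (intro conjI ballI allI)
    show "continuous_on ({0..t} \<times> UNIV) (\<lambda>(s, x). fx n s x)"
    proof -
      have "continuous_on ({0..t} \<times> UNIV) (\<lambda>z. fx n 0 (snd z))"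
        by (rule continuous_on_compose2[OF C(1) continuous_on_snd[OF continuous_on_id] subset_UNIV])
      then show ?thesis by (simp add: case_prod_beta' fx_def)
    qed
    show "continuous_on ({0..t} \<times> UNIV) (\<lambda>(s, x). fxx n s x)"
    proof -
      have "continuous_on ({0..t} \<times> UNIV) (\<lambda>z. fxx n 0 (snd z))"
        by (rule continuous_on_compose2[OF C(2) continuous_on_snd[OF continuous_on_id] subset_UNIV])
      then show ?thesis by (simp add: case_prod_beta' fxx_def)
    qed
    fix s x
    show "((\<lambda>s. f n s x) has_real_derivative 0) (at s within {0..t})" by (simp add: f_def)
    show "\<bar>f n s x\<bar> \<le> K" "\<bar>fx n s x\<bar> \<le> K" "\<bar>fxx n s x\<bar> \<le> K" using fb[of n s x] fxb[of n s x] fxxb[of n s x] K by auto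
  qed (use D1 D2 K in auto)
  let ?b = "\<lambda>\<omega> s. U1' r tstar s (X s \<omega>)"
  have "\<forall>n. \<exists>V. V \<in> borel_measurable M \<and> integrable M (\<lambda>\<omega>. (V \<omega>)\<^sup>2) \<and>
     expectation (\<lambda>\<omega>. (V \<omega>)\<^sup>2) \<le> 8 * K\<^sup>2 + 2 * (2 * K\<^sup>2 + K\<^sup>2 * tstar) * (t - 0) \<and>
     (\<forall>\<omega>. good_path \<omega> \<longrightarrow> V \<omega> = (LINT s:{0<..t}|lborel. 0 + fxx n s (X s \<omega>) / 2 - fx n s (X s \<omega>) * ?b \<omega> s)) \<and>
     (\<forall>Z c. Z \<in> borel_measurable (F 0) \<longrightarrow> (\<forall>\<omega>. \<bar>Z \<omega>\<bar> \<le> c) \<longrightarrow>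
        expectation (\<lambda>\<omega>. Z \<omega> * (f n t (X t \<omega>) - f n 0 (X 0 \<omega>))) = expectation (\<lambda>\<omega>. Z \<omega> * V \<omega>))"
    using ito_expectation[OF order_refl t ito] by blast
  from choice[OF this] obtain V where V: "\<And>n. V n \<in> borel_measurable M" "\<And>n. integrable M (\<lambda>\<omega>. (V n \<omega>)\<^sup>2)"
    "\<And>n. expectation (\<lambda>\<omega>. (V n \<omega>)\<^sup>2) \<le> 8 * K\<^sup>2 + 2 * (2 * K\<^sup>2 + K\<^sup>2 * tstar) * (t - 0)"
    "\<And>n \<omega>. good_path \<omega> \<Longrightarrow> V n \<omega> = (LINT s:{0<..t}|lborel. 0 + fxx n s (X s \<omega>) / 2 - fx n s (X s \<omega>) * ?b \<omega> s)"
    "\<And>n Z c. Z \<in> borel_measurable (F 0) \<Longrightarrow> (\<forall>\<omega>. \<bar>Z \<omega>\<bar> \<le> c) \<Longrightarrow>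
        expectation (\<lambda>\<omega>. Z \<omega> * (f n t (X t \<omega>) - f n 0 (X 0 \<omega>))) = expectation (\<lambda>\<omega>. Z \<omega> * V n \<omega>)"
    by blast
  have rat: "(\<lambda>n. \<epsilon> n / (\<epsilon> n + c x)) \<longlonglongrightarrow> (if c x = 0 then 1 else 0)" for x
  proof (cases "c x = 0")
    case True
    then show ?thesis using \<epsilon> by (simp add: less_imp_neq[THEN not_sym])
  next
    case False
    then have "(\<lambda>n. \<epsilon> n / (\<epsilon> n + c x)) \<longlonglongrightarrow> 0 / (0 + c x)" by (intro tendsto_intros \<epsilon>0) auto
    then show ?thesis using False by simp
  qed
  have sc: "sin (x / r) = 0" "cos (x / r) = 1" if "c x = 0" for x
    using that sin_cos_squared_add[of "x / r"] by (auto simp: c_def)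
  have fxl: "(\<lambda>n. fx n s x) \<longlonglongrightarrow> 0" for s x
    using tendsto_mult_left[OF rat[of x], of "sin (x / r) / r"] sc(1)[of x] by (auto simp: fx_def split: if_splits)
  have fxxl: "(\<lambda>n. fxx n s x) \<longlonglongrightarrow> (if c x = 0 then 1 / r\<^sup>2 else 0)" for s x
  proof (cases "c x = 0")
    case True
    then show ?thesis using sc[OF True] \<epsilon> by (simp add: fxx_def less_imp_neq[THEN not_sym])
  next
    case False
    then have "(\<lambda>n. cos (x / r) / r\<^sup>2 * (\<epsilon> n / (\<epsilon> n + c x)) - (sin (x / r) / r)\<^sup>2 * (\<epsilon> n / (\<epsilon> n + c x)\<^sup>2))
      \<longlonglongrightarrow> cos (x / r) / r\<^sup>2 * (0 / (0 + c x)) - (sin (x / r) / r)\<^sup>2 * (0 / (0 + c x)\<^sup>2)"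
      by (intro tendsto_intros \<epsilon>0) auto
    then show ?thesis using False by (simp add: fxx_def)
  qed
  \<comment> \<open>Half the pointwise limit of \<open>fxx n\<close>. It is nonnegative, so a
    vanishing mean of its time integral forces it to vanish at almost every time.\<close>
  define J where "J \<omega> s = (if c (X s \<omega>) = 0 then 1 / r\<^sup>2 else 0) / 2" for \<omega> s
  have Jlim: "(\<lambda>n. V n \<omega>) \<longlonglongrightarrow> (LINT s:{0<..t}|lborel. J \<omega> s)"
    and Jint: "set_integrable lborel {0<..t} (J \<omega>)" if good: "good_path \<omega>" for \<omega>
  proof -
    have Xc: "continuous_on {0..t} (\<lambda>s. X s \<omega>)" by (rule good_path_continuous[OF good]) (use t in auto)
    then have Xc': "continuous_on {0<..t} (\<lambda>s. X s \<omega>)" by (rule continuous_on_subset) auto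
    have bi: "set_integrable lborel {0<..t} (?b \<omega>)"
      by (rule set_integrable_subset[of lborel "{0..t}"]) (use good t in \<open>auto simp: good_path_def\<close>)
    define w where "w s = indicator {0<..t} s * (K + K * \<bar>?b \<omega> s\<bar>)" for s
    define g where "g n s = indicator {0<..t} s *\<^sub>R (0 + fxx n s (X s \<omega>) / 2 - fx n s (X s \<omega>) * ?b \<omega> s)" for n s
    have "set_integrable lborel {0<..t} (\<lambda>s. K + K * \<bar>?b \<omega> s\<bar>)"
    proof (rule set_integral_add(1))
      show "set_integrable lborel {0<..t} (\<lambda>s. K)" using t by (simp add: set_integrable_def)
      show "set_integrable lborel {0<..t} (\<lambda>s. K * \<bar>?b \<omega> s\<bar>)" by (intro set_integrable_mult_right set_integrable_abs bi)
    qed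
    then have w: "integrable lborel w" by (simp add: set_integrable_def w_def[abs_def])
    have gw: "\<bar>g n s\<bar> \<le> w s" for n s
    proof -
      have "\<bar>fx n s (X s \<omega>) * ?b \<omega> s\<bar> \<le> K * \<bar>?b \<omega> s\<bar>"
        using order_trans[OF fxb[of n s "X s \<omega>"] K(2)] by (simp add: abs_mult mult_right_mono)
      moreover have "\<bar>fxx n s (X s \<omega>) / 2\<bar> \<le> K" using fxxb[of n s "X s \<omega>"] K(3,4) by simp
      ultimately have "\<bar>0 + fxx n s (X s \<omega>) / 2 - fx n s (X s \<omega>) * ?b \<omega> s\<bar> \<le> K + K * \<bar>?b \<omega> s\<bar>" by linarith
      then show ?thesis by (auto simp: g_def w_def indicator_def)
    qed
    have gl: "(\<lambda>n. g n s) \<longlonglongrightarrow> indicator {0<..t} s *\<^sub>R J \<omega> s" for s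
    proof -
      have "(\<lambda>n. g n s) \<longlonglongrightarrow> indicator {0<..t} s *\<^sub>R (0 + (if c (X s \<omega>) = 0 then 1 / r\<^sup>2 else 0) / 2 - 0 * ?b \<omega> s)"
        unfolding g_def by (intro tendsto_intros fxl fxxl) simp
      then show ?thesis by (simp add: J_def)
    qed
    have gm: "g n \<in> borel_measurable lborel" for n
    proof -
      have m: "(\<lambda>s. indicator {0<..t} s *\<^sub>R h (X s \<omega>)) \<in> borel_measurable borel" if "continuous_on UNIV h" for h :: "real \<Rightarrow> real"
        by (rule borel_measurable_continuous_on_indicator) (auto intro: continuous_on_compose2[OF that Xc'])
      have [measurable]: "(\<lambda>s. indicator {0<..t} s *\<^sub>R ?b \<omega> s) \<in> borel_measurable borel"
        using borel_measurable_integrable[OF bi[unfolded set_integrable_def]] by simp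
      note [measurable] = m[OF C(1)[of n 0]] m[OF C(2)[of n 0]]
      have "g n = (\<lambda>s. (indicator {0<..t} s *\<^sub>R fxx n 0 (X s \<omega>)) / 2 - (indicator {0<..t} s *\<^sub>R fx n 0 (X s \<omega>)) * (indicator {0<..t} s *\<^sub>R ?b \<omega> s))"
        by (auto simp: g_def fx_def fxx_def indicator_def)
      moreover have "(\<lambda>s. (indicator {0<..t} s *\<^sub>R fxx n 0 (X s \<omega>)) / 2 - (indicator {0<..t} s *\<^sub>R fx n 0 (X s \<omega>)) * (indicator {0<..t} s *\<^sub>R ?b \<omega> s)) \<in> borel_measurable lborel"
        by measurable
      ultimately show ?thesis by (simp only:)
    qed
    have Jm: "(\<lambda>s. indicator {0<..t} s *\<^sub>R J \<omega> s) \<in> borel_measurable lborel"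
      by (rule borel_measurable_LIMSEQ_real[OF gl gm])
    show "(\<lambda>n. V n \<omega>) \<longlonglongrightarrow> (LINT s:{0<..t}|lborel. J \<omega> s)"
      unfolding V(4)[OF good] set_lebesgue_integral_def g_def[symmetric]
      by (rule integral_dominated_convergence[OF Jm gm w]) (use gl gw in auto)
    have "\<bar>indicator {0<..t} s *\<^sub>R J \<omega> s\<bar> \<le> w s" for s
      by (rule LIMSEQ_le_const2[OF tendsto_rabs[OF gl]]) (use gw in auto)
    then show "set_integrable lborel {0<..t} (J \<omega>)" unfolding set_integrable_def
      using Jm by (intro Bochner_Integration.integrable_bound[OF w]) (auto intro: order_trans[OF _ abs_ge_self])
  qed
  define W where "W \<omega> = lim (\<lambda>n. V n \<omega>)" for \<omega>
  have Wm[measurable]: "W \<in> borel_measurable M" unfolding W_def by (rule borel_measurable_lim_metric[OF V(1)])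
  have W: "W \<omega> = (LINT s:{0<..t}|lborel. J \<omega> s)" if "good_path \<omega>" for \<omega>
    unfolding W_def by (rule limI[OF Jlim[OF that]])
  have Wlim: "AE \<omega> in M. (\<lambda>n. V n \<omega>) \<longlonglongrightarrow> W \<omega>"
    using AE_good_path by eventually_elim (simp add: W Jlim)
  note L2 = L2_bounded_limit[OF V(1) Wm V(2,3) Wlim]
  have "(\<lambda>n. expectation (\<lambda>\<omega>. 1 * V n \<omega>)) \<longlonglongrightarrow> expectation (\<lambda>\<omega>. 1 * W \<omega>)"
    by (rule L2(3)[where c = 1]) auto
  moreover have "(\<lambda>n. expectation (\<lambda>\<omega>. 1 * V n \<omega>)) \<longlonglongrightarrow> 0"
  proof -
    have [measurable]: "X t \<in> borel_measurable M" "X 0 \<in> borel_measurable M" using X_M_measurable t by auto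
    have [measurable]: "f n s \<in> borel_measurable borel" for n s
      by (intro borel_measurable_continuous_onI DERIV_continuous_on[of UNIV _ "fx n s"]) (use D1 in auto)
    have fl: "(\<lambda>n. f n s x) \<longlonglongrightarrow> 0" for s x
    proof (rule tendsto_sandwich[OF _ _ tendsto_const])
      have "(\<lambda>n. 2 * sqrt (\<epsilon> n * c x)) \<longlonglongrightarrow> 2 * sqrt (0 * c x)" by (intro tendsto_intros \<epsilon>0)
      then show "(\<lambda>n. 2 * sqrt (\<epsilon> n * c x)) \<longlonglongrightarrow> 0" by simp
    qed (use fb in auto)
    have "(\<lambda>n. expectation (\<lambda>\<omega>. 1 * (f n t (X t \<omega>) - f n 0 (X 0 \<omega>)))) \<longlonglongrightarrow> expectation (\<lambda>\<omega>. 1 * (0 - 0))"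
    proof (rule integral_dominated_convergence[where w = "\<lambda>_. 2"])
      show "AE \<omega> in M. (\<lambda>n. 1 * (f n t (X t \<omega>) - f n 0 (X 0 \<omega>))) \<longlonglongrightarrow> 1 * (0 - 0)"
        by (intro AE_I2 tendsto_intros fl)
      show "AE \<omega> in M. norm (1 * (f n t (X t \<omega>) - f n 0 (X 0 \<omega>))) \<le> 2" for n
        using fb(1,2)[of n t] fb(1,2)[of n 0] by (intro AE_I2) (simp add: abs_le_iff, smt (verit))
    qed auto
    then show ?thesis using V(5)[of "\<lambda>_. 1" 1] by simp
  qed
  ultimately have "expectation W = 0" by (simp add: LIMSEQ_unique)
  moreover have "integrable M W" by (rule square_integrable_imp_integrable[OF Wm L2(1)])
  moreover have "AE \<omega> in M. 0 \<le> W \<omega>"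
    using AE_good_path
  proof eventually_elim
    case (elim \<omega>)
    show ?case unfolding W[OF elim] set_lebesgue_integral_def by (rule integral_nonneg_AE) (simp add: J_def)
  qed
  ultimately have "AE \<omega> in M. W \<omega> = 0" by (subst (asm) integral_nonneg_eq_0_iff_AE) auto
  with AE_good_path show ?thesis
  proof eventually_elim
    case (elim \<omega>)
    have "(LINT s|lborel. indicator {0<..t} s *\<^sub>R J \<omega> s) = 0"
      using elim W[of \<omega>] by (simp add: set_lebesgue_integral_def)
    then have "AE s in lborel. indicator {0<..t} s *\<^sub>R J \<omega> s = 0"
      using Jint[OF elim(1)] unfolding set_integrable_def by (subst (asm) integral_nonneg_eq_0_iff_AE) (auto simp: J_def)
    then show ?case
    proof eventually_elim
      case (elim s)
      show ?case
      proof
        assume s: "s \<in> {0<..t}"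
        then have "c (X s \<omega>) \<noteq> 0" using elim r by (auto simp: J_def)
        moreover have "cos (X s \<omega> / r) = 1 - 2 * (sin (X s \<omega> / (2 * r)))\<^sup>2"
          using cos_double_sin[of "X s \<omega> / (2 * r)"] by simp
        ultimately show "sin (X s \<omega> / (2 * r)) \<noteq> 0" by (auto simp: c_def)
      qed
    qed
  qed
qed

section \<open>Martingales along the process and their intertwining with the kernel\<close>

text \<open>The exponential in the function compensates the eigenvalue. Off the singular times the
  backward equation annihilates the integrand of \<open>V\<close>, and the singular times are null
  for almost every path.\<close>

lemma theta_martingale:
  assumes st: "0 \<le> s" "s \<le> t" "t < tstar" and Z: "Z \<in> borel_measurable (F s)" "\<And>\<omega>. \<bar>Z \<omega>\<bar> \<le> c"
  shows "expectation (\<lambda>\<omega>. Z \<omega> * (dirichlet_kernel m (X t \<omega> / r) / theta_k r (tstar - t) (X t \<omega>)))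
       = exp (- dirichlet_rate r m * (t - s)) *
         expectation (\<lambda>\<omega>. Z \<omega> * (dirichlet_kernel m (X s \<omega> / r) / theta_k r (tstar - s) (X s \<omega>)))"
proof (cases "s = t")
  case False
  then have lt: "s < t" using st by simp
  define \<mu> where "\<mu> = dirichlet_rate r m"
  define f where "f = (\<lambda>s x. exp (\<mu> * s) * (dirichlet_kernel m (x / r) / theta_k r (tstar - s) x))"
  obtain ft fx fxx K where ito0: "ito_function s t (\<lambda>s x. exp (dirichlet_rate r m * s) * (dirichlet_kernel m (x / r) / theta_k r (tstar - s) x)) ft fx fxx K"
    and pde: "\<And>q x. q \<in> {s..t} \<Longrightarrow> sin (x / (2*r)) \<noteq> 0 \<Longrightarrow> ft q x + fxx q x / 2 + theta_drift r (tstar - q) x * fx q x = 0"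
    by (rule theta_ito_function[OF r st(2,3), of m]) (rule that)
  have ito: "ito_function s t f ft fx fxx K" unfolding f_def \<mu>_def by (rule ito0)
  from ito_expectation[OF st(1) lt st(3) ito] obtain V where
    V1: "\<forall>\<omega>. good_path \<omega> \<longrightarrow> V \<omega> = (LINT q:{s<..t}|lborel. ft q (X q \<omega>) + fxx q (X q \<omega>) / 2 - fx q (X q \<omega>) * U1' r tstar q (X q \<omega>))"
    and V2: "\<forall>Z c. Z \<in> borel_measurable (F s) \<longrightarrow> (\<forall>\<omega>. \<bar>Z \<omega>\<bar> \<le> c) \<longrightarrow>
        expectation (\<lambda>\<omega>. Z \<omega> * (f t (X t \<omega>) - f s (X s \<omega>))) = expectation (\<lambda>\<omega>. Z \<omega> * V \<omega>)"
    by (elim exE conjE)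
  have V: "\<And>\<omega>. good_path \<omega> \<Longrightarrow> V \<omega> = (LINT q:{s<..t}|lborel. ft q (X q \<omega>) + fxx q (X q \<omega>) / 2 - fx q (X q \<omega>) * U1' r tstar q (X q \<omega>))"
    "expectation (\<lambda>\<omega>. Z \<omega> * (f t (X t \<omega>) - f s (X s \<omega>))) = expectation (\<lambda>\<omega>. Z \<omega> * V \<omega>)"
    using V1 V2[rule_format, OF Z] by auto
  have "AE \<omega> in M. Z \<omega> * V \<omega> = 0"
  proof -
    have "AE \<omega> in M. AE q in lborel. q \<in> {0<..t} \<longrightarrow> sin (X q \<omega> / (2 * r)) \<noteq> 0"
      by (rule occupation) (use st lt in auto)
    with AE_good_path show ?thesis
    proof eventually_elim
      case (elim \<omega>)
      have "AE q in lborel. indicator {s<..t} q *\<^sub>R (ft q (X q \<omega>) + fxx q (X q \<omega>) / 2 - fx q (X q \<omega>) * U1' r tstar q (X q \<omega>)) = 0"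
        using elim(2)
      proof eventually_elim
        case (elim q)
        show ?case
        proof (cases "q \<in> {s<..t}")
          case True
          then have "sin (X q \<omega> / (2 * r)) \<noteq> 0" using elim st by auto
          then show ?thesis using pde[of q "X q \<omega>"] U1'_theta_drift[OF r, of q tstar "X q \<omega>"] True st by (simp add: algebra_simps)
        qed simp
      qed
      then show ?case unfolding V(1)[OF elim(1)] set_lebesgue_integral_def by (simp add: integral_eq_zero_AE)
    qed
  qed
  then have "expectation (\<lambda>\<omega>. Z \<omega> * V \<omega>) = 0" by (rule integral_eq_zero_AE)
  then have 0: "expectation (\<lambda>\<omega>. Z \<omega> * f t (X t \<omega>) - Z \<omega> * f s (X s \<omega>)) = 0" using V(2) by (simp add: right_diff_distrib)
  have i: "integrable M (\<lambda>\<omega>. Z \<omega> * f q (X q \<omega>))" if "q \<in> {s..t}" for q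
  proof (rule integrable_mult_bounded[OF _ _ Z(2)])
    show "Z \<in> borel_measurable M" by (rule F_measurable_M[OF st(1) Z(1)])
    show "(\<lambda>\<omega>. f q (X q \<omega>)) \<in> borel_measurable M"
      using measurable_compose[OF X_M_measurable ito_function_props(8)[OF ito that]] that st by simp
    show "\<bar>f q (X q \<omega>)\<bar> \<le> K" for \<omega> by (rule ito_function_props(4)[OF ito that])
  qed
  have "expectation (\<lambda>\<omega>. Z \<omega> * f t (X t \<omega>)) = expectation (\<lambda>\<omega>. Z \<omega> * f s (X s \<omega>))"
    using 0 i[of t] i[of s] lt by simp
  then have "exp (\<mu> * t) * expectation (\<lambda>\<omega>. Z \<omega> * (dirichlet_kernel m (X t \<omega> / r) / theta_k r (tstar - t) (X t \<omega>)))
     = exp (\<mu> * s) * expectation (\<lambda>\<omega>. Z \<omega> * (dirichlet_kernel m (X s \<omega> / r) / theta_k r (tstar - s) (X s \<omega>)))"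
    unfolding f_def mult.left_commute[of "Z _" "exp _"] by (simp only: Bochner_Integration.integral_mult_right_zero)
  then have "exp (- \<mu> * t) * (exp (\<mu> * t) * expectation (\<lambda>\<omega>. Z \<omega> * (dirichlet_kernel m (X t \<omega> / r) / theta_k r (tstar - t) (X t \<omega>))))
     = exp (- \<mu> * t) * (exp (\<mu> * s) * expectation (\<lambda>\<omega>. Z \<omega> * (dirichlet_kernel m (X s \<omega> / r) / theta_k r (tstar - s) (X s \<omega>))))"
    by simp
  then show ?thesis
    unfolding mult.assoc[symmetric] exp_add[symmetric] by (simp add: \<mu>_def algebra_simps)
qed simp

lemma X_measurable_compose:
  assumes "0 \<le> t" "t < tstar" "g \<in> borel_measurable borel"
  shows "(\<lambda>\<omega>. g (X t \<omega>)) \<in> borel_measurable M" "(\<lambda>\<omega>. g (X t \<omega>)) \<in> borel_measurable (F t)"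
  using assms X_M_measurable[of t] X_measurable[of t] by (auto intro: measurable_compose)

lemma trig_poly_ratio_bounded:
  assumes "trig_poly r f" "0 \<le> t" "t < tstar"
  shows "(\<lambda>x. f x / theta_k r (tstar - t) x) \<in> borel_measurable borel" "\<exists>C. \<forall>x. \<bar>f x / theta_k r (tstar - t) x\<bar> \<le> C"
proof -
  have e: "even_periodic r (\<lambda>x. f x / theta_k r (tstar - t) x)"
    by (rule even_periodic_mult_theta(1)[OF r _ trig_poly_even_periodic(1)[OF r assms(1)]]) (use assms in simp)
  show "(\<lambda>x. f x / theta_k r (tstar - t) x) \<in> borel_measurable borel" using e by (simp add: even_periodic_def)
  show "\<exists>C. \<forall>x. \<bar>f x / theta_k r (tstar - t) x\<bar> \<le> C" by (rule even_periodic_bounded[OF e]) blast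
qed

text \<open>An intertwining relation: one and the same \<open>f'\<close> describes the signed kernel
  acting on \<open>sin (y / (2 * r)) * f y\<close> and the conditional mean of
  \<open>f / theta_k\<close> along the process. On a generator both multiply by the same
  exponential; linearity does the rest.\<close>

lemma trig_poly_evolve:
  assumes st: "0 \<le> s" "s \<le> t" "t < tstar" and f: "trig_poly r f"
  shows "\<exists>f'. trig_poly r f' \<and>
     (\<forall>x\<in>{0..<2*pi*r}. p_minus_int r (t - s) x (\<lambda>y. sin (y / (2*r)) * f y) = sin (x / (2*r)) * f' x) \<and>
     (\<forall>(Z :: 'a \<Rightarrow> real) c. Z \<in> borel_measurable (F s) \<longrightarrow> (\<forall>\<omega>. \<bar>Z \<omega>\<bar> \<le> c) \<longrightarrow>
        expectation (\<lambda>\<omega>. Z \<omega> * (f (X t \<omega>) / theta_k r (tstar - t) (X t \<omega>)))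
      = expectation (\<lambda>\<omega>. Z \<omega> * (f' (X s \<omega>) / theta_k r (tstar - s) (X s \<omega>))))"
  using f
proof (induction rule: trig_poly.induct)
  case (base m)
  define e where "e = exp (- dirichlet_rate r m * (t - s))"
  have sd: "sin (y / (2*r)) * dirichlet_kernel m (y / r) = sin ((real m + 1/2) * y / r)" for y
    using sin_dirichlet_kernel[of "y / r" m] by (simp add: mult.commute)
  show ?case
  proof (intro exI conjI ballI allI impI)
    show "trig_poly r (\<lambda>x. e * dirichlet_kernel m (x / r))" by (intro trig_poly_scale trig_poly.base)
    show "p_minus_int r (t - s) x (\<lambda>y. sin (y / (2*r)) * dirichlet_kernel m (y / r)) = sin (x / (2*r)) * (e * dirichlet_kernel m (x / r))"
      if x: "x \<in> {0..<2*pi*r}" for x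
    proof (cases "s = t")
      case True
      then show ?thesis using x by (simp add: p_minus_int_0 e_def)
    next
      case False
      then have "p_minus_int r (t - s) x (\<lambda>y. sin ((real m + 1/2) * y / r)) = e * sin ((real m + 1/2) * x / r)"
        unfolding e_def using st by (intro p_minus_int_sin r) simp
      then show ?thesis unfolding sd[symmetric] by (simp only: mult.left_commute)
    qed
    fix Z :: "'a \<Rightarrow> real" and c assume Z: "Z \<in> borel_measurable (F s)" "\<forall>\<omega>. \<bar>Z \<omega>\<bar> \<le> c"
    have "expectation (\<lambda>\<omega>. Z \<omega> * (dirichlet_kernel m (X t \<omega> / r) / theta_k r (tstar - t) (X t \<omega>)))
      = e * expectation (\<lambda>\<omega>. Z \<omega> * (dirichlet_kernel m (X s \<omega> / r) / theta_k r (tstar - s) (X s \<omega>)))"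
      unfolding e_def by (rule theta_martingale[OF st Z(1)]) (use Z(2) in blast)
    also have "\<dots> = expectation (\<lambda>\<omega>. Z \<omega> * (e * dirichlet_kernel m (X s \<omega> / r) / theta_k r (tstar - s) (X s \<omega>)))"
      by (subst Bochner_Integration.integral_mult_right_zero[symmetric]) (simp add: mult_ac)
    finally show "expectation (\<lambda>\<omega>. Z \<omega> * (dirichlet_kernel m (X t \<omega> / r) / theta_k r (tstar - t) (X t \<omega>)))
      = expectation (\<lambda>\<omega>. Z \<omega> * (e * dirichlet_kernel m (X s \<omega> / r) / theta_k r (tstar - s) (X s \<omega>)))" .
  qed
next
  case (lin f g a)
  obtain f' where f': "trig_poly r f'"
    "\<And>x. x \<in> {0..<2*pi*r} \<Longrightarrow> p_minus_int r (t - s) x (\<lambda>y. sin (y / (2*r)) * f y) = sin (x / (2*r)) * f' x"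
    "\<And>(Z :: 'a \<Rightarrow> real) c. Z \<in> borel_measurable (F s) \<Longrightarrow> (\<forall>\<omega>. \<bar>Z \<omega>\<bar> \<le> c) \<Longrightarrow>
        expectation (\<lambda>\<omega>. Z \<omega> * (f (X t \<omega>) / theta_k r (tstar - t) (X t \<omega>)))
      = expectation (\<lambda>\<omega>. Z \<omega> * (f' (X s \<omega>) / theta_k r (tstar - s) (X s \<omega>)))"
    using lin.IH(1) by blast
  obtain g' where g': "trig_poly r g'"
    "\<And>x. x \<in> {0..<2*pi*r} \<Longrightarrow> p_minus_int r (t - s) x (\<lambda>y. sin (y / (2*r)) * g y) = sin (x / (2*r)) * g' x"
    "\<And>(Z :: 'a \<Rightarrow> real) c. Z \<in> borel_measurable (F s) \<Longrightarrow> (\<forall>\<omega>. \<bar>Z \<omega>\<bar> \<le> c) \<Longrightarrow>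
        expectation (\<lambda>\<omega>. Z \<omega> * (g (X t \<omega>) / theta_k r (tstar - t) (X t \<omega>)))
      = expectation (\<lambda>\<omega>. Z \<omega> * (g' (X s \<omega>) / theta_k r (tstar - s) (X s \<omega>)))"
    using lin.IH(2) by blast
  show ?case
  proof (intro exI conjI ballI allI impI)
    show "trig_poly r (\<lambda>x. a * f' x + g' x)" by (intro trig_poly.lin f' g')
    have sb: "\<exists>C. \<forall>y. \<bar>sin (y / (2*r)) * h y\<bar> \<le> C" and sm: "(\<lambda>y. sin (y / (2*r)) * h y) \<in> borel_measurable borel" if h: "trig_poly r h" for h
    proof -
      obtain C where C: "\<And>x. \<bar>h x\<bar> \<le> C" by (rule even_periodic_bounded[OF trig_poly_even_periodic(1)[OF r h]]) blast
      have "\<bar>sin (y / (2*r)) * h y\<bar> \<le> 1 * C" for y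
        unfolding abs_mult by (intro mult_mono C) auto
      then show "\<exists>C. \<forall>y. \<bar>sin (y / (2*r)) * h y\<bar> \<le> C" by blast
      have [measurable]: "h \<in> borel_measurable borel" using trig_poly_even_periodic(1)[OF r h] by (simp add: even_periodic_def)
      show "(\<lambda>y. sin (y / (2*r)) * h y) \<in> borel_measurable borel" by measurable
    qed
    show "p_minus_int r (t - s) x (\<lambda>y. sin (y / (2*r)) * (a * f y + g y)) = sin (x / (2*r)) * (a * f' x + g' x)"
      if x: "x \<in> {0..<2*pi*r}" for x
    proof -
      obtain Cf Cg where C: "\<And>y. \<bar>sin (y / (2*r)) * f y\<bar> \<le> Cf" "\<And>y. \<bar>sin (y / (2*r)) * g y\<bar> \<le> Cg"
        using sb[OF lin.hyps(1)] sb[OF lin.hyps(2)] by blast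
      have "p_minus_int r (t - s) x (\<lambda>y. a * (sin (y / (2*r)) * f y) + sin (y / (2*r)) * g y)
        = p_minus_int r (t - s) x (\<lambda>y. a * (sin (y / (2*r)) * f y)) + p_minus_int r (t - s) x (\<lambda>y. sin (y / (2*r)) * g y)"
      proof (rule p_minus_int_add[OF r])
        show "0 < t - s \<or> t - s = 0 \<and> x \<in> {0..<2*pi*r}" using st x by auto
        show "\<bar>a * (sin (y / (2*r)) * f y)\<bar> \<le> \<bar>a\<bar> * Cf" for y
          unfolding abs_mult[of a] by (intro mult_left_mono C) simp
      qed (use sm[OF lin.hyps(1)] sm[OF lin.hyps(2)] C in auto)
      then show ?thesis
        by (simp only: distrib_left mult.left_commute[of "sin _" a] p_minus_int_cmult f'(2)[OF x] g'(2)[OF x])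
    qed
    fix Z :: "'a \<Rightarrow> real" and c assume Z: "Z \<in> borel_measurable (F s)" "\<forall>\<omega>. \<bar>Z \<omega>\<bar> \<le> c"
    have ZM: "Z \<in> borel_measurable M" by (rule F_measurable_M[OF st(1) Z(1)])
    have i: "integrable M (\<lambda>\<omega>. Z \<omega> * (h (X q \<omega>) / theta_k r (tstar - q) (X q \<omega>)))"
      if h: "trig_poly r h" and q: "0 \<le> q" "q < tstar" for h q
    proof -
      obtain C where C: "\<And>x. \<bar>h x / theta_k r (tstar - q) x\<bar> \<le> C" using trig_poly_ratio_bounded(2)[OF h q] by blast
      show ?thesis
        by (rule integrable_mult_bounded[OF ZM _ _ C]) (use Z(2) X_measurable_compose(1)[OF q trig_poly_ratio_bounded(1)[OF h q]] in auto)
    qed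
    have split: "expectation (\<lambda>\<omega>. Z \<omega> * ((a * h1 (X q \<omega>) + h2 (X q \<omega>)) / theta_k r (tstar - q) (X q \<omega>)))
       = a * expectation (\<lambda>\<omega>. Z \<omega> * (h1 (X q \<omega>) / theta_k r (tstar - q) (X q \<omega>))) + expectation (\<lambda>\<omega>. Z \<omega> * (h2 (X q \<omega>) / theta_k r (tstar - q) (X q \<omega>)))"
      if h: "trig_poly r h1" "trig_poly r h2" and q: "0 \<le> q" "q < tstar" for h1 h2 q
    proof -
      have "expectation (\<lambda>\<omega>. Z \<omega> * ((a * h1 (X q \<omega>) + h2 (X q \<omega>)) / theta_k r (tstar - q) (X q \<omega>)))
         = expectation (\<lambda>\<omega>. a * (Z \<omega> * (h1 (X q \<omega>) / theta_k r (tstar - q) (X q \<omega>))) + Z \<omega> * (h2 (X q \<omega>) / theta_k r (tstar - q) (X q \<omega>)))"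
        by (simp add: add_divide_distrib algebra_simps)
      then show ?thesis using i[OF h(1) q] i[OF h(2) q]
        by (simp only: Bochner_Integration.integral_add integrable_mult_right Bochner_Integration.integral_mult_right_zero)
    qed
    show "expectation (\<lambda>\<omega>. Z \<omega> * ((a * f (X t \<omega>) + g (X t \<omega>)) / theta_k r (tstar - t) (X t \<omega>)))
       = expectation (\<lambda>\<omega>. Z \<omega> * ((a * f' (X s \<omega>) + g' (X s \<omega>)) / theta_k r (tstar - s) (X s \<omega>)))"
      using split[OF lin.hyps, of t] split[OF f'(1) g'(1), of s] f'(3)[OF Z] g'(3)[OF Z] st by simp
  qed
qed

section \<open>Multi-time laws\<close>

text \<open>The polynomial obtained from the later times is multiplied by the power of the cosine at
  the current time and evolved once more. At the terminal time the weight
  \<open>theta_h = sin * theta_k\<close> has been divided by \<open>theta_k\<close>, which leaves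
  \<open>c0 * sin\<close> on the kernel side and \<open>1 / theta_k\<close> on the process side;
  \<open>c0\<close> is kept free for the normalisation by the initial weight.\<close>

lemma chain_trig:
  assumes "sorted_wrt (<) ts" "ts \<noteq> []" "last ts = T" "T < tstar" "0 \<le> s" "\<forall>t\<in>set ts. s \<le> t"
  shows "\<exists>\<psi>. trig_poly r \<psi> \<and>
     (\<forall>x\<in>{0..<2*pi*r}. chain r s x ts (\<lambda>t y. cos (y / r) ^ \<kappa> t * (if t = T then c0 * sin (y / (2*r)) else 1))
         = c0 * (sin (x / (2*r)) * \<psi> x)) \<and>
     (\<forall>(Z :: 'a \<Rightarrow> real) c. Z \<in> borel_measurable (F s) \<longrightarrow> (\<forall>\<omega>. \<bar>Z \<omega>\<bar> \<le> c) \<longrightarrow>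
        expectation (\<lambda>\<omega>. Z \<omega> * (\<Prod>t\<in>set ts. cos (X t \<omega> / r) ^ \<kappa> t / (if t = T then theta_k r (tstar - T) (X T \<omega>) else 1)))
      = expectation (\<lambda>\<omega>. Z \<omega> * (\<psi> (X s \<omega>) / theta_k r (tstar - s) (X s \<omega>))))"
  using assms
proof (induction ts arbitrary: s)
  case (Cons t ts)
  let ?G = "\<lambda>t y. cos (y / r) ^ \<kappa> t * (if t = T then c0 * sin (y / (2*r)) else 1)"
  let ?E = "\<lambda>t \<omega>. cos (X t \<omega> / r) ^ \<kappa> t / (if t = T then theta_k r (tstar - T) (X T \<omega>) else 1)"
  have T: "T \<in> set (t # ts)" using Cons.prems(2,3) last_in_set by metis
  have tT: "t \<le> T" using T Cons.prems(1) by auto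
  have st: "0 \<le> s" "s \<le> t" "t < tstar" using Cons.prems tT by auto
  show ?case
  proof (cases "ts = []")
    case True
    then have tT: "t = T" using Cons.prems by simp
    from trig_poly_evolve[OF st trig_poly_cos_power[of r "\<kappa> t"]] obtain \<psi> where \<psi>: "trig_poly r \<psi>"
      "\<And>x. x \<in> {0..<2*pi*r} \<Longrightarrow> p_minus_int r (t - s) x (\<lambda>y. sin (y / (2*r)) * cos (y / r) ^ \<kappa> t) = sin (x / (2*r)) * \<psi> x"
      "\<And>(Z :: 'a \<Rightarrow> real) c. Z \<in> borel_measurable (F s) \<Longrightarrow> (\<forall>\<omega>. \<bar>Z \<omega>\<bar> \<le> c) \<Longrightarrow>
        expectation (\<lambda>\<omega>. Z \<omega> * (cos (X t \<omega> / r) ^ \<kappa> t / theta_k r (tstar - t) (X t \<omega>)))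
      = expectation (\<lambda>\<omega>. Z \<omega> * (\<psi> (X s \<omega>) / theta_k r (tstar - s) (X s \<omega>)))" by blast
    have "chain r s x (t # ts) ?G = c0 * (sin (x / (2*r)) * \<psi> x)" if x: "x \<in> {0..<2*pi*r}" for x
    proof -
      have "chain r s x (t # ts) ?G = p_minus_int r (t - s) x (\<lambda>y. c0 * (sin (y / (2*r)) * cos (y / r) ^ \<kappa> t))"
        using True tT by (simp add: mult_ac)
      then show ?thesis by (simp only: p_minus_int_cmult \<psi>(2)[OF x])
    qed
    then show ?thesis using \<psi>(1,3) True tT by (intro exI[of _ \<psi>]) auto
  next
    case False
    have tT: "t < T" "t \<noteq> T" using T Cons.prems(1) False Cons.prems(3) last_in_set[of ts] by (auto split: if_splits)
    have tts: "t \<notin> set ts" using Cons.prems(1) by auto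
    have "\<exists>\<psi>. trig_poly r \<psi> \<and>
     (\<forall>x\<in>{0..<2*pi*r}. chain r t x ts ?G = c0 * (sin (x / (2*r)) * \<psi> x)) \<and>
     (\<forall>(Z :: 'a \<Rightarrow> real) c. Z \<in> borel_measurable (F t) \<longrightarrow> (\<forall>\<omega>. \<bar>Z \<omega>\<bar> \<le> c) \<longrightarrow>
        expectation (\<lambda>\<omega>. Z \<omega> * (\<Prod>t\<in>set ts. ?E t \<omega>))
      = expectation (\<lambda>\<omega>. Z \<omega> * (\<psi> (X t \<omega>) / theta_k r (tstar - t) (X t \<omega>))))"
      by (rule Cons.IH) (use Cons.prems False st in auto)
    then obtain \<psi>1 where \<psi>1: "trig_poly r \<psi>1"
      "\<And>x. x \<in> {0..<2*pi*r} \<Longrightarrow> chain r t x ts ?G = c0 * (sin (x / (2*r)) * \<psi>1 x)"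
      "\<And>(Z :: 'a \<Rightarrow> real) c. Z \<in> borel_measurable (F t) \<Longrightarrow> (\<forall>\<omega>. \<bar>Z \<omega>\<bar> \<le> c) \<Longrightarrow>
        expectation (\<lambda>\<omega>. Z \<omega> * (\<Prod>t\<in>set ts. ?E t \<omega>))
      = expectation (\<lambda>\<omega>. Z \<omega> * (\<psi>1 (X t \<omega>) / theta_k r (tstar - t) (X t \<omega>)))" by blast
    from trig_poly_evolve[OF st trig_poly_cos_power_mult[OF \<psi>1(1), of "\<kappa> t"]] obtain \<psi> where \<psi>: "trig_poly r \<psi>"
      "\<And>x. x \<in> {0..<2*pi*r} \<Longrightarrow> p_minus_int r (t - s) x (\<lambda>y. sin (y / (2*r)) * (cos (y / r) ^ \<kappa> t * \<psi>1 y)) = sin (x / (2*r)) * \<psi> x"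
      "\<And>(Z :: 'a \<Rightarrow> real) c. Z \<in> borel_measurable (F s) \<Longrightarrow> (\<forall>\<omega>. \<bar>Z \<omega>\<bar> \<le> c) \<Longrightarrow>
        expectation (\<lambda>\<omega>. Z \<omega> * (cos (X t \<omega> / r) ^ \<kappa> t * \<psi>1 (X t \<omega>) / theta_k r (tstar - t) (X t \<omega>)))
      = expectation (\<lambda>\<omega>. Z \<omega> * (\<psi> (X s \<omega>) / theta_k r (tstar - s) (X s \<omega>)))" by blast
    have "chain r s x (t # ts) ?G = c0 * (sin (x / (2*r)) * \<psi> x)" if x: "x \<in> {0..<2*pi*r}" for x
    proof -
      have "chain r s x (t # ts) ?G = p_minus_int r (t - s) x (\<lambda>y. c0 * (sin (y / (2*r)) * (cos (y / r) ^ \<kappa> t * \<psi>1 y)))"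
        unfolding chain.simps by (rule p_minus_int_cong) (use \<psi>1(2) tT in \<open>simp add: mult_ac\<close>)
      then show ?thesis by (simp only: p_minus_int_cmult \<psi>(2)[OF x])
    qed
    moreover have "expectation (\<lambda>\<omega>. Z \<omega> * (\<Prod>t\<in>set (t # ts). ?E t \<omega>)) = expectation (\<lambda>\<omega>. Z \<omega> * (\<psi> (X s \<omega>) / theta_k r (tstar - s) (X s \<omega>)))"
      if Z: "Z \<in> borel_measurable (F s)" "\<forall>\<omega>. \<bar>Z \<omega>\<bar> \<le> c" for Z :: "'a \<Rightarrow> real" and c
    proof -
      \<comment> \<open>The factor at time \<open>t\<close> joins the test variable, which stays
        bounded and becomes measurable at \<open>t\<close>; the later factors can then be evaluated
        by the induction hypothesis.\<close>
      define Z' where "Z' \<omega> = Z \<omega> * cos (X t \<omega> / r) ^ \<kappa> t" for \<omega>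
      have "\<bar>Z' \<omega>\<bar> \<le> c * 1 ^ \<kappa> t" for \<omega>
        unfolding Z'_def abs_mult power_abs using Z(2) order_trans[OF abs_ge_zero] by (intro mult_mono power_mono) auto
      then have Z'b: "\<forall>\<omega>. \<bar>Z' \<omega>\<bar> \<le> c" by simp
      have [measurable]: "Z \<in> borel_measurable (F t)" "X t \<in> borel_measurable (F t)"
        using F_measurable_mono[OF st(2) Z(1)] X_measurable[of t] st by auto
      have Z'm: "Z' \<in> borel_measurable (F t)" unfolding Z'_def by measurable
      have "expectation (\<lambda>\<omega>. Z \<omega> * (\<Prod>t\<in>set (t # ts). ?E t \<omega>)) = expectation (\<lambda>\<omega>. Z' \<omega> * (\<Prod>t\<in>set ts. ?E t \<omega>))"
        using tts tT by (simp add: Z'_def mult.assoc)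
      also have "\<dots> = expectation (\<lambda>\<omega>. Z' \<omega> * (\<psi>1 (X t \<omega>) / theta_k r (tstar - t) (X t \<omega>)))" by (rule \<psi>1(3)[OF Z'm Z'b])
      also have "\<dots> = expectation (\<lambda>\<omega>. Z \<omega> * (cos (X t \<omega> / r) ^ \<kappa> t * \<psi>1 (X t \<omega>) / theta_k r (tstar - t) (X t \<omega>)))"
        by (simp add: Z'_def mult.assoc)
      also have "\<dots> = expectation (\<lambda>\<omega>. Z \<omega> * (\<psi> (X s \<omega>) / theta_k r (tstar - s) (X s \<omega>)))" by (rule \<psi>(3)[OF Z])
      finally show ?thesis .
    qed
    ultimately show ?thesis using \<psi>(1) by blast
  qed
qed simp

lemma X_0: "AE \<omega> in M. X 0 \<omega> = u"
  using AE_good_path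
proof eventually_elim
  case (elim \<omega>)
  then have "X 0 \<omega> = u + B 0 \<omega> - (LINT s:{0..0}|lborel. U1' r tstar s (X s \<omega>))" "B 0 \<omega> = 0"
    using tstar unfolding good_path_def by auto
  moreover have "(LINT s:{0..0}|lborel. U1' r tstar s (X s \<omega>)) = 0"
    unfolding set_lebesgue_integral_def
  proof (rule integral_eq_zero_AE)
    show "AE s in lborel. indicator {0..0} s *\<^sub>R U1' r tstar s (X s \<omega>) = 0"
      using AE_lborel_singleton[of "0 :: real"] by eventually_elim simp
  qed
  ultimately show ?case by simp
qed

text \<open>Starting from powers of the cosine at all times, the factors are replaced one time after
  another by arbitrary even periodic ones. With the other factors fixed, both sides are linear and
  continuous under bounded pointwise limits in a single factor, so the closure principle
  applies.\<close>

lemma multi_time_law: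
  assumes J: "finite J" "T \<in> J" "J \<subseteq> {0..T}" and T: "T < tstar" and \<gamma>: "\<And>t. t \<in> J \<Longrightarrow> even_periodic r (\<gamma> t)"
  shows "expectation (\<lambda>\<omega>. \<Prod>t\<in>J. \<gamma> t (X t \<omega>))
     = chain r 0 u (sorted_list_of_set J)
         (\<lambda>t y. \<gamma> t y * (if t = T then theta_h r (tstar - T) y / theta_h r tstar u else 1))"
proof -
  define ts where "ts = sorted_list_of_set J"
  have ts: "sorted_wrt (<) ts" "set ts = J" "ts \<noteq> []"
    using J strict_sorted_list_of_set[of J] by (auto simp: ts_def)
  have last: "last ts = T"
  proof (rule ccontr)
    assume ne: "last ts \<noteq> T"
    obtain xs ys where xs: "ts = xs @ T # ys" using split_list[of T ts] ts(2) J(2) by auto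
    then have "ys \<noteq> []" using ne by auto
    then have "last ts \<in> set ys" "\<forall>y\<in>set ys. T < y" using xs ts(1) by (auto simp: sorted_wrt_append)
    then have "T < last ts" "last ts \<in> J" using xs ts(2) by auto
    then show False using subsetD[OF J(3)] by force
  qed
  have J': "0 \<le> t" "t < tstar" if "t \<in> J" for t using subsetD[OF J(3) that] T by simp_all
  have uL: "u \<in> {0..<2*pi*r}" using u by auto
  have cs: "chain_start r 0 u ts" unfolding chain_start_def
  proof (intro conjI disjI2 ballI)
    show "0 \<le> t" if "t \<in> set ts" for t using that J'(1) ts(2) by blast
  qed (use ts(1) uL in auto)
  have \<tau>: "0 < tstar - T" using T by simp
  have k0: "theta_k r (tstar - T) x \<noteq> 0" for x using theta_k_pos[OF r \<tau>, of x] by simp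
  \<comment> \<open>The recursion delivers the law for factors divided by \<open>w\<close>; as
    \<open>w\<close> is even, periodic and positive, it can be put back into the factors at the
    end.\<close>
  define w where "w t y = (if t = T then theta_k r (tstar - T) y else 1)" for t y
  define W where "W t y = (if t = T then theta_h r (tstar - T) y / theta_h r tstar u else 1)" for t y
  define law where "law \<gamma> \<longleftrightarrow> expectation (\<lambda>\<omega>. \<Prod>t\<in>J. \<gamma> t (X t \<omega>)) = chain r 0 u ts (\<lambda>t y. \<gamma> t y * W t y)" for \<gamma>
  have wm: "even_periodic r (\<lambda>y. g y * w t y)" "even_periodic r (\<lambda>y. g y / w t y)" if "even_periodic r g" for g t
    using even_periodic_mult_theta[OF r \<tau> that] that by (cases "t = T"; simp add: w_def)+
  have Wm: "W t \<in> borel_measurable borel" and Wb: "\<exists>C. \<forall>y. \<bar>W t y\<bar> \<le> C" for t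
  proof -
    have k: "even_periodic r (theta_k r (tstar - T))"
      by (intro even_periodicI_continuous r theta_k_continuous_x \<tau> theta_k_symmetry)
    obtain C where C: "\<And>y. \<bar>theta_k r (tstar - T) y\<bar> \<le> C" by (rule even_periodic_bounded[OF k]) blast
    have "\<bar>theta_h r (tstar - T) y / theta_h r tstar u\<bar> \<le> 1 * C / \<bar>theta_h r tstar u\<bar>" for y
      unfolding theta_h_def[of r "tstar - T"] abs_divide abs_mult by (intro divide_right_mono mult_mono C) auto
    then show "\<exists>C. \<forall>y. \<bar>W t y\<bar> \<le> C" unfolding W_def by (cases "t = T") auto
    have "theta_h r (tstar - T) \<in> borel_measurable borel"
      by (rule borel_measurable_continuous_onI[OF theta_k_continuous_x(2)[OF r \<tau>]])
    then show "W t \<in> borel_measurable borel" unfolding W_def by (cases "t = T") auto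
  qed
  have base: "law (\<lambda>t y. cos (y / r) ^ \<kappa> t / w t y)" for \<kappa>
  proof -
    define c0 where "c0 = inverse (theta_h r tstar u)"
    have "\<exists>\<psi>. trig_poly r \<psi> \<and>
     (\<forall>x\<in>{0..<2*pi*r}. chain r 0 x ts (\<lambda>t y. cos (y / r) ^ \<kappa> t * (if t = T then c0 * sin (y / (2*r)) else 1))
         = c0 * (sin (x / (2*r)) * \<psi> x)) \<and>
     (\<forall>(Z :: 'a \<Rightarrow> real) c. Z \<in> borel_measurable (F 0) \<longrightarrow> (\<forall>\<omega>. \<bar>Z \<omega>\<bar> \<le> c) \<longrightarrow>
        expectation (\<lambda>\<omega>. Z \<omega> * (\<Prod>t\<in>set ts. cos (X t \<omega> / r) ^ \<kappa> t / (if t = T then theta_k r (tstar - T) (X T \<omega>) else 1)))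
      = expectation (\<lambda>\<omega>. Z \<omega> * (\<psi> (X 0 \<omega>) / theta_k r (tstar - 0) (X 0 \<omega>))))"
      by (rule chain_trig) (use ts last T J in auto)
    then obtain \<psi> where \<psi>1: "trig_poly r \<psi>"
      and \<psi>2: "\<forall>x\<in>{0..<2*pi*r}. chain r 0 x ts (\<lambda>t y. cos (y / r) ^ \<kappa> t * (if t = T then c0 * sin (y / (2*r)) else 1))
         = c0 * (sin (x / (2*r)) * \<psi> x)"
      and \<psi>3: "\<forall>(Z :: 'a \<Rightarrow> real) c. Z \<in> borel_measurable (F 0) \<longrightarrow> (\<forall>\<omega>. \<bar>Z \<omega>\<bar> \<le> c) \<longrightarrow>
        expectation (\<lambda>\<omega>. Z \<omega> * (\<Prod>t\<in>set ts. cos (X t \<omega> / r) ^ \<kappa> t / (if t = T then theta_k r (tstar - T) (X T \<omega>) else 1)))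
      = expectation (\<lambda>\<omega>. Z \<omega> * (\<psi> (X 0 \<omega>) / theta_k r (tstar - 0) (X 0 \<omega>)))"
      by (elim exE conjE)
    have "expectation (\<lambda>\<omega>. 1 * (\<Prod>t\<in>set ts. cos (X t \<omega> / r) ^ \<kappa> t / (if t = T then theta_k r (tstar - T) (X T \<omega>) else 1)))
      = expectation (\<lambda>\<omega>. 1 * (\<psi> (X 0 \<omega>) / theta_k r (tstar - 0) (X 0 \<omega>)))"
      by (rule \<psi>3[rule_format, of "\<lambda>_. 1" 1]) simp_all
    note \<psi> = \<psi>1 bspec[OF \<psi>2 uL] this
    have "expectation (\<lambda>\<omega>. \<Prod>t\<in>J. cos (X t \<omega> / r) ^ \<kappa> t / w t (X t \<omega>))
      = expectation (\<lambda>\<omega>. 1 * (\<Prod>t\<in>set ts. cos (X t \<omega> / r) ^ \<kappa> t / (if t = T then theta_k r (tstar - T) (X T \<omega>) else 1)))"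
      unfolding ts(2) by (intro Bochner_Integration.integral_cong refl) (auto simp: w_def intro!: prod.cong)
    also have "\<dots> = expectation (\<lambda>\<omega>. \<psi> u / theta_k r tstar u)"
      unfolding \<psi>(3)
    proof (rule integral_cong_AE)
      have "X 0 \<in> borel_measurable M" using X_M_measurable[of 0] tstar by simp
      from measurable_compose[OF this trig_poly_ratio_bounded(1)[OF \<psi>(1), of 0]]
      show "(\<lambda>\<omega>. 1 * (\<psi> (X 0 \<omega>) / theta_k r (tstar - 0) (X 0 \<omega>))) \<in> borel_measurable M" using tstar by simp
      show "AE \<omega> in M. 1 * (\<psi> (X 0 \<omega>) / theta_k r (tstar - 0) (X 0 \<omega>)) = \<psi> u / theta_k r tstar u"
        using X_0 by eventually_elim simp
    qed simp
    also have "\<dots> = c0 * (sin (u / (2*r)) * \<psi> u)"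
    proof -
      \<comment> \<open>The start lies strictly inside the period, so the sine in
        \<open>theta_h r tstar u\<close> is nonzero and cancels.\<close>
      have "sin (u / (2*r)) \<noteq> 0" using half_angle_sin_pos[OF r u] by simp
      moreover have "p / k = inverse (a * k) * (a * p)" if "a \<noteq> 0" for a p k :: real
        using that by (cases "k = 0") (simp_all add: field_simps)
      ultimately have "\<psi> u / theta_k r tstar u = c0 * (sin (u / (2*r)) * \<psi> u)" unfolding c0_def theta_h_def by blast
      then show ?thesis by (simp add: prob_space)
    qed
    also have "\<dots> = chain r 0 u ts (\<lambda>t y. cos (y / r) ^ \<kappa> t / w t y * W t y)"
      unfolding \<psi>(2)[symmetric]
    proof (rule chain_cong)
      show "(\<lambda>y. cos (y / r) ^ \<kappa> t * (if t = T then c0 * sin (y / (2*r)) else 1)) = (\<lambda>y. cos (y / r) ^ \<kappa> t / w t y * W t y)" for t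
      proof (cases "t = T")
        case True
        have "p * (c0 * q) = p / k * (q * k / theta_h r tstar u)" if "k \<noteq> 0" for p q k :: real
          using that by (simp add: c0_def divide_inverse)
        note * = this[OF k0]
        show ?thesis unfolding True w_def W_def theta_h_def[of r "tstar - T"] simp_thms if_True by (rule ext) (rule *)
      qed (simp add: w_def W_def)
    qed
    finally show ?thesis by (simp add: law_def)
  qed
  \<comment> \<open>\<open>A\<close> is the set of times whose factor is already general; at the
    other times it is still a power of the cosine.\<close>
  have ext: "law (\<lambda>t y. \<phi> t y / w t y)"
    if "A \<subseteq> J" "\<And>t. t \<in> A \<Longrightarrow> even_periodic r (\<phi> t)" "\<And>t. t \<in> J - A \<Longrightarrow> \<exists>k. \<phi> t = (\<lambda>y. cos (y / r) ^ k)" for A \<phi>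
  proof -
    have "finite A" using that(1) J(1) finite_subset by blast
    then show ?thesis using that
    proof (induction A arbitrary: \<phi> rule: finite_induct)
      case empty
      then have "\<forall>t\<in>J. \<exists>k. \<phi> t = (\<lambda>y. cos (y / r) ^ k)" by simp
      from bchoice[OF this] obtain \<kappa> where \<kappa>: "\<And>t. t \<in> J \<Longrightarrow> \<phi> t = (\<lambda>y. cos (y / r) ^ \<kappa> t)" by blast
      have "chain r 0 u ts (\<lambda>t y. \<phi> t y / w t y * W t y) = chain r 0 u ts (\<lambda>t y. cos (y / r) ^ \<kappa> t / w t y * W t y)"
        by (rule chain_cong) (simp add: ts(2) \<kappa>)
      then show ?case using base[of \<kappa>] by (simp add: law_def \<kappa> cong: prod.cong)
    next
      case (insert t0 A)
      have t0: "t0 \<in> J" "t0 \<in> set ts" using insert.prems(1) ts(2) by auto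
      \<comment> \<open>Letting \<open>h\<close> vary in place of the factor at \<open>t0\<close>,
        with all others fixed, makes the law a property of one function.\<close>
      define \<rho> where "\<rho> h t y = (\<phi>(t0 := h)) t y / w t y" for h t y
      define R where "R \<omega> = (\<Prod>t\<in>J - {t0}. \<phi> t (X t \<omega>) / w t (X t \<omega>))" for \<omega>
      define G where "G t y = \<phi> t y / w t y * W t y" for t y
      define c where "c y = inverse (w t0 y) * W t0 y" for y
      have \<phi>e: "even_periodic r (\<phi> t)" if "t \<in> J" for t
      proof (cases "t \<in> insert t0 A")
        case False
        then have "t \<in> J - insert t0 A" using \<open>t \<in> J\<close> by simp
        from insert.prems(3)[OF this] obtain k where "\<phi> t = (\<lambda>y. cos (y / r) ^ k)" ..
        then show ?thesis using trig_poly_even_periodic(1)[OF r trig_poly_cos_power] by simp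
      qed (rule insert.prems(2))
      have bme: "h \<in> borel_measurable borel" "\<exists>C. \<forall>y. \<bar>h y\<bar> \<le> C" if "even_periodic r h" for h
      proof -
        show "h \<in> borel_measurable borel" using that by (simp add: even_periodic_def)
        obtain C where "\<And>y. \<bar>h y\<bar> \<le> C" by (rule even_periodic_bounded[OF \<open>even_periodic r h\<close>]) blast
        then show "\<exists>C. \<forall>y. \<bar>h y\<bar> \<le> C" by blast
      qed
      have \<phi>w: "(\<lambda>y. \<phi> t y / w t y) \<in> borel_measurable borel" "\<exists>C. \<forall>y. \<bar>\<phi> t y / w t y\<bar> \<le> C" if "t \<in> J" for t
        by (fact bme[OF wm(2)[OF \<phi>e[OF that]]])+
      have Gm: "G t \<in> borel_measurable borel" if "t \<in> J" for t
        unfolding G_def using \<phi>w(1)[OF that] Wm by measurable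
      have "\<exists>C. \<forall>y. \<bar>G t y\<bar> \<le> C" if "t \<in> J" for t
      proof -
        obtain C where C: "\<forall>y. \<bar>\<phi> t y / w t y\<bar> \<le> C" using \<phi>w(2)[OF \<open>t \<in> J\<close>] ..
        obtain D where D: "\<forall>y. \<bar>W t y\<bar> \<le> D" using Wb[of t] ..
        have "\<bar>G t y\<bar> \<le> C * D" for y
          unfolding G_def by (rule abs_mult_le[OF C[rule_format] D[rule_format]])
        then show ?thesis by blast
      qed
      then have "\<forall>t\<in>J. \<exists>C. \<forall>y. \<bar>G t y\<bar> \<le> C" by simp
      from bchoice[OF this] obtain GC where "\<forall>t\<in>J. \<forall>y. \<bar>G t y\<bar> \<le> GC t" ..
      then have GC: "\<bar>G t y\<bar> \<le> GC t" if "t \<in> J" for t y using that by simp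
      have wi: "even_periodic r (\<lambda>y. inverse (w t0 y))"
        using wm(2)[of "\<lambda>_. 1" t0] trig_poly_even_periodic(1)[OF r trig_poly_cos_power, of 0] by (simp add: divide_inverse)
      obtain wC where wC: "\<And>y. \<bar>inverse (w t0 y)\<bar> \<le> wC" by (rule even_periodic_bounded[OF wi]) blast
      obtain WC where WC: "\<And>y. \<bar>W t0 y\<bar> \<le> WC" using Wb by blast
      have cm: "c \<in> borel_measurable borel" unfolding c_def using bme(1)[OF wi] Wm by measurable
      have cb: "\<bar>c y\<bar> \<le> wC * WC" for y
        unfolding c_def by (rule abs_mult_le[OF wC WC])
      have Rm: "R \<in> borel_measurable M"
        unfolding R_def using X_measurable_compose(1)[OF J' \<phi>w(1)] by (intro borel_measurable_prod) auto
      obtain RC where RC: "\<And>\<omega>. \<bar>R \<omega>\<bar> \<le> RC"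
      proof -
        have "\<forall>t\<in>J. \<exists>C. \<forall>y. \<bar>\<phi> t y / w t y\<bar> \<le> C" using \<phi>w(2) by simp
        from bchoice[OF this] obtain C where "\<forall>t\<in>J. \<forall>y. \<bar>\<phi> t y / w t y\<bar> \<le> C t" ..
        then have C: "\<bar>\<phi> t y / w t y\<bar> \<le> C t" if "t \<in> J" for t y using that by simp
        have "\<bar>R \<omega>\<bar> \<le> (\<Prod>t\<in>J - {t0}. C t)" for \<omega>
          unfolding R_def abs_prod by (intro prod_mono) (use C in auto)
        then show ?thesis using that by blast
      qed
      have lawR: "law (\<rho> h) \<longleftrightarrow> expectation (\<lambda>\<omega>. R \<omega> * (h (X t0 \<omega>) * inverse (w t0 (X t0 \<omega>)))) = chain r 0 u ts (G(t0 := \<lambda>y. h y * c y))" for h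
      proof -
        have "(\<Prod>t\<in>J. \<rho> h t (X t \<omega>)) = R \<omega> * (h (X t0 \<omega>) * inverse (w t0 (X t0 \<omega>)))" for \<omega>
        proof -
          have "(\<Prod>t\<in>J. \<rho> h t (X t \<omega>)) = \<rho> h t0 (X t0 \<omega>) * (\<Prod>t\<in>J - {t0}. \<rho> h t (X t \<omega>))"
            by (rule prod.remove[OF J(1) t0(1)])
          also have "(\<Prod>t\<in>J - {t0}. \<rho> h t (X t \<omega>)) = R \<omega>" unfolding R_def by (rule prod.cong) (auto simp: \<rho>_def)
          finally show ?thesis by (simp add: \<rho>_def divide_inverse mult_ac)
        qed
        moreover have "(\<lambda>t y. \<rho> h t y * W t y) = G(t0 := \<lambda>y. h y * c y)"
          by (intro ext) (simp add: \<rho>_def G_def c_def divide_inverse mult_ac)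
        ultimately show ?thesis by (simp add: law_def)
      qed
      define P where "P h \<longleftrightarrow> h \<in> borel_measurable borel \<and> (\<exists>C. \<forall>y. \<bar>h y\<bar> \<le> C) \<and> law (\<rho> h)" for h
      have int: "integrable M (\<lambda>\<omega>. R \<omega> * (h (X t0 \<omega>) * inverse (w t0 (X t0 \<omega>))))"
        if h: "h \<in> borel_measurable borel" "\<And>y. \<bar>h y\<bar> \<le> C" for h C
      proof (rule integrable_mult_bounded[OF Rm _ RC])
        show "(\<lambda>\<omega>. h (X t0 \<omega>) * inverse (w t0 (X t0 \<omega>))) \<in> borel_measurable M"
          using X_measurable_compose(1)[OF J'[OF t0(1)] h(1)] X_measurable_compose(1)[OF J'[OF t0(1)] bme(1)[OF wi]] by measurable
        show "\<bar>h (X t0 \<omega>) * inverse (w t0 (X t0 \<omega>))\<bar> \<le> C * wC" for \<omega>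
          by (rule abs_mult_le[OF h(2) wC])
      qed
      have hc: "(\<lambda>y. h y * c y) \<in> borel_measurable borel" "\<bar>h y * c y\<bar> \<le> C * (wC * WC)"
        if h: "h \<in> borel_measurable borel" "\<And>y. \<bar>h y\<bar> \<le> C" for h C y
      proof -
        show "(\<lambda>y. h y * c y) \<in> borel_measurable borel" using h(1) cm by measurable
        show "\<bar>h y * c y\<bar> \<le> C * (wC * WC)" by (rule abs_mult_le[OF h(2) cb])
      qed
      have "P (\<phi> t0)"
      proof (rule even_periodic_closure[OF r \<phi>e[OF t0(1)]])
        fix k
        have "law (\<rho> (\<lambda>y. cos (y / r) ^ k))"
          unfolding \<rho>_def by (rule insert.IH) (use insert.prems insert.hyps in auto)
        then show "P (\<lambda>y. cos (y / r) ^ k)"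
          using bme[OF trig_poly_even_periodic(1)[OF r trig_poly_cos_power[of r k]]] by (simp add: P_def)
      next
        fix a f g assume "P f" "P g"
        then obtain C D where f: "f \<in> borel_measurable borel" "\<And>y. \<bar>f y\<bar> \<le> C" "law (\<rho> f)"
          and g: "g \<in> borel_measurable borel" "\<And>y. \<bar>g y\<bar> \<le> D" "law (\<rho> g)" unfolding P_def by blast
        have "chain r 0 u ts (G(t0 := \<lambda>y. a * (f y * c y) + g y * c y)) = a * chain r 0 u ts (G(t0 := \<lambda>y. f y * c y)) + chain r 0 u ts (G(t0 := \<lambda>y. g y * c y))"
          by (rule chain_linear[OF r cs t0(2) _ _ hc[OF f(1,2)] hc[OF g(1,2)]]) (use Gm GC ts(2) in auto)
        moreover have "expectation (\<lambda>\<omega>. R \<omega> * ((a * f (X t0 \<omega>) + g (X t0 \<omega>)) * inverse (w t0 (X t0 \<omega>))))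
          = a * expectation (\<lambda>\<omega>. R \<omega> * (f (X t0 \<omega>) * inverse (w t0 (X t0 \<omega>)))) + expectation (\<lambda>\<omega>. R \<omega> * (g (X t0 \<omega>) * inverse (w t0 (X t0 \<omega>))))"
        proof -
          have "expectation (\<lambda>\<omega>. R \<omega> * ((a * f (X t0 \<omega>) + g (X t0 \<omega>)) * inverse (w t0 (X t0 \<omega>))))
             = expectation (\<lambda>\<omega>. a * (R \<omega> * (f (X t0 \<omega>) * inverse (w t0 (X t0 \<omega>)))) + R \<omega> * (g (X t0 \<omega>) * inverse (w t0 (X t0 \<omega>))))"
            by (simp add: algebra_simps)
          then show ?thesis using int[OF f(1,2)] int[OF g(1,2)]
            by (simp only: Bochner_Integration.integral_add integrable_mult_right Bochner_Integration.integral_mult_right_zero)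
        qed
        ultimately have "law (\<rho> (\<lambda>y. a * f y + g y))"
          using f(3) g(3) unfolding lawR by (simp add: distrib_right mult.assoc)
        moreover have "\<bar>a * f y + g y\<bar> \<le> \<bar>a\<bar> * C + D" for y
          using mult_left_mono[OF f(2)[of y] abs_ge_zero[of a]] g(2)[of y] abs_triangle_ineq[of "a * f y" "g y"] unfolding abs_mult by linarith
        ultimately show "P (\<lambda>y. a * f y + g y)" unfolding P_def using f(1) g(1) by auto
      next
        fix f F' C assume f: "\<And>n. P (f n)" and C: "\<And>n y. \<bar>f n y\<bar> \<le> C" and lim: "\<And>y. (\<lambda>n. f n y) \<longlonglongrightarrow> F' y"
        have fm: "f n \<in> borel_measurable borel" for n using f by (simp add: P_def)
        have Fm: "F' \<in> borel_measurable borel" by (rule borel_measurable_LIMSEQ_real[OF lim fm])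
        have FC: "\<bar>F' y\<bar> \<le> C" for y by (rule LIMSEQ_le_const2[OF tendsto_rabs[OF lim]]) (use C in auto)
        have "(\<lambda>n. chain r 0 u ts (G(t0 := \<lambda>y. f n y * c y))) \<longlonglongrightarrow> chain r 0 u ts (G(t0 := \<lambda>y. F' y * c y))"
          by (rule chain_tendsto[OF r cs t0(2) _ _ hc[OF fm C]]) (use Gm GC ts(2) in \<open>auto intro!: tendsto_intros lim\<close>)
        moreover have "(\<lambda>n. expectation (\<lambda>\<omega>. R \<omega> * (f n (X t0 \<omega>) * inverse (w t0 (X t0 \<omega>))))) \<longlonglongrightarrow> expectation (\<lambda>\<omega>. R \<omega> * (F' (X t0 \<omega>) * inverse (w t0 (X t0 \<omega>))))"
        proof (rule integral_dominated_convergence[where w = "\<lambda>_. RC * (C * wC)"])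
          show "AE \<omega> in M. (\<lambda>n. R \<omega> * (f n (X t0 \<omega>) * inverse (w t0 (X t0 \<omega>)))) \<longlonglongrightarrow> R \<omega> * (F' (X t0 \<omega>) * inverse (w t0 (X t0 \<omega>)))"
            by (intro AE_I2 tendsto_mult tendsto_const lim)
          show "AE \<omega> in M. norm (R \<omega> * (f n (X t0 \<omega>) * inverse (w t0 (X t0 \<omega>)))) \<le> RC * (C * wC)" for n
          proof (rule AE_I2)
            fix \<omega>
            show "norm (R \<omega> * (f n (X t0 \<omega>) * inverse (w t0 (X t0 \<omega>)))) \<le> RC * (C * wC)"
              unfolding real_norm_def by (rule abs_mult_le[OF RC abs_mult_le[OF C wC]])
          qed
        qed (use int[OF Fm FC] int[OF fm C] in \<open>auto dest: borel_measurable_integrable\<close>)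
        moreover have "expectation (\<lambda>\<omega>. R \<omega> * (f n (X t0 \<omega>) * inverse (w t0 (X t0 \<omega>)))) = chain r 0 u ts (G(t0 := \<lambda>y. f n y * c y))" for n
          using f[of n] unfolding P_def lawR by blast
        ultimately have "law (\<rho> F')" unfolding lawR by (simp add: LIMSEQ_unique)
        then show "P F'" unfolding P_def using Fm FC by blast
      qed
      moreover have "\<rho> (\<phi> t0) = (\<lambda>t y. \<phi> t y / w t y)" by (simp add: \<rho>_def fun_eq_iff)
      ultimately show ?case by (simp add: P_def)
    qed
  qed
  have "law (\<lambda>t y. (\<gamma> t y * w t y) / w t y)"
    by (rule ext[of J]) (use wm(1) \<gamma> in auto)
  moreover have "w t y \<noteq> 0" for t y using k0 by (simp add: w_def)
  ultimately show ?thesis by (simp add: law_def W_def ts_def)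
qed

end

text \<open>Evenness is given only for points inside the period; a general point is shifted there,
  and periodicity carries the reflection back. The left end 0 is its own reflection.\<close>

lemma observable_even_periodic:
  assumes r: "0 < r" and g: "g \<in> borel_measurable borel" "bounded (range g)"
    "\<forall>x. \<forall>k::int. g (x + 2 * pi * r * of_int k) = g x" "\<forall>x\<in>{0<..<2 * pi * r}. g (- x) = g x"
  shows "even_periodic r g"
proof -
  have per: "g (x + 2 * pi * r) = g x" for x using g(3)[rule_format, of x 1] by simp
  have "g (- x) = g x" for x
  proof -
    define k where "k = \<lfloor>x / (2*pi*r)\<rfloor>"
    define y where "y = x rmod (2*pi*r)"
    have x: "x = y + 2 * pi * r * of_int k" using r by (simp add: y_def k_def rmod_def)
    have y: "0 \<le> y" "y < 2*pi*r" using r rmod_nonneg[of "2*pi*r" x] rmod_less[of "2*pi*r" x] by (auto simp: y_def)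
    have "g (- x) = g (- y + 2 * pi * r * of_int (- k))" by (simp add: x)
    also have "\<dots> = g (- y)" using g(3) by blast
    also have "\<dots> = g y" using g(4) y by (cases "y = 0") auto
    also have "\<dots> = g x" unfolding x using g(3) by simp
    finally show ?thesis .
  qed
  with g per show ?thesis by (simp add: even_periodic_def)
qed

theorem lemma2p5:
  fixes M :: "'a measure" and X :: "real \<Rightarrow> 'a \<Rightarrow> real"
    and r tstar u T :: real
    and n :: nat and t :: "nat \<Rightarrow> real" and g :: "nat \<Rightarrow> real \<Rightarrow> real"
  assumes "0 < r" and "0 < tstar" and "u \<in> {0<..<2 * pi * r}"
    and "elliptic_bessel3 M r tstar u X"
    and "T \<in> {0..<tstar}"
    and "is_observable r T n t g"
  shows "(LINT \<omega>|M. observable n t g (\<lambda>s. X s \<omega>))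
       = Y_expectation r u (insert T (t ` {1..n}))
           (\<lambda>y. observable n t g y *
                (p_minus r (tstar - T) (pi * r) (y T) / p_minus r tstar (pi * r) u))"
proof -
  obtain F B Xc where lift: "elliptic_bessel3_lift M F B r tstar u Xc"
    and X: "\<And>s \<omega>. s \<in> {0..<tstar} \<Longrightarrow> \<omega> \<in> space M \<Longrightarrow> X s \<omega> = Xc s \<omega> rmod (2 * pi * r)"
    using assms(4) unfolding elliptic_bessel3_def by blast
  interpret elliptic_lift M F B Xc r tstar u
    by unfold_locales (use assms lift in auto)
  \<comment> \<open>The weight is evaluated at \<open>T\<close>, so this time joins those of the
    observable; if it is not among them, its factor is the constant 1.\<close>
  define J where "J = insert T (t ` {1..n})"
  define \<gamma> where "\<gamma> s = (if s \<in> t ` {1..n} then g (the_inv_into {1..n} t s) else (\<lambda>_. 1))" for s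
  have obs: "strict_mono_on {1..n} t" "t ` {1..n} \<subseteq> {0..T}"
    "\<And>m. m \<in> {1..n} \<Longrightarrow> g m \<in> borel_measurable borel \<and> bounded (range (g m)) \<and>
        (\<forall>x. \<forall>k::int. g m (x + 2 * pi * r * of_int k) = g m x) \<and> (\<forall>x\<in>{0<..<2 * pi * r}. g m (- x) = g m x)"
    using assms(6) unfolding is_observable_def by blast+
  have inj: "inj_on t {1..n}" by (rule strict_mono_on_imp_inj_on[OF obs(1)])
  have T: "0 \<le> T" "T < tstar" using assms(5) by auto
  have J: "finite J" "T \<in> J" "J \<subseteq> {0..T}" using obs(2) T by (auto simp: J_def)
  have ge: "even_periodic r (g m)" if "m \<in> {1..n}" for m
    using obs(3)[OF that] by (intro observable_even_periodic r) auto
  have \<gamma>e: "even_periodic r (\<gamma> s)" for s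
  proof (cases "s \<in> t ` {1..n}")
    case True
    then show ?thesis using ge the_inv_into_into[OF inj True order_refl] by (simp add: \<gamma>_def)
  qed (auto simp: \<gamma>_def even_periodic_def)
  have prod: "observable n t g y = (\<Prod>s\<in>J. \<gamma> s (y s))" for y
  proof -
    have "(\<Prod>s\<in>J. \<gamma> s (y s)) = (\<Prod>s\<in>t ` {1..n}. \<gamma> s (y s))"
      by (rule prod.mono_neutral_right) (use J(1) in \<open>auto simp: J_def \<gamma>_def\<close>)
    also have "\<dots> = (\<Prod>m=1..n. \<gamma> (t m) (y (t m)))" by (simp only: prod.reindex[OF inj] o_def)
    also have "\<dots> = (\<Prod>m=1..n. g m (y (t m)))"
      by (rule prod.cong) (auto simp: \<gamma>_def the_inv_into_f_f[OF inj[unfolded One_nat_def]])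
    finally show ?thesis by (simp add: observable_def)
  qed
  have "(LINT \<omega>|M. observable n t g (\<lambda>s. X s \<omega>)) = (LINT \<omega>|M. (\<Prod>s\<in>J. \<gamma> s (Xc s \<omega>)))"
  proof (rule Bochner_Integration.integral_cong[OF refl])
    fix \<omega> assume \<omega>: "\<omega> \<in> space M"
    show "observable n t g (\<lambda>s. X s \<omega>) = (\<Prod>s\<in>J. \<gamma> s (Xc s \<omega>))"
      unfolding prod
    proof (rule prod.cong[OF refl])
      fix s assume s: "s \<in> J"
      \<comment> \<open>The process and its lift differ by a multiple of the period, which the
        periodic factors do not see.\<close>
      have "X s \<omega> = Xc s \<omega> + 2 * pi * r * of_int (- \<lfloor>Xc s \<omega> / (2 * pi * r)\<rfloor>)"
        using X[OF _ \<omega>, of s] s J(3) T r by (auto simp: rmod_def)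
      then show "\<gamma> s (X s \<omega>) = \<gamma> s (Xc s \<omega>)" using even_periodic_int[OF \<gamma>e[of s]] by (simp only:)
    qed
  qed
  also have "\<dots> = chain r 0 u (sorted_list_of_set J)
      (\<lambda>s y. \<gamma> s y * (if s = T then theta_h r (tstar - T) y / theta_h r tstar u else 1))"
    by (rule multi_time_law[OF J T(2) \<gamma>e])
  also have "\<dots> = Y_integral r 0 u (sorted_list_of_set J)
      (\<lambda>\<xi>. \<Prod>s\<in>{} \<union> set (sorted_list_of_set J). \<gamma> s (\<xi> s) * (if s = T then theta_h r (tstar - T) (\<xi> s) / theta_h r tstar u else 1)) (\<lambda>_. 0)"
    by (subst Y_integral_product) auto
  also have "(\<lambda>\<xi>. \<Prod>s\<in>{} \<union> set (sorted_list_of_set J). \<gamma> s (\<xi> s) * (if s = T then theta_h r (tstar - T) (\<xi> s) / theta_h r tstar u else 1))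
     = (\<lambda>y. observable n t g y * (p_minus r (tstar - T) (pi * r) (y T) / p_minus r tstar (pi * r) u))"
  proof
    fix \<xi> :: "real \<Rightarrow> real"
    have "(\<Prod>s\<in>J. if s = T then theta_h r (tstar - T) (\<xi> s) / theta_h r tstar u else 1) = theta_h r (tstar - T) (\<xi> T) / theta_h r tstar u"
      using J(1,2) by (simp add: prod.delta)
    \<comment> \<open>Poisson summation at both times; the constant \<open>2 * pi * r\<close>
      cancels in the ratio.\<close>
    also have "\<dots> = p_minus r (tstar - T) (pi * r) (\<xi> T) / p_minus r tstar (pi * r) u"
      using r T tstar by (simp add: poisson_theta_h)
    finally show "(\<Prod>s\<in>{} \<union> set (sorted_list_of_set J). \<gamma> s (\<xi> s) * (if s = T then theta_h r (tstar - T) (\<xi> s) / theta_h r tstar u else 1))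
       = observable n t g \<xi> * (p_minus r (tstar - T) (pi * r) (\<xi> T) / p_minus r tstar (pi * r) u)"
      using J(1) by (simp only: prod prod.distrib set_sorted_list_of_set Un_empty_left)
  qed
  finally show ?thesis by (simp only: Y_expectation_def J_def)
qed

end
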